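(* Let $s>\frac32$ and let $u_0\in H^s(\mathbb{R})$. For $\alpha\in(0,1)$, let $\mathbf{S}_t^{\alpha}(u_0)$ denote the solution $u=u(t,x)$ of the Camassa-Holm equation with filter parameter $\alpha$, $$ \partial_t u+u\,\partial_x u=-\partial_x\left(1-\alpha^2\partial_x^2\right)^{-1}\left(u^2+\frac{\alpha^2}{2}(\partial_x u)^2\right),\qquad u(0,x)=u_0(x),\qquad (t,x)\in\mathbb{R}^+\times\mathbb{R}, $$ and let $\mathbf{S}_t^{0}(u_0)$ denote the solution $u=u(t,x)$ of the inviscid Burgers equation $$ \partial_t u+3u\,\partial_x u=0,\qquad u(0,x)=u_0(x),\qquad (t,x)\in\mathbb{R}^+\times\mathbb{R}. $$ Then there exists a time $T=T(\|u_0\|_{H^s})>0$, depending on $u_0$ only through $\|u_0\|_{H^s}$ and independent of $\alpha\in(0,1)$, such that $\mathbf{S}_t^{\alpha}(u_0)\in\mathcal{C}([0,T];H^s(\mathbb{R}))$ for every $\alpha\in(0,1)$, $\mathbf{S}_t^{0}(u_0)\in\mathcal{C}([0,T];H^s(\mathbb{R}))$, and $$ \lim_{\alpha\to0}\left\|\mathbf{S}_t^{\alpha}(u_0)-\mathbf{S}_t^{0}(u_0)\right\|_{L^\infty(0,T;H^s(\mathbb{R}))}=0. $$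
   Context: Functions are real-valued on $\mathbb{R}$. The Fourier transform is $\widehat f(\xi)=\int_{\mathbb{R}}e^{-ix\xi}f(x)\,dx$, and for $s\in\mathbb{R}$ the nonhomogeneous Sobolev space $H^s=H^s(\mathbb{R})$ has norm $\|f\|_{H^s}^2=\int_{\mathbb{R}}(1+|\xi|^2)^s|\widehat f(\xi)|^2\,d\xi$. The operator $(1-\alpha^2\partial_x^2)^{-1}$ is the Fourier multiplier with symbol $(1+\alpha^2\xi^2)^{-1}$; equivalently $(1-\alpha^2\partial_x^2)^{-1}f=g*f$ with $g(x)=\frac{1}{2\alpha}e^{-|x|/\alpha}$. For a Banach space $X$, $\mathcal{C}([0,T];X)$ is the space of continuous functions on $[0,T]$ with values in $X$, and $\|f\|_{L^\infty(0,T;X)}=\operatorname{ess\,sup}_{t\in[0,T]}\|f(t)\|_X$. "The solution" with data $u_0\in H^s$, $s>\frac32$, of either Cauchy problem means the unique solution in the class $\mathcal{C}([0,T'];H^s(\mathbb{R}))$ on some time interval $[0,T']$, $T'>0$, given by classical local well-posedness (a priori $T'$ may depend on $\alpha$ for the Camassa-Holm equation); the equation is satisfied as an equality in $H^{s-1}(\mathbb{R})$. *)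

theory Defs
  imports "HOL-Probability.Essential_Supremum"
begin

text \<open>Elements of \<open>L\<^sup>2(\<real>)\<close> and \<open>H\<^sup>s(\<real>)\<close> are represented by Borel functions \<open>real \<Rightarrow> real\<close>;
  two functions that agree almost everywhere represent the same element.\<close>

definition L2 :: "(real \<Rightarrow> real) set" where
  "L2 = {f \<in> borel_measurable lborel. integrable lborel (\<lambda>x. (f x)\<^sup>2)}"

text \<open>The Fourier transform of \<open>f \<in> L\<^sup>2\<close>: the integral of \<open>e\<^sup>-\<^sup>i\<^sup>x\<^sup>\<xi> f(x)\<close> need not converge
  absolutely, so the transform is the \<open>L\<^sup>2\<close>-limit of the truncated integrals (Plancherel).
  It is determined up to null sets, and \<open>SOME\<close> picks a representative.\<close>

definition is_fourier :: "(real \<Rightarrow> real) \<Rightarrow> (real \<Rightarrow> complex) \<Rightarrow> bool" where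
  "is_fourier f F \<longleftrightarrow> F \<in> borel_measurable lborel \<and>
     ((\<lambda>R. \<integral>\<^sup>+ \<xi>. ennreal ((cmod (F \<xi> -
          (LINT x:{-R..R}|lborel. exp (- (\<i> * complex_of_real (x * \<xi>))) * complex_of_real (f x))))\<^sup>2)
        \<partial>lborel) \<longlongrightarrow> 0) at_top"

definition fourier :: "(real \<Rightarrow> real) \<Rightarrow> real \<Rightarrow> complex" where
  "fourier f = (SOME F. is_fourier f F)"

text \<open>\<open>H\<^sup>s(\<real>)\<close> for \<open>s \<ge> 0\<close>, where \<open>H\<^sup>s \<subseteq> L\<^sup>2\<close>. (For \<open>s < 0\<close> the set below is not the
  Sobolev space, which then contains distributions; only \<open>s > 1/2\<close> is used.)\<close>

definition sobolev :: "real \<Rightarrow> (real \<Rightarrow> real) set" where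
  "sobolev s = {f \<in> L2. integrable lborel (\<lambda>\<xi>. (1 + \<xi>\<^sup>2) powr s * (cmod (fourier f \<xi>))\<^sup>2)}"

text \<open>The norm is meaningful only on \<^term>\<open>sobolev s\<close>: the integral of a non-integrable
  function is \<open>0\<close>.\<close>

definition sobolev_norm :: "real \<Rightarrow> (real \<Rightarrow> real) \<Rightarrow> real" where
  "sobolev_norm s f = sqrt (LINT \<xi>|lborel. (1 + \<xi>\<^sup>2) powr s * (cmod (fourier f \<xi>))\<^sup>2)"

definition test_function :: "(real \<Rightarrow> real) \<Rightarrow> bool" where
  "test_function \<phi> \<longleftrightarrow> (\<forall>n. (deriv ^^ n) \<phi> differentiable_on UNIV) \<and> (\<exists>R. \<forall>x. \<bar>x\<bar> > R \<longrightarrow> \<phi> x = 0)"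

definition locally_integrable :: "(real \<Rightarrow> real) \<Rightarrow> bool" where
  "locally_integrable f \<longleftrightarrow> f \<in> borel_measurable lborel \<and> (\<forall>R. set_integrable lborel {-R..R} f)"

definition is_weak_deriv :: "(real \<Rightarrow> real) \<Rightarrow> (real \<Rightarrow> real) \<Rightarrow> bool" where
  "is_weak_deriv f g \<longleftrightarrow> locally_integrable f \<and> locally_integrable g \<and>
     (\<forall>\<phi>. test_function \<phi> \<longrightarrow> (LINT x|lborel. f x * deriv \<phi> x) = - (LINT x|lborel. g x * \<phi> x))"

text \<open>The distributional derivative \<open>\<partial>\<^sub>x f\<close>. It is applied only to functions in \<open>H\<^sup>r\<close> with
  \<open>r \<ge> 1\<close>, for which it exists and is unique up to null sets.\<close>

definition weak_deriv :: "(real \<Rightarrow> real) \<Rightarrow> real \<Rightarrow> real" where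
  "weak_deriv f = (SOME g. is_weak_deriv f g)"

text \<open>\<open>(1 - \<alpha>\<^sup>2 \<partial>\<^sub>x\<^sup>2)\<^sup>-\<^sup>1\<close> on \<open>L\<^sup>2\<close>, as a Fourier multiplier.\<close>

definition helmholtz_inv :: "real \<Rightarrow> (real \<Rightarrow> real) \<Rightarrow> real \<Rightarrow> real" where
  "helmholtz_inv \<alpha> f = (SOME h. h \<in> L2 \<and>
     (AE \<xi> in lborel. fourier h \<xi> = complex_of_real (inverse (1 + \<alpha>\<^sup>2 * \<xi>\<^sup>2)) * fourier f \<xi>))"

definition sobolev_continuous :: "real \<Rightarrow> real \<Rightarrow> (real \<Rightarrow> real \<Rightarrow> real) \<Rightarrow> bool" where
  "sobolev_continuous s T u \<longleftrightarrow> (\<forall>t\<in>{0..T}. u t \<in> sobolev s \<and>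
     ((\<lambda>r. sobolev_norm s (\<lambda>x. u r x - u t x)) \<longlongrightarrow> 0) (at t within {0..T}))"

text \<open>\<open>w = \<partial>\<^sub>t u\<close> on \<open>[0,T]\<close> as a derivative in the Banach space \<open>H\<^sup>s\<close> (one-sided at the endpoints).\<close>

definition sobolev_time_deriv ::
    "real \<Rightarrow> real \<Rightarrow> (real \<Rightarrow> real \<Rightarrow> real) \<Rightarrow> (real \<Rightarrow> real \<Rightarrow> real) \<Rightarrow> bool" where
  "sobolev_time_deriv s T u w \<longleftrightarrow> (\<forall>t\<in>{0..T}. u t \<in> sobolev s \<and> w t \<in> sobolev s \<and>
     ((\<lambda>r. sobolev_norm s (\<lambda>x. (u r x - u t x) / (r - t) - w t x)) \<longlongrightarrow> 0) (at t within {0..T}))"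

text \<open>The equations, at a fixed time, for a state \<open>v = u(t)\<close> and its time derivative
  \<open>w = \<partial>\<^sub>t u(t)\<close>.\<close>

definition camassa_holm :: "real \<Rightarrow> (real \<Rightarrow> real) \<Rightarrow> (real \<Rightarrow> real) \<Rightarrow> bool" where
  "camassa_holm \<alpha> v w \<longleftrightarrow> (AE x in lborel. w x + v x * weak_deriv v x =
     - weak_deriv (helmholtz_inv \<alpha> (\<lambda>y. (v y)\<^sup>2 + \<alpha>\<^sup>2 / 2 * (weak_deriv v y)\<^sup>2)) x)"

definition burgers :: "(real \<Rightarrow> real) \<Rightarrow> (real \<Rightarrow> real) \<Rightarrow> bool" where
  "burgers v w \<longleftrightarrow> (AE x in lborel. w x + 3 * v x * weak_deriv v x = 0)"

definition cauchy_solution ::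
    "real \<Rightarrow> ((real \<Rightarrow> real) \<Rightarrow> (real \<Rightarrow> real) \<Rightarrow> bool) \<Rightarrow> (real \<Rightarrow> real) \<Rightarrow> real \<Rightarrow>
     (real \<Rightarrow> real \<Rightarrow> real) \<Rightarrow> bool" where
  "cauchy_solution s eqn u\<^sub>0 T u \<longleftrightarrow>
     sobolev_continuous s T u \<and>
     (AE x in lborel. u 0 x = u\<^sub>0 x) \<and>
     (\<exists>w. sobolev_time_deriv (s - 1) T u w \<and> (\<forall>t\<in>{0..T}. eqn (u t) (w t)))"

text \<open>\<open>u\<close> is ``the'' solution on \<open>[0,T]\<close>: it is a solution there, and every solution in the
  same class, on any time interval, coincides with it on the common interval.\<close>

definition the_solution ::
    "real \<Rightarrow> ((real \<Rightarrow> real) \<Rightarrow> (real \<Rightarrow> real) \<Rightarrow> bool) \<Rightarrow> (real \<Rightarrow> real) \<Rightarrow> real \<Rightarrow>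
     (real \<Rightarrow> real \<Rightarrow> real) \<Rightarrow> bool" where
  "the_solution s eqn u\<^sub>0 T u \<longleftrightarrow>
     cauchy_solution s eqn u\<^sub>0 T u \<and>
     (\<forall>T' v. cauchy_solution s eqn u\<^sub>0 T' v \<longrightarrow>
        (\<forall>t\<in>{0..min T T'}. AE x in lborel. v t x = u t x))"

definition Linf_sobolev_norm :: "real \<Rightarrow> real \<Rightarrow> (real \<Rightarrow> real \<Rightarrow> real) \<Rightarrow> ereal" where
  "Linf_sobolev_norm s T u =
     esssup (restrict_space lborel {0..T}) (\<lambda>t. ereal (sobolev_norm s (u t)))"

end

theory Submission
  imports Defs "HOL-Probability.Levy"
begin

text \<open>Let \<open>U\<close> be the Fourier transform of \<open>u\<close> divided by \<open>2\<pi>\<close>. Both equations become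
  \<open>\<partial>\<^sub>t U = B\<^sub>\<alpha>(U, U)\<close> with \<open>B\<^sub>\<alpha>(U, V)(x) = -i x \<integral> k\<^sub>\<alpha>(x, y) U(x - y) V(y) dy\<close>,
  \<open>k\<^sub>\<alpha>(x, y) = 1/2 + m(x) - \<alpha>\<^sup>2/2 m(x) (x - y) y\<close> and \<open>m(x) = 1 / (1 + \<alpha>\<^sup>2 x\<^sup>2)\<close>; the value \<open>\<alpha> = 0\<close>
  is the Burgers equation. Symmetrising the trilinear form of the energy identity gives estimates that are
  uniform in \<open>\<alpha>\<close>, for the Sobolev weight and for weights that see only high frequencies, so the
  \<open>H\<^sup>s\<close> norm and the high-frequency tail of a solution are controlled by those of the data on a time
  depending only on the norm of the data.

  Differences of (approximate) solutions are estimated in \<open>H\<^sup>1\<^sup>/\<^sup>2\<close> by a Gronwall argument. Together with the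
  uniform control of the tails, interpolation turns smallness in \<open>H\<^sup>1\<^sup>/\<^sup>2\<close> into smallness in \<open>H\<^sup>s\<close>. Applied
  to an Euler-Galerkin scheme this gives existence, applied to two solutions uniqueness. Finally, the
  Camassa-Holm solutions solve the Burgers equation up to an error that vanishes with \<open>\<alpha>\<close>, which gives
  the limit in \<open>H\<^sup>s\<close>.\<close>


section \<open>Square integrable functions\<close>

text \<open>On the Fourier side derivatives are factors and products are convolutions, so a
  commutator estimate becomes a pointwise inequality between symbols followed by Young's inequality.
  The obstacle is that \<open>Bop\<close> loses one derivative: it maps H^s only into H^(s-1), and
  recovering the loss from the smoothing of the Helmholtz inverse would cost a factor 1/\<alpha>.
  Uniformly in \<alpha>, only the cancellation in the antisymmetric part of the energy form is
  available. Differences are measured in H^(1/2) because truncation residuals are controlled in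
  H^(s-1), which lies in H^(1/2) for s >= 3/2, and because the linearised energy form closes there
  with an H^s coefficient. Such a bound says nothing about H^s. The tail weights replace
  compactness: for every M at once, the tail of an approximation is at most twice that of the datum.
  The time step of the explicit scheme is at most \<open>jb N\<close> to the power -2, so that its
  quadratic error is absorbed into the growth rate. All solutions, Burgers included, obey the same
  bounds on one interval of length \<open>1 / rate s (2 * R)\<close>.\<close>

definition sqint :: "(real \<Rightarrow> complex) \<Rightarrow> bool" where
  "sqint f \<longleftrightarrow> f \<in> borel_measurable borel \<and> integrable lborel (\<lambda>x. (cmod (f x))\<^sup>2)"

definition n2 :: "(real \<Rightarrow> complex) \<Rightarrow> real" where
  "n2 f = sqrt (LINT x|lborel. (cmod (f x))\<^sup>2)"

lemma sqint_measurable: "sqint f \<Longrightarrow> f \<in> borel_measurable borel"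
  by (simp add: sqint_def)

lemma n2_nonneg [simp]: "0 \<le> n2 f"
  by (simp add: n2_def)

lemma n2_sq: "(n2 f)\<^sup>2 = (LINT x|lborel. (cmod (f x))\<^sup>2)"
  by (simp add: n2_def)

lemma sqint_nn_integral:
  assumes "sqint f"
  shows "(\<integral>\<^sup>+x. ennreal ((cmod (f x))\<^sup>2) \<partial>lborel) = ennreal ((n2 f)\<^sup>2)"
  unfolding n2_sq using assms
  by (intro nn_integral_eq_integral) (auto simp: sqint_def)

lemma sqint_boundI:
  assumes [measurable]: "f \<in> borel_measurable borel" and c: "0 \<le> c"
    and le: "(\<integral>\<^sup>+x. ennreal ((cmod (f x))\<^sup>2) \<partial>lborel) \<le> ennreal (c\<^sup>2)"
  shows "sqint f" "n2 f \<le> c"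
proof -
  have "integrable lborel (\<lambda>x. (cmod (f x))\<^sup>2)"
    by (rule integrableI_nonneg) (use le in \<open>auto simp: less_top[symmetric] top_unique\<close>)
  then show *: "sqint f" by (simp add: sqint_def)
  have "ennreal ((n2 f)\<^sup>2) \<le> ennreal (c\<^sup>2)"
    using le sqint_nn_integral[OF *] by simp
  then have "(n2 f)\<^sup>2 \<le> c\<^sup>2" by (simp add: ennreal_le_iff)
  then show "n2 f \<le> c" using c by (simp add: power2_le_iff_abs_le)
qed

lemma sqint_mono:
  assumes f: "sqint f" and [measurable]: "g \<in> borel_measurable borel" and C: "0 \<le> C"
    and le: "AE x in lborel. cmod (g x) \<le> C * cmod (f x)"
  shows "sqint g" "n2 g \<le> C * n2 f"
proof -
  have "(\<integral>\<^sup>+x. ennreal ((cmod (g x))\<^sup>2) \<partial>lborel) \<le> (\<integral>\<^sup>+x. ennreal (C\<^sup>2) * ennreal ((cmod (f x))\<^sup>2) \<partial>lborel)"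
    using le
    by (intro nn_integral_mono_AE)
      (auto elim!: eventually_mono simp: power_mono ennreal_mult[symmetric] power_mult_distrib[symmetric]
        intro!: ennreal_leI)
  also have "\<dots> = ennreal (C\<^sup>2) * ennreal ((n2 f)\<^sup>2)"
    using f by (subst nn_integral_cmult) (auto simp: sqint_nn_integral dest: sqint_measurable)
  also have "\<dots> = ennreal ((C * n2 f)\<^sup>2)"
    by (simp add: ennreal_mult[symmetric] power_mult_distrib)
  finally have *: "(\<integral>\<^sup>+x. ennreal ((cmod (g x))\<^sup>2) \<partial>lborel) \<le> ennreal ((C * n2 f)\<^sup>2)" .
  show "sqint g" "n2 g \<le> C * n2 f"
    by (rule sqint_boundI[OF _ _ *]; use C in simp)+
qed

lemma sqint_mono1:
  assumes "sqint f" "g \<in> borel_measurable borel" "\<And>x. cmod (g x) \<le> cmod (f x)"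
  shows "sqint g" "n2 g \<le> n2 f"
  using sqint_mono[OF assms(1,2), of 1] assms(3) by auto

lemma n2_cong_AE:
  assumes "AE x in lborel. f x = g x" "f \<in> borel_measurable borel" "g \<in> borel_measurable borel"
  shows "n2 f = n2 g"
  unfolding n2_def using assms by (intro arg_cong[where f=sqrt] integral_cong_AE) auto

lemma sqint_cong_AE:
  assumes "sqint f" "g \<in> borel_measurable borel" "AE x in lborel. f x = g x"
  shows "sqint g"
proof (rule sqint_mono(1)[OF assms(1,2), of 1])
  show "AE x in lborel. cmod (g x) \<le> 1 * cmod (f x)"
    using assms(3) by eventually_elim simp
qed simp

lemma sqint_zero [simp]: "sqint (\<lambda>x. 0)" "n2 (\<lambda>x. 0) = 0"
  by (auto simp: sqint_def n2_def)

lemma sqint_cmult: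
  assumes "sqint f"
  shows "sqint (\<lambda>x. c * f x)" "n2 (\<lambda>x. c * f x) = cmod c * n2 f"
  using assms by (auto simp: sqint_def n2_def norm_mult power_mult_distrib real_sqrt_mult)

lemma Cauchy_Schwarz_real:
  fixes a b :: "real \<Rightarrow> real"
  assumes [measurable]: "a \<in> borel_measurable borel" "b \<in> borel_measurable borel"
    and pos: "\<And>x. 0 \<le> a x" "\<And>x. 0 \<le> b x" "0 \<le> X" "0 \<le> Y"
    and A: "(\<integral>\<^sup>+x. ennreal ((a x)\<^sup>2) \<partial>lborel) \<le> ennreal (X\<^sup>2)"
    and B: "(\<integral>\<^sup>+x. ennreal ((b x)\<^sup>2) \<partial>lborel) \<le> ennreal (Y\<^sup>2)"
  shows "(\<integral>\<^sup>+x. ennreal (a x * b x) \<partial>lborel) \<le> ennreal (X * Y)"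
proof -
  have "(\<integral>\<^sup>+x. ennreal (a x * b x) \<partial>lborel)\<^sup>2
      \<le> (\<integral>\<^sup>+x. (ennreal (a x))\<^sup>2 \<partial>lborel) * (\<integral>\<^sup>+x. (ennreal (b x))\<^sup>2 \<partial>lborel)"
    using Cauchy_Schwarz_nn_integral[of "\<lambda>x. ennreal (a x)" lborel "\<lambda>x. ennreal (b x)"] pos
    by (simp add: ennreal_mult)
  also have "\<dots> \<le> ennreal (X\<^sup>2) * ennreal (Y\<^sup>2)"
    using A B pos by (intro mult_mono) (auto simp: ennreal_power)
  also have "\<dots> = (ennreal (X * Y))\<^sup>2"
    using pos by (simp add: ennreal_mult[symmetric] ennreal_power power_mult_distrib)
  finally show ?thesis
    using pos by (cases "\<integral>\<^sup>+x. ennreal (a x * b x) \<partial>lborel")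
      (auto simp: ennreal_power ennreal_le_iff power_eq_top_ennreal power2_le_iff_abs_le top_unique)
qed

lemma sqint_Cauchy_Schwarz:
  assumes f: "sqint f" and g: "sqint g"
  shows "(\<integral>\<^sup>+x. ennreal (cmod (f x) * cmod (g x)) \<partial>lborel) \<le> ennreal (n2 f * n2 g)"
    and "integrable lborel (\<lambda>x. f x * g x)"
    and "(LINT x|lborel. cmod (f x) * cmod (g x)) \<le> n2 f * n2 g"
    and "integrable lborel (\<lambda>x. cmod (f x) * cmod (g x))"
proof -
  have [measurable]: "f \<in> borel_measurable borel" "g \<in> borel_measurable borel"
    using f g by (auto dest: sqint_measurable)
  show *: "(\<integral>\<^sup>+x. ennreal (cmod (f x) * cmod (g x)) \<partial>lborel) \<le> ennreal (n2 f * n2 g)"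
    by (rule Cauchy_Schwarz_real) (auto simp: sqint_nn_integral f g)
  show i: "integrable lborel (\<lambda>x. cmod (f x) * cmod (g x))"
    by (rule integrableI_nonneg) (use * in \<open>auto simp: less_top[symmetric] top_unique\<close>)
  then show "integrable lborel (\<lambda>x. f x * g x)"
    by (rule Bochner_Integration.integrable_bound) (auto simp: norm_mult)
  have "ennreal (LINT x|lborel. cmod (f x) * cmod (g x)) \<le> ennreal (n2 f * n2 g)"
    using * nn_integral_eq_integral[OF i] by simp
  then show "(LINT x|lborel. cmod (f x) * cmod (g x)) \<le> n2 f * n2 g"
    by (subst (asm) ennreal_le_iff) auto
qed

text \<open>The expansion of the square is the form used by the energy method: its cross term is the
  place where the trilinear form enters a time step.\<close>

lemma sqint_add:
  assumes f: "sqint f" and g: "sqint g"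
  shows "sqint (\<lambda>x. f x + g x)"
    and "n2 (\<lambda>x. f x + g x) \<le> n2 f + n2 g"
    and "(n2 (\<lambda>x. f x + g x))\<^sup>2 = (n2 f)\<^sup>2 + 2 * Re (LINT x|lborel. cnj (f x) * g x) + (n2 g)\<^sup>2"
proof -
  have [measurable]: "f \<in> borel_measurable borel" "g \<in> borel_measurable borel"
    using f g by (auto dest: sqint_measurable)
  have "(\<lambda>x. cnj (f x)) \<in> borel_measurable borel"
    by (intro borel_measurable_continuous_on[OF _ \<open>f \<in> borel_measurable borel\<close>] continuous_intros)
  then have cf: "sqint (\<lambda>x. cnj (f x))" using f by (auto simp: sqint_def)
  have ncf: "n2 (\<lambda>x. cnj (f x)) = n2 f" by (simp add: n2_def)
  note cs = sqint_Cauchy_Schwarz[OF cf g]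
  define I where "I x = Re (cnj (f x) * g x)" for x
  have eq: "(cmod (f x + g x))\<^sup>2 = (cmod (f x))\<^sup>2 + 2 * I x + (cmod (g x))\<^sup>2" for x
    unfolding cmod_power2 I_def by (simp add: power2_eq_square algebra_simps)
  have ir: "integrable lborel I" unfolding I_def using cs(2) by (rule integrable_Re)
  have int_I: "(LINT x|lborel. I x) = Re (LINT x|lborel. cnj (f x) * g x)"
    unfolding I_def by (rule integral_Re[OF cs(2)])
  show "sqint (\<lambda>x. f x + g x)" using f g ir by (simp add: sqint_def eq)
  show n: "(n2 (\<lambda>x. f x + g x))\<^sup>2 = (n2 f)\<^sup>2 + 2 * Re (LINT x|lborel. cnj (f x) * g x) + (n2 g)\<^sup>2"
    unfolding n2_sq eq int_I[symmetric] using f g ir by (simp add: sqint_def)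
  have "Re (LINT x|lborel. cnj (f x) * g x) \<le> cmod (LINT x|lborel. cnj (f x) * g x)"
    by (rule complex_Re_le_cmod)
  also have "\<dots> \<le> (LINT x|lborel. cmod (cnj (f x) * g x))"
    by (rule integral_norm_bound)
  also have "\<dots> \<le> n2 f * n2 g" using cs(3) by (simp add: norm_mult ncf)
  finally have "(n2 (\<lambda>x. f x + g x))\<^sup>2 \<le> (n2 f + n2 g)\<^sup>2"
    unfolding n by (simp add: power2_eq_square algebra_simps)
  then show "n2 (\<lambda>x. f x + g x) \<le> n2 f + n2 g"
    by (simp add: power2_le_iff_abs_le)
qed

lemma sqint_diff:
  assumes f: "sqint f" and g: "sqint g"
  shows "sqint (\<lambda>x. f x - g x)" and "n2 (\<lambda>x. f x - g x) \<le> n2 f + n2 g"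
  using sqint_add(1,2)[OF f sqint_cmult(1)[OF g, of "-1"]] sqint_cmult(2)[OF g, of "-1"] by auto

lemma n2_minus_commute: "n2 (\<lambda>x. f x - g x) = n2 (\<lambda>x. g x - f x)"
  by (simp add: n2_def norm_minus_commute)

lemma n2_triangle_diff:
  assumes "sqint (\<lambda>x. f x - g x)" "sqint (\<lambda>x. g x - h x)"
  shows "n2 (\<lambda>x. f x - h x) \<le> n2 (\<lambda>x. f x - g x) + n2 (\<lambda>x. g x - h x)"
  using sqint_add(2)[OF assms] by simp

lemma n2_eq_0_AE:
  assumes f: "sqint f" and "n2 f = 0"
  shows "AE x in lborel. f x = 0"
proof -
  have "(\<integral>\<^sup>+x. ennreal ((cmod (f x))\<^sup>2) \<partial>lborel) = 0"
    using sqint_nn_integral[OF f] assms(2) by simp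
  then show ?thesis
    using sqint_measurable[OF f] by (subst (asm) nn_integral_0_iff_AE) auto
qed

text \<open>The squared norms decay like 4^(-k), so the squares can be summed with weights 2^k. The
  weighted sum is integrable, hence finite almost everywhere, and it dominates the sum of the
  moduli.\<close>

lemma AE_summable_if_fast:
  fixes g :: "nat \<Rightarrow> real \<Rightarrow> complex"
  assumes g: "\<And>k. sqint (g k)" and n: "\<And>k. n2 (g k) \<le> (1/2) ^ k"
  shows "AE x in lborel. summable (\<lambda>k. g k x)"
proof -
  have [measurable]: "g k \<in> borel_measurable borel" for k using g sqint_measurable by auto
  have "(\<integral>\<^sup>+x. (\<Sum>k. ennreal (2^k * (cmod (g k x))\<^sup>2)) \<partial>lborel)
      = (\<Sum>k. \<integral>\<^sup>+x. ennreal (2^k * (cmod (g k x))\<^sup>2) \<partial>lborel)"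
    by (rule nn_integral_suminf) auto
  also have "\<dots> = (\<Sum>k. ennreal (2^k * (n2 (g k))\<^sup>2))"
    by (simp add: ennreal_mult nn_integral_cmult sqint_nn_integral g)
  also have "\<dots> \<le> (\<Sum>k. ennreal ((1/2)^k))"
  proof (intro suminf_le allI ennreal_leI)
    fix k
    have "2^k * (n2 (g k))\<^sup>2 \<le> 2^k * ((1/2)^k)\<^sup>2"
      using n by (intro mult_left_mono power_mono) auto
    also have "\<dots> = (1/2)^k" by (simp add: power2_eq_square field_simps)
    finally show "2^k * (n2 (g k))\<^sup>2 \<le> (1/2)^k" .
  qed auto
  also have "\<dots> = ennreal (\<Sum>k. (1/2)^k)"
    by (rule suminf_ennreal2) (auto intro: summable_geometric)
  also have "\<dots> < \<infinity>" by simp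
  finally have "AE x in lborel. (\<Sum>k. ennreal (2^k * (cmod (g k x))\<^sup>2)) \<noteq> \<infinity>"
    by (intro nn_integral_PInf_AE) auto
  then show ?thesis
  proof eventually_elim
    case (elim x)
    have s: "summable (\<lambda>k. 2^k * (cmod (g k x))\<^sup>2)"
      using elim by (intro summable_suminf_not_top) auto
    have s2: "summable (\<lambda>k. (1/2)^k + 2^k * (cmod (g k x))\<^sup>2)"
      using s by (intro summable_add summable_geometric) auto
    \<comment> \<open>Arithmetic-geometric mean inequality, in the form of a completed
      square.\<close>
    have "cmod (g k x) \<le> (1/2)^k + 2^k * (cmod (g k x))\<^sup>2" for k
    proof -
      have "0 \<le> (1 - 2^k * cmod (g k x))\<^sup>2" by simp
      also have "\<dots> = 2^k * ((1/2)^k + 2^k * (cmod (g k x))\<^sup>2 - 2 * cmod (g k x))"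
        by (simp add: power2_eq_square field_simps)
      finally have "0 \<le> (1/2)^k + 2^k * (cmod (g k x))\<^sup>2 - 2 * cmod (g k x)"
        by (intro mult_left_le_imp_le[of "2^k" 0]) auto
      then show ?thesis using norm_ge_zero[of "g k x"] by linarith
    qed
    then show ?case
      by (intro summable_comparison_test[OF _ s2]) auto
  qed
qed

text \<open>Riesz-Fischer: a rapidly convergent subsequence has a pointwise limit almost everywhere,
  and Fatou's lemma turns the Cauchy condition into convergence of the full sequence to it.\<close>

lemma sqint_complete:
  assumes f: "\<And>n. sqint (f n)"
    and cauchy: "\<And>e. e > 0 \<Longrightarrow> \<exists>N. \<forall>m\<ge>N. \<forall>n\<ge>N. n2 (\<lambda>x. f m x - f n x) < e"
  shows "\<exists>g. sqint g \<and> (\<lambda>n. n2 (\<lambda>x. f n x - g x)) \<longlonglongrightarrow> 0"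
proof -
  have [measurable]: "f k \<in> borel_measurable borel" for k using f sqint_measurable by auto
  have "\<exists>N. \<forall>k. \<forall>m\<ge>N k. \<forall>n\<ge>N k. n2 (\<lambda>x. f m x - f n x) < (1/2)^k"
    using cauchy[of "(1/2)^k" for k] by (intro choice allI) auto
  then obtain N where N: "\<And>k m n. m \<ge> N k \<Longrightarrow> n \<ge> N k \<Longrightarrow> n2 (\<lambda>x. f m x - f n x) < (1/2)^k"
    by blast
  \<comment> \<open>The maximum puts both \<open>r k\<close> and \<open>r (Suc k)\<close> beyond
    \<open>N k\<close>; the summand k makes the indices tend to infinity.\<close>
  define r where "r k = k + Max (N ` {..k})" for k :: nat
  have r: "r k \<ge> N k" "r (Suc k) \<ge> N k" for k by (auto simp: r_def intro!: trans_le_add2 Max_ge le_SucI)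
  have fast: "n2 (\<lambda>x. f (r (Suc k)) x - f (r k) x) \<le> (1/2)^k" for k
    using N[OF r(2) r(1), of k] by simp
  define g where "g x = lim (\<lambda>k. f (r k) x)" for x
  have [measurable]: "g \<in> borel_measurable borel" unfolding g_def by measurable
  have conv: "AE x in lborel. (\<lambda>k. f (r k) x) \<longlonglongrightarrow> g x"
    using AE_summable_if_fast[OF sqint_diff(1)[OF f f] fast]
  proof eventually_elim
    case (elim x)
    have "convergent (\<lambda>n. \<Sum>k<n. f (r (Suc k)) x - f (r k) x)"
      using elim by (simp add: summable_iff_convergent)
    then have "convergent (\<lambda>n. (f (r n) x - f (r 0) x) + f (r 0) x)"
      unfolding sum_lessThan_telescope[of "\<lambda>k. f (r k) x"] by (intro convergent_add convergent_const)
    then show ?case by (simp add: g_def convergent_LIMSEQ_iff)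
  qed
  have bound: "sqint (\<lambda>x. f n x - g x) \<and> n2 (\<lambda>x. f n x - g x) \<le> e"
    if e: "e > 0" and M: "\<forall>m\<ge>M. \<forall>n\<ge>M. n2 (\<lambda>x. f m x - f n x) < e" and n: "n \<ge> M" for e M n
  proof -
    have "(\<integral>\<^sup>+x. ennreal ((cmod (f n x - g x))\<^sup>2) \<partial>lborel)
        = (\<integral>\<^sup>+x. liminf (\<lambda>k. ennreal ((cmod (f n x - f (r k) x))\<^sup>2)) \<partial>lborel)"
    proof (rule nn_integral_cong_AE, use conv in eventually_elim)
      case (elim x)
      have "(\<lambda>k. ennreal ((cmod (f n x - f (r k) x))\<^sup>2)) \<longlonglongrightarrow> ennreal ((cmod (f n x - g x))\<^sup>2)"
        by (intro tendsto_ennrealI tendsto_intros elim)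
      then show ?case by (intro lim_imp_Liminf[symmetric] sequentially_bot)
    qed
    also have "\<dots> \<le> liminf (\<lambda>k. \<integral>\<^sup>+x. ennreal ((cmod (f n x - f (r k) x))\<^sup>2) \<partial>lborel)"
      by (rule nn_integral_liminf) auto
    also have "\<dots> \<le> ennreal (e\<^sup>2)"
    proof (rule Liminf_le)
      show "\<forall>\<^sub>F k in sequentially. (\<integral>\<^sup>+x. ennreal ((cmod (f n x - f (r k) x))\<^sup>2) \<partial>lborel) \<le> ennreal (e\<^sup>2)"
        using eventually_ge_at_top[of M]
      proof eventually_elim
        case (elim k)
        then have "r k \<ge> M" by (simp add: r_def)
        then have "n2 (\<lambda>x. f n x - f (r k) x) \<le> e" using M n by (auto intro: less_imp_le)
        then show ?case
          by (simp add: sqint_nn_integral[OF sqint_diff(1)[OF f f]] power_mono ennreal_leI)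
      qed
    qed auto
    finally have *: "(\<integral>\<^sup>+x. ennreal ((cmod (f n x - g x))\<^sup>2) \<partial>lborel) \<le> ennreal (e\<^sup>2)" .
    show ?thesis using sqint_boundI[OF _ _ *] e by auto
  qed
  obtain M where "\<forall>m\<ge>M. \<forall>n\<ge>M. n2 (\<lambda>x. f m x - f n x) < 1" using cauchy[of 1] by auto
  from bound[OF _ this order_refl] have "sqint (\<lambda>x. f M x - g x)" by simp
  from sqint_diff(1)[OF f[of M] this] have "sqint g" by simp
  moreover have "(\<lambda>n. n2 (\<lambda>x. f n x - g x)) \<longlonglongrightarrow> 0"
  proof (rule LIMSEQ_I)
    fix e :: real assume "e > 0"
    then obtain M where "\<forall>m\<ge>M. \<forall>n\<ge>M. n2 (\<lambda>x. f m x - f n x) < e/2" using cauchy[of "e/2"] by auto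
    from bound[OF _ this] \<open>e > 0\<close> have "n2 (\<lambda>x. f n x - g x) \<le> e/2" if "n \<ge> M" for n using that by auto
    then show "\<exists>M. \<forall>n\<ge>M. norm (n2 (\<lambda>x. f n x - g x) - 0) < e"
      using \<open>e > 0\<close> by (intro exI[of _ M]) force
  qed
  ultimately show ?thesis by blast
qed


lemma nn_integral_reflect:
  fixes f :: "real \<Rightarrow> ennreal"
  assumes "f \<in> borel_measurable borel"
  shows "(\<integral>\<^sup>+y. f (x - y) \<partial>lborel) = (\<integral>\<^sup>+y. f y \<partial>lborel)"
  using nn_integral_real_affine[OF assms, of "-1" x] by simp

lemma nn_integral_translate:
  fixes f :: "real \<Rightarrow> ennreal"
  assumes "f \<in> borel_measurable borel"
  shows "(\<integral>\<^sup>+y. f (y - x) \<partial>lborel) = (\<integral>\<^sup>+y. f y \<partial>lborel)"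
  using nn_integral_real_affine[OF assms, of 1 "-x"] by simp

section \<open>Convolution inequalities\<close>

text \<open>Young's inequality for L^2 and L^1: the kernel b is split into two square roots before
  Cauchy-Schwarz, and Fubini integrates its translates.\<close>

lemma Young_nn_integral:
  fixes a b :: "real \<Rightarrow> real"
  assumes [measurable]: "a \<in> borel_measurable borel" "b \<in> borel_measurable borel"
    and pos: "\<And>x. 0 \<le> a x" "\<And>x. 0 \<le> b x"
  shows "(\<integral>\<^sup>+x. (\<integral>\<^sup>+y. ennreal (a y * b (x - y)) \<partial>lborel)\<^sup>2 \<partial>lborel)
    \<le> (\<integral>\<^sup>+y. ennreal ((a y)\<^sup>2) \<partial>lborel) * (\<integral>\<^sup>+y. ennreal (b y) \<partial>lborel)\<^sup>2"
proof -
  define B where "B = (\<integral>\<^sup>+y. ennreal (b y) \<partial>lborel)"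
  have B: "(\<integral>\<^sup>+y. ennreal (b (x - y)) \<partial>lborel) = B" for x
    unfolding B_def by (rule nn_integral_reflect) measurable
  have B': "(\<integral>\<^sup>+x. ennreal (b (x - y)) \<partial>lborel) = B" for y
    unfolding B_def by (rule nn_integral_translate) measurable
  have "(\<integral>\<^sup>+y. ennreal (a y * b (x - y)) \<partial>lborel)\<^sup>2
      \<le> (\<integral>\<^sup>+y. ennreal ((a y)\<^sup>2) * ennreal (b (x - y)) \<partial>lborel) * B" for x
  proof -
    have "(\<integral>\<^sup>+y. ennreal (a y * b (x - y)) \<partial>lborel)
        = (\<integral>\<^sup>+y. ennreal (a y * sqrt (b (x - y))) * ennreal (sqrt (b (x - y))) \<partial>lborel)"
      using pos by (intro nn_integral_cong) (simp add: ennreal_mult[symmetric] mult.assoc)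
    also have "\<dots>\<^sup>2 \<le> (\<integral>\<^sup>+y. (ennreal (a y * sqrt (b (x - y))))\<^sup>2 \<partial>lborel)
        * (\<integral>\<^sup>+y. (ennreal (sqrt (b (x - y))))\<^sup>2 \<partial>lborel)"
      by (rule Cauchy_Schwarz_nn_integral) measurable
    also have "\<dots> = (\<integral>\<^sup>+y. ennreal ((a y)\<^sup>2) * ennreal (b (x - y)) \<partial>lborel) * B"
      using pos by (simp add: ennreal_power power_mult_distrib ennreal_mult[symmetric] B)
    finally show ?thesis .
  qed
  then have "(\<integral>\<^sup>+x. (\<integral>\<^sup>+y. ennreal (a y * b (x - y)) \<partial>lborel)\<^sup>2 \<partial>lborel)
      \<le> (\<integral>\<^sup>+x. (\<integral>\<^sup>+y. ennreal ((a y)\<^sup>2) * ennreal (b (x - y)) \<partial>lborel) * B \<partial>lborel)"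
    by (intro nn_integral_mono) auto
  also have "\<dots> = (\<integral>\<^sup>+x. (\<integral>\<^sup>+y. ennreal ((a y)\<^sup>2) * ennreal (b (x - y)) \<partial>lborel) \<partial>lborel) * B"
    by (rule nn_integral_multc) measurable
  also have "(\<integral>\<^sup>+x. (\<integral>\<^sup>+y. ennreal ((a y)\<^sup>2) * ennreal (b (x - y)) \<partial>lborel) \<partial>lborel)
      = (\<integral>\<^sup>+y. (\<integral>\<^sup>+x. ennreal ((a y)\<^sup>2) * ennreal (b (x - y)) \<partial>lborel) \<partial>lborel)"
    by (rule lborel_pair.Fubini') measurable
  also have "\<dots> = (\<integral>\<^sup>+y. ennreal ((a y)\<^sup>2) \<partial>lborel) * B"
    by (simp add: nn_integral_cmult nn_integral_multc B')
  finally show ?thesis by (simp add: B_def power2_eq_square mult.assoc)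
qed

text \<open>The three frequencies are tied by x = (x - y) + y, so one factor in L^1 and two in L^2
  bound the form. Which factor can afford L^1 depends on where a symbol places its derivatives;
  hence the versions for each position.\<close>

lemma trilinear_L1_middle:
  fixes a b c :: "real \<Rightarrow> real"
  assumes [measurable]: "a \<in> borel_measurable borel" "b \<in> borel_measurable borel" "c \<in> borel_measurable borel"
    and pos: "\<And>x. 0 \<le> a x" "\<And>x. 0 \<le> b x" "\<And>x. 0 \<le> c x" and XYZ: "0 \<le> X" "0 \<le> Y" "0 \<le> Z"
    and A: "(\<integral>\<^sup>+x. ennreal ((a x)\<^sup>2) \<partial>lborel) \<le> ennreal (X\<^sup>2)"
    and B: "(\<integral>\<^sup>+x. ennreal (b x) \<partial>lborel) \<le> ennreal Y"
    and C: "(\<integral>\<^sup>+x. ennreal ((c x)\<^sup>2) \<partial>lborel) \<le> ennreal (Z\<^sup>2)"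
  shows "(\<integral>\<^sup>+x. (\<integral>\<^sup>+y. ennreal (a x * b (x - y) * c y) \<partial>lborel) \<partial>lborel) \<le> ennreal (X * Y * Z)"
proof -
  let ?J = "\<lambda>x. \<integral>\<^sup>+y. ennreal (c y * b (x - y)) \<partial>lborel"
  have "(\<integral>\<^sup>+x. (\<integral>\<^sup>+y. ennreal (a x * b (x - y) * c y) \<partial>lborel) \<partial>lborel)
      = (\<integral>\<^sup>+x. ennreal (a x) * ?J x \<partial>lborel)"
    using pos by (intro nn_integral_cong, subst nn_integral_cmult[symmetric])
      (auto simp: ennreal_mult[symmetric] mult_ac)
  also have "\<dots>\<^sup>2 \<le> (\<integral>\<^sup>+x. (ennreal (a x))\<^sup>2 \<partial>lborel) * (\<integral>\<^sup>+x. (?J x)\<^sup>2 \<partial>lborel)"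
    by (rule Cauchy_Schwarz_nn_integral) measurable
  also have "\<dots> \<le> ennreal (X\<^sup>2) * ((\<integral>\<^sup>+y. ennreal ((c y)\<^sup>2) \<partial>lborel) * (\<integral>\<^sup>+y. ennreal (b y) \<partial>lborel)\<^sup>2)"
    using A pos by (intro mult_mono Young_nn_integral) (auto simp: ennreal_power)
  also have "\<dots> \<le> ennreal (X\<^sup>2) * (ennreal (Z\<^sup>2) * (ennreal Y)\<^sup>2)"
    using B C by (intro mult_mono power_mono) auto
  also have "\<dots> = (ennreal (X * Y * Z))\<^sup>2"
    using XYZ by (simp add: ennreal_power ennreal_mult[symmetric] power_mult_distrib mult_ac)
  finally show ?thesis
    using XYZ by (cases "\<integral>\<^sup>+x. (\<integral>\<^sup>+y. ennreal (a x * b (x - y) * c y) \<partial>lborel) \<partial>lborel")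
      (auto simp: ennreal_power ennreal_le_iff power_eq_top_ennreal power2_le_iff_abs_le top_unique)
qed

lemma trilinear_L1_left:
  fixes a b c :: "real \<Rightarrow> real"
  assumes [measurable]: "a \<in> borel_measurable borel" "b \<in> borel_measurable borel" "c \<in> borel_measurable borel"
    and pos: "\<And>x. 0 \<le> a x" "\<And>x. 0 \<le> b x" "\<And>x. 0 \<le> c x" and XYZ: "0 \<le> X" "0 \<le> Y" "0 \<le> Z"
    and A: "(\<integral>\<^sup>+x. ennreal (a x) \<partial>lborel) \<le> ennreal X"
    and B: "(\<integral>\<^sup>+x. ennreal ((b x)\<^sup>2) \<partial>lborel) \<le> ennreal (Y\<^sup>2)"
    and C: "(\<integral>\<^sup>+x. ennreal ((c x)\<^sup>2) \<partial>lborel) \<le> ennreal (Z\<^sup>2)"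
  shows "(\<integral>\<^sup>+x. (\<integral>\<^sup>+y. ennreal (a x * b (x - y) * c y) \<partial>lborel) \<partial>lborel) \<le> ennreal (X * Y * Z)"
proof -
  have "(\<integral>\<^sup>+y. ennreal (a x * b (x - y) * c y) \<partial>lborel) \<le> ennreal (a x) * ennreal (Y * Z)" for x
  proof -
    have "(\<integral>\<^sup>+y. ennreal (a x * b (x - y) * c y) \<partial>lborel)
        = ennreal (a x) * (\<integral>\<^sup>+y. ennreal (b (x - y) * c y) \<partial>lborel)"
      using pos by (subst nn_integral_cmult[symmetric]) (auto simp: ennreal_mult[symmetric] mult_ac)
    also have "\<dots> \<le> ennreal (a x) * ennreal (Y * Z)"
      using pos XYZ B C nn_integral_reflect[of "\<lambda>y. ennreal ((b y)\<^sup>2)" x]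
      by (intro mult_left_mono Cauchy_Schwarz_real) auto
    finally show ?thesis .
  qed
  then have "(\<integral>\<^sup>+x. (\<integral>\<^sup>+y. ennreal (a x * b (x - y) * c y) \<partial>lborel) \<partial>lborel)
      \<le> (\<integral>\<^sup>+x. ennreal (a x) * ennreal (Y * Z) \<partial>lborel)"
    by (intro nn_integral_mono) auto
  also have "\<dots> = (\<integral>\<^sup>+x. ennreal (a x) \<partial>lborel) * ennreal (Y * Z)"
    by (rule nn_integral_multc) measurable
  also have "\<dots> \<le> ennreal X * ennreal (Y * Z)" using A by (intro mult_right_mono) auto
  finally show ?thesis using XYZ by (simp add: ennreal_mult[symmetric] mult.assoc)
qed

text \<open>Exchanging x and y reflects b and reduces this position to the left one.\<close>

lemma trilinear_L1_right:
  fixes a b c :: "real \<Rightarrow> real"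
  assumes [measurable]: "a \<in> borel_measurable borel" "b \<in> borel_measurable borel" "c \<in> borel_measurable borel"
    and pos: "\<And>x. 0 \<le> a x" "\<And>x. 0 \<le> b x" "\<And>x. 0 \<le> c x" and XYZ: "0 \<le> X" "0 \<le> Y" "0 \<le> Z"
    and A: "(\<integral>\<^sup>+x. ennreal ((a x)\<^sup>2) \<partial>lborel) \<le> ennreal (X\<^sup>2)"
    and B: "(\<integral>\<^sup>+x. ennreal ((b x)\<^sup>2) \<partial>lborel) \<le> ennreal (Y\<^sup>2)"
    and C: "(\<integral>\<^sup>+x. ennreal (c x) \<partial>lborel) \<le> ennreal Z"
  shows "(\<integral>\<^sup>+x. (\<integral>\<^sup>+y. ennreal (a x * b (x - y) * c y) \<partial>lborel) \<partial>lborel) \<le> ennreal (X * Y * Z)"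
proof -
  have "(\<integral>\<^sup>+x. (\<integral>\<^sup>+y. ennreal (a x * b (x - y) * c y) \<partial>lborel) \<partial>lborel)
      = (\<integral>\<^sup>+y. (\<integral>\<^sup>+x. ennreal (a x * b (x - y) * c y) \<partial>lborel) \<partial>lborel)"
    by (rule lborel_pair.Fubini') measurable
  also have "\<dots> = (\<integral>\<^sup>+y. (\<integral>\<^sup>+x. ennreal (c y * b (- (y - x)) * a x) \<partial>lborel) \<partial>lborel)"
    by (simp add: mult_ac)
  also have "\<dots> \<le> ennreal (Z * Y * X)"
    using pos XYZ A B C nn_integral_reflect[of "\<lambda>y. ennreal ((b y)\<^sup>2)" 0]
    by (intro trilinear_L1_left[where b = "\<lambda>x. b (- x)"]) auto
  finally show ?thesis by (simp add: mult_ac)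
qed

section \<open>A Gronwall inequality for upper right Dini derivatives\<close>

text \<open>Only a right-sided inequality with an arbitrary slack d is available later: Euler
  interpolants have corners, and difference quotients converge without a rate. The comparison
  function carries the same slack, which rules out a first crossing.\<close>

lemma Dini_Gronwall:
  fixes f :: "real \<Rightarrow> real"
  assumes cont: "continuous_on {0..T} f" and K: "0 \<le> K" and c: "0 \<le> c" and f0: "f 0 \<le> a" "0 \<le> a"
    and dini: "\<And>t d. 0 \<le> t \<Longrightarrow> t < T \<Longrightarrow> d > 0 \<Longrightarrow>
      \<forall>\<^sub>F h in at_right 0. f (t + h) \<le> f t + h * (K * f t + c + d)"
    and t: "0 \<le> t" "t \<le> T"
  shows "f t \<le> exp (K * t) * (a + c * t)"
proof (rule field_le_epsilon)
  fix e :: real assume e: "e > 0"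
  \<comment> \<open>With this slack the comparison function exceeds the claimed bound by at most e
    on the whole interval.\<close>
  define d where "d = e / (exp (K * T) * (1 + T))"
  have T: "T \<ge> 0" using t by simp
  have d: "d > 0" using e T by (simp add: d_def)
  define g where "g t = exp (K * t) * (a + d + (c + d) * t)" for t
  have g_cont: "continuous_on A g" for A unfolding g_def by (intro continuous_intros)
  have g_step: "g (r + h) \<ge> g r + h * (K * g r + c + d)" if "r \<ge> 0" "h \<ge> 0" for r h
  proof -
    define E where "E = exp (K * r)"
    define p where "p = a + d + (c + d) * r"
    have E: "E \<ge> 1" and p: "p \<ge> 0" using K c d f0 that by (auto simp: E_def p_def)
    have "1 + K * h \<le> exp (K * h)" by (rule exp_ge_add_one_self)
    then have "E * (1 + K * h) * p + E * (c + d) * h \<le> E * exp (K * h) * p + E * exp (K * h) * (c + d) * h"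
      using E p c d that K by (intro add_mono mult_right_mono mult_left_mono) (auto intro: order_trans[of 1])
    also have "\<dots> = g (r + h)" by (simp add: g_def E_def p_def exp_add algebra_simps)
    finally have "E * (1 + K * h) * p + E * (c + d) * h \<le> g (r + h)" .
    moreover have "E * (c + d) * h \<ge> 1 * (c + d) * h"
      using E c d that by (intro mult_right_mono) auto
    moreover have "g r = E * p" by (simp add: g_def E_def p_def)
    ultimately show ?thesis by (simp add: algebra_simps)
  qed
  \<comment> \<open>Let r be the infimum of the times where f exceeds g. Continuity gives f r <= g
    r, and the Dini inequality keeps f below g on a right neighbourhood of r, a
    contradiction.\<close>
  have fg: "f t \<le> g t"
  proof (rule ccontr)
    assume "\<not> f t \<le> g t"
    define S where "S = {r \<in> {0..T}. f r > g r}"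
    define r where "r = Inf S"
    have S: "S \<noteq> {}" "bdd_below S" using \<open>\<not> f t \<le> g t\<close> t by (auto simp: S_def intro!: bdd_belowI[of _ 0])
    obtain q0 where q0: "q0 \<in> S" using S(1) by blast
    have "0 \<le> r" unfolding r_def by (rule cInf_greatest[OF S(1)]) (simp add: S_def)
    moreover have "r \<le> T"
      using cInf_lower[OF q0 S(2)] q0 unfolding r_def[symmetric] by (simp add: S_def)
    ultimately have r: "0 \<le> r" "r \<le> T" .
    have below: "f q \<le> g q" if "0 \<le> q" "q < r" for q
      using cInf_lower[OF _ S(2), of q] that r by (force simp: S_def r_def)
    have fgr: "f r \<le> g r"
    proof (cases "r = 0")
      case True
      then show ?thesis using f0 d by (simp add: g_def)
    next
      case False
      then have r0: "r > 0" using r by simp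
      have lim: "((\<lambda>q. g q - f q) \<longlongrightarrow> g r - f r) (at r within {0..r})"
        using continuous_on_subset[OF cont, of "{0..r}"] r g_cont[of "{0..r}"]
        by (intro tendsto_diff) (auto simp: continuous_on_def)
      have "at r within {0..r} \<noteq> bot"
        using r0 by (simp add: trivial_limit_within islimpt_Icc)
      moreover have "\<forall>\<^sub>F q in at r within {0..r}. 0 \<le> g q - f q"
        unfolding eventually_at_filter using below by (auto intro!: always_eventually)
      ultimately have "0 \<le> g r - f r" using tendsto_lowerbound[OF lim] by blast
      then show ?thesis by simp
    qed
    have "r < T"
    proof (rule ccontr)
      assume "\<not> r < T"
      then have "r = T" using r by simp
      then have "S \<subseteq> {}" using below fgr unfolding S_def by (force simp: le_less)
      then show False using S by simp
    qed
    have "\<forall>\<^sub>F h in at_right 0. f (r + h) \<le> g (r + h)"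
      using dini[OF r(1) \<open>r < T\<close> d] eventually_at_right_less[of 0]
    proof eventually_elim
      case (elim h)
      have "f (r + h) \<le> f r + h * (K * f r + c + d)" by (rule elim)
      also have "\<dots> \<le> g r + h * (K * g r + c + d)"
        using fgr K elim by (intro add_mono mult_left_mono) auto
      also have "\<dots> \<le> g (r + h)" using r elim by (intro g_step) auto
      finally show ?case .
    qed
    then obtain b where b: "b > 0" "\<And>h. 0 < h \<Longrightarrow> h < b \<Longrightarrow> f (r + h) \<le> g (r + h)"
      by (auto simp: eventually_at_right_field)
    have "r + b \<le> q" if "q \<in> S" for q
    proof (rule ccontr)
      assume "\<not> r + b \<le> q"
      moreover have "q \<ge> r" using that S by (auto simp: r_def intro: cInf_lower)
      ultimately have "f q \<le> g q" using b(2)[of "q - r"] fgr by (cases "q = r") auto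
      then show False using that by (simp add: S_def)
    qed
    then have "r + b \<le> r" using S unfolding r_def by (intro cInf_greatest)
    then show False using b by simp
  qed
  have "g t = exp (K * t) * (a + c * t) + exp (K * t) * (d * (1 + t))"
    by (simp add: g_def algebra_simps)
  moreover have "exp (K * t) * (d * (1 + t)) \<le> exp (K * T) * (d * (1 + T))"
    using t K d by (intro mult_mono) (auto intro: mult_left_mono)
  moreover have "exp (K * T) * (d * (1 + T)) = e" using T by (simp add: d_def)
  ultimately show "f t \<le> exp (K * t) * (a + c * t) + e" using fg by simp
qed

section \<open>Symbol inequalities\<close>

definition jb :: "real \<Rightarrow> real" where
  "jb x = sqrt (1 + x\<^sup>2)"

lemma jb_measurable [measurable]: "jb \<in> borel_measurable borel"
  unfolding jb_def by measurable

lemma jb_ge_1 [simp]: "1 \<le> jb x" and jb_pos [simp]: "0 < jb x" and jb_nonneg [simp]: "0 \<le> jb x"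
proof -
  show "1 \<le> jb x" unfolding jb_def by simp
  then show "0 < jb x" "0 \<le> jb x" by linarith+
qed

lemma abs_le_jb: "\<bar>x\<bar> \<le> jb x"
  unfolding jb_def by (rule real_le_rsqrt) simp

lemma jb_sq: "(jb x)\<^sup>2 = 1 + x\<^sup>2"
  by (simp add: jb_def)

lemma jb_minus [simp]: "jb (- x) = jb x"
  by (simp add: jb_def)

lemma jb_diff_commute: "jb (x - y) = jb (y - x)"
  by (metis jb_minus minus_diff_eq)

lemma abs_jb_diff_le: "\<bar>jb x - jb y\<bar> \<le> \<bar>x - y\<bar>"
proof -
  have "(jb x - jb y) * (jb x + jb y) = (x - y) * (x + y)"
    using jb_sq[of x] jb_sq[of y] by (simp add: algebra_simps power2_eq_square)
  then have "\<bar>jb x - jb y\<bar> * (jb x + jb y) = \<bar>x - y\<bar> * \<bar>x + y\<bar>"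
    by (metis abs_mult abs_of_nonneg add_nonneg_nonneg jb_nonneg)
  also have "\<dots> \<le> \<bar>x - y\<bar> * (jb x + jb y)"
    using abs_le_jb[of x] abs_le_jb[of y] by (intro mult_left_mono) auto
  finally show ?thesis
    by (rule mult_right_le_imp_le) (simp add: add_pos_pos)
qed

lemma jb_le_add_abs: "jb x \<le> jb y + \<bar>x - y\<bar>"
  using abs_jb_diff_le[of x y] by linarith

lemma jb_triangle: "jb x \<le> jb y + jb (x - y)"
  using jb_le_add_abs[of x y] abs_le_jb[of "x - y"] by linarith

lemma jb_mono: "\<bar>x\<bar> \<le> \<bar>y\<bar> \<Longrightarrow> jb x \<le> jb y"
  by (simp add: jb_def abs_le_square_iff)

definition gw :: "real \<Rightarrow> real \<Rightarrow> real \<Rightarrow> real" where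
  "gw s M j = j powr s * sqrt (j / (j + M))"

text \<open>For \<open>M = 0\<close> this is the Sobolev weight; for large \<open>M\<close> it suppresses frequencies below \<open>M\<close>, so that an
  energy estimate uniform in \<open>M\<close> propagates the smallness of the high-frequency tail.\<close>

definition wt :: "real \<Rightarrow> real \<Rightarrow> real \<Rightarrow> real" where
  "wt s M x = gw s M (jb x)"

lemma wt_measurable [measurable]: "wt s M \<in> borel_measurable borel"
  unfolding wt_def gw_def by measurable

lemma wt_0: "wt s 0 x = jb x powr s"
  by (simp add: wt_def gw_def order_less_imp_not_eq2)

lemma wt_nonneg [simp]: "0 \<le> M \<Longrightarrow> 0 \<le> wt s M x"
  unfolding wt_def gw_def by (auto intro!: mult_nonneg_nonneg)

lemma wt_minus [simp]: "wt s M (- x) = wt s M x"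
  by (simp add: wt_def)

lemma wt_le_0: "0 \<le> M \<Longrightarrow> wt s M x \<le> wt s 0 x"
  using add_pos_nonneg[OF jb_pos[of x], of M] order_less_imp_not_eq2[OF jb_pos[of x]]
  unfolding wt_def gw_def by (intro mult_left_mono real_sqrt_le_mono) auto

lemma frac_mono: "0 < a \<Longrightarrow> a \<le> b \<Longrightarrow> 0 \<le> M \<Longrightarrow> a / (a + M) \<le> b / (b + M)" for a b M :: real
  using mult_left_mono[of a b M] by (simp add: divide_simps algebra_simps)

lemma gw_mono:
  assumes "1 \<le> a" "a \<le> b" "0 \<le> M" "0 \<le> s"
  shows "gw s M a \<le> gw s M b"
  unfolding gw_def using assms
  by (intro mult_mono powr_mono2 real_sqrt_le_mono frac_mono) auto

lemma gw_pos: "1 \<le> a \<Longrightarrow> 0 \<le> M \<Longrightarrow> 0 < gw s M a"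
  unfolding gw_def by (auto intro!: mult_pos_pos divide_pos_pos)

text \<open>The power contributes K^s, and the quotient j / (j + M) at most K^2 under the root. The
  constant does not involve M, so the estimates built on it are uniform in the tail
  parameter.\<close>

lemma gw_scale:
  assumes "1 \<le> a" "1 \<le> K" "0 \<le> M"
  shows "gw s M (K * a) \<le> K powr (s + 1) * gw s M a"
proof -
  have "sqrt (K * a / (K * a + M)) \<le> sqrt (K\<^sup>2 * (a / (a + M)))"
  proof (rule real_sqrt_le_mono)
    have "K * a / (K * a + M) \<le> K * a / (a + M)"
      using assms mult_right_mono[of 1 K a] by (intro divide_left_mono) (auto intro!: mult_pos_pos add_pos_nonneg)
    also have "\<dots> \<le> K\<^sup>2 * a / (a + M)"
      using assms by (intro divide_right_mono mult_right_mono) (auto simp: power2_eq_square)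
    finally show "K * a / (K * a + M) \<le> K\<^sup>2 * (a / (a + M))" by simp
  qed
  also have "\<dots> = K * sqrt (a / (a + M))" using assms by (simp only: real_sqrt_mult real_sqrt_abs abs_of_nonneg[of K])
  finally have "gw s M (K * a) \<le> (K * a) powr s * (K * sqrt (a / (a + M)))"
    unfolding gw_def using assms by (intro mult_left_mono) auto
  also have "\<dots> = K powr (s + 1) * gw s M a"
    using assms by (simp add: gw_def powr_mult powr_add)
  finally show ?thesis .
qed

lemma gw_le_scale:
  assumes "1 \<le> a" "1 \<le> b" "b \<le> K * a" "1 \<le> K" "0 \<le> M" "0 \<le> s"
  shows "gw s M b \<le> K powr (s + 1) * gw s M a"
  using gw_mono[of b "K * a" M s] gw_scale[of a K M s] assms by linarith

text \<open>Division by j lowers the order of the weight to s - 1 >= 0, where it is still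
  nondecreasing. This lets the derivative gained by the nonlocal term be spent at the larger
  frequency.\<close>

lemma gw_over_mono:
  assumes "1 \<le> a" "a \<le> b" "0 \<le> M" "1 \<le> s"
  shows "gw s M a / a \<le> gw s M b / b"
proof -
  have "gw s M x / x = gw (s - 1) M x" if "1 \<le> x" for x
    using that by (simp add: gw_def powr_diff)
  then show ?thesis using gw_mono[of a b M "s - 1"] assms by auto
qed

lemma wt_triangle:
  assumes "0 \<le> M" "0 \<le> s"
  shows "wt s M x \<le> 2 powr (s + 1) * (wt s M y + wt s M (x - y))"
proof -
  define a where "a = max (jb y) (jb (x - y))"
  have "jb x \<le> 2 * a" using jb_triangle[of x y] by (auto simp: a_def)
  then have "wt s M x \<le> 2 powr (s + 1) * gw s M a"
    unfolding wt_def using assms by (intro gw_le_scale) (auto simp: a_def max_def)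
  also have "\<dots> \<le> 2 powr (s + 1) * (wt s M y + wt s M (x - y))"
    using assms wt_nonneg[of M s y] wt_nonneg[of M s "x - y"]
    by (intro mult_left_mono) (auto simp: a_def wt_def max_def)
  finally show ?thesis .
qed

section \<open>The Helmholtz symbol and the kernel of the nonlinearity\<close>

definition hm :: "real \<Rightarrow> real \<Rightarrow> real" where
  "hm \<alpha> x = 1 / (1 + \<alpha>\<^sup>2 * x\<^sup>2)"

lemma hm_measurable [measurable]: "hm \<alpha> \<in> borel_measurable borel"
  unfolding hm_def by measurable

lemma hm_pos: "0 < hm \<alpha> x" and hm_le_1: "hm \<alpha> x \<le> 1" and hm_nonneg [simp]: "0 \<le> hm \<alpha> x"
proof -
  have "1 + \<alpha>\<^sup>2 * x\<^sup>2 > 0" by (intro add_pos_nonneg) auto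
  then show "0 < hm \<alpha> x" "hm \<alpha> x \<le> 1" unfolding hm_def by (simp_all add: divide_simps)
  then show "0 \<le> hm \<alpha> x" by simp
qed

lemma hm_minus [simp]: "hm \<alpha> (- x) = hm \<alpha> x"
  by (simp add: hm_def)

lemma hm_eq: "hm \<alpha> x * (1 + \<alpha>\<^sup>2 * x\<^sup>2) = 1"
  using add_pos_nonneg[of 1 "\<alpha>\<^sup>2 * x\<^sup>2"] by (simp add: hm_def)

lemma hm_bound1: "\<bar>\<alpha>\<bar> * \<bar>x\<bar> * hm \<alpha> x \<le> 1 / 2"
proof -
  have "0 \<le> (1 - \<bar>\<alpha>\<bar> * \<bar>x\<bar>)\<^sup>2" by simp
  then have "\<bar>\<alpha>\<bar> * \<bar>x\<bar> \<le> 1 / 2 * (1 + \<alpha>\<^sup>2 * x\<^sup>2)"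
    by (simp add: power2_diff power_mult_distrib)
  then have "\<bar>\<alpha>\<bar> * \<bar>x\<bar> * hm \<alpha> x \<le> 1 / 2 * (1 + \<alpha>\<^sup>2 * x\<^sup>2) * hm \<alpha> x"
    by (rule mult_right_mono) simp
  then show ?thesis using hm_eq[of \<alpha> x] by (simp add: mult_ac)
qed

lemma hm_bound2: "\<alpha>\<^sup>2 * x\<^sup>2 * hm \<alpha> x \<le> 1"
  using hm_eq[of \<alpha> x] hm_pos[of \<alpha> x] by (simp add: algebra_simps)

text \<open>The prefactor \<alpha>^2 of the quadratic derivative term pays for the smoothing: the
  symbol of \<open>\<alpha>\<^sup>2 \<partial>\<^sub>x\<close> applied to the Helmholtz inverse has
  order -1 uniformly in \<alpha>.\<close>

lemma hm_bound_jb: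
  assumes "0 \<le> \<alpha>" "\<alpha> \<le> 1"
  shows "\<alpha>\<^sup>2 * \<bar>x\<bar> * hm \<alpha> x \<le> 2 / jb x"
proof -
  have a2: "\<alpha>\<^sup>2 \<le> 1" using assms by (simp add: power_le_one)
  have h1: "\<alpha>\<^sup>2 * \<bar>x\<bar> * hm \<alpha> x * \<bar>x\<bar> \<le> 1"
    using hm_bound2[of \<alpha> x] by (simp add: power2_eq_square mult_ac)
  have "\<bar>\<alpha>\<bar> * (\<bar>\<alpha>\<bar> * \<bar>x\<bar> * hm \<alpha> x) \<le> 1 * (1/2)"
    using assms hm_bound1[of \<alpha> x] by (intro mult_mono) auto
  then have h2: "\<alpha>\<^sup>2 * \<bar>x\<bar> * hm \<alpha> x \<le> 1"
    using assms by (simp add: power2_eq_square mult_ac)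
  have "\<alpha>\<^sup>2 * \<bar>x\<bar> * hm \<alpha> x * jb x \<le> \<alpha>\<^sup>2 * \<bar>x\<bar> * hm \<alpha> x * (1 + \<bar>x\<bar>)"
    using jb_le_add_abs[of x 0] by (intro mult_left_mono) (auto simp: jb_def)
  also have "\<dots> \<le> 2" using h1 h2 by (simp add: algebra_simps)
  finally show ?thesis by (simp add: divide_simps)
qed

text \<open>The summand 1/2 is the transport term written as half the derivative of u^2,
  \<open>hm\<close> is the nonlocal u^2, and the last summand is the squared derivative, with symbol
  i (x - y) times i y. At \<alpha> = 0 the kernel is the constant 3/2 of Burgers.\<close>

definition kern :: "real \<Rightarrow> real \<Rightarrow> real \<Rightarrow> real" where
  "kern \<alpha> x y = 1 / 2 + hm \<alpha> x - \<alpha>\<^sup>2 / 2 * hm \<alpha> x * ((x - y) * y)"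

lemma kern_measurable [measurable]: "(\<lambda>p. kern \<alpha> (fst p) (snd p)) \<in> borel_measurable (borel \<Otimes>\<^sub>M borel)"
  unfolding kern_def by measurable

text \<open>The multiplier gains a factor 2 / \<open>jb x\<close> against the two inner derivatives.
  The larger of the inner frequencies takes the weight, the smaller one keeps its bracket.\<close>

lemma nonlocal_symbol_bound:
  assumes "0 \<le> \<alpha>" "\<alpha> \<le> 1" "0 \<le> M" "1 \<le> s"
  shows "wt s M x * (\<alpha>\<^sup>2 / 2 * \<bar>x\<bar> * hm \<alpha> x * (\<bar>x - y\<bar> * \<bar>y\<bar>))
    \<le> 2 powr (s + 1) * (wt s M y * jb (x - y) + wt s M (x - y) * jb y)"
proof -
  have key: "wt s M x / jb x * (\<bar>z\<bar> * \<bar>y\<bar>) \<le> 2 powr (s + 1) * (wt s M y * jb z)"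
    if "jb z \<le> jb y" "jb x \<le> jb y + jb z" for z y
  proof -
    have "wt s M x / jb x \<le> gw s M (2 * jb y) / (2 * jb y)"
      unfolding wt_def using that assms by (intro gw_over_mono) auto
    also have "\<dots> \<le> (2 powr (s + 1) * wt s M y) / (2 * jb y)"
      unfolding wt_def using assms by (intro divide_right_mono gw_scale) auto
    also have "\<dots> \<le> (2 powr (s + 1) * wt s M y) / jb y"
      using assms by (intro divide_left_mono) (auto intro!: mult_nonneg_nonneg)
    finally have "wt s M x / jb x * (\<bar>z\<bar> * \<bar>y\<bar>) \<le> (2 powr (s + 1) * wt s M y) / jb y * (jb z * jb y)"
      using abs_le_jb[of z] abs_le_jb[of y] assms by (intro mult_mono) auto
    then show ?thesis by (simp add: order_less_imp_not_eq2)
  qed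
  have "wt s M x * (\<alpha>\<^sup>2 / 2 * \<bar>x\<bar> * hm \<alpha> x * (\<bar>x - y\<bar> * \<bar>y\<bar>))
      = wt s M x * (1/2) * (\<alpha>\<^sup>2 * \<bar>x\<bar> * hm \<alpha> x) * (\<bar>x - y\<bar> * \<bar>y\<bar>)" by simp
  also have "\<dots> \<le> wt s M x * (1/2) * (2 / jb x) * (\<bar>x - y\<bar> * \<bar>y\<bar>)"
    using hm_bound_jb[of \<alpha> x] assms by (intro mult_right_mono mult_left_mono) auto
  also have "\<dots> = wt s M x / jb x * (\<bar>x - y\<bar> * \<bar>y\<bar>)" by simp
  also have "\<dots> \<le> 2 powr (s + 1) * (wt s M y * jb (x - y) + wt s M (x - y) * jb y)"
  proof (cases "jb (x - y) \<le> jb y")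
    case True
    have "wt s M x / jb x * (\<bar>x - y\<bar> * \<bar>y\<bar>) \<le> 2 powr (s + 1) * (wt s M y * jb (x - y))"
      using key[OF True] jb_triangle[of x y] by simp
    also have "\<dots> \<le> 2 powr (s + 1) * (wt s M y * jb (x - y) + wt s M (x - y) * jb y)"
      using assms by (intro mult_left_mono) auto
    finally show ?thesis .
  next
    case False
    have "wt s M x / jb x * (\<bar>y\<bar> * \<bar>x - y\<bar>) \<le> 2 powr (s + 1) * (wt s M (x - y) * jb y)"
      using key[of y "x - y"] False jb_triangle[of x y] by simp
    also have "\<dots> \<le> 2 powr (s + 1) * (wt s M y * jb (x - y) + wt s M (x - y) * jb y)"
      using assms by (intro mult_left_mono) auto
    finally show ?thesis by (simp add: mult_ac)
  qed
  finally show ?thesis .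
qed

text \<open>The factor \<open>jb x\<close> is the loss of one derivative. It is caused by 1/2 +
  \<open>hm\<close> alone; the summand with (x - y) y satisfies the bound without it.\<close>

lemma kern_bound:
  assumes "0 \<le> \<alpha>" "\<alpha> \<le> 1" "0 \<le> M" "1 \<le> s"
  shows "wt s M x * \<bar>x * kern \<alpha> x y\<bar>
    \<le> 2 powr (s + 3) * jb x * (wt s M y * jb (x - y) + wt s M (x - y) * jb y)"
proof -
  define R where "R = wt s M y * jb (x - y) + wt s M (x - y) * jb y"
  have "wt s M y * 1 + wt s M (x - y) * 1 \<le> R"
    unfolding R_def using assms by (intro add_mono mult_left_mono) auto
  then have R: "wt s M x \<le> 2 powr (s + 1) * R"
    using wt_triangle[of M s x y] assms mult_left_mono[of "wt s M y + wt s M (x - y)" R "2 powr (s + 1)"]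
    by (auto intro: order_trans)
  have R0: "0 \<le> R" unfolding R_def using assms by simp
  have "\<bar>x * kern \<alpha> x y\<bar> = \<bar>x * (1/2 + hm \<alpha> x) - x * (\<alpha>\<^sup>2 / 2 * hm \<alpha> x * ((x - y) * y))\<bar>"
    by (simp add: kern_def algebra_simps)
  also have "\<dots> \<le> \<bar>x * (1/2 + hm \<alpha> x)\<bar> + \<bar>x * (\<alpha>\<^sup>2 / 2 * hm \<alpha> x * ((x - y) * y))\<bar>"
    by (rule abs_triangle_ineq4)
  also have "\<bar>x * (1/2 + hm \<alpha> x)\<bar> = \<bar>x\<bar> * (1/2 + hm \<alpha> x)" by (simp add: abs_mult)
  also have "\<dots> \<le> jb x * (3/2)"
    using hm_le_1[of \<alpha> x] hm_pos[of \<alpha> x] by (intro mult_mono abs_le_jb) auto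
  also have "\<bar>x * (\<alpha>\<^sup>2 / 2 * hm \<alpha> x * ((x - y) * y))\<bar> = \<alpha>\<^sup>2 / 2 * \<bar>x\<bar> * hm \<alpha> x * (\<bar>x - y\<bar> * \<bar>y\<bar>)"
    by (simp add: abs_mult)
  finally have "wt s M x * \<bar>x * kern \<alpha> x y\<bar>
      \<le> wt s M x * (jb x * (3/2)) + wt s M x * (\<alpha>\<^sup>2 / 2 * \<bar>x\<bar> * hm \<alpha> x * (\<bar>x - y\<bar> * \<bar>y\<bar>))"
    using assms mult_left_mono[OF _ wt_nonneg[of M s x]] by (simp only: distrib_left[symmetric])
  also have "\<dots> \<le> 2 powr (s + 1) * R * (jb x * (3/2)) + 2 powr (s + 1) * R * jb x"
  proof (rule add_mono)
    show "wt s M x * (jb x * (3/2)) \<le> 2 powr (s + 1) * R * (jb x * (3/2))"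
      using R by (intro mult_right_mono) auto
    have "wt s M x * (\<alpha>\<^sup>2 / 2 * \<bar>x\<bar> * hm \<alpha> x * (\<bar>x - y\<bar> * \<bar>y\<bar>)) \<le> 2 powr (s + 1) * R * 1"
      using nonlocal_symbol_bound[OF assms] by (simp add: R_def)
    also have "\<dots> \<le> 2 powr (s + 1) * R * jb x" using R0 by (intro mult_left_mono) auto
    finally show "wt s M x * (\<alpha>\<^sup>2 / 2 * \<bar>x\<bar> * hm \<alpha> x * (\<bar>x - y\<bar> * \<bar>y\<bar>)) \<le> 2 powr (s + 1) * R * jb x" .
  qed
  also have "\<dots> \<le> 2 powr (s + 3) * jb x * R"
    using R0 by (simp add: powr_add algebra_simps)
  finally show ?thesis by (simp add: R_def)
qed

text \<open>A finite-difference form of a |f'(a)| <= C f(a) on dyadic intervals. It passes to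
  products, so the energy weight is treated factor by factor with a constant free of M and
  \<alpha>.\<close>

definition slow :: "real \<Rightarrow> (real \<Rightarrow> real) \<Rightarrow> bool" where
  "slow C f \<longleftrightarrow> 0 \<le> C \<and> (\<forall>a. 1 \<le> a \<longrightarrow> 0 \<le> f a) \<and>
     (\<forall>a b. 1 \<le> a \<longrightarrow> a \<le> b \<longrightarrow> b \<le> 2 * a \<longrightarrow> a * \<bar>f b - f a\<bar> \<le> C * (b - a) * f a)"

lemma slow_mult:
  assumes f: "slow C f" and g: "slow D g"
  shows "slow (C * (1 + D) + D) (\<lambda>a. f a * g a)"
  unfolding slow_def
proof (intro conjI allI impI)
  show "0 \<le> C * (1 + D) + D" using f g by (auto simp: slow_def)
  show "0 \<le> f a * g a" if "1 \<le> a" for a using f g that by (auto simp: slow_def)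
  fix a b :: real assume ab: "1 \<le> a" "a \<le> b" "b \<le> 2 * a"
  have CD: "0 \<le> C" "0 \<le> D" using f g by (auto simp: slow_def)
  have F: "a * \<bar>f b - f a\<bar> \<le> C * (b - a) * f a" and G: "a * \<bar>g b - g a\<bar> \<le> D * (b - a) * g a"
    and pos: "0 \<le> f a" "0 \<le> g a" "0 \<le> g b"
    using f g ab by (auto simp: slow_def)
  have "a * \<bar>g b - g a\<bar> \<le> D * a * g a"
    using G mult_right_mono[of "D * (b - a)" "D * a" "g a"] mult_left_mono[of "b - a" a D] pos ab CD by linarith
  then have "a * \<bar>g b - g a\<bar> \<le> a * (D * g a)" by (simp add: mult_ac)
  then have "\<bar>g b - g a\<bar> \<le> D * g a" using ab by (subst (asm) mult_le_cancel_left_pos) auto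
  then have gb: "g b \<le> (1 + D) * g a" by (simp add: algebra_simps)
  have "f b * g b - f a * g a = (f b - f a) * g b + f a * (g b - g a)" by (simp add: algebra_simps)
  then have "a * \<bar>f b * g b - f a * g a\<bar> \<le> a * (\<bar>f b - f a\<bar> * g b + f a * \<bar>g b - g a\<bar>)"
    using ab pos abs_triangle_ineq[of "(f b - f a) * g b" "f a * (g b - g a)"] by (simp add: abs_mult)
  also have "\<dots> = (a * \<bar>f b - f a\<bar>) * g b + f a * (a * \<bar>g b - g a\<bar>)" by (simp add: algebra_simps)
  also have "\<dots> \<le> (C * (b - a) * f a) * ((1 + D) * g a) + f a * (D * (b - a) * g a)"
    using F G gb pos CD ab by (intro add_mono mult_mono[OF F gb] mult_left_mono[OF G]) auto
  also have "\<dots> = (C * (1 + D) + D) * (b - a) * (f a * g a)" by (simp add: algebra_simps)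
  finally show "a * \<bar>f b * g b - f a * g a\<bar> \<le> (C * (1 + D) + D) * (b - a) * (f a * g a)" .
qed

lemma slow_powr:
  assumes r: "1 \<le> r"
  shows "slow (r * 2 powr (r - 1)) (\<lambda>a. a powr r)"
  unfolding slow_def
proof (intro conjI allI impI)
  fix a b :: real assume ab: "1 \<le> a" "a \<le> b" "b \<le> 2 * a"
  show "a * \<bar>b powr r - a powr r\<bar> \<le> r * 2 powr (r - 1) * (b - a) * a powr r"
  proof (cases "a = b")
    case False
    have "\<exists>z. a < z \<and> z < b \<and> b powr r - a powr r = (b - a) * (r * z powr (r - 1))"
      using ab False by (intro MVT2) (auto intro!: derivative_eq_intros)
    then obtain z where z: "a < z" "z < b" "b powr r - a powr r = (b - a) * (r * z powr (r - 1))" by blast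
    have "a * \<bar>b powr r - a powr r\<bar> = a * ((b - a) * (r * z powr (r - 1)))"
      using z ab r by (simp add: abs_mult)
    also have "\<dots> \<le> a * ((b - a) * (r * (2 * a) powr (r - 1)))"
      using z ab r by (intro mult_left_mono powr_mono2) auto
    also have "\<dots> = r * 2 powr (r - 1) * (b - a) * a powr r"
      using ab by (simp add: powr_mult powr_diff)
    finally show ?thesis .
  qed simp
qed (use r in auto)

lemma slow_frac:
  assumes "0 \<le> M"
  shows "slow 1 (\<lambda>a. a / (a + M))"
  unfolding slow_def
proof (intro conjI allI impI)
  fix a b :: real assume ab: "1 \<le> a" "a \<le> b" "b \<le> 2 * a"
  have pos: "a + M > 0" "b + M > 0" using ab assms by auto
  have "b / (b + M) - a / (a + M) = (b - a) * (M / (b + M)) / (a + M)"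
    using pos by (simp add: divide_simps) (simp add: algebra_simps)
  moreover have "\<dots> \<le> (b - a) * 1 / (a + M)"
    using pos ab assms by (intro divide_right_mono mult_left_mono) auto
  moreover have "0 \<le> b / (b + M) - a / (a + M)" using frac_mono[of a b M] ab assms by simp
  ultimately have "\<bar>b / (b + M) - a / (a + M)\<bar> \<le> (b - a) * 1 / (a + M)" by linarith
  then have "a * \<bar>b / (b + M) - a / (a + M)\<bar> \<le> a * ((b - a) * 1 / (a + M))"
    using ab by (intro mult_left_mono) auto
  then show "a * \<bar>b / (b + M) - a / (a + M)\<bar> \<le> 1 * (b - a) * (a / (a + M))" by (simp add: mult_ac)
qed (use assms in auto)

text \<open>The Helmholtz symbol as a function of the bracket, because slow variation is measured in
  \<open>jb x\<close> rather than in x.\<close>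

definition hmj :: "real \<Rightarrow> real \<Rightarrow> real" where
  "hmj \<alpha> j = 1 / (1 + \<alpha>\<^sup>2 * (j\<^sup>2 - 1))"

lemma hm_hmj: "hm \<alpha> x = hmj \<alpha> (jb x)"
  by (simp add: hm_def hmj_def jb_sq)

lemma slow_hmj:
  assumes "0 \<le> \<alpha>" "\<alpha> \<le> 1"
  shows "slow 3 (\<lambda>a. 1/2 + hmj \<alpha> a)"
  unfolding slow_def
proof (intro conjI allI impI)
  have pos: "0 < 1 + \<alpha>\<^sup>2 * (a\<^sup>2 - 1)" if "1 \<le> a" for a
    using that by (intro add_pos_nonneg mult_nonneg_nonneg) auto
  fix a :: real assume a: "1 \<le> a"
  show "0 \<le> 1/2 + hmj \<alpha> a" using pos[OF a] by (simp add: hmj_def)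
  fix b :: real assume ab: "a \<le> b" "b \<le> 2 * a"
  have b: "1 \<le> b" using a ab by simp
  have a2: "\<alpha>\<^sup>2 \<le> 1" using assms by (simp add: power_le_one)
  define p where "p = 1 + \<alpha>\<^sup>2 * (a\<^sup>2 - 1)"
  define q where "q = 1 + \<alpha>\<^sup>2 * (b\<^sup>2 - 1)"
  have pq: "0 < p" "0 < q" using pos a b by (auto simp: p_def q_def)
  have "p \<le> q" unfolding p_def q_def using a ab by (intro add_left_mono mult_left_mono) (auto intro: power_mono)
  \<comment> \<open>Here \<alpha> <= 1 enters: p exceeds \<alpha>^2 a^2 by 1 - \<alpha>^2.\<close>
  have ap: "\<alpha>\<^sup>2 * a\<^sup>2 \<le> p" using a2 by (simp add: p_def algebra_simps)
  have "hmj \<alpha> b - hmj \<alpha> a = (p - q) / (p * q)"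
    using pq unfolding hmj_def p_def[symmetric] q_def[symmetric] by (simp add: divide_simps)
  also have "p - q = - (\<alpha>\<^sup>2 * (b - a) * (a + b))" by (simp add: p_def q_def algebra_simps power2_eq_square)
  finally have "a * \<bar>hmj \<alpha> b - hmj \<alpha> a\<bar> = a * (\<alpha>\<^sup>2 * (b - a) * (a + b)) / (p * q)"
    using pq a ab by (simp add: abs_mult)
  also have "\<dots> \<le> a * (\<alpha>\<^sup>2 * (b - a) * (3 * a)) / (p * q)"
    using pq a ab by (intro divide_right_mono mult_left_mono) auto
  also have "\<dots> = 3 * (b - a) * (\<alpha>\<^sup>2 * a\<^sup>2) / (p * q)" by (simp add: power2_eq_square)
  also have "\<dots> \<le> 3 * (b - a) * p / (p * q)"
    using pq a ab ap by (intro divide_right_mono mult_left_mono) auto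
  also have "\<dots> = 3 * (b - a) * (1 / q)" using pq by simp
  also have "\<dots> \<le> 3 * (b - a) * (1 / p)"
    using pq ab \<open>p \<le> q\<close> by (intro mult_left_mono divide_left_mono) auto
  also have "\<dots> \<le> 3 * (b - a) * (1/2 + hmj \<alpha> a)"
    using ab by (intro mult_left_mono) (auto simp: hmj_def p_def)
  finally show "a * \<bar>1/2 + hmj \<alpha> b - (1/2 + hmj \<alpha> a)\<bar> \<le> 3 * (b - a) * (1/2 + hmj \<alpha> a)" by simp
qed simp

text \<open>Coefficient of the transport part of the energy form: the squared weight times the part
  of \<open>kern\<close> that depends only on the output frequency.\<close>

definition esym :: "real \<Rightarrow> real \<Rightarrow> real \<Rightarrow> real \<Rightarrow> real" where
  "esym s M \<alpha> x = (wt s M x)\<^sup>2 * (1/2 + hm \<alpha> x)"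

lemma esym_slow:
  assumes "1 \<le> s"
  shows "\<exists>C\<ge>0. \<forall>\<alpha> M. 0 \<le> \<alpha> \<longrightarrow> \<alpha> \<le> 1 \<longrightarrow> 0 \<le> M \<longrightarrow>
    slow C (\<lambda>j. (gw s M j)\<^sup>2 * (1/2 + hmj \<alpha> j))"
proof -
  define C1 where "C1 = 2 * s * 2 powr (2 * s - 1)"
  define C where "C = (C1 * (1 + 1) + 1) * (1 + 3) + 3"
  have "slow C (\<lambda>j. (gw s M j)\<^sup>2 * (1/2 + hmj \<alpha> j))" if "0 \<le> \<alpha>" "\<alpha> \<le> 1" "0 \<le> M" for \<alpha> M
  proof -
    have "slow C (\<lambda>j. (j powr (2 * s) * (j / (j + M))) * (1/2 + hmj \<alpha> j))"
      unfolding C_def C1_def using that assms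
      by (intro slow_mult slow_hmj slow_frac slow_powr) auto
    moreover have "(gw s M j)\<^sup>2 = j powr (2 * s) * (j / (j + M))" if "1 \<le> j" for j
      using that \<open>0 \<le> M\<close> by (simp add: gw_def power_mult_distrib powr_power mult.commute)
    ultimately show ?thesis unfolding slow_def by auto
  qed
  moreover have "C \<ge> 0" using assms by (simp add: C_def C1_def)
  ultimately show ?thesis by blast
qed

lemma energy_symbol_bound:
  assumes s: "1 \<le> s"
  shows "\<exists>C\<ge>0. \<forall>\<alpha> M x y. 0 \<le> \<alpha> \<longrightarrow> \<alpha> \<le> 1 \<longrightarrow> 0 \<le> M \<longrightarrow>
    \<bar>y * esym s M \<alpha> x - x * esym s M \<alpha> y\<bar> \<le> C * (wt s M x * wt s M y * jb (x - y)
      + wt s M x * wt s M (x - y) * jb y + wt s M y * wt s M (x - y) * jb x)"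
proof -
  obtain C where C: "C \<ge> 0" "\<And>\<alpha> M. 0 \<le> \<alpha> \<Longrightarrow> \<alpha> \<le> 1 \<Longrightarrow> 0 \<le> M \<Longrightarrow>
    slow C (\<lambda>j. (gw s M j)\<^sup>2 * (1/2 + hmj \<alpha> j))" using esym_slow[OF s] by blast
  define D where "D = 3 / 2 * 3 powr (s + 1) + 3 * C"
  have D0: "D \<ge> 0" using C by (simp add: D_def)
  have "\<bar>y * esym s M \<alpha> x - x * esym s M \<alpha> y\<bar> \<le> D * (wt s M x * wt s M y * jb (x - y)
      + wt s M x * wt s M (x - y) * jb y + wt s M y * wt s M (x - y) * jb x)" (is "?L \<le> D * (?A + ?B + ?E)")
    if a: "0 \<le> \<alpha>" "\<alpha> \<le> 1" "0 \<le> M" for \<alpha> M x y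
  proof -
    have pos: "0 \<le> ?A" "0 \<le> ?B" "0 \<le> ?E" using a by auto
    have e: "esym s M \<alpha> v \<le> 3/2 * (wt s M v * wt s M v)" for v
    proof -
      have "(wt s M v)\<^sup>2 * (1/2 + hm \<alpha> v) \<le> (wt s M v)\<^sup>2 * (3/2)"
        using hm_le_1[of \<alpha> v] by (intro mult_left_mono) auto
      then show ?thesis by (simp add: esym_def power2_eq_square)
    qed
    have e0: "0 \<le> esym s M \<alpha> v" for v
      unfolding esym_def using hm_nonneg[of \<alpha> v] by (intro mult_nonneg_nonneg) auto
    show ?thesis
    proof (cases "jb x \<le> 2 * \<bar>x - y\<bar> \<or> jb y \<le> 2 * \<bar>x - y\<bar>")
      case True
      \<comment> \<open>Both brackets are controlled by that of x - y, which can therefore take over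
        one of the two weights.\<close>
      have "jb x \<le> 3 * jb (x - y)" "jb y \<le> 3 * jb (x - y)"
        using True jb_le_add_abs[of x y] jb_le_add_abs[of y x] abs_le_jb[of "x - y"]
        by (auto simp: abs_minus_commute[of y x])
      then have w: "wt s M x \<le> 3 powr (s + 1) * wt s M (x - y)" "wt s M y \<le> 3 powr (s + 1) * wt s M (x - y)"
        unfolding wt_def using a s by (auto intro!: gw_le_scale)
      have 1: "\<bar>y * esym s M \<alpha> x\<bar> \<le> 3/2 * 3 powr (s + 1) * ?B"
      proof -
        have "\<bar>y * esym s M \<alpha> x\<bar> = \<bar>y\<bar> * esym s M \<alpha> x" using e0[of x] by (simp add: abs_mult)
        also have "\<dots> \<le> jb y * (3/2 * (wt s M x * wt s M x))" using e[of x] e0[of x] by (intro mult_mono abs_le_jb) auto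
        also have "\<dots> \<le> jb y * (3/2 * (wt s M x * (3 powr (s + 1) * wt s M (x - y))))"
          using w a by (intro mult_left_mono) auto
        finally show ?thesis by (simp add: mult_ac)
      qed
      have 2: "\<bar>x * esym s M \<alpha> y\<bar> \<le> 3/2 * 3 powr (s + 1) * ?E"
      proof -
        have "\<bar>x * esym s M \<alpha> y\<bar> = \<bar>x\<bar> * esym s M \<alpha> y" using e0[of y] by (simp add: abs_mult)
        also have "\<dots> \<le> jb x * (3/2 * (wt s M y * wt s M y))" using e[of y] e0[of y] by (intro mult_mono abs_le_jb) auto
        also have "\<dots> \<le> jb x * (3/2 * (wt s M y * (3 powr (s + 1) * wt s M (x - y))))"
          using w a by (intro mult_left_mono) auto
        finally show ?thesis by (simp add: mult_ac)
      qed
      have "?L \<le> \<bar>y * esym s M \<alpha> x\<bar> + \<bar>x * esym s M \<alpha> y\<bar>" by (rule abs_triangle_ineq4)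
      also have "\<dots> \<le> 3/2 * 3 powr (s + 1) * (?B + ?E)" using 1 2 by (simp add: distrib_left)
      also have "\<dots> \<le> D * (?A + ?B + ?E)"
        using pos C(1) by (intro mult_mono) (auto simp: D_def)
      finally show ?thesis .
    next
      case False
      \<comment> \<open>Both brackets exceed 2 |x - y|, so they differ at most by a factor 2 and
        \<open>slow\<close> applies with the smaller one as base point.\<close>
      define z where "z = \<bar>x - y\<bar>"
      have z: "2 * z < jb x" "2 * z < jb y" using False by (auto simp: z_def)
      have near: "jb y \<le> 2 * jb x" "jb x \<le> 2 * jb y"
        using z jb_le_add_abs[of x y] jb_le_add_abs[of y x] by (auto simp: z_def abs_minus_commute[of y x])
      define m where "m = min (jb x) (jb y)"
      define f where "f j = (gw s M j)\<^sup>2 * (1/2 + hmj \<alpha> j)" for j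
      have f: "esym s M \<alpha> v = f (jb v)" for v by (simp add: esym_def f_def wt_def hm_hmj)
      have m1: "1 \<le> m" by (simp add: m_def)
      have fm: "0 \<le> f m" "f m \<le> 3/2 * (wt s M x * wt s M y)"
      proof -
        obtain v where v: "m = jb v" using that by (cases "jb x \<le> jb y") (auto simp: m_def min_def)
        show "0 \<le> f m" using e0[of v] f[of v] v by simp
        have "f m \<le> 3/2 * (gw s M m * gw s M m)" using e[of v] f[of v] by (simp add: v wt_def)
        also have "\<dots> \<le> 3/2 * (wt s M x * wt s M y)"
          unfolding wt_def using a s m1 gw_pos[of m M s] gw_pos[of "jb x" M s]
          by (intro mult_left_mono mult_mono gw_mono) (auto simp: m_def)
        finally show "f m \<le> 3/2 * (wt s M x * wt s M y)" .
      qed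
      have "m * \<bar>f (jb x) - f (jb y)\<bar> \<le> C * \<bar>jb x - jb y\<bar> * f m"
      proof (cases "jb x \<le> jb y")
        case True
        then show ?thesis using C(2)[OF a] near unfolding slow_def f_def
          by (auto simp: m_def abs_minus_commute)
      next
        case False
        then show ?thesis using C(2)[OF a] near unfolding slow_def f_def
          by (auto simp: m_def)
      qed
      also have "\<dots> \<le> C * z * f m"
        using abs_jb_diff_le[of x y] fm C by (intro mult_right_mono mult_left_mono) (auto simp: z_def)
      finally have fd: "m * \<bar>f (jb x) - f (jb y)\<bar> \<le> C * z * f m" .
      have "?L = \<bar>(y - x) * esym s M \<alpha> x + x * (esym s M \<alpha> x - esym s M \<alpha> y)\<bar>" by (simp add: algebra_simps)
      also have "\<dots> \<le> \<bar>(y - x) * esym s M \<alpha> x\<bar> + \<bar>x * (esym s M \<alpha> x - esym s M \<alpha> y)\<bar>"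
        by (rule abs_triangle_ineq)
      also have "\<dots> = z * f (jb x) + \<bar>x\<bar> * \<bar>f (jb x) - f (jb y)\<bar>"
        using e0[of x] by (simp add: abs_mult f z_def abs_minus_commute)
      also have "\<dots> \<le> z * f (jb x) + 2 * m * \<bar>f (jb x) - f (jb y)\<bar>"
        using near abs_le_jb[of x] by (intro add_left_mono mult_right_mono) (auto simp: m_def)
      also have "\<dots> \<le> z * f (jb x) + 2 * (C * z * f m)" using fd by simp
      also have "\<dots> \<le> z * (3/2 * 3 powr (s + 1) * (wt s M x * wt s M y)) + 2 * (C * z * (3/2 * (wt s M x * wt s M y)))"
      proof (intro add_mono mult_left_mono)
        have "wt s M x \<le> 3 powr (s + 1) * wt s M y" unfolding wt_def using near a s by (intro gw_le_scale) auto
        then have "3/2 * (wt s M x * wt s M x) \<le> 3/2 * (wt s M x * (3 powr (s + 1) * wt s M y))"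
          using a by (intro mult_left_mono) auto
        then show "f (jb x) \<le> 3/2 * 3 powr (s + 1) * (wt s M x * wt s M y)"
          using e[of x] by (simp add: f mult_ac)
      qed (use fm C in \<open>auto simp: z_def\<close>)
      also have "\<dots> = D * (wt s M x * wt s M y * z)" by (simp add: D_def algebra_simps)
      also have "\<dots> \<le> D * ?A"
        using D0 a abs_le_jb[of "x - y"] by (intro mult_left_mono) (auto simp: z_def)
      also have "\<dots> \<le> D * (?A + ?B + ?E)" using D0 pos by (intro mult_left_mono) auto
      finally show ?thesis .
    qed
  qed
  then show ?thesis using D0 by blast
qed

text \<open>If the brackets of x and y are comparable, they split evenly into two square roots.
  Otherwise x - y dominates and takes s powers. This leaves the power 3/2 - s of a bracket on a
  spectrum in H^(1/2), which makes that spectrum integrable when s > 3/2.\<close>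

lemma half_level_bound:
  assumes s: "3/2 \<le> s"
  shows "(jb x + jb y) * jb (x - y) \<le> 5 * (jb x powr (1/2) * jb y powr (1/2) *
    (jb (x - y) + jb (x - y) powr s * (jb y powr (1 - s) + jb x powr (1 - s))))"
proof -
  have *: "(jb x + jb y) * jb (x - y) \<le> 5 * (jb x powr (1/2) * jb y powr (1/2) *
    (jb (x - y) + jb (x - y) powr s * (jb y powr (1 - s) + jb x powr (1 - s))))"
    if le: "jb y \<le> jb x" for x y
  proof -
    define a b z where "a = jb x powr (1/2)" and "b = jb y powr (1/2)" and "z = jb (x - y)"
    have a: "jb x = a * a" and b: "jb y = b * b" by (simp_all add: a_def b_def powr_add[symmetric])
    have ab: "1 \<le> b" "b \<le> a" using le by (auto simp: a_def b_def ge_one_powr_ge_zero intro!: powr_mono2)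
    have z1: "1 \<le> z" by (simp add: z_def)
    show ?thesis
    proof (cases "jb x \<le> 4 * jb y")
      case True
      then have "a\<^sup>2 \<le> (2 * b)\<^sup>2" by (simp add: a b power2_eq_square)
      then have a2: "a \<le> 2 * b" by (rule power2_le_imp_le) (use ab in simp)
      have "a * a + b * b \<le> a * (2 * b) + a * b" using a2 ab by (intro add_mono mult_left_mono mult_right_mono) auto
      then have "(jb x + jb y) * z \<le> (3 * (a * b)) * z" using z1 by (intro mult_right_mono) (auto simp: a b)
      also have "\<dots> \<le> 5 * (a * b * z)" using ab z1 by simp
      also have "\<dots> \<le> 5 * (a * b * (z + z powr s * (jb y powr (1 - s) + jb x powr (1 - s))))"
        using ab z1 by (intro mult_left_mono) auto
      finally show ?thesis by (simp add: a_def b_def z_def)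
    next
      case False
      then have zx: "3/4 * jb x \<le> z" using jb_triangle[of x y] by (simp add: z_def)
      then have zy: "jb y \<le> z" using False jb_pos[of x] by linarith
      have z12: "z powr (1/2) * z powr (1/2) = z" using z1 by (simp add: powr_add[symmetric])
      have "a * a \<le> (2 * z powr (1/2)) * (2 * z powr (1/2))" using zx z12 z1 by (simp add: a algebra_simps)
      then have "a\<^sup>2 \<le> (2 * z powr (1/2))\<^sup>2" by (simp add: power2_eq_square)
      then have az: "a \<le> 2 * z powr (1/2)" by (rule power2_le_imp_le) simp
      \<comment> \<open>z^(3/2) is z^s times z^(3/2 - s), and since the last exponent is not
        positive, z may be replaced there by the smaller \<open>jb y\<close>.\<close>
      have p: "z powr (1/2) * z \<le> b * (z powr s * jb y powr (1 - s))"
      proof -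
        have "jb y powr (s - 3/2) \<le> z powr (s - 3/2)" using zy s by (intro powr_mono2) auto
        then have "z powr (3/2) * jb y powr (s - 3/2) * jb y powr (3/2 - s) \<le> z powr (3/2) * z powr (s - 3/2) * jb y powr (3/2 - s)"
          by (intro mult_right_mono mult_left_mono) auto
        then have "z powr (3/2) \<le> z powr s * jb y powr (3/2 - s)"
          by (simp add: powr_add[symmetric] mult.assoc order_less_imp_not_eq2)
        moreover have "jb y powr (3/2 - s) = b * jb y powr (1 - s)" by (simp add: b_def powr_add[symmetric])
        moreover have "z powr (3/2) = z powr (1/2) * z" using z1 powr_add[of z "1/2" 1] by simp
        ultimately show ?thesis by (simp add: mult_ac)
      qed
      have "(jb x + jb y) * z \<le> (5/4 * (a * a)) * z" using False z1 by (intro mult_right_mono) (auto simp: a)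
      also have "\<dots> \<le> (5/4 * (a * (2 * z powr (1/2)))) * z"
        using ab z1 az by (intro mult_right_mono mult_left_mono) auto
      also have "\<dots> = 5/2 * a * (z powr (1/2) * z)" by simp
      also have "\<dots> \<le> 5/2 * a * (b * (z powr s * jb y powr (1 - s)))" using ab p by (intro mult_left_mono) auto
      also have "\<dots> = 5/2 * (a * b * (z powr s * jb y powr (1 - s)))" by simp
      also have "\<dots> \<le> 5 * (a * b * (z + z powr s * (jb y powr (1 - s) + jb x powr (1 - s))))"
        using ab z1 by (intro mult_mono mult_left_mono) (auto simp: distrib_left)
      finally show ?thesis by (simp add: a_def b_def z_def)
    qed
  qed
  show ?thesis
  proof (cases "jb y \<le> jb x")
    case False
    then have "(jb y + jb x) * jb (y - x) \<le> 5 * (jb y powr (1/2) * jb x powr (1/2) *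
      (jb (y - x) + jb (y - x) powr s * (jb x powr (1 - s) + jb y powr (1 - s))))" by (intro *) auto
    then show ?thesis by (simp add: jb_diff_commute[of y x] add_ac mult_ac)
  qed (rule *)
qed

text \<open>A symbol of order two, so its difference should gain |x - y| and keep one bracket. The
  factor \<open>hm\<close> does not destroy uniformity in \<alpha>: its difference, multiplied by
  |y|, is at most a multiple of |x - y|, because \<alpha>^2 y^2 \<open>hm\<close> and \<alpha> |x|
  \<open>hm\<close> are bounded.\<close>

lemma transport_symbol_bound:
  "\<bar>x * (jb x * (1/2 + hm \<alpha> x)) - y * (jb y * (1/2 + hm \<alpha> y))\<bar> \<le> 3 * (jb x + jb y) * jb (x - y)"
proof -
  define z where "z = \<bar>x - y\<bar>"
  have hx: "1/2 + hm \<alpha> x \<le> 3/2" using hm_le_1[of \<alpha> x] by simp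
  have m: "\<bar>y\<bar> * \<bar>hm \<alpha> x - hm \<alpha> y\<bar> \<le> 5/4 * z"
  proof -
    have px: "0 < 1 + \<alpha>\<^sup>2 * x\<^sup>2" "0 < 1 + \<alpha>\<^sup>2 * y\<^sup>2" by (auto intro!: add_pos_nonneg)
    have "hm \<alpha> x - hm \<alpha> y = \<alpha>\<^sup>2 * ((y - x) * (y + x)) * (hm \<alpha> x * hm \<alpha> y)"
      using px unfolding hm_def by (simp add: divide_simps) (simp add: algebra_simps power2_eq_square)
    then have "\<bar>y\<bar> * \<bar>hm \<alpha> x - hm \<alpha> y\<bar> = \<bar>y\<bar> * (\<alpha>\<^sup>2 * (z * \<bar>y + x\<bar>) * (hm \<alpha> x * hm \<alpha> y))"
      by (simp add: abs_mult z_def abs_minus_commute)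
    also have "\<dots> \<le> \<bar>y\<bar> * (\<alpha>\<^sup>2 * (z * (\<bar>y\<bar> + \<bar>x\<bar>)) * (hm \<alpha> x * hm \<alpha> y))"
      by (intro mult_left_mono mult_right_mono) (auto simp: z_def)
    also have "\<dots> = z * ((\<alpha>\<^sup>2 * y\<^sup>2 * hm \<alpha> y) * hm \<alpha> x + (\<bar>\<alpha>\<bar> * \<bar>x\<bar> * hm \<alpha> x) * (\<bar>\<alpha>\<bar> * \<bar>y\<bar> * hm \<alpha> y))"
    proof -
      have e: "\<alpha>\<^sup>2 = A * A" "y\<^sup>2 = Y * Y" if "A = \<bar>\<alpha>\<bar>" "Y = \<bar>y\<bar>" for A Y
        using that by (simp_all add: power2_eq_square)
      define A Y where "A = \<bar>\<alpha>\<bar>" and "Y = \<bar>y\<bar>"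
      show ?thesis unfolding e[OF A_def Y_def] A_def[symmetric] Y_def[symmetric] by (simp add: algebra_simps)
    qed
    also have "\<dots> \<le> z * (1 * 1 + 1/2 * (1/2))"
      using hm_bound2[of \<alpha> y] hm_le_1[of \<alpha> x] hm_bound1[of \<alpha> x] hm_bound1[of \<alpha> y]
      by (intro mult_left_mono add_mono mult_mono) (auto simp: z_def)
    finally show ?thesis by simp
  qed
  have "x * (jb x * (1/2 + hm \<alpha> x)) - y * (jb y * (1/2 + hm \<alpha> y))
      = (x - y) * (jb x * (1/2 + hm \<alpha> x)) + y * ((jb x - jb y) * (1/2 + hm \<alpha> x)) + (y * (hm \<alpha> x - hm \<alpha> y)) * jb y"
    by (simp add: field_simps)
  then have "\<bar>x * (jb x * (1/2 + hm \<alpha> x)) - y * (jb y * (1/2 + hm \<alpha> y))\<bar>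
      \<le> \<bar>(x - y) * (jb x * (1/2 + hm \<alpha> x))\<bar> + \<bar>y * ((jb x - jb y) * (1/2 + hm \<alpha> x))\<bar> + \<bar>(y * (hm \<alpha> x - hm \<alpha> y)) * jb y\<bar>"
    by (simp only:) (rule order_trans[OF abs_triangle_ineq add_right_mono[OF abs_triangle_ineq]])
  also have "\<dots> = z * (jb x * (1/2 + hm \<alpha> x)) + \<bar>y\<bar> * (\<bar>jb x - jb y\<bar> * (1/2 + hm \<alpha> x)) + (\<bar>y\<bar> * \<bar>hm \<alpha> x - hm \<alpha> y\<bar>) * jb y"
    using hm_pos[of \<alpha> x] by (simp add: abs_mult z_def)
  also have "\<dots> \<le> z * (jb x * (3/2)) + jb y * (z * (3/2)) + (5/4 * z) * jb y"
    using hx hm_pos[of \<alpha> x] abs_le_jb[of y] abs_jb_diff_le[of x y]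
    by (intro add_mono mult_left_mono mult_mono mult_right_mono[OF m]) (auto simp: z_def)
  also have "\<dots> \<le> 3 * (jb x + jb y) * z"
  proof -
    have "0 \<le> jb x * z" "0 \<le> jb y * z" by (simp_all add: z_def)
    then show ?thesis by (simp add: algebra_simps)
  qed
  also have "\<dots> \<le> 3 * (jb x + jb y) * jb (x - y)"
    using abs_le_jb[of "x - y"] by (intro mult_left_mono) (auto simp: z_def)
  finally show ?thesis .
qed

lemma nonlocal_half_level:
  assumes "0 \<le> \<alpha>" "\<alpha> \<le> 1"
  shows "jb x * (\<alpha>\<^sup>2 / 2 * \<bar>x\<bar> * hm \<alpha> x * (\<bar>x - y\<bar> * \<bar>y\<bar>)) \<le> (jb x + jb y) * jb (x - y)"
proof -
  have "jb x * (\<alpha>\<^sup>2 / 2 * \<bar>x\<bar> * hm \<alpha> x * (\<bar>x - y\<bar> * \<bar>y\<bar>))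
      = jb x * (1/2) * (\<alpha>\<^sup>2 * \<bar>x\<bar> * hm \<alpha> x) * (\<bar>x - y\<bar> * \<bar>y\<bar>)" by simp
  also have "\<dots> \<le> jb x * (1/2) * (2 / jb x) * (\<bar>x - y\<bar> * \<bar>y\<bar>)"
    using hm_bound_jb[OF assms, of x] by (intro mult_right_mono mult_left_mono) auto
  also have "\<dots> = \<bar>x - y\<bar> * \<bar>y\<bar>" by (simp add: order_less_imp_not_eq2)
  also have "\<dots> \<le> jb (x - y) * jb y" by (intro mult_mono abs_le_jb) auto
  also have "\<dots> \<le> (jb x + jb y) * jb (x - y)" by (simp add: algebra_simps)
  finally show ?thesis .
qed

text \<open>Regularity above 3/2 is traded for a power of \<alpha>: the distance of
  \<open>hm\<close> from 1 is bounded by 1 and by the square of \<alpha> \<open>jb x\<close>, hence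
  by its power d. The cap d <= 1 comes from the quadratic derivative term, which leaves a single
  power of \<alpha>.\<close>

lemma consistency_symbol_bound:
  assumes a: "0 \<le> \<alpha>" "\<alpha> \<le> 1" and s: "3/2 < s" and d: "d = min 1 (s - 3/2)"
  shows "jb x powr (1/2) * \<bar>x * (kern \<alpha> x y - kern 0 x y)\<bar>
    \<le> 2 powr (s + 2) * \<alpha> powr d * (wt s 0 y * jb (x - y) + wt s 0 (x - y) * jb y)"
proof -
  define R where "R = wt s 0 y * jb (x - y) + wt s 0 (x - y) * jb y"
  have R0: "0 \<le> R" by (simp add: R_def)
  have d01: "0 < d" "d \<le> 1" "3/2 + d \<le> s" using s d by auto
  have R1: "wt s 0 x \<le> 2 powr (s + 1) * R"
  proof -
    have "wt s 0 y * 1 + wt s 0 (x - y) * 1 \<le> R"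
      unfolding R_def by (intro add_mono mult_left_mono) auto
    then show ?thesis
      using wt_triangle[of 0 s x y] s mult_left_mono[of "wt s 0 y + wt s 0 (x - y)" R "2 powr (s + 1)"]
      by (auto intro: order_trans)
  qed
  have h: "\<bar>hm \<alpha> x - 1\<bar> \<le> \<alpha> powr d * jb x powr d"
  proof (cases "\<alpha> * jb x \<le> 1")
    case True
    have "\<bar>hm \<alpha> x - 1\<bar> = 1 - hm \<alpha> x" using hm_le_1[of \<alpha> x] by simp
    also have "\<dots> = \<alpha>\<^sup>2 * x\<^sup>2 * hm \<alpha> x" using hm_eq[of \<alpha> x] by (simp add: algebra_simps)
    also have "\<dots> \<le> \<alpha>\<^sup>2 * x\<^sup>2 * 1" using hm_le_1[of \<alpha> x] by (intro mult_left_mono) auto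
    also have "\<dots> \<le> (\<alpha> * jb x)\<^sup>2" using jb_sq[of x] by (simp add: power_mult_distrib mult_left_mono)
    also have "\<dots> \<le> (\<alpha> * jb x) powr d"
    proof (cases "\<alpha> = 0")
      case False
      then have "0 < \<alpha> * jb x" using a by simp
      then have "(\<alpha> * jb x) powr 2 \<le> (\<alpha> * jb x) powr d" using True d01 by (intro powr_mono') auto
      then show ?thesis using \<open>0 < \<alpha> * jb x\<close> by simp
    qed simp
    finally show ?thesis using a by (simp add: powr_mult)
  next
    case False
    have "\<bar>hm \<alpha> x - 1\<bar> \<le> 1" using hm_le_1[of \<alpha> x] hm_pos[of \<alpha> x] by simp
    also have "\<dots> \<le> (\<alpha> * jb x) powr d" using False d01 by (intro ge_one_powr_ge_zero) auto
    finally show ?thesis using a by (simp add: powr_mult)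
  qed
  have p1: "jb x powr (1/2) * (\<bar>x\<bar> * \<bar>hm \<alpha> x - 1\<bar>) \<le> \<alpha> powr d * wt s 0 x"
  proof -
    have "jb x powr (1/2) * (\<bar>x\<bar> * \<bar>hm \<alpha> x - 1\<bar>) \<le> jb x powr (1/2) * (jb x powr 1 * (\<alpha> powr d * jb x powr d))"
      using h abs_le_jb[of x] by (intro mult_left_mono mult_mono) auto
    also have "\<dots> = \<alpha> powr d * jb x powr (3/2 + d)"
    proof -
      have "jb x powr (3/2 + d) = jb x powr (1/2) * (jb x powr 1 * jb x powr d)"
        unfolding powr_add[symmetric] by (rule arg_cong[where f = "\<lambda>r. jb x powr r"]) simp
      then show ?thesis by (simp only: mult_ac)
    qed
    also have "\<dots> \<le> \<alpha> powr d * wt s 0 x" using d01 by (simp add: wt_0 mult_left_mono powr_mono)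
    finally show ?thesis .
  qed
  have p2: "jb x powr (1/2) * (\<alpha>\<^sup>2 / 2 * \<bar>x\<bar> * hm \<alpha> x * (\<bar>x - y\<bar> * \<bar>y\<bar>)) \<le> \<alpha> powr d * R"
  proof -
    have half: "jb v powr (1/2) * jb v \<le> wt s 0 v" for v
    proof -
      have "jb v powr (1/2) * jb v = jb v powr (3/2)" using powr_add[of "jb v" "1/2" 1] by simp
      also have "\<dots> \<le> wt s 0 v" using s by (simp add: wt_0 powr_mono)
      finally show ?thesis .
    qed
    have sub: "jb x powr (1/2) \<le> jb y powr (1/2) + jb (x - y) powr (1/2)"
    proof -
      have "sqrt (jb x) \<le> sqrt (jb y + jb (x - y))" using jb_triangle[of x y] by simp
      also have "\<dots> \<le> sqrt (jb y) + sqrt (jb (x - y))" by (rule sqrt_add_le_add_sqrt) auto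
      finally show ?thesis by (simp add: powr_half_sqrt)
    qed
    have "\<alpha>\<^sup>2 / 2 * \<bar>x\<bar> * hm \<alpha> x = \<alpha> / 2 * (\<bar>\<alpha>\<bar> * \<bar>x\<bar> * hm \<alpha> x)" using a by (simp add: power2_eq_square)
    also have "\<dots> \<le> \<alpha> / 2 * (1/2)" using a hm_bound1[of \<alpha> x] by (intro mult_left_mono) auto
    also have "\<dots> \<le> \<alpha> powr 1" using a by simp
    also have "\<dots> \<le> \<alpha> powr d" using a d01 powr_mono'[of d 1 \<alpha>] by simp
    finally have al: "\<alpha>\<^sup>2 / 2 * \<bar>x\<bar> * hm \<alpha> x \<le> \<alpha> powr d" .
    have "jb x powr (1/2) * (\<alpha>\<^sup>2 / 2 * \<bar>x\<bar> * hm \<alpha> x * (\<bar>x - y\<bar> * \<bar>y\<bar>))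
        \<le> (jb y powr (1/2) + jb (x - y) powr (1/2)) * (\<alpha> powr d * (jb (x - y) * jb y))"
      using sub al a by (intro mult_mono abs_le_jb) auto
    also have "\<dots> = \<alpha> powr d * ((jb y powr (1/2) * jb y) * jb (x - y) + (jb (x - y) powr (1/2) * jb (x - y)) * jb y)"
      by (simp add: algebra_simps)
    also have "\<dots> \<le> \<alpha> powr d * R"
      unfolding R_def by (intro mult_left_mono add_mono mult_right_mono half) auto
    finally show ?thesis .
  qed
  have "kern \<alpha> x y - kern 0 x y = (hm \<alpha> x - 1) - \<alpha>\<^sup>2 / 2 * hm \<alpha> x * ((x - y) * y)"
    by (simp add: kern_def hm_def[of 0])
  then have "\<bar>x * (kern \<alpha> x y - kern 0 x y)\<bar> \<le> \<bar>x * (hm \<alpha> x - 1)\<bar> + \<bar>x * (\<alpha>\<^sup>2 / 2 * hm \<alpha> x * ((x - y) * y))\<bar>"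
    using abs_triangle_ineq4[of "x * (hm \<alpha> x - 1)" "x * (\<alpha>\<^sup>2 / 2 * hm \<alpha> x * ((x - y) * y))"]
    by (simp add: right_diff_distrib)
  also have "\<dots> = \<bar>x\<bar> * \<bar>hm \<alpha> x - 1\<bar> + \<alpha>\<^sup>2 / 2 * \<bar>x\<bar> * hm \<alpha> x * (\<bar>x - y\<bar> * \<bar>y\<bar>)"
    by (simp add: abs_mult)
  finally have "jb x powr (1/2) * \<bar>x * (kern \<alpha> x y - kern 0 x y)\<bar>
      \<le> jb x powr (1/2) * (\<bar>x\<bar> * \<bar>hm \<alpha> x - 1\<bar>) + jb x powr (1/2) * (\<alpha>\<^sup>2 / 2 * \<bar>x\<bar> * hm \<alpha> x * (\<bar>x - y\<bar> * \<bar>y\<bar>))"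
    using mult_left_mono[of _ _ "jb x powr (1/2)"] by (simp only: distrib_left[symmetric] powr_ge_zero)
  also have "\<dots> \<le> \<alpha> powr d * (2 powr (s + 1) * R) + \<alpha> powr d * R"
    using p1 p2 mult_left_mono[OF R1, of "\<alpha> powr d"] by simp
  also have "\<dots> \<le> 2 powr (s + 2) * \<alpha> powr d * R"
  proof -
    have "1 \<le> 2 powr (s + 1)" using s by (intro ge_one_powr_ge_zero) auto
    then have "\<alpha> powr d * R * 1 \<le> \<alpha> powr d * R * 2 powr (s + 1)" using R0 by (intro mult_left_mono) auto
    moreover have "2 powr (s + 2) = 2 * 2 powr (s + 1)" using powr_add[of 2 "s + 1" 1] by (simp add: add.assoc)
    ultimately show ?thesis by (simp add: algebra_simps)
  qed
  finally show ?thesis by (simp add: R_def)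
qed

section \<open>Weighted spaces and bilinear operators\<close>

text \<open>The weight is a parameter so that Sobolev norms and tail norms share one
  calculus.\<close>

definition wsq :: "(real \<Rightarrow> real) \<Rightarrow> (real \<Rightarrow> complex) \<Rightarrow> bool" where
  "wsq p U \<longleftrightarrow> U \<in> borel_measurable borel \<and> sqint (\<lambda>x. complex_of_real (p x) * U x)"

definition wn :: "(real \<Rightarrow> real) \<Rightarrow> (real \<Rightarrow> complex) \<Rightarrow> real" where
  "wn p U = n2 (\<lambda>x. complex_of_real (p x) * U x)"

abbreviation "inH r \<equiv> wsq (wt r 0)"
abbreviation "hn r \<equiv> wn (wt r 0)"

lemma wn_nonneg [simp]: "0 \<le> wn p U"
  by (simp add: wn_def)

lemma wsq_measurable: "wsq p U \<Longrightarrow> U \<in> borel_measurable borel"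
  by (simp add: wsq_def)

lemma wsq_sqint: "wsq p U \<Longrightarrow> sqint (\<lambda>x. complex_of_real (p x) * U x)"
  by (simp add: wsq_def)

lemma wsq_zero [simp]: "wsq p (\<lambda>x. 0)" "wn p (\<lambda>x. 0) = 0"
  by (simp_all add: wsq_def wn_def)

lemma wsq_add:
  assumes "wsq p U" "wsq p V"
  shows "wsq p (\<lambda>x. U x + V x)" "wn p (\<lambda>x. U x + V x) \<le> wn p U + wn p V"
  using sqint_add(1,2)[of "\<lambda>x. complex_of_real (p x) * U x" "\<lambda>x. complex_of_real (p x) * V x"] assms
  by (auto simp: wsq_def wn_def distrib_left)

lemma wsq_cmult:
  assumes "wsq p U"
  shows "wsq p (\<lambda>x. c * U x)" "wn p (\<lambda>x. c * U x) = cmod c * wn p U"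
  using sqint_cmult[of "\<lambda>x. complex_of_real (p x) * U x" c] assms
  by (auto simp: wsq_def wn_def mult_ac)

lemma wsq_diff:
  assumes "wsq p U" "wsq p V"
  shows "wsq p (\<lambda>x. U x - V x)" "wn p (\<lambda>x. U x - V x) \<le> wn p U + wn p V"
  using sqint_diff[of "\<lambda>x. complex_of_real (p x) * U x" "\<lambda>x. complex_of_real (p x) * V x"] assms
  by (auto simp: wsq_def wn_def right_diff_distrib)

lemma wn_minus_commute: "wn p (\<lambda>x. U x - V x) = wn p (\<lambda>x. V x - U x)"
  unfolding wn_def right_diff_distrib by (rule n2_minus_commute)

lemma wn_triangle_diff:
  assumes "wsq p U" "wsq p V" "wsq p W"
  shows "wn p (\<lambda>x. U x - W x) \<le> wn p (\<lambda>x. U x - V x) + wn p (\<lambda>x. V x - W x)"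
  using wsq_add(2)[OF wsq_diff(1)[OF assms(1,2)] wsq_diff(1)[OF assms(2,3)]] by simp

lemma wn_le_diff:
  assumes "wsq p U" "wsq p V"
  shows "wn p U \<le> wn p V + wn p (\<lambda>x. U x - V x)"
  using wsq_add(2)[OF assms(2) wsq_diff(1)[OF assms]] by simp

lemma wsq_mono:
  assumes U: "wsq p U" and [measurable]: "q \<in> borel_measurable borel" "V \<in> borel_measurable borel" and C: "0 \<le> C"
    and le: "\<And>x. \<bar>q x\<bar> * cmod (V x) \<le> C * (\<bar>p x\<bar> * cmod (U x))"
  shows "wsq q V" "wn q V \<le> C * wn p U"
  using sqint_mono[of "\<lambda>x. complex_of_real (p x) * U x" "\<lambda>x. complex_of_real (q x) * V x" C] U C le
  by (auto simp: wsq_def wn_def norm_mult)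

lemma wsq_mono1:
  assumes "wsq p U" "q \<in> borel_measurable borel" "V \<in> borel_measurable borel"
    and "\<And>x. \<bar>q x\<bar> * cmod (V x) \<le> \<bar>p x\<bar> * cmod (U x)"
  shows "wsq q V" "wn q V \<le> wn p U"
  using wsq_mono[OF assms(1-3), of 1] assms(4) by auto

lemma wn_cong_AE:
  assumes "AE x in lborel. U x = V x" "wsq p U" "wsq p V"
  shows "wn p U = wn p V"
  unfolding wn_def using assms by (intro n2_cong_AE) (auto simp: wsq_def sqint_def)

lemma inH_tail:
  assumes "inH r U" "0 \<le> M"
  shows "wsq (wt r M) U" "wn (wt r M) U \<le> hn r U"
proof -
  have "\<bar>wt r M x\<bar> * cmod (U x) \<le> \<bar>wt r 0 x\<bar> * cmod (U x)" for x
    using wt_le_0[OF assms(2), of r x] assms(2) by (intro mult_right_mono) auto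
  then show "wsq (wt r M) U" "wn (wt r M) U \<le> hn r U"
    using wsq_mono1[OF assms(1) wt_measurable wsq_measurable[OF assms(1)]] by blast+
qed

lemma inH_mono:
  assumes "inH r U" "q \<le> r"
  shows "inH q U" "hn q U \<le> hn r U"
proof -
  have "\<bar>wt q 0 x\<bar> * cmod (U x) \<le> \<bar>wt r 0 x\<bar> * cmod (U x)" for x
    using assms(2) by (intro mult_right_mono) (auto simp: wt_0 powr_mono)
  then show "inH q U" "hn q U \<le> hn r U"
    using wsq_mono1[OF assms(1) wt_measurable wsq_measurable[OF assms(1)]] by blast+
qed

lemma inH_nn_integral:
  assumes "wsq p U"
  shows "(\<integral>\<^sup>+x. ennreal ((\<bar>p x\<bar> * cmod (U x))\<^sup>2) \<partial>lborel) = ennreal ((wn p U)\<^sup>2)"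
  using sqint_nn_integral[OF wsq_sqint[OF assms]] by (simp add: wn_def norm_mult)

section \<open>Embedding of H^r into weighted L^1\<close>

lemma jb_powr_integrable:
  assumes p: "1 < p"
  shows "integrable lborel (\<lambda>x. jb x powr (- p))"
proof -
  define f where "f x = indicator {1..} x * x powr (- p)" for x :: real
  have [measurable]: "f \<in> borel_measurable borel" unfolding f_def by measurable
  have f0: "0 \<le> f x" for x by (simp add: f_def)
  have "((\<lambda>x. x powr (- p)) has_integral - (1 powr (- p + 1)) / (- p + 1)) {1..}"
    by (rule has_integral_powr_to_inf) (use p in auto)
  from has_integral_restrict_UNIV[THEN iffD2, OF this]
  have "(f has_integral - (1 powr (- p + 1)) / (- p + 1)) UNIV"
    by (rule has_integral_eq[rotated]) (auto simp: f_def indicator_def)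
  then have "(\<integral>\<^sup>+x. ennreal (f x) \<partial>lborel) = ennreal (- (1 powr (- p + 1)) / (- p + 1))"
    by (rule nn_integral_has_integral_lborel[rotated 2]) (auto simp: f0)
  then have "integrable lborel f" by (intro integrableI_nonneg) (auto simp: f0)
  moreover from lborel_integrable_real_affine[OF this, of "-1" 0] have "integrable lborel (\<lambda>x. f (- x))" by simp
  moreover have "integrable lborel (indicator {-1..1::real} :: real \<Rightarrow> real)" by simp
  ultimately have "integrable lborel (\<lambda>x. f x + f (- x) + indicator {-1..1} x)" by auto
  then show ?thesis
  proof (rule Bochner_Integration.integrable_bound, safe intro!: AE_I2)
    fix x :: real
    have "jb x powr (- p) \<le> f x + f (- x) + indicator {-1..1} x"
    proof (cases "\<bar>x\<bar> \<le> 1")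
      case True
      have "jb x powr (- p) \<le> 1 powr (- p)" using p by (intro powr_mono2') auto
      moreover have "0 \<le> f x" "0 \<le> f (- x)" by (auto simp: f_def)
      ultimately show ?thesis using True by (simp add: abs_le_iff)
    next
      case False
      have "jb x powr (- p) \<le> \<bar>x\<bar> powr (- p)" using p False by (intro powr_mono2' abs_le_jb) auto
      moreover have "\<bar>x\<bar> powr (- p) \<le> f x + f (- x)" using False by (auto simp: f_def indicator_def abs_if)
      ultimately show ?thesis using False by (auto simp: indicator_def)
    qed
    then show "norm (jb x powr (- p)) \<le> norm (f x + f (- x) + indicator {-1..1} x)"
      by (simp add: abs_if)
  qed measurable
qed

text \<open>The L^2 norm of the bracket to the power -r, the embedding constant. It is meaningful
  for r > 1/2; elsewhere the divergent integral defaults to 0.\<close>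

definition emb :: "real \<Rightarrow> real" where
  "emb r = sqrt (LINT x|lborel. jb x powr (- 2 * r))"

lemma emb_nonneg [simp]: "0 \<le> emb r"
  by (simp add: emb_def)

text \<open>Cauchy-Schwarz against \<open>jb x powr (q - r)\<close>, which is square integrable
  because r - q > 1/2.\<close>

lemma inH_integrable:
  assumes U: "inH r U" and q: "q + 1/2 < r"
  shows "integrable lborel (\<lambda>x. jb x powr q * cmod (U x))"
    and "(\<integral>\<^sup>+x. ennreal (jb x powr q * cmod (U x)) \<partial>lborel) \<le> ennreal (emb (r - q) * hn r U)"
    and "(LINT x|lborel. jb x powr q * cmod (U x)) \<le> emb (r - q) * hn r U"
proof -
  have [measurable]: "U \<in> borel_measurable borel" using U by (rule wsq_measurable)
  have i: "integrable lborel (\<lambda>x. jb x powr (- 2 * (r - q)))"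
    using jb_powr_integrable[of "2 * (r - q)"] q by simp
  have "(\<integral>\<^sup>+x. ennreal ((jb x powr (q - r))\<^sup>2) \<partial>lborel) = (\<integral>\<^sup>+x. ennreal (jb x powr (- 2 * (r - q))) \<partial>lborel)"
  proof (intro nn_integral_cong)
    fix x :: real
    have "(jb x powr (q - r))\<^sup>2 = jb x powr (q - r) * jb x powr (q - r)" by (rule power2_eq_square)
    also have "\<dots> = jb x powr (- 2 * (r - q))" unfolding powr_add[symmetric] by (rule arg_cong[where f = "\<lambda>p. jb x powr p"]) simp
    finally show "ennreal ((jb x powr (q - r))\<^sup>2) = ennreal (jb x powr (- 2 * (r - q)))" by simp
  qed
  also have "\<dots> = ennreal ((emb (r - q))\<^sup>2)"
    unfolding emb_def by (subst nn_integral_eq_integral[OF i]) auto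
  finally have 1: "(\<integral>\<^sup>+x. ennreal ((jb x powr (q - r))\<^sup>2) \<partial>lborel) \<le> ennreal ((emb (r - q))\<^sup>2)" by simp
  have 2: "(\<integral>\<^sup>+x. ennreal ((jb x powr r * cmod (U x))\<^sup>2) \<partial>lborel) \<le> ennreal ((hn r U)\<^sup>2)"
    using inH_nn_integral[OF U] by (simp add: wt_0)
  have "(\<integral>\<^sup>+x. ennreal (jb x powr (q - r) * (jb x powr r * cmod (U x))) \<partial>lborel) \<le> ennreal (emb (r - q) * hn r U)"
    by (rule Cauchy_Schwarz_real[OF _ _ _ _ _ _ 1 2]) auto
  moreover have "jb x powr (q - r) * (jb x powr r * cmod (U x)) = jb x powr q * cmod (U x)" for x
    by (simp add: mult.assoc[symmetric] powr_add[symmetric])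
  ultimately show *: "(\<integral>\<^sup>+x. ennreal (jb x powr q * cmod (U x)) \<partial>lborel) \<le> ennreal (emb (r - q) * hn r U)" by simp
  show i: "integrable lborel (\<lambda>x. jb x powr q * cmod (U x))"
    by (rule integrableI_nonneg) (use * in \<open>auto simp: less_top[symmetric] top_unique\<close>)
  have "ennreal (LINT x|lborel. jb x powr q * cmod (U x)) \<le> ennreal (emb (r - q) * hn r U)"
    using * nn_integral_eq_integral[OF i] by simp
  then show "(LINT x|lborel. jb x powr q * cmod (U x)) \<le> emb (r - q) * hn r U"
    by (subst (asm) ennreal_le_iff) auto
qed

text \<open>A Wiener algebra norm of the spectrum. It bounds the function and its derivative
  uniformly and supplies the L^1 factor of the trilinear estimates.\<close>

definition aw :: "(real \<Rightarrow> complex) \<Rightarrow> real" where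
  "aw U = (LINT x|lborel. jb x * cmod (U x))"

lemma aw_nonneg [simp]: "0 \<le> aw U"
  unfolding aw_def by (rule integral_nonneg_AE) auto

lemma inH_aw:
  assumes "inH s U" "3/2 < s"
  shows "integrable lborel (\<lambda>x. jb x * cmod (U x))" "aw U \<le> emb (s - 1) * hn s U"
  using inH_integrable[OF assms(1), of 1] assms(2) by (auto simp: aw_def)

lemma aw_nn_integral:
  assumes "integrable lborel (\<lambda>x. jb x * cmod (U x))"
  shows "(\<integral>\<^sup>+x. ennreal (jb x * cmod (U x)) \<partial>lborel) = ennreal (aw U)"
  unfolding aw_def using assms by (intro nn_integral_eq_integral) auto

section \<open>Bilinear Fourier multipliers\<close>

definition Kop :: "(real \<Rightarrow> real \<Rightarrow> real) \<Rightarrow> (real \<Rightarrow> complex) \<Rightarrow> (real \<Rightarrow> complex) \<Rightarrow> real \<Rightarrow> complex" where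
  "Kop \<kappa> U V x = (LINT y|lborel. complex_of_real (\<kappa> x y) * U (x - y) * V y)"

lemma Kop_measurable [measurable (raw)]:
  assumes [measurable]: "(\<lambda>p. \<kappa> (fst p) (snd p)) \<in> borel_measurable (borel \<Otimes>\<^sub>M borel)"
    "U \<in> borel_measurable borel" "V \<in> borel_measurable borel"
  shows "Kop \<kappa> U V \<in> borel_measurable borel"
proof -
  have "(\<lambda>p. complex_of_real (\<kappa> (fst p) (snd p)) * U (fst p - snd p) * V (snd p)) \<in> borel_measurable (borel \<Otimes>\<^sub>M lborel)"
    by measurable
  then have "(\<lambda>x. LINT y|lborel. complex_of_real (\<kappa> x y) * U (x - y) * V y) \<in> borel_measurable borel"
    by (intro lborel.borel_measurable_lebesgue_integral) (simp add: split_beta')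
  then show ?thesis unfolding Kop_def[abs_def] .
qed

text \<open>No integrability is assumed: a divergent Bochner integral is 0. Hence \<open>Kop\<close>
  can be estimated before its convergence is known.\<close>

lemma norm_integral_le_nn_integral:
  fixes f :: "'a \<Rightarrow> 'b::{banach, second_countable_topology}"
  shows "ennreal (norm (integral\<^sup>L M f)) \<le> (\<integral>\<^sup>+x. ennreal (norm (f x)) \<partial>M)"
  by (cases "integrable M f") (auto simp: integral_norm_bound_ennreal not_integrable_integral_eq)

text \<open>The symbol hypothesis puts the weight p on one factor and a bracket on the other, so
  each half is a convolution of L^2 with L^1 and Young's inequality applies.\<close>

lemma Kop_bound:
  assumes m[measurable]: "(\<lambda>p. \<kappa> (fst p) (snd p)) \<in> borel_measurable (borel \<Otimes>\<^sub>M borel)"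
    and [measurable]: "w \<in> borel_measurable borel" "p \<in> borel_measurable borel"
    and pos: "\<And>x. 0 \<le> w x" "\<And>x. 0 \<le> p x" "0 \<le> C"
    and U: "wsq p U" and V: "wsq p V"
    and AU: "integrable lborel (\<lambda>x. jb x * cmod (U x))" and AV: "integrable lborel (\<lambda>x. jb x * cmod (V x))"
    and le: "\<And>x y. w x * \<bar>\<kappa> x y\<bar> \<le> C * (p y * jb (x - y) + p (x - y) * jb y)"
  shows "wsq w (Kop \<kappa> U V)" "wn w (Kop \<kappa> U V) \<le> 2 * C * (wn p V * aw U + wn p U * aw V)"
proof -
  have [measurable]: "U \<in> borel_measurable borel" "V \<in> borel_measurable borel"
    using U V by (auto dest: wsq_measurable)
  define I where "I A B x = (\<integral>\<^sup>+y. ennreal ((p y * cmod (B y)) * (jb (x - y) * cmod (A (x - y)))) \<partial>lborel)"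
    for A B x
  have [measurable]: "I A B \<in> borel_measurable borel" if [measurable]: "A \<in> borel_measurable borel" "B \<in> borel_measurable borel" for A B
    unfolding I_def by measurable
  have I2: "(\<integral>\<^sup>+x. (I A B x)\<^sup>2 \<partial>lborel) \<le> ennreal ((wn p B * aw A)\<^sup>2)"
    if A: "integrable lborel (\<lambda>x. jb x * cmod (A x))" "A \<in> borel_measurable borel" and B: "wsq p B" for A B
  proof -
    have [measurable]: "A \<in> borel_measurable borel" "B \<in> borel_measurable borel"
      using A B by (auto dest: wsq_measurable)
    have "(\<integral>\<^sup>+x. (I A B x)\<^sup>2 \<partial>lborel) \<le> (\<integral>\<^sup>+y. ennreal ((p y * cmod (B y))\<^sup>2) \<partial>lborel) * (\<integral>\<^sup>+y. ennreal (jb y * cmod (A y)) \<partial>lborel)\<^sup>2"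
      unfolding I_def using pos by (intro Young_nn_integral) auto
    also have "\<dots> = ennreal ((wn p B)\<^sup>2) * (ennreal (aw A))\<^sup>2"
      using inH_nn_integral[OF B] aw_nn_integral[OF A(1)] pos by simp
    also have "\<dots> = ennreal ((wn p B * aw A)\<^sup>2)"
      by (simp add: ennreal_power ennreal_mult[symmetric] power_mult_distrib)
    finally show ?thesis .
  qed
  have pw: "ennreal (w x * cmod (Kop \<kappa> U V x)) \<le> ennreal C * (I U V x + I V U x)" for x
  proof -
    have "ennreal (w x * cmod (Kop \<kappa> U V x)) = ennreal (w x) * ennreal (cmod (Kop \<kappa> U V x))"
      using pos by (simp add: ennreal_mult)
    also have "\<dots> \<le> ennreal (w x) * (\<integral>\<^sup>+y. ennreal (\<bar>\<kappa> x y\<bar> * cmod (U (x - y)) * cmod (V y)) \<partial>lborel)"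
      unfolding Kop_def using norm_integral_le_nn_integral[of lborel "\<lambda>y. complex_of_real (\<kappa> x y) * U (x - y) * V y"]
      by (intro mult_left_mono) (auto simp: norm_mult)
    also have "\<dots> = (\<integral>\<^sup>+y. ennreal (w x * (\<bar>\<kappa> x y\<bar> * cmod (U (x - y)) * cmod (V y))) \<partial>lborel)"
      using pos measurable_compose[OF measurable_Pair1'[of x borel borel] m]
      by (subst nn_integral_cmult[symmetric]) (auto simp: ennreal_mult[symmetric])
    also have "\<dots> \<le> (\<integral>\<^sup>+y. ennreal C * (ennreal ((p y * cmod (V y)) * (jb (x - y) * cmod (U (x - y))))
        + ennreal ((p (x - y) * cmod (U (x - y))) * (jb y * cmod (V y)))) \<partial>lborel)"
    proof (intro nn_integral_mono)
      fix y
      have "w x * \<bar>\<kappa> x y\<bar> * (cmod (U (x - y)) * cmod (V y)) \<le> C * (p y * jb (x - y) + p (x - y) * jb y) * (cmod (U (x - y)) * cmod (V y))"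
        using le by (intro mult_right_mono) auto
      then have "w x * (\<bar>\<kappa> x y\<bar> * cmod (U (x - y)) * cmod (V y))
        \<le> C * ((p y * cmod (V y)) * (jb (x - y) * cmod (U (x - y))) + (p (x - y) * cmod (U (x - y))) * (jb y * cmod (V y)))"
        by (simp add: algebra_simps)
      then show "ennreal (w x * (\<bar>\<kappa> x y\<bar> * cmod (U (x - y)) * cmod (V y))) \<le> ennreal C * (ennreal ((p y * cmod (V y)) * (jb (x - y) * cmod (U (x - y))))
        + ennreal ((p (x - y) * cmod (U (x - y))) * (jb y * cmod (V y))))"
        using pos by (simp add: ennreal_mult[symmetric] ennreal_plus[symmetric] ennreal_leI del: ennreal_plus)
    qed
    also have "\<dots> = ennreal C * (I U V x + (\<integral>\<^sup>+y. ennreal ((p (x - y) * cmod (U (x - y))) * (jb y * cmod (V y))) \<partial>lborel))"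
      unfolding I_def by (simp add: nn_integral_cmult nn_integral_add)
    also have "(\<integral>\<^sup>+y. ennreal ((p (x - y) * cmod (U (x - y))) * (jb y * cmod (V y))) \<partial>lborel) = I V U x"
      unfolding I_def using nn_integral_reflect[of "\<lambda>y. ennreal ((p (x - y) * cmod (U (x - y))) * (jb y * cmod (V y)))" x]
      by simp
    finally show ?thesis .
  qed
  define a b where "a = wn p V * aw U" and "b = wn p U * aw V"
  have ab: "0 \<le> a" "0 \<le> b" by (auto simp: a_def b_def)
  have Km: "Kop \<kappa> U V \<in> borel_measurable borel" by measurable
  note [measurable] = Km
  have sq: "(s + t)\<^sup>2 \<le> 2 * s\<^sup>2 + 2 * t\<^sup>2" for s t :: ennreal
  proof -
    show ?thesis
    proof (cases "s = top \<or> t = top")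
      case True
      then show ?thesis by (auto simp: ennreal_mult_eq_top_iff top_power_ennreal)
    next
      case False
      then obtain u v where uv: "0 \<le> u" "s = ennreal u" "0 \<le> v" "t = ennreal v"
        by (metis ennreal_cases)
      have "(u + v)\<^sup>2 \<le> 2 * u\<^sup>2 + 2 * v\<^sup>2" using sum_squares_bound[of u v] by (simp add: power2_sum)
      then have "ennreal ((u + v)\<^sup>2) \<le> ennreal (2 * u\<^sup>2 + 2 * v\<^sup>2)" by (rule ennreal_leI)
      then show ?thesis using uv by (simp add: ennreal_mult ennreal_power[symmetric])
    qed
  qed
  have "(\<integral>\<^sup>+x. ennreal ((cmod (complex_of_real (w x) * Kop \<kappa> U V x))\<^sup>2) \<partial>lborel)
      \<le> (\<integral>\<^sup>+x. ennreal (C\<^sup>2) * (2 * (I U V x)\<^sup>2 + 2 * (I V U x)\<^sup>2) \<partial>lborel)"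
  proof (intro nn_integral_mono)
    fix x
    have "ennreal ((cmod (complex_of_real (w x) * Kop \<kappa> U V x))\<^sup>2) = (ennreal (w x * cmod (Kop \<kappa> U V x)))\<^sup>2"
      using pos by (simp add: norm_mult ennreal_power)
    also have "\<dots> \<le> (ennreal C * (I U V x + I V U x))\<^sup>2" by (intro power_mono_ennreal pw)
    also have "\<dots> \<le> ennreal (C\<^sup>2) * (2 * (I U V x)\<^sup>2 + 2 * (I V U x)\<^sup>2)"
      using pos by (auto simp: power_mult_distrib ennreal_power intro!: mult_left_mono sq)
    finally show "ennreal ((cmod (complex_of_real (w x) * Kop \<kappa> U V x))\<^sup>2) \<le> ennreal (C\<^sup>2) * (2 * (I U V x)\<^sup>2 + 2 * (I V U x)\<^sup>2)" .
  qed
  also have "\<dots> = ennreal (C\<^sup>2) * (2 * (\<integral>\<^sup>+x. (I U V x)\<^sup>2 \<partial>lborel) + 2 * (\<integral>\<^sup>+x. (I V U x)\<^sup>2 \<partial>lborel))"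
    by (simp add: nn_integral_cmult nn_integral_add)
  also have "\<dots> \<le> ennreal (C\<^sup>2) * (2 * ennreal (a\<^sup>2) + 2 * ennreal (b\<^sup>2))"
    unfolding a_def b_def using U V AU AV by (intro mult_left_mono add_mono I2) auto
  also have "\<dots> = ennreal (C\<^sup>2 * (2 * a\<^sup>2 + 2 * b\<^sup>2))"
    by (simp add: ennreal_mult)
  also have "\<dots> \<le> ennreal ((2 * C * (a + b))\<^sup>2)"
  proof (rule ennreal_leI)
    have "C\<^sup>2 * (2 * a\<^sup>2 + 2 * b\<^sup>2) \<le> C\<^sup>2 * (4 * (a + b)\<^sup>2)"
      using ab by (intro mult_left_mono) (auto simp: power2_sum)
    then show "C\<^sup>2 * (2 * a\<^sup>2 + 2 * b\<^sup>2) \<le> (2 * C * (a + b))\<^sup>2" by (simp add: power_mult_distrib)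
  qed
  finally have *: "(\<integral>\<^sup>+x. ennreal ((cmod (complex_of_real (w x) * Kop \<kappa> U V x))\<^sup>2) \<partial>lborel) \<le> ennreal ((2 * C * (a + b))\<^sup>2)" .
  have "0 \<le> 2 * C * (a + b)" using pos ab by simp
  from sqint_boundI[OF _ this *] Km
  show "wsq w (Kop \<kappa> U V)" "wn w (Kop \<kappa> U V) \<le> 2 * C * (wn p V * aw U + wn p U * aw V)"
    by (auto simp: wsq_def wn_def a_def b_def)
qed

section \<open>The nonlinearity on the Fourier side\<close>

definition Bop :: "real \<Rightarrow> (real \<Rightarrow> complex) \<Rightarrow> (real \<Rightarrow> complex) \<Rightarrow> real \<Rightarrow> complex" where
  "Bop \<alpha> U V x = - \<i> * complex_of_real x * Kop (kern \<alpha>) U V x"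

lemma Bop_measurable [measurable (raw)]:
  assumes "U \<in> borel_measurable borel" "V \<in> borel_measurable borel"
  shows "Bop \<alpha> U V \<in> borel_measurable borel"
  using Kop_measurable[OF kern_measurable assms] unfolding Bop_def[abs_def] by measurable

lemma Bop_Kop: "Bop \<alpha> U V x = - \<i> * Kop (\<lambda>x y. x * kern \<alpha> x y) U V x"
  unfolding Bop_def Kop_def by (simp add: mult.assoc)

lemma wt_pred: "wt (s - 1) M x = wt s M x / jb x"
  by (simp add: wt_def gw_def powr_diff)

lemma Bop_bound:
  assumes a: "0 \<le> \<alpha>" "\<alpha> \<le> 1" "0 \<le> M" and s: "3/2 < s" and U: "inH s U" and V: "inH s V"
  shows "wsq (wt (s - 1) M) (Bop \<alpha> U V)"
    "wn (wt (s - 1) M) (Bop \<alpha> U V) \<le> 2 powr (s + 4) * (wn (wt s M) V * aw U + wn (wt s M) U * aw V)"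
proof -
  have [measurable]: "U \<in> borel_measurable borel" "V \<in> borel_measurable borel"
    using U V by (auto dest: wsq_measurable)
  have le: "wt (s - 1) M x * \<bar>x * kern \<alpha> x y\<bar> \<le> 2 powr (s + 3) * (wt s M y * jb (x - y) + wt s M (x - y) * jb y)" for x y
    using kern_bound[OF a, of s x y] s jb_pos[of x] by (simp add: wt_pred divide_simps mult_ac)
  note kb = Kop_bound[of "\<lambda>x y. x * kern \<alpha> x y" "wt (s - 1) M" "wt s M" "2 powr (s + 3)" U V]
  have *: "wsq (wt (s - 1) M) (Kop (\<lambda>x y. x * kern \<alpha> x y) U V)"
    "wn (wt (s - 1) M) (Kop (\<lambda>x y. x * kern \<alpha> x y) U V) \<le> 2 * 2 powr (s + 3) * (wn (wt s M) V * aw U + wn (wt s M) U * aw V)"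
    by (rule kb[OF _ _ _ _ _ _ inH_tail(1)[OF U a(3)] inH_tail(1)[OF V a(3)] inH_aw(1)[OF U s] inH_aw(1)[OF V s] le]; use a in simp)+
  have 2: "2 * 2 powr (s + 3) = (2::real) powr (s + 4)" using powr_add[of "2::real" 1 "s + 3"] by (simp add: add_ac)
  show "wsq (wt (s - 1) M) (Bop \<alpha> U V)" using wsq_cmult(1)[OF *(1), of "-\<i>"] by (simp add: Bop_Kop[abs_def])
  show "wn (wt (s - 1) M) (Bop \<alpha> U V) \<le> 2 powr (s + 4) * (wn (wt s M) V * aw U + wn (wt s M) U * aw V)"
    using wsq_cmult(2)[OF *(1), of "-\<i>"] *(2) 2 by (simp add: Bop_Kop[abs_def])
qed

definition cB :: "real \<Rightarrow> real" where
  "cB s = 2 * 2 powr (s + 4) * emb (s - 1)"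

lemma cB_nonneg [simp]: "0 \<le> cB s"
  by (simp add: cB_def)

lemma Bop_inH:
  assumes a: "0 \<le> \<alpha>" "\<alpha> \<le> 1" and s: "3/2 < s" and U: "inH s U" and V: "inH s V"
  shows "inH (s - 1) (Bop \<alpha> U V)" "hn (s - 1) (Bop \<alpha> U V) \<le> cB s * hn s U * hn s V"
proof -
  show "inH (s - 1) (Bop \<alpha> U V)" using Bop_bound(1)[OF a _ s U V] by simp
  have "hn (s - 1) (Bop \<alpha> U V) \<le> 2 powr (s + 4) * (hn s V * aw U + hn s U * aw V)"
    using Bop_bound(2)[OF a _ s U V] by simp
  also have "\<dots> \<le> 2 powr (s + 4) * (hn s V * (emb (s - 1) * hn s U) + hn s U * (emb (s - 1) * hn s V))"
    using inH_aw[OF U s] inH_aw[OF V s] by (intro mult_left_mono add_mono) auto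
  also have "\<dots> = cB s * hn s U * hn s V" by (simp add: cB_def algebra_simps)
  finally show "hn (s - 1) (Bop \<alpha> U V) \<le> cB s * hn s U * hn s V" .
qed

lemma Bop_tail:
  assumes a: "0 \<le> \<alpha>" "\<alpha> \<le> 1" "0 \<le> M" and s: "3/2 < s" and U: "inH s U"
  shows "wn (wt (s - 1) M) (Bop \<alpha> U U) \<le> cB s * hn s U * wn (wt s M) U"
proof -
  have "wn (wt (s - 1) M) (Bop \<alpha> U U) \<le> 2 powr (s + 4) * (wn (wt s M) U * aw U + wn (wt s M) U * aw U)"
    by (rule Bop_bound(2)[OF a s U U])
  also have "\<dots> \<le> 2 powr (s + 4) * (wn (wt s M) U * (emb (s - 1) * hn s U) + wn (wt s M) U * (emb (s - 1) * hn s U))"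
    using inH_aw[OF U s] by (intro mult_left_mono add_mono) auto
  also have "\<dots> = cB s * hn s U * wn (wt s M) U" by (simp add: cB_def algebra_simps)
  finally show ?thesis .
qed

lemma abs_kern_le:
  assumes "0 \<le> \<alpha>" "\<alpha> \<le> 1"
  shows "\<bar>kern \<alpha> x y\<bar> \<le> 2 * (jb (x - y) * jb y)"
proof -
  have "1 * 1 \<le> jb (x - y) * jb y" by (intro mult_mono) auto
  then have j: "1 \<le> jb (x - y) * jb y" by simp
  have a2: "\<alpha>\<^sup>2 / 2 * hm \<alpha> x \<le> 1/2 * 1"
    using assms hm_le_1[of \<alpha> x] power_le_one[of \<alpha> 2] by (intro mult_mono[of _ _ "hm \<alpha> x"]) auto
  have "\<bar>kern \<alpha> x y\<bar> \<le> \<bar>1/2 + hm \<alpha> x\<bar> + \<bar>\<alpha>\<^sup>2 / 2 * hm \<alpha> x * ((x - y) * y)\<bar>"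
    unfolding kern_def by (rule abs_triangle_ineq4)
  also have "\<dots> \<le> 3/2 + 1/2 * (jb (x - y) * jb y)"
  proof (rule add_mono)
    show "\<bar>1/2 + hm \<alpha> x\<bar> \<le> 3/2" using hm_le_1[of \<alpha> x] hm_pos[of \<alpha> x] by simp
    have "\<bar>\<alpha>\<^sup>2 / 2 * hm \<alpha> x * ((x - y) * y)\<bar> = \<alpha>\<^sup>2 / 2 * hm \<alpha> x * (\<bar>x - y\<bar> * \<bar>y\<bar>)" by (simp add: abs_mult)
    also have "\<dots> \<le> 1/2 * 1 * (jb (x - y) * jb y)" by (intro mult_mono[OF a2] mult_mono abs_le_jb) auto
    finally show "\<bar>\<alpha>\<^sup>2 / 2 * hm \<alpha> x * ((x - y) * y)\<bar> \<le> 1/2 * (jb (x - y) * jb y)" by simp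
  qed
  also have "\<dots> \<le> 2 * (jb (x - y) * jb y)" using j by simp
  finally show ?thesis .
qed

text \<open>Cauchy-Schwarz at a fixed x: with one bracket on each factor the integral converges for
  every x, not merely almost everywhere. The bilinearity and symmetry of \<open>Bop\<close> then
  hold pointwise.\<close>

lemma Kop_integrable:
  assumes m[measurable]: "(\<lambda>p. \<kappa> (fst p) (snd p)) \<in> borel_measurable (borel \<Otimes>\<^sub>M borel)"
    and U: "inH 1 U" and V: "inH 1 V" and le: "\<And>y. \<bar>\<kappa> x y\<bar> \<le> C * (jb (x - y) * jb y)"
  shows "integrable lborel (\<lambda>y. complex_of_real (\<kappa> x y) * U (x - y) * V y)"
proof -
  have [measurable]: "U \<in> borel_measurable borel" "V \<in> borel_measurable borel"
    using U V by (auto dest: wsq_measurable)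
  have [measurable]: "\<kappa> x \<in> borel_measurable borel"
    using measurable_compose[OF measurable_Pair1'[of x borel borel] m] by simp
  have 1: "sqint (\<lambda>y. complex_of_real (jb y) * U y)" "sqint (\<lambda>y. complex_of_real (jb y) * V y)"
    using wsq_sqint[OF U] wsq_sqint[OF V] by (simp_all add: wt_0)
  have "sqint (\<lambda>y. complex_of_real (jb (x - y)) * U (x - y))"
  proof -
    have "integrable lborel (\<lambda>y. (cmod (complex_of_real (jb (x + - 1 * y)) * U (x + - 1 * y)))\<^sup>2)"
      by (rule lborel_integrable_real_affine) (use 1 in \<open>auto simp: sqint_def\<close>)
    then show ?thesis by (simp add: sqint_def)
  qed
  from sqint_Cauchy_Schwarz(2)[OF this 1(2)]
  have "integrable lborel (\<lambda>y. C * cmod (complex_of_real (jb (x - y)) * U (x - y) * (complex_of_real (jb y) * V y)))"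
    by auto
  then show ?thesis
  proof (rule Bochner_Integration.integrable_bound, safe intro!: AE_I2)
    fix y
    have "\<bar>\<kappa> x y\<bar> * (cmod (U (x - y)) * cmod (V y)) \<le> C * (jb (x - y) * jb y) * (cmod (U (x - y)) * cmod (V y))"
      using le by (intro mult_right_mono) auto
    then show "norm (complex_of_real (\<kappa> x y) * U (x - y) * V y)
        \<le> norm (C * cmod (complex_of_real (jb (x - y)) * U (x - y) * (complex_of_real (jb y) * V y)))"
      by (simp add: norm_mult mult_ac abs_mult) (erule order_trans, simp add: mult_right_mono)
  qed measurable
qed

lemma kern_integrable:
  assumes "0 \<le> \<alpha>" "\<alpha> \<le> 1" "inH 1 U" "inH 1 V"
  shows "integrable lborel (\<lambda>y. complex_of_real (kern \<alpha> x y) * U (x - y) * V y)"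
  using assms by (intro Kop_integrable[where C = 2] abs_kern_le) auto

lemma Bop_commute: "Bop \<alpha> U V x = Bop \<alpha> V U x"
proof -
  have "Kop (kern \<alpha>) U V x = (LINT y|lborel. complex_of_real (kern \<alpha> x (x - y)) * U (x - (x - y)) * V (x - y))"
    unfolding Kop_def using lborel_integral_real_affine[of "-1" "\<lambda>y. complex_of_real (kern \<alpha> x y) * U (x - y) * V y" x] by simp
  also have "\<dots> = Kop (kern \<alpha>) V U x"
    unfolding Kop_def by (intro Bochner_Integration.integral_cong) (auto simp: kern_def mult_ac)
  finally show ?thesis by (simp add: Bop_def)
qed

lemma Bop_diff_right:
  assumes "0 \<le> \<alpha>" "\<alpha> \<le> 1" "inH 1 U" "inH 1 V" "inH 1 W"
  shows "Bop \<alpha> U (\<lambda>y. V y - W y) x = Bop \<alpha> U V x - Bop \<alpha> U W x"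
  using kern_integrable[OF assms(1-3), of V] kern_integrable[OF assms(1-3), of W] assms
  by (simp add: Bop_def Kop_def right_diff_distrib)

text \<open>By symmetry the mixed terms cancel. The difference of two solutions thus obeys a linear
  equation whose coefficient is their sum.\<close>

lemma Bop_square_diff:
  assumes a: "0 \<le> \<alpha>" "\<alpha> \<le> 1" and U: "inH 1 U" and V: "inH 1 V"
  shows "Bop \<alpha> U U x - Bop \<alpha> V V x = Bop \<alpha> (\<lambda>y. U y + V y) (\<lambda>y. U y - V y) x"
proof -
  have "Bop \<alpha> (\<lambda>y. U y + V y) (\<lambda>y. U y - V y) x = Bop \<alpha> (\<lambda>y. U y + V y) U x - Bop \<alpha> (\<lambda>y. U y + V y) V x"
    by (rule Bop_diff_right[OF a wsq_add(1)[OF U V] U V])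
  also have "\<dots> = Bop \<alpha> U (\<lambda>y. U y + V y) x - Bop \<alpha> V (\<lambda>y. U y + V y) x"
    by (simp add: Bop_commute[of \<alpha> "\<lambda>y. U y + V y"])
  also have "\<dots> = Bop \<alpha> U U x - Bop \<alpha> V V x"
  proof -
    have "Bop \<alpha> A (\<lambda>y. B y + C y) x = Bop \<alpha> A B x + Bop \<alpha> A C x" if "inH 1 A" "inH 1 B" "inH 1 C" for A B C
      using kern_integrable[OF a that(1,2)] kern_integrable[OF a that(1,3)] by (simp add: Bop_def Kop_def distrib_left)
    then show ?thesis using U V by (simp add: Bop_commute[of \<alpha> V U])
  qed
  finally show ?thesis by simp
qed

text \<open>Characterises spectra of real functions. The identity is asked for at every point, so
  that exchanging the variables conjugates the integrand of the energy form exactly.\<close>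

definition herm :: "(real \<Rightarrow> complex) \<Rightarrow> bool" where
  "herm U \<longleftrightarrow> (\<forall>x. U (- x) = cnj (U x))"

lemma hermD: "herm U \<Longrightarrow> U (- x) = cnj (U x)"
  by (simp add: herm_def)

lemma herm_Kop:
  assumes "herm U" "herm V" and \<kappa>: "\<And>x y. \<kappa> (- x) (- y) = \<kappa> x y"
  shows "Kop \<kappa> U V (- x) = cnj (Kop \<kappa> U V x)"
proof -
  have "Kop \<kappa> U V (- x) = (LINT y|lborel. complex_of_real (\<kappa> (- x) (- y)) * U (- x - - y) * V (- y))"
    unfolding Kop_def using lborel_integral_real_affine[of "-1" "\<lambda>y. complex_of_real (\<kappa> (- x) y) * U (- x - y) * V y" 0] by simp
  also have "\<dots> = (LINT y|lborel. cnj (complex_of_real (\<kappa> x y) * U (x - y) * V y))"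
  proof (intro Bochner_Integration.integral_cong refl)
    fix y
    have "U (- x - - y) = cnj (U (x - y))" using hermD[OF assms(1), of "x - y"] by simp
    then show "complex_of_real (\<kappa> (- x) (- y)) * U (- x - - y) * V (- y) = cnj (complex_of_real (\<kappa> x y) * U (x - y) * V y)"
      using hermD[OF assms(2), of y] by (simp add: \<kappa>)
  qed
  also have "\<dots> = cnj (Kop \<kappa> U V x)" unfolding Kop_def by (rule Bochner_Integration.integral_cnj)
  finally show ?thesis .
qed

lemma herm_Bop:
  assumes "herm U" "herm V"
  shows "herm (Bop \<alpha> U V)"
proof -
  have "(- x - - y) * - y = (x - y) * y" for x y :: real by (simp add: algebra_simps)
  then have "kern \<alpha> (- x) (- y) = kern \<alpha> x y" for x y by (simp only: kern_def hm_minus)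
  from herm_Kop[OF assms, of "kern \<alpha>", OF this] show ?thesis
    unfolding herm_def Bop_def by simp
qed

lemma consistency_bound:
  assumes a: "0 \<le> \<alpha>" "\<alpha> \<le> 1" and s: "3/2 < s" and U: "inH s U"
  shows "hn (1/2) (\<lambda>x. Bop \<alpha> U U x - Bop 0 U U x) \<le> \<alpha> powr (min 1 (s - 3/2)) * (cB s * (hn s U)\<^sup>2)"
proof -
  define d where "d = min 1 (s - 3/2)"
  define \<kappa> where "\<kappa> x y = x * (kern \<alpha> x y - kern 0 x y)" for x y
  have \<kappa>m: "(\<lambda>p. \<kappa> (fst p) (snd p)) \<in> borel_measurable (borel \<Otimes>\<^sub>M borel)" unfolding \<kappa>_def by measurable
  have U1: "inH 1 U" using U s by (auto intro: inH_mono)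
  have Um: "U \<in> borel_measurable borel" using U by (rule wsq_measurable)
  have eq: "Bop \<alpha> U U x - Bop 0 U U x = - \<i> * Kop \<kappa> U U x" for x
  proof -
    have "Kop \<kappa> U U x = (LINT y|lborel. complex_of_real x * (complex_of_real (kern \<alpha> x y) * U (x - y) * U y
        - complex_of_real (kern 0 x y) * U (x - y) * U y))"
      unfolding Kop_def \<kappa>_def by (intro Bochner_Integration.integral_cong) (auto simp: algebra_simps)
    also have "\<dots> = complex_of_real x * (Kop (kern \<alpha>) U U x - Kop (kern 0) U U x)"
      using kern_integrable[OF a U1 U1, of x] kern_integrable[of 0, OF _ _ U1 U1, of x] by (simp add: Kop_def)
    finally show ?thesis by (simp only: Bop_def) (simp add: algebra_simps)
  qed
  have le: "wt (1/2) 0 x * \<bar>\<kappa> x y\<bar> \<le> (2 powr (s + 2) * \<alpha> powr d) * (wt s 0 y * jb (x - y) + wt s 0 (x - y) * jb y)" for x y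
    using consistency_symbol_bound[OF a s d_def, of x y] by (simp add: \<kappa>_def wt_0)
  have k: "inH (1/2) (Kop \<kappa> U U)"
    "hn (1/2) (Kop \<kappa> U U) \<le> 2 * (2 powr (s + 2) * \<alpha> powr d) * (hn s U * aw U + hn s U * aw U)"
    by (rule Kop_bound[OF \<kappa>m _ _ _ _ _ U U _ _ le]; use inH_aw[OF U s] in simp)+
  have "hn (1/2) (\<lambda>x. Bop \<alpha> U U x - Bop 0 U U x) = hn (1/2) (Kop \<kappa> U U)"
    unfolding eq using wsq_cmult(2)[OF k(1), of "-\<i>"] by simp
  also have "\<dots> \<le> 2 * (2 powr (s + 2) * \<alpha> powr d) * (hn s U * (emb (s - 1) * hn s U) + hn s U * (emb (s - 1) * hn s U))"
    using inH_aw[OF U s] by (intro order_trans[OF k(2)] mult_left_mono add_mono) auto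
  also have "\<dots> = \<alpha> powr d * ((2 * 2 powr (s + 3) * emb (s - 1)) * (hn s U)\<^sup>2)"
    using powr_add[of "2::real" "s + 2" 1] by (simp add: power2_eq_square algebra_simps)
  also have "\<dots> \<le> \<alpha> powr d * (cB s * (hn s U)\<^sup>2)"
    unfolding cB_def by (intro mult_left_mono mult_right_mono powr_mono) auto
  finally show ?thesis by (simp add: d_def)
qed

section \<open>Energy estimates\<close>

lemma pair_integrable:
  fixes f :: "real \<times> real \<Rightarrow> complex"
  assumes m[measurable]: "f \<in> borel_measurable (borel \<Otimes>\<^sub>M borel)" and K: "0 \<le> K"
    and le: "(\<integral>\<^sup>+x. (\<integral>\<^sup>+y. ennreal (cmod (f (x, y))) \<partial>lborel) \<partial>lborel) \<le> ennreal K"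
  shows "integrable (lborel \<Otimes>\<^sub>M lborel) f" "(LINT p|(lborel \<Otimes>\<^sub>M lborel). cmod (f p)) \<le> K"
    "cmod (LINT p|(lborel \<Otimes>\<^sub>M lborel). f p) \<le> K"
proof -
  have "(\<integral>\<^sup>+p. ennreal (cmod (f p)) \<partial>(lborel \<Otimes>\<^sub>M lborel)) = (\<integral>\<^sup>+x. (\<integral>\<^sup>+y. ennreal (cmod (f (x, y))) \<partial>lborel) \<partial>lborel)"
    by (subst lborel.nn_integral_fst[symmetric]) auto
  then have *: "(\<integral>\<^sup>+p. ennreal (cmod (f p)) \<partial>(lborel \<Otimes>\<^sub>M lborel)) \<le> ennreal K" using le by simp
  show i: "integrable (lborel \<Otimes>\<^sub>M lborel) f"
    by (rule integrableI_bounded) (use * in \<open>auto simp: less_top[symmetric] top_unique\<close>)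
  have "ennreal (LINT p|(lborel \<Otimes>\<^sub>M lborel). cmod (f p)) \<le> ennreal K"
    using * nn_integral_eq_integral[OF integrable_norm[OF i]] by simp
  then show 1: "(LINT p|(lborel \<Otimes>\<^sub>M lborel). cmod (f p)) \<le> K" using K by (simp add: ennreal_le_iff)
  show "cmod (LINT p|(lborel \<Otimes>\<^sub>M lborel). f p) \<le> K"
    by (rule order_trans[OF integral_norm_bound 1])
qed

text \<open>Exchanging x and y conjugates H, so behind the factor i the symmetric part of c cancels
  in the real part and half of c(x, y) - c(y, x) survives. Absolute convergence licenses the
  exchange, but its size does not enter the bound.\<close>

lemma skew_symmetrization:
  fixes H :: "real \<times> real \<Rightarrow> complex" and c :: "real \<Rightarrow> real \<Rightarrow> real"
  assumes [measurable]: "H \<in> borel_measurable (borel \<Otimes>\<^sub>M borel)"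
    and cm[measurable]: "(\<lambda>p. c (fst p) (snd p)) \<in> borel_measurable (borel \<Otimes>\<^sub>M borel)"
    and int: "integrable (lborel \<Otimes>\<^sub>M lborel) (\<lambda>p. complex_of_real (c (fst p) (snd p)) * H p)"
    and H: "\<And>x y. H (y, x) = cnj (H (x, y))" and K: "0 \<le> K"
    and le: "(\<integral>\<^sup>+x. (\<integral>\<^sup>+y. ennreal (\<bar>c x y - c y x\<bar> * cmod (H (x, y))) \<partial>lborel) \<partial>lborel) \<le> ennreal K"
  shows "Re (LINT p|(lborel \<Otimes>\<^sub>M lborel). - \<i> * (complex_of_real (c (fst p) (snd p)) * H p)) \<le> K / 2"
proof -
  let ?P = "lborel \<Otimes>\<^sub>M lborel :: (real \<times> real) measure"
  define f where "f p = - \<i> * (complex_of_real (c (fst p) (snd p)) * H p)" for p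
  define g where "g p = f (snd p, fst p)" for p
  define h where "h p = - \<i> * (complex_of_real (c (fst p) (snd p) - c (snd p) (fst p)) * H p)" for p
  have [measurable]: "f \<in> borel_measurable (borel \<Otimes>\<^sub>M borel)" unfolding f_def by measurable
  have f: "integrable ?P f" unfolding f_def using int by simp
  have g: "integrable ?P g" unfolding g_def
    using lborel_pair.integrable_product_swap[OF f] by (simp add: split_beta')
  have gf: "integral\<^sup>L ?P g = integral\<^sup>L ?P f" unfolding g_def
    using lborel_pair.integral_product_swap[of f] by (simp add: split_beta')
  have fg: "Re (f p) + Re (g p) = Re (h p)" for p
    using H[of "fst p" "snd p"] by (cases p) (simp add: f_def g_def h_def algebra_simps)
  have cs: "(\<lambda>p. c (snd p) (fst p)) \<in> borel_measurable (borel \<Otimes>\<^sub>M borel)"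
    using measurable_compose[OF measurable_pair_swap' cm] by (simp add: split_beta')
  note [measurable] = cs
  have hm: "h \<in> borel_measurable (borel \<Otimes>\<^sub>M borel)" unfolding h_def by measurable
  have hb: "(\<integral>\<^sup>+x. (\<integral>\<^sup>+y. ennreal (cmod (h (x, y))) \<partial>lborel) \<partial>lborel) \<le> ennreal K"
    using le by (simp add: h_def norm_mult of_real_diff[symmetric] del: of_real_diff)
  note h = pair_integrable[OF hm K hb]
  have "2 * Re (integral\<^sup>L ?P f) = Re (integral\<^sup>L ?P f) + Re (integral\<^sup>L ?P g)" by (simp add: gf)
  also have "\<dots> = (LINT p|?P. Re (f p) + Re (g p))"
    using f g by (simp add: integral_Re)
  also have "\<dots> = Re (integral\<^sup>L ?P h)" unfolding fg by (rule integral_Re[OF h(1)])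
  also have "\<dots> \<le> K" using complex_Re_le_cmod[of "integral\<^sup>L ?P h"] h(3) by simp
  finally have "Re (integral\<^sup>L ?P f) \<le> K / 2" by simp
  then show ?thesis unfolding f_def[abs_def] .
qed

lemma iterated_eq_pair_integral:
  fixes f :: "real \<times> real \<Rightarrow> complex"
  assumes "integrable (lborel \<Otimes>\<^sub>M lborel) f"
  shows "(LINT x|lborel. LINT y|lborel. f (x, y)) = (LINT p|(lborel \<Otimes>\<^sub>M lborel). f p)"
  using lborel_pair.integral_fst'[OF assms] by simp

definition tri :: "(real \<Rightarrow> complex) \<Rightarrow> (real \<Rightarrow> complex) \<Rightarrow> real \<times> real \<Rightarrow> complex" where
  "tri W S p = cnj (W (fst p)) * S (fst p - snd p) * W (snd p)"

lemma tri_measurable [measurable (raw)]: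
  assumes [measurable]: "W \<in> borel_measurable borel" "S \<in> borel_measurable borel"
  shows "tri W S \<in> borel_measurable (borel \<Otimes>\<^sub>M borel)"
proof -
  have [measurable]: "(\<lambda>x. cnj (W x)) \<in> borel_measurable borel"
    by (intro borel_measurable_continuous_on[OF _ assms(1)] continuous_intros)
  show ?thesis unfolding tri_def[abs_def] by measurable
qed

lemma tri_swap: "herm S \<Longrightarrow> tri W S (y, x) = cnj (tri W S (x, y))"
  using hermD[of S "x - y"] by (simp add: tri_def mult_ac)

lemma cmod_tri: "cmod (tri W S (x, y)) = cmod (W x) * cmod (S (x - y)) * cmod (W y)"
  by (simp add: tri_def norm_mult)

text \<open>The terms of \<open>half_level_bound\<close> match the three positions of the L^1
  factor: the bracket on S, or the power 3/2 - s on either copy of W. Each gives the same product of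
  norms, and 15 is 3 times the 5 of the symbol bound.\<close>

lemma difference_integral_bound:
  assumes s: "3/2 < s" and W: "inH s W" and S: "inH s S"
  shows "(\<integral>\<^sup>+x. (\<integral>\<^sup>+y. ennreal ((jb x + jb y) * jb (x - y) * cmod (tri W S (x, y))) \<partial>lborel) \<partial>lborel)
    \<le> ennreal (15 * emb (s - 1) * hn s S * (hn (1/2) W)\<^sup>2)"
proof -
  have [measurable]: "W \<in> borel_measurable borel" "S \<in> borel_measurable borel"
    using W S by (auto dest: wsq_measurable)
  have Wh: "inH (1/2) W" using W s by (auto intro: inH_mono)
  define a where "a x = jb x powr (1/2) * cmod (W x)" for x
  define b where "b x = jb x powr s * cmod (S x)" for x
  define b1 where "b1 x = jb x * cmod (S x)" for x
  define e where "e x = jb x powr (3/2 - s) * cmod (W x)" for x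
  define n where "n = hn (1/2) W"
  define m where "m = hn s S"
  define k where "k = emb (s - 1)"
  have nn: "0 \<le> n" "0 \<le> m" "0 \<le> k" by (auto simp: n_def m_def k_def)
  have [measurable]: "a \<in> borel_measurable borel" "b \<in> borel_measurable borel" "b1 \<in> borel_measurable borel" "e \<in> borel_measurable borel"
    unfolding a_def b_def b1_def e_def by measurable
  have pos: "0 \<le> a x" "0 \<le> b x" "0 \<le> b1 x" "0 \<le> e x" for x by (auto simp: a_def b_def b1_def e_def)
  have A: "(\<integral>\<^sup>+x. ennreal ((a x)\<^sup>2) \<partial>lborel) \<le> ennreal (n\<^sup>2)"
    using inH_nn_integral[OF Wh] by (simp add: a_def n_def wt_0)
  have B: "(\<integral>\<^sup>+x. ennreal ((b x)\<^sup>2) \<partial>lborel) \<le> ennreal (m\<^sup>2)"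
    using inH_nn_integral[OF S] by (simp add: b_def m_def wt_0)
  have B1: "(\<integral>\<^sup>+x. ennreal (b1 x) \<partial>lborel) \<le> ennreal (k * m)"
    using inH_integrable(2)[OF S, of 1] s by (simp add: b1_def m_def k_def)
  have E: "(\<integral>\<^sup>+x. ennreal (e x) \<partial>lborel) \<le> ennreal (k * n)"
    using inH_integrable(2)[OF Wh, of "3/2 - s"] s by (simp add: e_def n_def k_def)
  have pw: "(jb x + jb y) * jb (x - y) * cmod (tri W S (x, y))
      \<le> 5 * (a x * b1 (x - y) * a y + a x * b (x - y) * e y + e x * b (x - y) * a y)" for x y
  proof -
    define t where "t = cmod (tri W S (x, y))"
    have ae: "jb v powr (1/2) * jb v powr (1 - s) = jb v powr (3/2 - s)" for v
      unfolding powr_add[symmetric] by (rule arg_cong[where f = "\<lambda>r. jb v powr r"]) simp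
    have "(jb x + jb y) * jb (x - y) * t \<le> 5 * (jb x powr (1/2) * jb y powr (1/2) *
      (jb (x - y) + jb (x - y) powr s * (jb y powr (1 - s) + jb x powr (1 - s)))) * t"
      using half_level_bound[of s x y] s by (intro mult_right_mono) (auto simp: t_def)
    also have "\<dots> = 5 * (jb x powr (1/2) * jb (x - y) * jb y powr (1/2)
        + jb x powr (1/2) * jb (x - y) powr s * (jb y powr (1/2) * jb y powr (1 - s))
        + (jb x powr (1/2) * jb x powr (1 - s)) * jb (x - y) powr s * jb y powr (1/2)) * t"
      by (simp add: algebra_simps)
    also have "\<dots> = 5 * (a x * b1 (x - y) * a y + a x * b (x - y) * e y + e x * b (x - y) * a y)"
      unfolding ae t_def cmod_tri a_def b_def b1_def e_def by (simp add: algebra_simps)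
    finally show ?thesis by (simp add: t_def)
  qed
  have "(\<integral>\<^sup>+x. (\<integral>\<^sup>+y. ennreal ((jb x + jb y) * jb (x - y) * cmod (tri W S (x, y))) \<partial>lborel) \<partial>lborel)
    \<le> (\<integral>\<^sup>+x. (\<integral>\<^sup>+y. 5 * (ennreal (a x * b1 (x - y) * a y) + ennreal (a x * b (x - y) * e y) + ennreal (e x * b (x - y) * a y)) \<partial>lborel) \<partial>lborel)"
  proof (intro nn_integral_mono)
    fix x y
    have "ennreal ((jb x + jb y) * jb (x - y) * cmod (tri W S (x, y)))
      \<le> ennreal (5 * (a x * b1 (x - y) * a y + a x * b (x - y) * e y + e x * b (x - y) * a y))"
      by (rule ennreal_leI[OF pw])
    then show "ennreal ((jb x + jb y) * jb (x - y) * cmod (tri W S (x, y)))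
      \<le> 5 * (ennreal (a x * b1 (x - y) * a y) + ennreal (a x * b (x - y) * e y) + ennreal (e x * b (x - y) * a y))"
      using pos by (simp add: ennreal_mult)
  qed
  also have "\<dots> = 5 * ((\<integral>\<^sup>+x. (\<integral>\<^sup>+y. ennreal (a x * b1 (x - y) * a y) \<partial>lborel) \<partial>lborel)
      + (\<integral>\<^sup>+x. (\<integral>\<^sup>+y. ennreal (a x * b (x - y) * e y) \<partial>lborel) \<partial>lborel)
      + (\<integral>\<^sup>+x. (\<integral>\<^sup>+y. ennreal (e x * b (x - y) * a y) \<partial>lborel) \<partial>lborel))"
    by (simp add: nn_integral_cmult nn_integral_add)
  also have "\<dots> \<le> 5 * (ennreal (n * (k * m) * n) + ennreal (n * m * (k * n)) + ennreal ((k * n) * m * n))"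
  proof (intro mult_left_mono add_mono)
    show "(\<integral>\<^sup>+x. (\<integral>\<^sup>+y. ennreal (a x * b1 (x - y) * a y) \<partial>lborel) \<partial>lborel) \<le> ennreal (n * (k * m) * n)"
      by (rule trilinear_L1_middle) (use pos nn A B1 in auto)
    show "(\<integral>\<^sup>+x. (\<integral>\<^sup>+y. ennreal (a x * b (x - y) * e y) \<partial>lborel) \<partial>lborel) \<le> ennreal (n * m * (k * n))"
      by (rule trilinear_L1_right) (use pos nn A B E in auto)
    show "(\<integral>\<^sup>+x. (\<integral>\<^sup>+y. ennreal (e x * b (x - y) * a y) \<partial>lborel) \<partial>lborel) \<le> ennreal ((k * n) * m * n)"
      by (rule trilinear_L1_left) (use pos nn A B E in auto)
  qed simp
  also have "\<dots> = ennreal (15 * k * m * n\<^sup>2)"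
  proof -
    have "5 * (ennreal u + ennreal v + ennreal w) = ennreal (5 * (u + v + w))" if "0 \<le> u" "0 \<le> v" "0 \<le> w" for u v w
      using that by (simp add: ennreal_mult)
    then have "5 * (ennreal (n * (k * m) * n) + ennreal (n * m * (k * n)) + ennreal ((k * n) * m * n))
      = ennreal (5 * (n * (k * m) * n + n * m * (k * n) + (k * n) * m * n))"
      using nn by (auto simp only: mult_nonneg_nonneg)
    also have "5 * (n * (k * m) * n + n * m * (k * n) + (k * n) * m * n) = 15 * k * m * n\<^sup>2"
      by (simp add: power2_eq_square algebra_simps)
    finally show ?thesis .
  qed
  finally show ?thesis by (simp add: k_def m_def n_def)
qed

text \<open>Symmetrisation requires convergence of the unsymmetrised form. Its symbol has order two,
  so the H^1 norm of W is spent here; this norm is absent from the final estimate.\<close>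

lemma difference_integrable:
  assumes s: "3/2 < s" and W: "inH s W" and S: "inH s S"
  shows "integrable (lborel \<Otimes>\<^sub>M lborel) (\<lambda>p. complex_of_real (fst p * (jb (fst p) * (1/2 + hm \<alpha> (fst p)))) * tri W S p)"
proof -
  have [measurable]: "W \<in> borel_measurable borel" "S \<in> borel_measurable borel"
    using W S by (auto dest: wsq_measurable)
  have W1: "inH 1 W" using W s by (auto intro: inH_mono)
  define a where "a x = jb x * cmod (W x)" for x
  define b where "b x = jb x * cmod (S x)" for x
  define n where "n = hn 1 W"
  define k where "k = aw S"
  have nn: "0 \<le> n" "0 \<le> k" by (auto simp: n_def k_def)
  have [measurable]: "a \<in> borel_measurable borel" "b \<in> borel_measurable borel"
    unfolding a_def b_def by measurable
  have pos: "0 \<le> a x" "0 \<le> b x" for x by (auto simp: a_def b_def)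
  have A: "(\<integral>\<^sup>+x. ennreal ((a x)\<^sup>2) \<partial>lborel) \<le> ennreal (n\<^sup>2)"
    using inH_nn_integral[OF W1] by (simp add: a_def n_def wt_0)
  have B: "(\<integral>\<^sup>+x. ennreal (b x) \<partial>lborel) \<le> ennreal k"
    using aw_nn_integral[OF inH_aw(1)[OF S s]] by (simp add: b_def k_def)
  have "(\<integral>\<^sup>+x. (\<integral>\<^sup>+y. ennreal (cmod (complex_of_real (x * (jb x * (1/2 + hm \<alpha> x))) * tri W S (x, y))) \<partial>lborel) \<partial>lborel)
    \<le> (\<integral>\<^sup>+x. (\<integral>\<^sup>+y. ennreal 3 * ennreal (a x * b (x - y) * a y) \<partial>lborel) \<partial>lborel)"
  proof (intro nn_integral_mono)
    fix x y
    define q where "q = complex_of_real (x * (jb x * (1/2 + hm \<alpha> x)))"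
    have "cmod (q) = \<bar>x\<bar> * (jb x * (1/2 + hm \<alpha> x))"
      using hm_pos[of \<alpha> x] by (simp only: norm_of_real q_def) (simp add: abs_mult)
    also have "\<dots> \<le> jb x * (jb x * (3/2))"
      using hm_le_1[of \<alpha> x] hm_pos[of \<alpha> x] by (intro mult_mono abs_le_jb) auto
    also have "\<dots> = 3/2 * jb x * jb x" by simp
    also have "\<dots> \<le> 3/2 * jb x * (jb y + jb (x - y))"
      by (intro mult_left_mono jb_triangle) auto
    also have "\<dots> \<le> 3/2 * jb x * (2 * (jb y * jb (x - y)))"
    proof (intro mult_left_mono)
      have "jb y * 1 \<le> jb y * jb (x - y)" "1 * jb (x - y) \<le> jb y * jb (x - y)"
        by (intro mult_mono; simp)+
      then show "jb y + jb (x - y) \<le> 2 * (jb y * jb (x - y))" by linarith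
    qed auto
    finally have "cmod (q) * cmod (tri W S (x, y))
      \<le> 3/2 * jb x * (2 * (jb y * jb (x - y))) * cmod (tri W S (x, y))"
      by (rule mult_right_mono) simp
    then have "cmod (q * tri W S (x, y)) \<le> 3 * (a x * b (x - y) * a y)"
      by (simp add: norm_mult cmod_tri a_def b_def mult_ac)
    then have "ennreal (cmod (q * tri W S (x, y))) \<le> ennreal (3 * (a x * b (x - y) * a y))"
      by (rule ennreal_leI)
    then show "ennreal (cmod (complex_of_real (x * (jb x * (1/2 + hm \<alpha> x))) * tri W S (x, y))) \<le> ennreal 3 * ennreal (a x * b (x - y) * a y)"
      unfolding q_def[symmetric] using pos by (simp add: ennreal_mult)
  qed
  also have "\<dots> = ennreal 3 * (\<integral>\<^sup>+x. (\<integral>\<^sup>+y. ennreal (a x * b (x - y) * a y) \<partial>lborel) \<partial>lborel)"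
    by (simp add: nn_integral_cmult)
  also have "\<dots> \<le> ennreal 3 * ennreal (n * k * n)"
    by (intro mult_left_mono trilinear_L1_middle) (use pos nn A B in auto)
  also have "\<dots> = ennreal (3 * (n * k * n))" using nn by (simp add: ennreal_mult)
  finally have *: "(\<integral>\<^sup>+x. (\<integral>\<^sup>+y. ennreal (cmod (complex_of_real (x * (jb x * (1/2 + hm \<alpha> x))) * tri W S (x, y))) \<partial>lborel) \<partial>lborel) \<le> ennreal (3 * (n * k * n))" .
  show ?thesis
    by (rule pair_integrable(1)[of _ "3 * (n * k * n)"]) (use * nn in auto)
qed

definition cD :: "real \<Rightarrow> real" where
  "cD s = 75 * emb (s - 1)"

lemma cD_nonneg [simp]: "0 \<le> cD s"
  by (simp add: cD_def)

text \<open>The transport part \<open>G1\<close> loses a derivative and must be symmetrised. The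
  nonlocal part \<open>G2\<close> is already of the admissible size at this level and is bounded in
  absolute value.\<close>

lemma difference_estimate:
  assumes a: "0 \<le> \<alpha>" "\<alpha> \<le> 1" and s: "3/2 < s" and W: "inH s W" and S: "inH s S" and hS: "herm S"
  shows "Re (LINT x|lborel. cnj (complex_of_real (wt (1/2) 0 x) * W x) * (complex_of_real (wt (1/2) 0 x) * Bop \<alpha> S W x))
    \<le> cD s * hn s S * (hn (1/2) W)\<^sup>2"
proof -
  let ?P = "lborel \<Otimes>\<^sub>M lborel :: (real \<times> real) measure"
  have [measurable]: "W \<in> borel_measurable borel" "S \<in> borel_measurable borel"
    using W S by (auto dest: wsq_measurable)
  define Q where "Q = 15 * emb (s - 1) * hn s S * (hn (1/2) W)\<^sup>2"
  have Q0: "0 \<le> Q" by (simp add: Q_def)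
  note ib = difference_integral_bound[OF s W S, folded Q_def]
  define c where "c x y = x * (jb x * (1/2 + hm \<alpha> x))" for x y :: real
  define d where "d x y = jb x * (\<alpha>\<^sup>2 / 2 * x * hm \<alpha> x * ((x - y) * y))" for x y
  define G1 where "G1 p = - \<i> * (complex_of_real (c (fst p) (snd p)) * tri W S p)" for p
  define G2 where "G2 p = \<i> * (complex_of_real (d (fst p) (snd p)) * tri W S p)" for p
  have [measurable]: "(\<lambda>p. c (fst p) (snd p)) \<in> borel_measurable (borel \<Otimes>\<^sub>M borel)" 
    "(\<lambda>p. d (fst p) (snd p)) \<in> borel_measurable (borel \<Otimes>\<^sub>M borel)"
    unfolding c_def d_def by measurable
  have ci: "integrable ?P (\<lambda>p. complex_of_real (c (fst p) (snd p)) * tri W S p)"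
    unfolding c_def by (rule difference_integrable[OF s W S])
  then have G1i: "integrable ?P G1" unfolding G1_def by simp
  have "(\<integral>\<^sup>+x. (\<integral>\<^sup>+y. ennreal (\<bar>c x y - c y x\<bar> * cmod (tri W S (x, y))) \<partial>lborel) \<partial>lborel)
      \<le> (\<integral>\<^sup>+x. (\<integral>\<^sup>+y. ennreal 3 * ennreal ((jb x + jb y) * jb (x - y) * cmod (tri W S (x, y))) \<partial>lborel) \<partial>lborel)"
  proof (intro nn_integral_mono)
    fix x y
    have "\<bar>c x y - c y x\<bar> * cmod (tri W S (x, y)) \<le> (3 * (jb x + jb y) * jb (x - y)) * cmod (tri W S (x, y))"
      unfolding c_def by (intro mult_right_mono transport_symbol_bound) auto
    also have "\<dots> = 3 * ((jb x + jb y) * jb (x - y) * cmod (tri W S (x, y)))" by (simp add: algebra_simps)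
    finally show "ennreal (\<bar>c x y - c y x\<bar> * cmod (tri W S (x, y))) \<le> ennreal 3 * ennreal ((jb x + jb y) * jb (x - y) * cmod (tri W S (x, y)))"
      by (subst ennreal_mult[symmetric]) (auto intro: ennreal_leI)
  qed
  also have "\<dots> = ennreal 3 * (\<integral>\<^sup>+x. (\<integral>\<^sup>+y. ennreal ((jb x + jb y) * jb (x - y) * cmod (tri W S (x, y))) \<partial>lborel) \<partial>lborel)"
    by (simp add: nn_integral_cmult cmod_tri)
  also have "\<dots> \<le> ennreal 3 * ennreal Q" by (intro mult_left_mono ib) auto
  also have "\<dots> = ennreal (3 * Q)" using Q0 by (simp add: ennreal_mult)
  finally have "Re (LINT p|?P. G1 p) \<le> 3 * Q / 2"
    unfolding G1_def using Q0 by (intro skew_symmetrization ci tri_swap hS) auto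
  moreover have G2b: "(\<integral>\<^sup>+x. (\<integral>\<^sup>+y. ennreal (cmod (G2 (x, y))) \<partial>lborel) \<partial>lborel) \<le> ennreal Q"
  proof (rule order_trans[OF _ ib], intro nn_integral_mono ennreal_leI)
    fix x y
    have "cmod (G2 (x, y)) = \<bar>d x y\<bar> * cmod (tri W S (x, y))" by (simp add: G2_def norm_mult)
    also have "\<bar>d x y\<bar> = jb x * (\<alpha>\<^sup>2 / 2 * \<bar>x\<bar> * hm \<alpha> x * (\<bar>x - y\<bar> * \<bar>y\<bar>))"
      by (simp add: d_def abs_mult)
    also have "\<dots> * cmod (tri W S (x, y)) \<le> (jb x + jb y) * jb (x - y) * cmod (tri W S (x, y))"
      by (intro mult_right_mono nonlocal_half_level a) auto
    finally show "cmod (G2 (x, y)) \<le> (jb x + jb y) * jb (x - y) * cmod (tri W S (x, y))" .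
  qed
  have G2m: "G2 \<in> borel_measurable (borel \<Otimes>\<^sub>M borel)" unfolding G2_def by measurable
  note G2 = pair_integrable[OF G2m Q0 G2b]
  have "Re (LINT p|?P. G2 p) \<le> Q" using complex_Re_le_cmod[of "LINT p|?P. G2 p"] G2(3) by simp
  moreover have "(LINT x|lborel. cnj (complex_of_real (wt (1/2) 0 x) * W x) * (complex_of_real (wt (1/2) 0 x) * Bop \<alpha> S W x))
      = (LINT x|lborel. LINT y|lborel. G1 (x, y) + G2 (x, y))"
  proof (intro Bochner_Integration.integral_cong refl)
    fix x
    have w: "wt (1/2) 0 x * wt (1/2) 0 x = jb x" by (simp add: wt_0 powr_add[symmetric])
    have "cnj (complex_of_real (wt (1/2) 0 x) * W x) * (complex_of_real (wt (1/2) 0 x) * Bop \<alpha> S W x)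
      = complex_of_real (wt (1/2) 0 x * wt (1/2) 0 x) * cnj (W x) * Bop \<alpha> S W x" by simp
    also have "\<dots> = complex_of_real (jb x) * cnj (W x) * (- \<i> * complex_of_real x) * Kop (kern \<alpha>) S W x"
      unfolding w Bop_def by simp
    also have "\<dots> = (LINT y|lborel. (complex_of_real (jb x) * cnj (W x) * (- \<i> * complex_of_real x)) * (complex_of_real (kern \<alpha> x y) * S (x - y) * W y))"
      unfolding Kop_def by (rule integral_mult_right_zero[symmetric])
    also have "\<dots> = (LINT y|lborel. G1 (x, y) + G2 (x, y))"
      by (intro Bochner_Integration.integral_cong refl)
        (simp add: G1_def G2_def c_def d_def tri_def kern_def field_simps)
    finally show "cnj (complex_of_real (wt (1/2) 0 x) * W x) * (complex_of_real (wt (1/2) 0 x) * Bop \<alpha> S W x)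
      = (LINT y|lborel. G1 (x, y) + G2 (x, y))" .
  qed
  moreover have "(LINT x|lborel. LINT y|lborel. G1 (x, y) + G2 (x, y)) = (LINT p|?P. G1 p) + (LINT p|?P. G2 p)"
    using iterated_eq_pair_integral[OF Bochner_Integration.integrable_add[OF G1i G2(1)]] G1i G2(1) by simp
  ultimately have "Re (LINT x|lborel. cnj (complex_of_real (wt (1/2) 0 x) * W x) * (complex_of_real (wt (1/2) 0 x) * Bop \<alpha> S W x)) \<le> 3 * Q / 2 + Q"
    by simp
  also have "\<dots> \<le> 5 * Q" using Q0 by simp
  also have "\<dots> = cD s * hn s S * (hn (1/2) W)\<^sup>2" by (simp add: Q_def cD_def)
  finally show ?thesis .
qed

definition band :: "real \<Rightarrow> (real \<Rightarrow> complex) \<Rightarrow> bool" where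
  "band N U \<longleftrightarrow> (\<forall>x. N < \<bar>x\<bar> \<longrightarrow> U x = 0)"

text \<open>The band limit makes the unsymmetrised integrals converge. The constant is independent
  of N, so the Galerkin truncation leaves no trace in the bound.\<close>

lemma energy_estimate:
  assumes s: "3/2 < s"
  shows "\<exists>C\<ge>0. \<forall>\<alpha> M N U. 0 \<le> \<alpha> \<longrightarrow> \<alpha> \<le> 1 \<longrightarrow> 0 \<le> M \<longrightarrow> inH s U \<longrightarrow> herm U \<longrightarrow> band N U \<longrightarrow>
    Re (LINT x|lborel. cnj (complex_of_real (wt s M x) * U x) * (complex_of_real (wt s M x) * Bop \<alpha> U U x))
    \<le> C * aw U * (wn (wt s M) U)\<^sup>2"
proof -
  have s1: "1 \<le> s" using s by simp
  let ?P = "lborel \<Otimes>\<^sub>M lborel :: (real \<times> real) measure"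
  obtain C where C: "0 \<le> C" "\<And>\<alpha> M x y. 0 \<le> \<alpha> \<Longrightarrow> \<alpha> \<le> 1 \<Longrightarrow> 0 \<le> M \<Longrightarrow>
    \<bar>y * esym s M \<alpha> x - x * esym s M \<alpha> y\<bar> \<le> C * (wt s M x * wt s M y * jb (x - y)
      + wt s M x * wt s M (x - y) * jb y + wt s M y * wt s M (x - y) * jb x)"
    using energy_symbol_bound[OF s1] by blast
  define D where "D = 3 * C + 2 * 2 powr (s + 1)"
  have "Re (LINT x|lborel. cnj (complex_of_real (wt s M x) * U x) * (complex_of_real (wt s M x) * Bop \<alpha> U U x))
    \<le> D * aw U * (wn (wt s M) U)\<^sup>2"
    if a: "0 \<le> \<alpha>" "\<alpha> \<le> 1" "0 \<le> M" and U: "inH s U" and hU: "herm U" and bU: "band N U" for \<alpha> M N U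
  proof -
    have [measurable]: "U \<in> borel_measurable borel" using U by (rule wsq_measurable)
    define w where "w x = wt s M x * cmod (U x)" for x
    define j where "j x = jb x * cmod (U x)" for x
    define n where "n = wn (wt s M) U"
    define k where "k = aw U"
    have nn: "0 \<le> n" "0 \<le> k" by (auto simp: n_def k_def)
    have [measurable]: "w \<in> borel_measurable borel" "j \<in> borel_measurable borel"
      unfolding w_def j_def by measurable
    have pos: "0 \<le> w x" "0 \<le> j x" for x using a by (auto simp: w_def j_def)
    have A: "(\<integral>\<^sup>+x. ennreal ((w x)\<^sup>2) \<partial>lborel) \<le> ennreal (n\<^sup>2)"
      using inH_nn_integral[OF inH_tail(1)[OF U a(3)]] a by (simp add: w_def n_def)
    have B: "(\<integral>\<^sup>+x. ennreal (j x) \<partial>lborel) \<le> ennreal k"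
      using aw_nn_integral[OF inH_aw(1)[OF U s]] by (simp add: j_def k_def)
    have T1: "(\<integral>\<^sup>+x. (\<integral>\<^sup>+y. ennreal (w x * j (x - y) * w y) \<partial>lborel) \<partial>lborel) \<le> ennreal (n * k * n)"
      by (rule trilinear_L1_middle) (use pos nn A B in auto)
    have T2: "(\<integral>\<^sup>+x. (\<integral>\<^sup>+y. ennreal (w x * w (x - y) * j y) \<partial>lborel) \<partial>lborel) \<le> ennreal (n * n * k)"
      by (rule trilinear_L1_right) (use pos nn A B in auto)
    have T3: "(\<integral>\<^sup>+x. (\<integral>\<^sup>+y. ennreal (j x * w (x - y) * w y) \<partial>lborel) \<partial>lborel) \<le> ennreal (k * n * n)"
      by (rule trilinear_L1_left) (use pos nn A B in auto)
    define H where "H = tri U U"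
    have [measurable]: "H \<in> borel_measurable (borel \<Otimes>\<^sub>M borel)" unfolding H_def by measurable
    have Hs: "H (x, x - y) = H (x, y)" for x y by (simp add: H_def tri_def)
    \<comment> \<open>On the band the symbols are bounded, which reduces integrability to
      \<open>difference_integral_bound\<close> with both arguments equal to U.\<close>
    have bdd: "integrable ?P (\<lambda>p. complex_of_real (c (fst p) (snd p)) * H p)"
      if cm[measurable]: "(\<lambda>p. c (fst p) (snd p)) \<in> borel_measurable (borel \<Otimes>\<^sub>M borel)" and R: "0 \<le> R"
        and cb: "\<And>x y. \<bar>x\<bar> \<le> N \<Longrightarrow> \<bar>y\<bar> \<le> N \<Longrightarrow> \<bar>c x y\<bar> \<le> R" for c :: "real \<Rightarrow> real \<Rightarrow> real" and R
    proof -
      have "(\<integral>\<^sup>+x. (\<integral>\<^sup>+y. ennreal (cmod (complex_of_real (c x y) * H (x, y))) \<partial>lborel) \<partial>lborel)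
        \<le> (\<integral>\<^sup>+x. (\<integral>\<^sup>+y. ennreal R * ennreal ((jb x + jb y) * jb (x - y) * cmod (H (x, y))) \<partial>lborel) \<partial>lborel)"
      proof (intro nn_integral_mono)
        fix x y
        have "\<bar>c x y\<bar> * cmod (H (x, y)) \<le> R * cmod (H (x, y))"
        proof (cases "\<bar>x\<bar> \<le> N \<and> \<bar>y\<bar> \<le> N")
          case False
          then have "H (x, y) = 0" using bU by (auto simp: band_def H_def tri_def)
          then show ?thesis by simp
        qed (auto intro!: mult_right_mono cb)
        also have "\<dots> = R * (1 * 1 * cmod (H (x, y)))" by simp
        also have "\<dots> \<le> R * ((jb x + jb y) * jb (x - y) * cmod (H (x, y)))"
          using R by (intro mult_left_mono mult_right_mono mult_mono) (auto simp: add_increasing2)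
        finally show "ennreal (cmod (complex_of_real (c x y) * H (x, y))) \<le> ennreal R * ennreal ((jb x + jb y) * jb (x - y) * cmod (H (x, y)))"
          using R by (simp add: norm_mult ennreal_mult[symmetric] ennreal_leI)
      qed
      also have "\<dots> = ennreal R * (\<integral>\<^sup>+x. (\<integral>\<^sup>+y. ennreal ((jb x + jb y) * jb (x - y) * cmod (H (x, y))) \<partial>lborel) \<partial>lborel)"
        by (simp add: nn_integral_cmult cmod_tri H_def)
      also have "\<dots> \<le> ennreal R * ennreal (15 * emb (s - 1) * hn s U * (hn (1/2) U)\<^sup>2)"
        unfolding H_def by (intro mult_left_mono difference_integral_bound s U) auto
      also have "\<dots> = ennreal (R * (15 * emb (s - 1) * hn s U * (hn (1/2) U)\<^sup>2))"
        using R by (subst ennreal_mult[symmetric]) auto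
      finally have "(\<integral>\<^sup>+x. (\<integral>\<^sup>+y. ennreal (cmod (complex_of_real (c x y) * H (x, y))) \<partial>lborel) \<partial>lborel)
        \<le> ennreal (R * (15 * emb (s - 1) * hn s U * (hn (1/2) U)\<^sup>2))" .
      then show ?thesis
        by (intro pair_integrable(1)[of _ "R * (15 * emb (s - 1) * hn s U * (hn (1/2) U)\<^sup>2)"]) (use R in auto)
    qed
    define E where "E = jb N * (3/2 * (wt s 0 N)\<^sup>2)"
    have E0: "0 \<le> E" by (simp add: E_def)
    have esym_bd: "\<bar>v * esym s M \<alpha> u\<bar> \<le> E" if uv: "\<bar>u\<bar> \<le> N" "\<bar>v\<bar> \<le> N" for u v
    proof -
      have jN: "jb u \<le> jb N" "jb v \<le> jb N" using uv by (auto intro!: jb_mono)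
      have "wt s M u \<le> wt s 0 N"
        using wt_le_0[OF a(3), of s u] gw_mono[OF jb_ge_1 jN(1), of 0 s] s by (simp add: wt_def)
      then have "(wt s M u)\<^sup>2 * (1/2 + hm \<alpha> u) \<le> (wt s 0 N)\<^sup>2 * (3/2)"
        using hm_le_1[of \<alpha> u] hm_pos[of \<alpha> u] a by (intro mult_mono power_mono) auto
      from mult_mono[OF order_trans[OF abs_le_jb jN(2)] this] have "\<bar>v\<bar> * esym s M \<alpha> u \<le> E"
        unfolding E_def esym_def by (simp add: mult_ac)
      moreover have "0 \<le> esym s M \<alpha> u" unfolding esym_def using hm_pos[of \<alpha> u] by (intro mult_nonneg_nonneg) auto
      ultimately show ?thesis by (simp add: abs_mult)
    qed
    have esm[measurable]: "esym s M \<alpha> \<in> borel_measurable borel" unfolding esym_def by measurable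
    define e where "e = esym s M \<alpha>"
    have [measurable]: "e \<in> borel_measurable borel" by (simp add: e_def esm)
    have iy: "integrable ?P (\<lambda>p. complex_of_real (snd p * e (fst p)) * H p)"
      using esym_bd unfolding e_def by (intro bdd[where c = "\<lambda>x y. y * esym s M \<alpha> x" and R = E] E0) auto
    have ix: "integrable ?P (\<lambda>p. complex_of_real (fst p * e (fst p)) * H p)"
      using esym_bd unfolding e_def by (intro bdd[where c = "\<lambda>x y. x * esym s M \<alpha> x" and R = E] E0) auto
    define d where "d x y = (wt s M x)\<^sup>2 * (\<alpha>\<^sup>2 / 2 * x * hm \<alpha> x * ((x - y) * y))" for x y
    have [measurable]: "(\<lambda>p. d (fst p) (snd p)) \<in> borel_measurable (borel \<Otimes>\<^sub>M borel)"
      unfolding d_def by measurable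
    define G2 where "G2 p = \<i> * (complex_of_real (d (fst p) (snd p)) * H p)" for p
    have G2m: "G2 \<in> borel_measurable (borel \<Otimes>\<^sub>M borel)" unfolding G2_def by measurable
    define L where "L = 2 powr (s + 1) * (n * k * n + n * n * k)"
    have L0: "0 \<le> L" using nn by (simp add: L_def)
    have G2b: "(\<integral>\<^sup>+x. (\<integral>\<^sup>+y. ennreal (cmod (G2 (x, y))) \<partial>lborel) \<partial>lborel) \<le> ennreal L"
    proof -
      have "(\<integral>\<^sup>+x. (\<integral>\<^sup>+y. ennreal (cmod (G2 (x, y))) \<partial>lborel) \<partial>lborel)
        \<le> (\<integral>\<^sup>+x. (\<integral>\<^sup>+y. ennreal (2 powr (s + 1)) * (ennreal (w x * j (x - y) * w y) + ennreal (w x * w (x - y) * j y)) \<partial>lborel) \<partial>lborel)"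
      proof (intro nn_integral_mono)
        fix x y
        have "cmod (G2 (x, y)) = \<bar>d x y\<bar> * cmod (H (x, y))" by (simp add: G2_def norm_mult)
        also have "\<bar>d x y\<bar> = wt s M x * (wt s M x * (\<alpha>\<^sup>2 / 2 * \<bar>x\<bar> * hm \<alpha> x * (\<bar>x - y\<bar> * \<bar>y\<bar>)))"
          by (simp add: d_def abs_mult power2_eq_square)
        also have "\<dots> * cmod (H (x, y)) \<le> wt s M x * (2 powr (s + 1) * (wt s M y * jb (x - y) + wt s M (x - y) * jb y)) * cmod (H (x, y))"
          using a by (intro mult_right_mono mult_left_mono nonlocal_symbol_bound s1) auto
        also have "\<dots> = 2 powr (s + 1) * (w x * j (x - y) * w y + w x * w (x - y) * j y)"
          by (simp add: H_def cmod_tri w_def j_def algebra_simps)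
        finally have "ennreal (cmod (G2 (x, y))) \<le> ennreal (2 powr (s + 1) * (w x * j (x - y) * w y + w x * w (x - y) * j y))"
          by (rule ennreal_leI)
        then show "ennreal (cmod (G2 (x, y))) \<le> ennreal (2 powr (s + 1)) * (ennreal (w x * j (x - y) * w y) + ennreal (w x * w (x - y) * j y))"
          using pos by (simp add: ennreal_mult)
      qed
      also have "\<dots> = ennreal (2 powr (s + 1)) * ((\<integral>\<^sup>+x. (\<integral>\<^sup>+y. ennreal (w x * j (x - y) * w y) \<partial>lborel) \<partial>lborel)
          + (\<integral>\<^sup>+x. (\<integral>\<^sup>+y. ennreal (w x * w (x - y) * j y) \<partial>lborel) \<partial>lborel))"
        by (simp add: nn_integral_cmult nn_integral_add)
      also have "\<dots> \<le> ennreal (2 powr (s + 1)) * (ennreal (n * k * n) + ennreal (n * n * k))"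
        by (intro mult_left_mono add_mono T1 T2) auto
      also have "\<dots> = ennreal L"
      proof -
        have "ennreal c * (ennreal u + ennreal v) = ennreal (c * (u + v))" if "0 \<le> c" "0 \<le> u" "0 \<le> v" for c u v
          using that by (simp add: ennreal_mult)
        then show ?thesis unfolding L_def using nn by (auto simp only: mult_nonneg_nonneg powr_ge_zero)
      qed
      finally show ?thesis .
    qed
    note G2 = pair_integrable[OF G2m L0 G2b]
    define K where "K = C * (n * k * n + n * n * k + k * n * n)"
    have K0: "0 \<le> K" using nn C by (simp add: K_def)
    have Kb: "(\<integral>\<^sup>+x. (\<integral>\<^sup>+y. ennreal (\<bar>y * e x - x * e y\<bar> * cmod (H (x, y))) \<partial>lborel) \<partial>lborel) \<le> ennreal K"
    proof -
      have "(\<integral>\<^sup>+x. (\<integral>\<^sup>+y. ennreal (\<bar>y * e x - x * e y\<bar> * cmod (H (x, y))) \<partial>lborel) \<partial>lborel)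
        \<le> (\<integral>\<^sup>+x. (\<integral>\<^sup>+y. ennreal C * (ennreal (w x * j (x - y) * w y) + ennreal (w x * w (x - y) * j y) + ennreal (j x * w (x - y) * w y)) \<partial>lborel) \<partial>lborel)"
      proof (intro nn_integral_mono)
        fix x y
        have "\<bar>y * e x - x * e y\<bar> * cmod (H (x, y)) \<le> C * (wt s M x * wt s M y * jb (x - y)
          + wt s M x * wt s M (x - y) * jb y + wt s M y * wt s M (x - y) * jb x) * cmod (H (x, y))"
          unfolding e_def using a by (intro mult_right_mono C) auto
        also have "\<dots> = C * (w x * j (x - y) * w y + w x * w (x - y) * j y + j x * w (x - y) * w y)"
          by (simp add: H_def cmod_tri w_def j_def algebra_simps)
        finally have "ennreal (\<bar>y * e x - x * e y\<bar> * cmod (H (x, y))) \<le> ennreal (C * (w x * j (x - y) * w y + w x * w (x - y) * j y + j x * w (x - y) * w y))"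
          by (rule ennreal_leI)
        then show "ennreal (\<bar>y * e x - x * e y\<bar> * cmod (H (x, y))) \<le> ennreal C * (ennreal (w x * j (x - y) * w y) + ennreal (w x * w (x - y) * j y) + ennreal (j x * w (x - y) * w y))"
          using pos C by (simp add: ennreal_mult)
      qed
      also have "\<dots> = ennreal C * ((\<integral>\<^sup>+x. (\<integral>\<^sup>+y. ennreal (w x * j (x - y) * w y) \<partial>lborel) \<partial>lborel)
          + (\<integral>\<^sup>+x. (\<integral>\<^sup>+y. ennreal (w x * w (x - y) * j y) \<partial>lborel) \<partial>lborel)
          + (\<integral>\<^sup>+x. (\<integral>\<^sup>+y. ennreal (j x * w (x - y) * w y) \<partial>lborel) \<partial>lborel))"
        by (simp add: nn_integral_cmult nn_integral_add)
      also have "\<dots> \<le> ennreal C * (ennreal (n * k * n) + ennreal (n * n * k) + ennreal (k * n * n))"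
        by (intro mult_left_mono add_mono T1 T2 T3) auto
      also have "\<dots> = ennreal K"
      proof -
        have "ennreal c * (ennreal u + ennreal v + ennreal w) = ennreal (c * (u + v + w))"
          if "0 \<le> c" "0 \<le> u" "0 \<le> v" "0 \<le> w" for c u v w
          using that by (simp add: ennreal_mult)
        then show ?thesis unfolding K_def using nn C(1) by (auto simp only: mult_nonneg_nonneg)
      qed
      finally show ?thesis .
    qed
    have S1: "Re (LINT p|?P. - \<i> * (complex_of_real (snd p * e (fst p)) * H p)) \<le> K / 2"
    proof (rule skew_symmetrization[where c = "\<lambda>x y. y * e x", OF _ _ iy _ K0 Kb])
      show "H (y, x) = cnj (H (x, y))" for x y unfolding H_def by (rule tri_swap[OF hU])
    qed measurable
    \<comment> \<open>H is invariant under y -> x - y, so x may be replaced by 2 y. The symbol x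
      e(x) would put a derivative on top of two weights at x; when y is small, x - y can take one
      weight, but x keeps the other together with the derivative. In y e(x) the derivative falls on
      the third factor.\<close>
    have half: "(LINT p|?P. complex_of_real (fst p * e (fst p)) * H p) = 2 * (LINT p|?P. complex_of_real (snd p * e (fst p)) * H p)"
    proof -
      have "(LINT p|?P. complex_of_real (fst p * e (fst p)) * H p)
          = (LINT x|lborel. LINT y|lborel. complex_of_real (x * e x) * H (x, y))"
        using iterated_eq_pair_integral[OF ix] by simp
      also have "\<dots> = (LINT x|lborel. 2 * (LINT y|lborel. complex_of_real (y * e x) * H (x, y)))"
      proof (rule integral_cong_AE)
        have my: "(\<lambda>p. complex_of_real (snd p * e (fst p)) * H p) \<in> borel_measurable (borel \<Otimes>\<^sub>M lborel)"
          "(\<lambda>p. complex_of_real (fst p * e (fst p)) * H p) \<in> borel_measurable (borel \<Otimes>\<^sub>M lborel)" by measurable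
        show "(\<lambda>x. LINT y|lborel. complex_of_real (x * e x) * H (x, y)) \<in> borel_measurable lborel"
          using my(2) by (intro lborel.borel_measurable_lebesgue_integral) (simp add: split_beta')
        have "(\<lambda>x. LINT y|lborel. complex_of_real (y * e x) * H (x, y)) \<in> borel_measurable lborel"
          using my(1) by (intro lborel.borel_measurable_lebesgue_integral) (simp add: split_beta')
        then show "(\<lambda>x. 2 * (LINT y|lborel. complex_of_real (y * e x) * H (x, y))) \<in> borel_measurable lborel" by simp
        show "AE x in lborel. (LINT y|lborel. complex_of_real (x * e x) * H (x, y)) = 2 * (LINT y|lborel. complex_of_real (y * e x) * H (x, y))"
          using lborel_pair.AE_integrable_fst'[OF iy] lborel_pair.AE_integrable_fst'[OF ix]
        proof eventually_elim
          case (elim x)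
          then have i: "integrable lborel (\<lambda>y. complex_of_real (y * e x) * H (x, y))"
            "integrable lborel (\<lambda>y. complex_of_real (x * e x) * H (x, y))" by simp_all
          have "(LINT y|lborel. complex_of_real (y * e x) * H (x, y))
              = (LINT y|lborel. complex_of_real ((x - y) * e x) * H (x, x - y))"
            using lborel_integral_real_affine[of "-1" "\<lambda>y. complex_of_real (y * e x) * H (x, y)" x] by simp
          also have "\<dots> = (LINT y|lborel. complex_of_real (x * e x) * H (x, y) - complex_of_real (y * e x) * H (x, y))"
            by (simp add: Hs algebra_simps)
          also have "\<dots> = (LINT y|lborel. complex_of_real (x * e x) * H (x, y)) - (LINT y|lborel. complex_of_real (y * e x) * H (x, y))"
            using i by (intro Bochner_Integration.integral_diff)
          finally show ?case by simp
        qed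
      qed
      also have "\<dots> = 2 * (LINT p|?P. complex_of_real (snd p * e (fst p)) * H p)"
        using iterated_eq_pair_integral[OF iy] by simp
      finally show ?thesis .
    qed
    define G1 where "G1 p = - \<i> * (complex_of_real (fst p * e (fst p)) * H p)" for p
    have G1i: "integrable ?P G1" unfolding G1_def using ix by simp
    have "(LINT p|?P. G1 p) = 2 * (LINT p|?P. - \<i> * (complex_of_real (snd p * e (fst p)) * H p))"
      unfolding G1_def integral_mult_right_zero half by simp
    then have "Re (LINT p|?P. G1 p) \<le> K" using S1 by simp
    moreover have "Re (LINT p|?P. G2 p) \<le> L" using complex_Re_le_cmod[of "LINT p|?P. G2 p"] G2(3) by simp
    moreover have "(LINT x|lborel. cnj (complex_of_real (wt s M x) * U x) * (complex_of_real (wt s M x) * Bop \<alpha> U U x))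
        = (LINT x|lborel. LINT y|lborel. G1 (x, y) + G2 (x, y))"
    proof (intro Bochner_Integration.integral_cong refl)
      fix x
      have "cnj (complex_of_real (wt s M x) * U x) * (complex_of_real (wt s M x) * Bop \<alpha> U U x)
        = (complex_of_real ((wt s M x)\<^sup>2) * cnj (U x) * (- \<i> * complex_of_real x)) * Kop (kern \<alpha>) U U x"
        by (simp add: Bop_def power2_eq_square)
      also have "\<dots> = (LINT y|lborel. (complex_of_real ((wt s M x)\<^sup>2) * cnj (U x) * (- \<i> * complex_of_real x)) * (complex_of_real (kern \<alpha> x y) * U (x - y) * U y))"
        unfolding Kop_def by (rule integral_mult_right_zero[symmetric])
      also have "\<dots> = (LINT y|lborel. G1 (x, y) + G2 (x, y))"
        by (intro Bochner_Integration.integral_cong refl)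
          (simp add: G1_def G2_def e_def esym_def d_def H_def tri_def kern_def field_simps power2_eq_square)
      finally show "cnj (complex_of_real (wt s M x) * U x) * (complex_of_real (wt s M x) * Bop \<alpha> U U x)
        = (LINT y|lborel. G1 (x, y) + G2 (x, y))" .
    qed
    moreover have "(LINT x|lborel. LINT y|lborel. G1 (x, y) + G2 (x, y)) = (LINT p|?P. G1 p) + (LINT p|?P. G2 p)"
      using iterated_eq_pair_integral[OF Bochner_Integration.integrable_add[OF G1i G2(1)]] G1i G2(1) by simp
    ultimately have "Re (LINT x|lborel. cnj (complex_of_real (wt s M x) * U x) * (complex_of_real (wt s M x) * Bop \<alpha> U U x)) \<le> K + L"
      by simp
    also have "\<dots> = D * k * n\<^sup>2" by (simp add: K_def L_def D_def power2_eq_square algebra_simps)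
    finally show ?thesis by (simp add: k_def n_def)
  qed
  moreover have "0 \<le> D" using C by (simp add: D_def)
  ultimately show ?thesis by blast
qed

section \<open>Truncation, tails and compactness in the weighted spaces\<close>

definition proj :: "real \<Rightarrow> (real \<Rightarrow> complex) \<Rightarrow> real \<Rightarrow> complex" where
  "proj N U x = (if \<bar>x\<bar> \<le> N then U x else 0)"

lemma proj_measurable [measurable (raw)]: "U \<in> borel_measurable borel \<Longrightarrow> proj N U \<in> borel_measurable borel"
proof -
  assume [measurable]: "U \<in> borel_measurable borel"
  have "proj N U = (\<lambda>x. indicator {-N..N} x *\<^sub>R U x)"
  proof
    fix x show "proj N U x = indicator {-N..N} x *\<^sub>R U x"
      by (cases "\<bar>x\<bar> \<le> N") (auto simp: proj_def indicator_def abs_le_iff)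
  qed
  then show ?thesis by simp
qed

lemma cmod_proj_le: "cmod (proj N U x) \<le> cmod (U x)"
  by (simp add: proj_def)

lemma wsq_proj:
  assumes "wsq p U" "p \<in> borel_measurable borel"
  shows "wsq p (proj N U)" "wn p (proj N U) \<le> wn p U"
proof -
  have "\<bar>p x\<bar> * cmod (proj N U x) \<le> \<bar>p x\<bar> * cmod (U x)" for x
    by (intro mult_left_mono cmod_proj_le) auto
  from wsq_mono1[OF assms(1,2) proj_measurable[OF wsq_measurable[OF assms(1)]] this]
  show "wsq p (proj N U)" "wn p (proj N U) \<le> wn p U" by auto
qed

lemma wsq_proj_transfer:
  assumes U: "wsq p U" and q: "q \<in> borel_measurable borel" and C: "0 \<le> C"
    and le: "\<And>x. \<bar>x\<bar> \<le> N \<Longrightarrow> \<bar>q x\<bar> \<le> C * \<bar>p x\<bar>"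
  shows "wsq q (proj N U)" "wn q (proj N U) \<le> C * wn p U"
proof -
  have "\<bar>q x\<bar> * cmod (proj N U x) \<le> C * (\<bar>p x\<bar> * cmod (U x))" for x
    using mult_right_mono[OF le[of x], of "cmod (U x)"] C by (auto simp: proj_def mult.assoc)
  from wsq_mono[OF U q proj_measurable[OF wsq_measurable[OF U]] C this]
  show "wsq q (proj N U)" "wn q (proj N U) \<le> C * wn p U" by auto
qed

lemma band_proj [simp]: "band N (proj N U)"
  by (simp add: band_def proj_def)

lemma herm_proj: "herm U \<Longrightarrow> herm (proj N U)"
  by (simp add: herm_def proj_def)

lemma wt_tail_compare:
  assumes "0 \<le> M" "M < jb x"
  shows "wt r 0 x \<le> 2 * wt r M x"
proof -
  have "1/2 \<le> jb x / (jb x + M)" using assms by (simp add: divide_simps)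
  then have "1/4 \<le> jb x / (jb x + M)" by linarith
  then have "sqrt (1/4) \<le> sqrt (jb x / (jb x + M))" by (rule real_sqrt_le_mono)
  moreover have "sqrt (1/4) = 1/2" by (rule real_sqrt_unique) (simp_all add: power2_eq_square)
  ultimately have "1 \<le> 2 * sqrt (jb x / (jb x + M))" by simp
  then have "jb x powr r * 1 \<le> jb x powr r * (2 * sqrt (jb x / (jb x + M)))" by (intro mult_left_mono) auto
  then show ?thesis by (simp only: wt_0) (simp add: wt_def gw_def)
qed

text \<open>Compares the sharp cut-off with the smooth tail weight at the same level: beyond N the
  quotient under its root is at least 1/2.\<close>

lemma tail_le:
  assumes U: "inH r U" and N: "0 \<le> N"
  shows "inH r (\<lambda>x. U x - proj N U x)" "hn r (\<lambda>x. U x - proj N U x) \<le> 2 * wn (wt r N) U"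
proof -
  have m: "(\<lambda>x. U x - proj N U x) \<in> borel_measurable borel"
    using wsq_measurable[OF U] by measurable
  have "\<bar>wt r 0 x\<bar> * cmod (U x - proj N U x) \<le> 2 * (\<bar>wt r N x\<bar> * cmod (U x))" for x
  proof (cases "\<bar>x\<bar> \<le> N")
    case False
    then have "N < jb x" using abs_le_jb[of x] by simp
    from mult_right_mono[OF wt_tail_compare[OF N this, of r], of "cmod (U x)"] False N
    show ?thesis by (simp add: proj_def)
  qed (simp add: proj_def)
  from wsq_mono[OF inH_tail(1)[OF U N] wt_measurable m _ this]
  show "inH r (\<lambda>x. U x - proj N U x)" "hn r (\<lambda>x. U x - proj N U x) \<le> 2 * wn (wt r N) U" by auto
qed

lemma inH_reflect_cnj:
  assumes "inH r U"
  shows "inH r (\<lambda>x. cnj (U (- x)))" "hn r (\<lambda>x. cnj (U (- x))) = hn r U"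
proof -
  have [measurable]: "U \<in> borel_measurable borel" using assms by (rule wsq_measurable)
  have m0: "(\<lambda>x. U (- x)) \<in> borel_measurable borel" by measurable
  have m: "(\<lambda>x. cnj (U (- x))) \<in> borel_measurable borel"
    by (intro borel_measurable_continuous_on[OF _ m0] continuous_intros)
  define F where "F x = (cmod (complex_of_real (wt r 0 x) * U x))\<^sup>2" for x
  have F: "(cmod (complex_of_real (wt r 0 x) * cnj (U (- x))))\<^sup>2 = F (0 + - 1 * x)" for x
    by (simp add: F_def norm_mult)
  have i: "integrable lborel F" using wsq_sqint[OF assms] unfolding F_def sqint_def by simp
  show "inH r (\<lambda>x. cnj (U (- x)))"
    unfolding wsq_def sqint_def F using m lborel_integrable_real_affine[OF i, of "-1" 0]
    by (intro conjI borel_measurable_times) auto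
  show "hn r (\<lambda>x. cnj (U (- x))) = hn r U"
    unfolding wn_def n2_def F using lborel_integral_real_affine[of "-1" F 0] by (simp add: F_def)
qed

text \<open>A norm limit is hermitian only almost everywhere. Averaging with the reflected conjugate
  restores the identity at every point and does not increase the distance to the hermitian
  approximants.\<close>

lemma inH_complete_herm:
  assumes V: "\<And>n. inH r (V n)" "\<And>n. herm (V n)"
    and cauchy: "\<And>e. e > 0 \<Longrightarrow> \<exists>N. \<forall>m\<ge>N. \<forall>n\<ge>N. hn r (\<lambda>x. V m x - V n x) < e"
  shows "\<exists>U. inH r U \<and> herm U \<and> (\<lambda>n. hn r (\<lambda>x. V n x - U x)) \<longlonglongrightarrow> 0"
proof -
  let ?f = "\<lambda>n x. complex_of_real (wt r 0 x) * V n x"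
  have w0: "wt r 0 x \<noteq> 0" for x by (simp add: wt_0 order_less_imp_not_eq2)
  have "\<exists>g. sqint g \<and> (\<lambda>n. n2 (\<lambda>x. ?f n x - g x)) \<longlonglongrightarrow> 0"
  proof (rule sqint_complete)
    show "sqint (?f n)" for n by (rule wsq_sqint[OF V(1)])
    show "\<exists>N. \<forall>m\<ge>N. \<forall>n\<ge>N. n2 (\<lambda>x. ?f m x - ?f n x) < e" if "e > 0" for e
      using cauchy[OF that] by (simp add: wn_def right_diff_distrib)
  qed
  then obtain g where g: "sqint g" "(\<lambda>n. n2 (\<lambda>x. ?f n x - g x)) \<longlonglongrightarrow> 0" by blast
  define U1 where "U1 x = g x / complex_of_real (wt r 0 x)" for x
  have [measurable]: "g \<in> borel_measurable borel" using g(1) by (rule sqint_measurable)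
  have gU: "g = (\<lambda>x. complex_of_real (wt r 0 x) * U1 x)" using w0 by (simp add: U1_def)
  have "U1 \<in> borel_measurable borel" unfolding U1_def by measurable
  then have U1: "inH r U1" using g(1) unfolding gU wsq_def by simp
  have l1: "(\<lambda>n. hn r (\<lambda>x. V n x - U1 x)) \<longlonglongrightarrow> 0"
    using g(2) unfolding gU by (simp add: wn_def right_diff_distrib)
  note U2 = inH_reflect_cnj(1)[OF U1]
  define U where "U x = (1/2) * (U1 x + cnj (U1 (- x)))" for x
  have U: "inH r U" unfolding U_def by (intro wsq_cmult wsq_add U1 U2)
  have "herm U" unfolding herm_def U_def by (simp add: add.commute)
  moreover have "hn r (\<lambda>x. V n x - U x) \<le> hn r (\<lambda>x. V n x - U1 x)" for n
  proof -
    have d: "inH r (\<lambda>x. V n x - U1 x)" by (rule wsq_diff(1)[OF V(1) U1])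
    have e: "V n x - U x = (1/2) * ((V n x - U1 x) + cnj (V n (- x) - U1 (- x)))" for x
      using hermD[OF V(2), of n x] by (simp add: U_def field_simps)
    have "hn r (\<lambda>x. V n x - U x) = 1/2 * hn r (\<lambda>x. (V n x - U1 x) + cnj (V n (- x) - U1 (- x)))"
      unfolding e using wsq_cmult(2)[OF wsq_add(1)[OF d inH_reflect_cnj(1)[OF d]], of "1/2"] by simp
    also have "\<dots> \<le> 1/2 * (hn r (\<lambda>x. V n x - U1 x) + hn r (\<lambda>x. V n x - U1 x))"
      using wsq_add(2)[OF d inH_reflect_cnj(1)[OF d]] inH_reflect_cnj(2)[OF d] by (intro mult_left_mono) auto
    finally show ?thesis by simp
  qed
  then have "(\<lambda>n. hn r (\<lambda>x. V n x - U x)) \<longlonglongrightarrow> 0"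
    by (intro tendsto_sandwich[OF _ _ tendsto_const l1]) auto
  ultimately show ?thesis using U by blast
qed

text \<open>A bound in the strong weight survives convergence in the weak norm. On a bounded band
  the strong weight is dominated by a multiple of the weak one, which gives the bound for every
  truncation; Fatou's lemma removes the truncation.\<close>

lemma wn_lower_semicontinuous:
  assumes U: "inH (1/2) U" and V: "\<And>n. inH s (V n)" and M: "0 \<le> M" and s: "1/2 \<le> s" and c: "0 \<le> c"
    and lim: "(\<lambda>n. hn (1/2) (\<lambda>x. V n x - U x)) \<longlonglongrightarrow> 0"
    and b: "\<And>n. wn (wt s M) (V n) \<le> c"
  shows "wsq (wt s M) U" "wn (wt s M) U \<le> c"
proof -
  have [measurable]: "U \<in> borel_measurable borel" using U by (rule wsq_measurable)
  have VM: "wsq (wt s M) (V n)" for n by (rule inH_tail(1)[OF V M])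
  have Vh: "inH (1/2) (V n)" for n by (rule inH_mono(1)[OF V s])
  have tr: "wsq (wt s M) (proj L U) \<and> wn (wt s M) (proj L U) \<le> c" for L
  proof -
    define C where "C = wt s 0 L"
    have C0: "0 \<le> C" by (simp add: C_def)
    have cmp: "\<bar>wt s M x\<bar> \<le> C * \<bar>wt (1/2) 0 x\<bar>" if "\<bar>x\<bar> \<le> L" for x
    proof -
      have "wt s M x \<le> wt s 0 x" by (rule wt_le_0[OF M])
      also have "\<dots> \<le> C * 1" unfolding C_def wt_def using s that by (simp, intro gw_mono jb_mono) auto
      also have "\<dots> \<le> C * wt (1/2) 0 x"
        using C0 by (intro mult_left_mono) (auto simp: wt_0 ge_one_powr_ge_zero)
      finally show ?thesis using M by simp
    qed
    note tU = wsq_proj_transfer[OF U wt_measurable C0 cmp]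
    have "wn (wt s M) (proj L U) \<le> c + C * hn (1/2) (\<lambda>x. V n x - U x)" for n
    proof -
      note pV = wsq_proj[OF VM[of n] wt_measurable, of L]
      have "wn (wt s M) (proj L U) \<le> wn (wt s M) (proj L (V n)) + wn (wt s M) (\<lambda>x. proj L U x - proj L (V n) x)"
        by (rule wn_le_diff[OF tU(1) pV(1)])
      also have "(\<lambda>x. proj L U x - proj L (V n) x) = proj L (\<lambda>x. U x - V n x)" by (auto simp: proj_def)
      also have "wn (wt s M) (proj L (\<lambda>x. U x - V n x)) \<le> C * hn (1/2) (\<lambda>x. U x - V n x)"
        by (rule wsq_proj_transfer(2)[OF wsq_diff(1)[OF U Vh] wt_measurable C0 cmp])
      also have "hn (1/2) (\<lambda>x. U x - V n x) = hn (1/2) (\<lambda>x. V n x - U x)" by (rule wn_minus_commute)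
      finally show ?thesis using pV(2) b[of n] by simp
    qed
    moreover have "(\<lambda>n. c + C * hn (1/2) (\<lambda>x. V n x - U x)) \<longlonglongrightarrow> c + C * 0"
      by (intro tendsto_intros lim)
    ultimately have "wn (wt s M) (proj L U) \<le> c" by (intro LIMSEQ_le_const) auto
    then show ?thesis using tU(1) by blast
  qed
  define f where "f k x = ennreal ((cmod (complex_of_real (wt s M x) * proj (real k) U x))\<^sup>2)" for k :: nat and x
  have [measurable]: "f k \<in> borel_measurable borel" for k unfolding f_def by measurable
  have "(\<integral>\<^sup>+x. ennreal ((cmod (complex_of_real (wt s M x) * U x))\<^sup>2) \<partial>lborel) = (\<integral>\<^sup>+x. liminf (\<lambda>k. f k x) \<partial>lborel)"
  proof (intro nn_integral_cong)
    fix x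
    obtain k0 :: nat where k0: "\<bar>x\<bar> \<le> real k0" using real_arch_simple by blast
    have "eventually (\<lambda>k. f k x = ennreal ((cmod (complex_of_real (wt s M x) * U x))\<^sup>2)) sequentially"
      using eventually_ge_at_top[of k0] by eventually_elim (use k0 in \<open>auto simp: f_def proj_def\<close>)
    then have "(\<lambda>k. f k x) \<longlonglongrightarrow> ennreal ((cmod (complex_of_real (wt s M x) * U x))\<^sup>2)"
      by (rule tendsto_eventually)
    then show "ennreal ((cmod (complex_of_real (wt s M x) * U x))\<^sup>2) = liminf (\<lambda>k. f k x)"
      by (intro lim_imp_Liminf[symmetric] sequentially_bot)
  qed
  also have "\<dots> \<le> liminf (\<lambda>k. \<integral>\<^sup>+x. f k x \<partial>lborel)" by (rule nn_integral_liminf) auto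
  also have "\<dots> \<le> ennreal (c\<^sup>2)"
  proof (rule Liminf_le)
    show "\<forall>\<^sub>F k in sequentially. (\<integral>\<^sup>+x. f k x \<partial>lborel) \<le> ennreal (c\<^sup>2)"
    proof (intro always_eventually allI)
      fix k
      have "(\<integral>\<^sup>+x. f k x \<partial>lborel) = ennreal ((wn (wt s M) (proj (real k) U))\<^sup>2)"
        unfolding f_def wn_def using tr[of "real k"] by (intro sqint_nn_integral wsq_sqint) auto
      also have "\<dots> \<le> ennreal (c\<^sup>2)" using tr[of "real k"] by (intro ennreal_leI power_mono) auto
      finally show "(\<integral>\<^sup>+x. f k x \<partial>lborel) \<le> ennreal (c\<^sup>2)" .
    qed
  qed auto
  finally have *: "(\<integral>\<^sup>+x. ennreal ((cmod (complex_of_real (wt s M x) * U x))\<^sup>2) \<partial>lborel) \<le> ennreal (c\<^sup>2)" .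
  have m: "(\<lambda>x. complex_of_real (wt s M x) * U x) \<in> borel_measurable borel" by measurable
  show "wsq (wt s M) U" "wn (wt s M) U \<le> c"
    using sqint_boundI[OF m c *] by (auto simp: wsq_def wn_def)
qed

text \<open>Frequencies with bracket at most M cost a factor M^s over H^(1/2); the tail weight at M
  controls the remaining ones.\<close>

lemma interpolation:
  assumes W: "inH s W" and M: "1 \<le> M" and s: "1/2 \<le> s"
  shows "hn s W \<le> M powr s * hn (1/2) W + 2 * wn (wt s M) W"
proof -
  have [measurable]: "W \<in> borel_measurable borel" using W by (rule wsq_measurable)
  have Wh: "inH (1/2) W" by (rule inH_mono(1)[OF W s])
  define A where "A x = (if jb x \<le> M then W x else 0)" for x
  define B where "B x = (if jb x \<le> M then 0 else W x)" for x
  have [measurable]: "A \<in> borel_measurable borel" "B \<in> borel_measurable borel"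
    unfolding A_def B_def by measurable
  have cA: "\<bar>wt s 0 x\<bar> * cmod (A x) \<le> M powr s * (\<bar>wt (1/2) 0 x\<bar> * cmod (W x))" for x
  proof (cases "jb x \<le> M")
    case True
    have "jb x powr s \<le> M powr s" using True s by (intro powr_mono2) auto
    then have "jb x powr s * 1 \<le> M powr s * jb x powr (1/2)"
      by (intro mult_mono) (auto simp: ge_one_powr_ge_zero)
    from mult_right_mono[OF this, of "cmod (W x)"] show ?thesis using True by (simp add: A_def wt_0 mult.assoc)
  qed (simp add: A_def)
  have cB: "\<bar>wt s 0 x\<bar> * cmod (B x) \<le> 2 * (\<bar>wt s M x\<bar> * cmod (W x))" for x
  proof (cases "jb x \<le> M")
    case False
    from mult_right_mono[OF wt_tail_compare[of M x s], of "cmod (W x)"] False M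
    show ?thesis by (simp add: B_def)
  qed (simp add: B_def)
  have A: "inH s A" "hn s A \<le> M powr s * hn (1/2) W"
    using wsq_mono[OF Wh wt_measurable _ _ cA] by auto
  have B: "inH s B" "hn s B \<le> 2 * wn (wt s M) W"
    using wsq_mono[OF inH_tail(1)[OF W] wt_measurable _ _ cB] M by auto
  have "W = (\<lambda>x. A x + B x)" by (auto simp: A_def B_def)
  then have "hn s W \<le> hn s A + hn s B" using wsq_add(2)[OF A(1) B(1)] by simp
  then show ?thesis using A(2) B(2) by simp
qed

lemma tail_tendsto_0:
  assumes U: "inH s U"
  shows "(\<lambda>n. wn (wt s (real n)) U) \<longlonglongrightarrow> 0"
proof -
  have [measurable]: "U \<in> borel_measurable borel" using U by (rule wsq_measurable)
  have "(\<lambda>n. LINT x|lborel. (cmod (complex_of_real (wt s (real n) x) * U x))\<^sup>2) \<longlonglongrightarrow> (LINT x::real|lborel. (0::real))"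
  proof (rule integral_dominated_convergence[where w = "\<lambda>x. (cmod (complex_of_real (wt s 0 x) * U x))\<^sup>2"])
    show "integrable lborel (\<lambda>x. (cmod (complex_of_real (wt s 0 x) * U x))\<^sup>2)"
      using wsq_sqint[OF U] by (simp add: sqint_def)
    show "AE x in lborel. (\<lambda>n. (cmod (complex_of_real (wt s (real n) x) * U x))\<^sup>2) \<longlonglongrightarrow> 0"
    proof (rule AE_I2)
      fix x
      have "(\<lambda>n. jb x / (jb x + real n)) \<longlonglongrightarrow> 0"
        by (intro tendsto_divide_0[OF tendsto_const] filterlim_at_top_imp_at_infinity
          filterlim_tendsto_add_at_top[OF tendsto_const filterlim_real_sequentially])
      then have "(\<lambda>n. (jb x powr s)\<^sup>2 * (jb x / (jb x + real n)) * (cmod (U x))\<^sup>2) \<longlonglongrightarrow> (jb x powr s)\<^sup>2 * 0 * (cmod (U x))\<^sup>2"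
        by (intro tendsto_intros)
      then show "(\<lambda>n. (cmod (complex_of_real (wt s (real n) x) * U x))\<^sup>2) \<longlonglongrightarrow> 0"
        by (simp add: norm_mult power_mult_distrib wt_def gw_def)
    qed
    show "AE x in lborel. norm ((cmod (complex_of_real (wt s (real n) x) * U x))\<^sup>2) \<le> (cmod (complex_of_real (wt s 0 x) * U x))\<^sup>2" for n
      using wt_le_0[of "real n" s] by (intro AE_I2) (auto simp: norm_mult intro!: power_mono mult_right_mono)
  qed measurable
  from tendsto_real_sqrt[OF this] show ?thesis by (simp add: wn_def n2_def)
qed

text \<open>A substitute for compactness: the tails of all admissible W are dominated by those of
  one fixed U0, so the cut-off is chosen before W. The factor 4 admits a difference of two curves
  whose tails are each at most twice that of the datum.\<close>

lemma small_if_tail_controlled: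
  assumes U0: "inH s U0" and s: "1/2 \<le> s" and e: "0 < e"
  shows "\<exists>d>0. \<forall>W. inH s W \<longrightarrow> (\<forall>M\<ge>0. wn (wt s M) W \<le> 4 * wn (wt s M) U0) \<longrightarrow> hn (1/2) W \<le> d \<longrightarrow> hn s W \<le> e"
proof -
  \<comment> \<open>The tail part of the interpolation will contribute 2 times 4 times e/16, half of
    e.\<close>
  obtain n where n: "\<And>m. m \<ge> n \<Longrightarrow> wn (wt s (real m)) U0 < e / 16"
    using LIMSEQ_D[OF tail_tendsto_0[OF U0], of "e/16"] e by auto
  define M where "M = real (max n 1)"
  have M: "1 \<le> M" by (simp add: M_def)
  define d where "d = e / 2 / M powr s"
  have "d > 0" using e M by (simp add: d_def)
  moreover have "hn s W \<le> e" if W: "inH s W" "\<And>M. M \<ge> 0 \<Longrightarrow> wn (wt s M) W \<le> 4 * wn (wt s M) U0" "hn (1/2) W \<le> d" for W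
  proof -
    have "hn s W \<le> M powr s * hn (1/2) W + 2 * wn (wt s M) W" by (rule interpolation[OF W(1) M s])
    also have "\<dots> \<le> M powr s * d + 2 * (4 * (e / 16))"
    proof (intro add_mono mult_left_mono)
      have "wn (wt s M) W \<le> 4 * wn (wt s M) U0" using M by (intro W(2)) simp
      also have "\<dots> \<le> 4 * (e / 16)" using n[of "max n 1"] by (simp add: M_def)
      finally show "wn (wt s M) W \<le> 4 * (e / 16)" .
    qed (use W(3) in auto)
    also have "M powr s * d = e / 2" using M by (simp add: d_def)
    finally show ?thesis by simp
  qed
  ultimately show ?thesis by blast
qed

section \<open>Stability of approximate solutions\<close>

text \<open>The residual is measured in H^(1/2), where differences are compared. Only a right
  derivative is demanded, because Euler interpolants have corners at the grid points.\<close>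

definition approx_sol ::
    "real \<Rightarrow> real \<Rightarrow> real \<Rightarrow> real \<Rightarrow> real \<Rightarrow> (real \<Rightarrow> real \<Rightarrow> complex) \<Rightarrow> (real \<Rightarrow> real \<Rightarrow> complex) \<Rightarrow> bool" where
  "approx_sol \<alpha> s T R \<epsilon> V D \<longleftrightarrow>
     (\<forall>t\<in>{0..T}. inH s (V t) \<and> herm (V t) \<and> hn s (V t) \<le> R \<and>
        ((\<lambda>r. hn (1/2) (\<lambda>x. V r x - V t x)) \<longlongrightarrow> 0) (at t within {0..T})) \<and>
     (\<forall>t\<in>{0..<T}. inH (1/2) (D t) \<and> hn (1/2) (\<lambda>x. D t x - Bop \<alpha> (V t) (V t) x) \<le> \<epsilon> \<and>
        ((\<lambda>h. hn (1/2) (\<lambda>x. (V (t + h) x - V t x) / complex_of_real h - D t x)) \<longlongrightarrow> 0) (at_right 0))"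

lemma wn_abs_diff_le:
  assumes "wsq p U" "wsq p V"
  shows "\<bar>wn p U - wn p V\<bar> \<le> wn p (\<lambda>x. U x - V x)"
  using wn_le_diff[OF assms] wn_le_diff[OF assms(2,1)] wn_minus_commute[of p U V] by linarith

text \<open>Up to residuals the difference W solves a linear equation with coefficient V1 + V2, so
  \<open>difference_estimate\<close> yields a Gronwall inequality for its squared norm, with the
  residuals as source.\<close>

lemma stability:
  assumes a: "0 \<le> \<alpha>" "\<alpha> \<le> 1" and s: "3/2 < s"
    and A1: "approx_sol \<alpha> s T R1 \<epsilon>1 V1 D1" and A2: "approx_sol \<alpha> s T R2 \<epsilon>2 V2 D2"
    and e0: "0 \<le> \<epsilon>1" "0 \<le> \<epsilon>2" and t: "0 \<le> t" "t \<le> T"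
  shows "(hn (1/2) (\<lambda>x. V1 t x - V2 t x))\<^sup>2 \<le> exp (2 * cD s * (R1 + R2) * t) *
    ((hn (1/2) (\<lambda>x. V1 0 x - V2 0 x))\<^sup>2 + 2 * (\<epsilon>1 + \<epsilon>2) * (R1 + R2) * t)"
proof -
  have sh: "1/2 \<le> s" using s by simp
  define f where "f t = (hn (1/2) (\<lambda>x. V1 t x - V2 t x))\<^sup>2" for t
  define R where "R = R1 + R2"
  define \<epsilon> where "\<epsilon> = \<epsilon>1 + \<epsilon>2"
  have V: "inH s (V1 t)" "inH s (V2 t)" "herm (V1 t)" "herm (V2 t)" "hn s (V1 t) \<le> R1" "hn s (V2 t) \<le> R2"
    and Vh: "inH (1/2) (V1 t)" "inH (1/2) (V2 t)" if "0 \<le> t" "t \<le> T" for t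
    using A1 A2 that inH_mono(1)[OF _ sh] by (auto simp: approx_sol_def)
  have R0: "0 \<le> R1" "0 \<le> R2" using V(5,6)[OF t] by (auto intro: order_trans[OF wn_nonneg])
  then have R: "0 \<le> R" and \<epsilon>: "0 \<le> \<epsilon>" using e0 by (auto simp: R_def \<epsilon>_def)
  have "f t \<le> exp (2 * cD s * R * t) * (f 0 + 2 * \<epsilon> * R * t)"
  proof (rule Dini_Gronwall[where T = T])
    show "continuous_on {0..T} f"
      unfolding continuous_on_def
    proof
      fix t assume "t \<in> {0..T}"
      then have t: "0 \<le> t" "t \<le> T" by auto
      let ?F = "at t within {0..T}"
      let ?d = "\<lambda>r. hn (1/2) (\<lambda>x. V1 r x - V1 t x) + hn (1/2) (\<lambda>x. V2 r x - V2 t x)"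
      have l: "(?d \<longlongrightarrow> 0 + 0) ?F"
        using A1 A2 t by (intro tendsto_add) (auto simp: approx_sol_def)
      have "((\<lambda>r. hn (1/2) (\<lambda>x. V1 r x - V2 r x)) \<longlongrightarrow> hn (1/2) (\<lambda>x. V1 t x - V2 t x)) ?F"
      proof (rule Lim_transform[OF tendsto_const], rule tendsto_rabs_zero_cancel, rule tendsto_sandwich[OF _ _ tendsto_const l[simplified]])
        show "\<forall>\<^sub>F r in ?F. \<bar>hn (1/2) (\<lambda>x. V1 r x - V2 r x) - hn (1/2) (\<lambda>x. V1 t x - V2 t x)\<bar> \<le> ?d r"
          unfolding eventually_at_filter
        proof (intro always_eventually allI impI)
          fix r assume "r \<noteq> t" "r \<in> {0..T}"
          then have r: "0 \<le> r" "r \<le> T" by auto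
          have "\<bar>hn (1/2) (\<lambda>x. V1 r x - V2 r x) - hn (1/2) (\<lambda>x. V1 t x - V2 t x)\<bar>
            \<le> hn (1/2) (\<lambda>x. (V1 r x - V2 r x) - (V1 t x - V2 t x))"
            by (intro wn_abs_diff_le wsq_diff Vh r t)
          also have "(\<lambda>x. (V1 r x - V2 r x) - (V1 t x - V2 t x)) = (\<lambda>x. (V1 r x - V1 t x) - (V2 r x - V2 t x))"
            by (auto simp: algebra_simps)
          also have "hn (1/2) \<dots> \<le> ?d r" by (intro wsq_diff Vh r t)
          finally show "\<bar>hn (1/2) (\<lambda>x. V1 r x - V2 r x) - hn (1/2) (\<lambda>x. V1 t x - V2 t x)\<bar> \<le> ?d r" .
        qed
      qed auto
      then show "(f \<longlongrightarrow> f t) ?F" unfolding f_def by (intro tendsto_power)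
    qed
    show "0 \<le> 2 * cD s * R" "0 \<le> 2 * \<epsilon> * R" "0 \<le> f 0" using R \<epsilon> by (auto simp: f_def)
    show "f 0 \<le> f 0" ..
    fix t d :: real assume t: "0 \<le> t" "t < T" and d: "0 < d"
    note Vt = V[of t] and Vht = Vh[of t]
    define W where "W x = V1 t x - V2 t x" for x
    define S where "S x = V1 t x + V2 t x" for x
    define G where "G = Bop \<alpha> S W"
    define L where "L = hn (1/2) G"
    have W: "inH s W" and S: "inH s S" using Vt t unfolding W_def S_def by (auto intro: wsq_diff wsq_add)
    have Wh: "inH (1/2) W" by (rule inH_mono(1)[OF W sh])
    have hS: "herm S" using Vt t by (auto simp: herm_def S_def)
    have G: "inH (1/2) G" unfolding G_def using s by (intro inH_mono(1)[OF Bop_inH(1)[OF a s S W]]) auto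
    have Bh: "inH (1/2) (Bop \<alpha> (V1 t) (V1 t))" "inH (1/2) (Bop \<alpha> (V2 t) (V2 t))"
      using s t Vt by (auto intro!: inH_mono(1)[OF Bop_inH(1)[OF a s]])
    have D: "inH (1/2) (D1 t)" "inH (1/2) (D2 t)"
      "hn (1/2) (\<lambda>x. D1 t x - Bop \<alpha> (V1 t) (V1 t) x) \<le> \<epsilon>1" "hn (1/2) (\<lambda>x. D2 t x - Bop \<alpha> (V2 t) (V2 t) x) \<le> \<epsilon>2"
      "((\<lambda>h. hn (1/2) (\<lambda>x. (V1 (t + h) x - V1 t x) / complex_of_real h - D1 t x)) \<longlongrightarrow> 0) (at_right 0)"
      "((\<lambda>h. hn (1/2) (\<lambda>x. (V2 (t + h) x - V2 t x) / complex_of_real h - D2 t x)) \<longlongrightarrow> 0) (at_right 0)"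
      using A1 A2 t by (auto simp: approx_sol_def)
    define o' where "o' h = hn (1/2) (\<lambda>x. (V1 (t + h) x - V1 t x) / complex_of_real h - D1 t x)
      + hn (1/2) (\<lambda>x. (V2 (t + h) x - V2 t x) / complex_of_real h - D2 t x)" for h
    have o0: "(o' \<longlongrightarrow> 0) (at_right 0)" using tendsto_add[OF D(5,6)] by (simp add: o'_def[abs_def])
    \<comment> \<open>The terms of the expanded square, divided by h, that do not belong to the
      Gronwall factor. As h tends to 0 only 2 \<epsilon> R remains.\<close>
    define q where "q h = 2 * (\<epsilon> + o' h) * R + h * (L\<^sup>2 + 2 * (\<epsilon> + o' h) * L + (\<epsilon> + o' h)\<^sup>2)" for h
    have "(q \<longlongrightarrow> 2 * (\<epsilon> + 0) * R + 0 * (L\<^sup>2 + 2 * (\<epsilon> + 0) * L + (\<epsilon> + 0)\<^sup>2)) (at_right 0)"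
      unfolding q_def by (intro tendsto_intros o0)
    then have q: "\<forall>\<^sub>F h in at_right 0. q h < 2 * \<epsilon> * R + d"
      using d by (intro order_tendstoD(2)) auto
    have WR: "hn (1/2) W \<le> R"
    proof -
      have "hn (1/2) W \<le> hn s W" by (rule inH_mono(2)[OF W sh])
      also have "\<dots> \<le> hn s (V1 t) + hn s (V2 t)" unfolding W_def using Vt t by (intro wsq_diff) auto
      finally show ?thesis using Vt(5,6) t by (simp add: R_def)
    qed
    have SR: "hn s S \<le> R"
    proof -
      have "hn s S \<le> hn s (V1 t) + hn s (V2 t)" unfolding S_def using Vt t by (intro wsq_add) auto
      then show ?thesis using Vt(5,6) t by (simp add: R_def)
    qed
    have diff: "G x = Bop \<alpha> (V1 t) (V1 t) x - Bop \<alpha> (V2 t) (V2 t) x" for x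
      unfolding G_def S_def W_def using Vt(1,2) t s
      by (intro Bop_square_diff[symmetric] a) (auto intro: inH_mono(1)[of s _ 1])
    have step: "f (t + h) \<le> f t + h * (2 * cD s * R * f t + q h)" if h: "0 < h" "t + h < T" for h
    proof -
      define E1 where "E1 x = (V1 (t + h) x - V1 t x) / complex_of_real h - D1 t x" for x
      define E2 where "E2 x = (V2 (t + h) x - V2 t x) / complex_of_real h - D2 t x" for x
      define F1 where "F1 x = D1 t x - Bop \<alpha> (V1 t) (V1 t) x" for x
      define F2 where "F2 x = D2 t x - Bop \<alpha> (V2 t) (V2 t) x" for x
      define E where "E x = (E1 x - E2 x) + (F1 x - F2 x)" for x
      have Vhh: "inH (1/2) (V1 (t + h))" "inH (1/2) (V2 (t + h))" using Vh[of "t + h"] t h by auto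
      have E12: "inH (1/2) E1" "inH (1/2) E2"
      proof -
        have "inH (1/2) (\<lambda>x. inverse (complex_of_real h) * (V (t + h) x - V t x) - D t x)"
          if "inH (1/2) (V (t + h))" "inH (1/2) (V t)" "inH (1/2) (D t)" for V D :: "real \<Rightarrow> real \<Rightarrow> complex"
          by (intro wsq_diff wsq_cmult that)
        moreover have "E1 = (\<lambda>x. inverse (complex_of_real h) * (V1 (t + h) x - V1 t x) - D1 t x)"
          "E2 = (\<lambda>x. inverse (complex_of_real h) * (V2 (t + h) x - V2 t x) - D2 t x)"
          by (auto simp: E1_def E2_def divide_inverse mult.commute)
        ultimately show "inH (1/2) E1" "inH (1/2) E2"
          using Vhh Vht[of] t D(1,2) by (simp_all only: less_imp_le)
      qed
      have F12: "inH (1/2) F1" "inH (1/2) F2" unfolding F1_def F2_def using D Bh by (auto intro: wsq_diff)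
      have E: "inH (1/2) E" unfolding E_def by (intro wsq_add wsq_diff E12 F12)
      have "hn (1/2) E \<le> hn (1/2) (\<lambda>x. E1 x - E2 x) + hn (1/2) (\<lambda>x. F1 x - F2 x)"
        unfolding E_def by (intro wsq_add wsq_diff E12 F12)
      also have "\<dots> \<le> (hn (1/2) E1 + hn (1/2) E2) + (hn (1/2) F1 + hn (1/2) F2)"
        by (intro add_mono wsq_diff E12 F12)
      also have "\<dots> \<le> \<epsilon> + o' h"
        using D(3,4) unfolding o'_def \<epsilon>_def E1_def E2_def F1_def F2_def by simp
      finally have nE: "hn (1/2) E \<le> \<epsilon> + o' h" .
      \<comment> \<open>An explicit step of the linear equation. The true difference at time t + h
        is Y plus h times the collected errors E.\<close>
      define Y where "Y x = W x + complex_of_real h * G x" for x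
      have hG: "inH (1/2) (\<lambda>x. complex_of_real h * G x)" by (rule wsq_cmult(1)[OF G])
      have Y: "inH (1/2) Y" unfolding Y_def by (rule wsq_add(1)[OF Wh hG])
      have eq: "(\<lambda>x. V1 (t + h) x - V2 (t + h) x) = (\<lambda>x. Y x + complex_of_real h * E x)"
        using h by (auto simp: Y_def E_def E1_def E2_def F1_def F2_def W_def diff field_simps)
      have "hn (1/2) (\<lambda>x. V1 (t + h) x - V2 (t + h) x) \<le> hn (1/2) Y + hn (1/2) (\<lambda>x. complex_of_real h * E x)"
        unfolding eq by (intro wsq_add(2) Y wsq_cmult(1) E)
      also have "\<dots> = hn (1/2) Y + h * hn (1/2) E" using wsq_cmult(2)[OF E, of "complex_of_real h"] h by simp
      also have "\<dots> \<le> hn (1/2) Y + h * (\<epsilon> + o' h)" using nE h by simp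
      finally have n1: "hn (1/2) (\<lambda>x. V1 (t + h) x - V2 (t + h) x) \<le> hn (1/2) Y + h * (\<epsilon> + o' h)" .
      have oh: "0 \<le> o' h" by (simp add: o'_def)
      have Y1: "hn (1/2) Y \<le> R + h * L"
        using wsq_add(2)[OF Wh hG] wsq_cmult(2)[OF G, of "complex_of_real h"] h WR by (simp add: Y_def[abs_def] L_def)
      have Y2: "(hn (1/2) Y)\<^sup>2 \<le> f t + h * (2 * cD s * R * f t) + h\<^sup>2 * L\<^sup>2"
      proof -
        let ?w = "\<lambda>x. complex_of_real (wt (1/2) 0 x) * W x"
        let ?g = "\<lambda>x. complex_of_real h * (complex_of_real (wt (1/2) 0 x) * G x)"
        have "(n2 (\<lambda>x. ?w x + ?g x))\<^sup>2 = (n2 ?w)\<^sup>2 + 2 * Re (LINT x|lborel. cnj (?w x) * ?g x) + (n2 ?g)\<^sup>2"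
          by (intro sqint_add(3) wsq_sqint[OF Wh] sqint_cmult(1) wsq_sqint[OF G])
        moreover have "(\<lambda>x. ?w x + ?g x) = (\<lambda>x. complex_of_real (wt (1/2) 0 x) * Y x)" by (simp add: Y_def algebra_simps)
        moreover have "n2 ?g = h * L" using sqint_cmult(2)[OF wsq_sqint[OF G], of "complex_of_real h"] h by (simp add: L_def wn_def)
        moreover have "Re (LINT x|lborel. cnj (?w x) * ?g x) \<le> h * (cD s * R * f t)"
        proof -
          have "(LINT x|lborel. cnj (?w x) * ?g x) = (LINT x|lborel. complex_of_real h * (cnj (?w x) * (complex_of_real (wt (1/2) 0 x) * G x)))"
            by (intro Bochner_Integration.integral_cong) (auto simp: mult_ac)
          also have "\<dots> = complex_of_real h * (LINT x|lborel. cnj (?w x) * (complex_of_real (wt (1/2) 0 x) * G x))"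
            by (rule integral_mult_right_zero)
          finally have "Re (LINT x|lborel. cnj (?w x) * ?g x) = h * Re (LINT x|lborel. cnj (?w x) * (complex_of_real (wt (1/2) 0 x) * G x))"
            by simp
          also have "\<dots> \<le> h * (cD s * hn s S * (hn (1/2) W)\<^sup>2)"
            using h difference_estimate[OF a s W S hS] unfolding G_def by (intro mult_left_mono) auto
          also have "\<dots> \<le> h * (cD s * R * f t)"
          proof -
            have "f t = (hn (1/2) W)\<^sup>2" by (simp add: f_def W_def[abs_def])
            show ?thesis unfolding \<open>f t = (hn (1/2) W)\<^sup>2\<close>
              using h SR by (intro mult_left_mono mult_right_mono) auto
          qed
          finally show ?thesis .
        qed
        moreover have "f t = (n2 ?w)\<^sup>2" by (simp add: f_def W_def[abs_def] wn_def)
        ultimately show ?thesis by (simp add: wn_def power_mult_distrib)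
      qed
      have "f (t + h) \<le> (hn (1/2) Y + h * (\<epsilon> + o' h))\<^sup>2"
        unfolding f_def by (rule power_mono[OF n1 wn_nonneg])
      also have "\<dots> = (hn (1/2) Y)\<^sup>2 + 2 * (hn (1/2) Y * (h * (\<epsilon> + o' h))) + (h * (\<epsilon> + o' h))\<^sup>2"
        by (simp add: power2_sum)
      also have "\<dots> \<le> (f t + h * (2 * cD s * R * f t) + h\<^sup>2 * L\<^sup>2) + 2 * ((R + h * L) * (h * (\<epsilon> + o' h))) + (h * (\<epsilon> + o' h))\<^sup>2"
        using Y1 Y2 h \<epsilon> oh by (intro add_mono mult_left_mono mult_right_mono) auto
      also have "\<dots> = f t + h * (2 * cD s * R * f t + q h)"
        by (simp add: q_def power2_eq_square algebra_simps)
      finally show ?thesis .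
    qed
    have "\<forall>\<^sub>F h in at_right 0. h < T - t" using t by (intro eventually_at_rightI[of 0 "T - t"]) auto
    then show "\<forall>\<^sub>F h in at_right 0. f (t + h) \<le> f t + h * (2 * cD s * R * f t + 2 * \<epsilon> * R + d)"
      using q eventually_at_right_less[of 0]
    proof eventually_elim
      case (elim h)
      have "f (t + h) \<le> f t + h * (2 * cD s * R * f t + q h)" using elim by (intro step) auto
      also have "\<dots> \<le> f t + h * (2 * cD s * R * f t + (2 * \<epsilon> * R + d))" using elim by (intro add_left_mono mult_left_mono) auto
      finally show ?case by (simp add: add.assoc)
    qed
  qed (use t in auto)
  then show ?thesis by (simp add: f_def R_def \<epsilon>_def)
qed

section \<open>An Euler--Galerkin scheme\<close>

text \<open>The energy estimate only asserts that a constant exists. Fixing one for each s lets the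
  existence time be a function of s and the norm.\<close>

definition cE :: "real \<Rightarrow> real" where
  "cE s = (SOME C. 0 \<le> C \<and> (\<forall>\<alpha> M N U. 0 \<le> \<alpha> \<longrightarrow> \<alpha> \<le> 1 \<longrightarrow> 0 \<le> M \<longrightarrow> inH s U \<longrightarrow> herm U \<longrightarrow> band N U \<longrightarrow>
    Re (LINT x|lborel. cnj (complex_of_real (wt s M x) * U x) * (complex_of_real (wt s M x) * Bop \<alpha> U U x))
    \<le> C * aw U * (wn (wt s M) U)\<^sup>2))"

lemma cE:
  assumes "3/2 < s"
  shows "0 \<le> cE s"
    and "0 \<le> \<alpha> \<Longrightarrow> \<alpha> \<le> 1 \<Longrightarrow> 0 \<le> M \<Longrightarrow> inH s U \<Longrightarrow> herm U \<Longrightarrow> band N U \<Longrightarrow>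
      Re (LINT x|lborel. cnj (complex_of_real (wt s M x) * U x) * (complex_of_real (wt s M x) * Bop \<alpha> U U x))
      \<le> cE s * aw U * (wn (wt s M) U)\<^sup>2"
  using someI_ex[OF energy_estimate[OF assms, unfolded Bex_def]] unfolding cE_def[symmetric] by blast+

text \<open>The first summand is the energy estimate with \<open>aw U\<close> at most
  \<open>emb (s - 1) * R\<close>, the second the squared Euler increment under the step restriction.
  The 1 keeps the rate away from 0, so that its reciprocal is a positive time.\<close>

definition rate :: "real \<Rightarrow> real \<Rightarrow> real" where
  "rate s R = 2 * cE s * emb (s - 1) * R + (cB s * R)\<^sup>2 + 1"

lemma rate_pos: "3/2 < s \<Longrightarrow> 0 \<le> R \<Longrightarrow> 1 \<le> rate s R"
  using cE(1)[of s] by (simp add: rate_def)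

lemma Bop_lipschitz:
  assumes a: "0 \<le> \<alpha>" "\<alpha> \<le> 1" and s: "3/2 < s" and U: "inH s U" and V: "inH s V"
  shows "hn (s - 1) (\<lambda>x. Bop \<alpha> U U x - Bop \<alpha> V V x) \<le> cB s * (hn s U + hn s V) * hn s (\<lambda>x. U x - V x)"
proof -
  have "(\<lambda>x. Bop \<alpha> U U x - Bop \<alpha> V V x) = Bop \<alpha> (\<lambda>y. U y + V y) (\<lambda>y. U y - V y)"
    using s by (intro ext Bop_square_diff a inH_mono(1)[OF U] inH_mono(1)[OF V]) auto
  then have "hn (s - 1) (\<lambda>x. Bop \<alpha> U U x - Bop \<alpha> V V x) \<le> cB s * hn s (\<lambda>y. U y + V y) * hn s (\<lambda>x. U x - V x)"
    using Bop_inH(2)[OF a s wsq_add(1)[OF U V] wsq_diff(1)[OF U V]] by simp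
  also have "\<dots> \<le> cB s * (hn s U + hn s V) * hn s (\<lambda>x. U x - V x)"
    by (intro mult_right_mono mult_left_mono wsq_add(2)[OF U V]) auto
  finally show ?thesis .
qed

lemma herm_comb: "herm U \<Longrightarrow> herm V \<Longrightarrow> herm (\<lambda>x. U x + complex_of_real c * V x)"
  by (simp add: herm_def)

lemma band_comb: "band N U \<Longrightarrow> band N V \<Longrightarrow> band N (\<lambda>x. U x + c * V x)"
  by (simp add: band_def)

text \<open>On the band the derivative lost by \<open>Bop\<close> costs a factor
  \<open>jb N\<close>, and the bound remains proportional to the tail norm of U.\<close>

lemma increment:
  assumes a: "0 \<le> \<alpha>" "\<alpha> \<le> 1" and s: "3/2 < s" and U: "inH s U" and M: "0 \<le> M"
  shows "wsq (wt s M) (proj N (Bop \<alpha> U U))"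
    "wn (wt s M) (proj N (Bop \<alpha> U U)) \<le> jb N * (cB s * hn s U * wn (wt s M) U)"
proof -
  have c: "\<bar>wt s M x\<bar> \<le> jb N * \<bar>wt (s - 1) M x\<bar>" if "\<bar>x\<bar> \<le> N" for x
  proof -
    have "jb x \<le> jb N" using that by (intro jb_mono) auto
    then have "wt (s - 1) M x * jb x \<le> wt (s - 1) M x * jb N" using M by (intro mult_left_mono) auto
    then show ?thesis using M by (simp add: wt_pred mult.commute order_less_imp_not_eq2)
  qed
  have 1: "wsq (wt (s - 1) M) (Bop \<alpha> U U)" by (rule Bop_bound(1)[OF a M s U U])
  note t = wsq_proj_transfer[OF 1 wt_measurable _ c]
  show "wsq (wt s M) (proj N (Bop \<alpha> U U))" by (rule t(1)) auto
  have "wn (wt s M) (proj N (Bop \<alpha> U U)) \<le> jb N * wn (wt (s - 1) M) (Bop \<alpha> U U)" by (rule t(2)) auto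
  also have "\<dots> \<le> jb N * (cB s * hn s U * wn (wt s M) U)"
    by (intro mult_left_mono Bop_tail[OF a M s U]) auto
  finally show "wn (wt s M) (proj N (Bop \<alpha> U U)) \<le> jb N * (cB s * hn s U * wn (wt s M) U)" .
qed

lemma euler_step:
  assumes a: "0 \<le> \<alpha>" "\<alpha> \<le> 1" and s: "3/2 < s" and U: "inH s U" "herm U" "band N U" "hn s U \<le> R"
    and M: "0 \<le> M" and \<tau>: "0 \<le> \<tau>" "\<tau> * (jb N)\<^sup>2 \<le> 1"
  shows "(wn (wt s M) (\<lambda>x. U x + complex_of_real \<tau> * proj N (Bop \<alpha> U U) x))\<^sup>2 \<le> exp (rate s R * \<tau>) * (wn (wt s M) U)\<^sup>2"
proof -
  define F where "F = proj N (Bop \<alpha> U U)"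
  define n where "n = wn (wt s M) U"
  have R: "0 \<le> R" using U(4) wn_nonneg by (rule order_trans[rotated])
  note F = increment[OF a s U(1) M, of N, folded F_def]
  have UM: "wsq (wt s M) U" by (rule inH_tail(1)[OF U(1) M])
  let ?w = "\<lambda>x. complex_of_real (wt s M x) * U x"
  let ?g = "\<lambda>x. complex_of_real \<tau> * (complex_of_real (wt s M x) * F x)"
  have "(n2 (\<lambda>x. ?w x + ?g x))\<^sup>2 = (n2 ?w)\<^sup>2 + 2 * Re (LINT x|lborel. cnj (?w x) * ?g x) + (n2 ?g)\<^sup>2"
    by (intro sqint_add(3) wsq_sqint[OF UM] sqint_cmult(1) wsq_sqint[OF F(1)])
  moreover have "(\<lambda>x. ?w x + ?g x) = (\<lambda>x. complex_of_real (wt s M x) * (U x + complex_of_real \<tau> * F x))"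
    by (simp add: algebra_simps)
  moreover have "n2 ?g = \<tau> * wn (wt s M) F"
    using sqint_cmult(2)[OF wsq_sqint[OF F(1)], of "complex_of_real \<tau>"] \<tau> by (simp add: wn_def)
  moreover have "Re (LINT x|lborel. cnj (?w x) * ?g x) \<le> \<tau> * (cE s * emb (s - 1) * R * n\<^sup>2)"
  proof -
    have "(LINT x|lborel. cnj (?w x) * ?g x)
        = (LINT x|lborel. complex_of_real \<tau> * (cnj (?w x) * (complex_of_real (wt s M x) * Bop \<alpha> U U x)))"
      using U(3) by (intro Bochner_Integration.integral_cong) (auto simp: mult_ac F_def proj_def band_def)
    also have "\<dots> = complex_of_real \<tau> * (LINT x|lborel. cnj (?w x) * (complex_of_real (wt s M x) * Bop \<alpha> U U x))"
      by (rule integral_mult_right_zero)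
    finally have "Re (LINT x|lborel. cnj (?w x) * ?g x)
        = \<tau> * Re (LINT x|lborel. cnj (?w x) * (complex_of_real (wt s M x) * Bop \<alpha> U U x))"
      by simp
    also have "\<dots> \<le> \<tau> * (cE s * aw U * n\<^sup>2)"
      unfolding n_def using \<tau> by (intro mult_left_mono cE(2)[OF s a M U(1-3)]) auto
    also have "\<dots> \<le> \<tau> * (cE s * (emb (s - 1) * R) * n\<^sup>2)"
    proof -
      have "aw U \<le> emb (s - 1) * R"
        using inH_aw(2)[OF U(1) s] mult_left_mono[OF U(4), of "emb (s - 1)"] by simp
      then show ?thesis using \<tau> cE(1)[OF s] by (intro mult_left_mono mult_right_mono) auto
    qed
    finally show ?thesis by (simp add: mult.assoc)
  qed
  ultimately have "(wn (wt s M) (\<lambda>x. U x + complex_of_real \<tau> * F x))\<^sup>2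
      \<le> n\<^sup>2 + 2 * (\<tau> * (cE s * emb (s - 1) * R * n\<^sup>2)) + (\<tau> * wn (wt s M) F)\<^sup>2"
    by (simp add: wn_def n_def)
  also have "(\<tau> * wn (wt s M) F)\<^sup>2 \<le> \<tau> * ((cB s * R)\<^sup>2 * n\<^sup>2)"
  proof -
    have "\<tau> * wn (wt s M) F \<le> \<tau> * (jb N * (cB s * R * n))"
    proof -
      have "wn (wt s M) F \<le> jb N * (cB s * hn s U * n)" using F(2) by (simp add: n_def)
      also have "\<dots> \<le> jb N * (cB s * R * n)"
        using U(4) by (intro mult_left_mono mult_right_mono) (auto simp: n_def)
      finally show ?thesis using \<tau> by (intro mult_left_mono) auto
    qed
    then have "(\<tau> * wn (wt s M) F)\<^sup>2 \<le> (\<tau> * (jb N * (cB s * R * n)))\<^sup>2"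
      using \<tau> by (intro power_mono) auto
    also have "\<dots> = (\<tau> * (jb N)\<^sup>2) * (\<tau> * ((cB s * R)\<^sup>2 * n\<^sup>2))" by (simp add: power2_eq_square mult_ac)
    also have "\<dots> \<le> 1 * (\<tau> * ((cB s * R)\<^sup>2 * n\<^sup>2))"
      using \<tau> by (intro mult_right_mono) auto
    finally show ?thesis by simp
  qed
  also have "n\<^sup>2 + 2 * (\<tau> * (cE s * emb (s - 1) * R * n\<^sup>2)) + \<tau> * ((cB s * R)\<^sup>2 * n\<^sup>2) \<le> (1 + rate s R * \<tau>) * n\<^sup>2"
    using \<tau> by (simp add: rate_def algebra_simps)
  also have "\<dots> \<le> exp (rate s R * \<tau>) * n\<^sup>2"
    by (intro mult_right_mono exp_ge_add_one_self) auto
  finally show ?thesis by (simp add: F_def n_def)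
qed

fun eul :: "real \<Rightarrow> real \<Rightarrow> real \<Rightarrow> (real \<Rightarrow> complex) \<Rightarrow> nat \<Rightarrow> real \<Rightarrow> complex" where
  "eul \<alpha> N h U0 0 = proj N U0"
| "eul \<alpha> N h U0 (Suc j) =
    (\<lambda>x. eul \<alpha> N h U0 j x + complex_of_real h * proj N (Bop \<alpha> (eul \<alpha> N h U0 j) (eul \<alpha> N h U0 j)) x)"

text \<open>The time spent in cell i up to t. With it the piecewise linear interpolant and its
  increments are plain sums, without case distinctions on cells.\<close>

definition clamp_time :: "real \<Rightarrow> nat \<Rightarrow> real \<Rightarrow> real" where
  "clamp_time h i t = max 0 (min h (t - real i * h))"

lemma clamp_time_mono: "r \<le> t \<Longrightarrow> clamp_time h i r \<le> clamp_time h i t"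
  by (auto simp: clamp_time_def)

lemma sum_clamp_time:
  assumes "0 \<le> h" "0 \<le> t"
  shows "(\<Sum>i<k. clamp_time h i t) = min t (real k * h)"
proof (induction k)
  case 0
  then show ?case using assms by simp
next
  case (Suc k)
  have "real (Suc k) * h = real k * h + h" by (simp add: algebra_simps)
  then show ?case using Suc assms by (auto simp: clamp_time_def min_def max_def)
qed

lemma wn_sum:
  assumes "finite I" "\<And>i. i \<in> I \<Longrightarrow> wsq p (f i)"
  shows "wsq p (\<lambda>x. \<Sum>i\<in>I. f i x) \<and> wn p (\<lambda>x. \<Sum>i\<in>I. f i x) \<le> (\<Sum>i\<in>I. wn p (f i))"
  using assms
proof (induction I)
  case (insert i I)
  then have IH: "wsq p (\<lambda>x. \<Sum>i\<in>I. f i x)" "wn p (\<lambda>x. \<Sum>i\<in>I. f i x) \<le> (\<Sum>i\<in>I. wn p (f i))" by auto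
  have "wsq p (f i)" using insert by auto
  from wsq_add[OF this IH(1)] IH(2) show ?case using insert(1,2) by auto
qed auto

text \<open>The rate is taken at 2 R, the bound that the scheme has to preserve. Over a time T with
  T times the rate at most 1, squared norms grow by at most e <= 4, hence norms by at most
  2.\<close>

locale euler_scheme =
  fixes \<alpha> s N h R T :: real and k :: nat and U0 :: "real \<Rightarrow> complex"
  assumes a: "0 \<le> \<alpha>" "\<alpha> \<le> 1" and s: "3/2 < s" and N: "0 \<le> N" and h: "0 < h" "h * (jb N)\<^sup>2 \<le> 1"
    and k: "0 < k" "T = real k * h" and T: "T * rate s (2 * R) \<le> 1"
    and U0: "inH s U0" "herm U0" "hn s U0 \<le> R"
begin

abbreviation "E \<equiv> eul \<alpha> N h U0"

definition "F j = proj N (Bop \<alpha> (E j) (E j))"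

definition "V t x = proj N U0 x + (\<Sum>i<k. complex_of_real (clamp_time h i t) * F i x)"

definition "D t = F (nat \<lfloor>t / h\<rfloor>)"

lemma R: "0 \<le> R"
  using order_trans[OF wn_nonneg U0(3)] .

lemma E_sum: "E j x = proj N U0 x + (\<Sum>i<j. complex_of_real h * F i x)"
  by (induction j) (simp_all add: F_def)

lemma growth_le:
  assumes "0 \<le> r" "r \<le> T"
  shows "exp (rate s (2 * R) * r) \<le> 4"
proof -
  have "rate s (2 * R) * r \<le> rate s (2 * R) * T"
    using assms rate_pos[OF s, of "2 * R"] R by (intro mult_left_mono) auto
  then have "exp (rate s (2 * R) * r) \<le> exp 1" using T by (simp add: mult.commute)
  also have "\<dots> \<le> 4" using exp_le by simp
  finally show ?thesis .
qed

lemma growth_bound: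
  assumes "x\<^sup>2 \<le> exp (rate s (2 * R) * r) * y\<^sup>2" "0 \<le> r" "r \<le> T" "0 \<le> y"
  shows "x \<le> 2 * y"
proof (rule power2_le_imp_le)
  have "x\<^sup>2 \<le> 4 * y\<^sup>2" using assms growth_le[of r] mult_right_mono[of "exp (rate s (2 * R) * r)" 4 "y\<^sup>2"] by simp
  then show "x\<^sup>2 \<le> (2 * y)\<^sup>2" by (simp add: power_mult_distrib)
qed (use assms in simp)

text \<open>A bootstrap: the accumulated exponential bound for M = 0 gives the bound 2 R on the
  current state, which is the hypothesis of the next \<open>euler_step\<close> for every M.\<close>

lemma invariant:
  assumes "j \<le> k"
  shows "inH s (E j) \<and> herm (E j) \<and> band N (E j) \<and>
    (\<forall>M\<ge>0. (wn (wt s M) (E j))\<^sup>2 \<le> exp (rate s (2 * R) * (real j * h)) * (wn (wt s M) U0)\<^sup>2)"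
  using assms
proof (induction j)
  case 0
  have "inH s (proj N U0)" by (rule wsq_proj(1)[OF U0(1) wt_measurable])
  moreover have "wn (wt s M) (proj N U0) \<le> wn (wt s M) U0" if "0 \<le> M" for M
    by (rule wsq_proj(2)[OF inH_tail(1)[OF U0(1) that] wt_measurable])
  ultimately show ?case using U0(2) by (auto intro: herm_proj power_mono)
next
  case (Suc j)
  then have IH: "inH s (E j)" "herm (E j)" "band N (E j)"
    "\<And>M. 0 \<le> M \<Longrightarrow> (wn (wt s M) (E j))\<^sup>2 \<le> exp (rate s (2 * R) * (real j * h)) * (wn (wt s M) U0)\<^sup>2" by auto
  have jT: "real j * h \<le> T" using Suc.prems h k by (simp add: mult_right_mono)
  have nE: "hn s (E j) \<le> 2 * R"
  proof -
    have "hn s (E j) \<le> 2 * hn s U0" using IH(4)[of 0] h jT by (intro growth_bound) auto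
    then show ?thesis using U0(3) by simp
  qed
  have "inH s (E (Suc j))" "herm (E (Suc j))" "band N (E (Suc j))"
    using IH increment(1)[OF a s IH(1) order_refl, of N]
    by (auto intro!: wsq_add wsq_cmult herm_comb band_comb herm_proj herm_Bop)
  moreover have "(wn (wt s M) (E (Suc j)))\<^sup>2 \<le> exp (rate s (2 * R) * (real (Suc j) * h)) * (wn (wt s M) U0)\<^sup>2" if "0 \<le> M" for M
  proof -
    have "(wn (wt s M) (E (Suc j)))\<^sup>2 \<le> exp (rate s (2 * R) * h) * (wn (wt s M) (E j))\<^sup>2"
      using euler_step[OF a s IH(1-3) nE that _ h(2)] h by simp
    also have "\<dots> \<le> exp (rate s (2 * R) * h) * (exp (rate s (2 * R) * (real j * h)) * (wn (wt s M) U0)\<^sup>2)"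
      by (intro mult_left_mono IH(4) that) auto
    also have "\<dots> = exp (rate s (2 * R) * (real (Suc j) * h)) * (wn (wt s M) U0)\<^sup>2"
      by (simp add: exp_add[symmetric] mult.assoc[symmetric]) (simp add: algebra_simps)
    finally show ?thesis .
  qed
  ultimately show ?case by blast
qed

lemma jT: "j \<le> k \<Longrightarrow> real j * h \<le> T"
  using h k by (simp add: mult_right_mono)

lemma E_props:
  assumes "j \<le> k"
  shows "inH s (E j)" "herm (E j)" "band N (E j)" "0 \<le> M \<Longrightarrow> wn (wt s M) (E j) \<le> 2 * wn (wt s M) U0" "hn s (E j) \<le> 2 * R"
proof -
  show "inH s (E j)" "herm (E j)" "band N (E j)" using invariant[OF assms] by auto
  show *: "wn (wt s M) (E j) \<le> 2 * wn (wt s M) U0" if "0 \<le> M" for M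
    using invariant[OF assms] h jT[OF assms] that by (intro growth_bound[of _ "real j * h"]) auto
  show "hn s (E j) \<le> 2 * R" using *[of 0] U0(3) by simp
qed

definition "L = jb N * (cB s * (2 * R) * (2 * R))"

lemma F_props:
  assumes "j \<le> k"
  shows "inH s (F j)" "herm (F j)" "hn s (F j) \<le> L"
proof -
  note E = E_props[OF assms]
  show "inH s (F j)" unfolding F_def by (rule increment(1)[OF a s E(1) order_refl])
  show "herm (F j)" unfolding F_def by (intro herm_proj herm_Bop E)
  have "hn s (F j) \<le> jb N * (cB s * hn s (E j) * hn s (E j))"
    unfolding F_def by (rule increment(2)[OF a s E(1) order_refl])
  also have "\<dots> \<le> L" unfolding L_def using E(5) R by (intro mult_left_mono mult_mono) auto
  finally show "hn s (F j) \<le> L" .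
qed

lemma cell:
  assumes j: "j < k" and t: "real j * h \<le> t" "t \<le> real j * h + h"
  shows "V t x = E j x + complex_of_real (t - real j * h) * F j x"
proof -
  have c: "clamp_time h i t = (if i < j then h else if i = j then t - real j * h else 0)" for i
  proof -
    consider "i < j" | "i = j" | "j < i" by linarith
    then show ?thesis
    proof cases
      case 1
      then have "real i * h + h \<le> real j * h" using h mult_right_mono[of "real i + 1" "real j" h] by (simp add: algebra_simps)
      then show ?thesis using 1 t h by (auto simp: clamp_time_def)
    next
      case 3
      then have "real j * h + h \<le> real i * h" using h mult_right_mono[of "real j + 1" "real i" h] by (simp add: algebra_simps)
      then show ?thesis using 3 t h by (auto simp: clamp_time_def)
    qed (use t h in \<open>auto simp: clamp_time_def\<close>)
  qed
  have "(\<Sum>i<k. complex_of_real (clamp_time h i t) * F i x)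
      = (\<Sum>i<k. (if i < j then complex_of_real h * F i x else 0) + (if i = j then complex_of_real (t - real j * h) * F j x else 0))"
    unfolding c by (intro sum.cong) auto
  also have "\<dots> = (\<Sum>i<k. if i < j then complex_of_real h * F i x else 0) + complex_of_real (t - real j * h) * F j x"
    using j by (simp add: sum.distrib)
  also have "(\<Sum>i<k. if i < j then complex_of_real h * F i x else 0) = (\<Sum>i<j. complex_of_real h * F i x)"
    using j by (intro sum.mono_neutral_cong_right) auto
  finally show ?thesis unfolding V_def E_sum by simp
qed

lemma find_cell:
  assumes "0 \<le> t" "t < T"
  shows "nat \<lfloor>t / h\<rfloor> < k" "real (nat \<lfloor>t / h\<rfloor>) * h \<le> t" "t < real (nat \<lfloor>t / h\<rfloor>) * h + h"
proof -
  define j where "j = nat \<lfloor>t / h\<rfloor>"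
  have "0 \<le> t / h" using assms h by simp
  then have j: "real j \<le> t / h" "t / h < real j + 1" unfolding j_def by linarith+
  then show 1: "real (nat \<lfloor>t / h\<rfloor>) * h \<le> t" "t < real (nat \<lfloor>t / h\<rfloor>) * h + h"
    using h by (simp_all add: j_def[symmetric] field_simps)
  have "real j * h < real k * h" using 1(1) assms k by (simp add: j_def)
  then show "nat \<lfloor>t / h\<rfloor> < k" using h by (simp add: j_def)
qed

lemma find_closed_cell:
  assumes "0 \<le> t" "t \<le> T"
  obtains j where "j < k" "real j * h \<le> t" "t \<le> real j * h + h"
proof (cases "t < T")
  case True
  then show ?thesis using that[OF find_cell(1,2) less_imp_le[OF find_cell(3)]] assms by simp
next
  case False
  have "real (k - 1) * h + h = T" using k by (simp add: of_nat_diff algebra_simps)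
  then show ?thesis using that[of "k - 1"] False assms k h by auto
qed

lemma V_props:
  assumes t: "0 \<le> t" "t \<le> T"
  shows "inH s (V t)" "herm (V t)" "0 \<le> M \<Longrightarrow> wn (wt s M) (V t) \<le> 2 * wn (wt s M) U0" "hn s (V t) \<le> 2 * R"
proof -
  obtain j where j: "j < k" "real j * h \<le> t" "t \<le> real j * h + h" by (rule find_closed_cell[OF t])
  have jk: "j \<le> k" using j by simp
  note E = E_props[OF jk] and F = F_props[OF jk]
  have V: "V t = (\<lambda>x. E j x + complex_of_real (t - real j * h) * F j x)" using cell[OF j] by auto
  show "inH s (V t)" "herm (V t)" unfolding V by (intro wsq_add wsq_cmult herm_comb E F)+
  show *: "wn (wt s M) (V t) \<le> 2 * wn (wt s M) U0" if M: "0 \<le> M" for M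
  proof (rule growth_bound[OF _ t])
    \<comment> \<open>A partial step inside a cell is an Euler step of smaller size, so the growth
      bound also holds between grid points.\<close>
    have "(t - real j * h) * (jb N)\<^sup>2 \<le> h * (jb N)\<^sup>2" using j by (intro mult_right_mono) auto
    then have "(wn (wt s M) (V t))\<^sup>2 \<le> exp (rate s (2 * R) * (t - real j * h)) * (wn (wt s M) (E j))\<^sup>2"
      unfolding V F_def using h j by (intro euler_step a s E M) auto
    also have "\<dots> \<le> exp (rate s (2 * R) * (t - real j * h)) * (exp (rate s (2 * R) * (real j * h)) * (wn (wt s M) U0)\<^sup>2)"
      using invariant[OF jk] M by (intro mult_left_mono) auto
    also have "\<dots> = exp (rate s (2 * R) * t) * (wn (wt s M) U0)\<^sup>2"
      by (simp add: exp_add[symmetric] mult.assoc[symmetric]) (simp add: algebra_simps)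
    finally show "(wn (wt s M) (V t))\<^sup>2 \<le> exp (rate s (2 * R) * t) * (wn (wt s M) U0)\<^sup>2" .
  qed simp
  show "hn s (V t) \<le> 2 * R" using *[of 0] U0(3) by simp
qed

text \<open>Takes the place of a time integral of the slopes: an increment of V is the sum of the
  slopes \<open>F i\<close> weighted by the time spent in each cell, and these times add up to t -
  r. Only cells that meet the interval contribute.\<close>

lemma mean_value:
  assumes r: "0 \<le> r" "r \<le> t" "t \<le> T" and q: "q \<le> s" and G: "inH q G" and m: "0 \<le> m"
    and b: "\<And>i. i < k \<Longrightarrow> real i * h < t \<Longrightarrow> r < real i * h + h \<Longrightarrow> hn q (\<lambda>x. F i x - G x) \<le> m"
  shows "hn q (\<lambda>x. V t x - V r x - complex_of_real (t - r) * G x) \<le> (t - r) * m"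
proof -
  define c where "c i = clamp_time h i t - clamp_time h i r" for i
  have c0: "0 \<le> c i" for i using clamp_time_mono[OF r(2)] by (simp add: c_def)
  have cs: "(\<Sum>i<k. c i) = t - r"
    using sum_clamp_time[of h t k] sum_clamp_time[of h r k] h r k by (simp add: c_def sum_subtractf min_def)
  have Fq: "inH q (F i)" if "i < k" for i using F_props(1)[of i] that q by (auto intro: inH_mono(1))
  have eq: "(\<lambda>x. V t x - V r x - complex_of_real (t - r) * G x) = (\<lambda>x. \<Sum>i<k. complex_of_real (c i) * (F i x - G x))"
  proof
    fix x
    have "V t x - V r x = (\<Sum>i<k. complex_of_real (c i) * F i x)"
      by (simp add: V_def c_def sum_subtractf left_diff_distrib)
    moreover have "complex_of_real (t - r) * G x = (\<Sum>i<k. complex_of_real (c i) * G x)"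
      unfolding cs[symmetric] by (simp add: sum_distrib_right)
    ultimately show "V t x - V r x - complex_of_real (t - r) * G x = (\<Sum>i<k. complex_of_real (c i) * (F i x - G x))"
      by (simp add: sum_subtractf right_diff_distrib)
  qed
  have "hn q (\<lambda>x. V t x - V r x - complex_of_real (t - r) * G x) \<le> (\<Sum>i<k. hn q (\<lambda>x. complex_of_real (c i) * (F i x - G x)))"
    unfolding eq by (rule wn_sum[THEN conjunct2]) (auto intro!: wsq_cmult wsq_diff Fq G)
  also have "\<dots> = (\<Sum>i<k. c i * hn q (\<lambda>x. F i x - G x))"
    using c0 by (intro sum.cong) (auto simp: wsq_cmult(2)[OF wsq_diff(1)[OF Fq G]])
  also have "\<dots> \<le> (\<Sum>i<k. c i * m)"
  proof (rule sum_mono)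
    fix i assume i: "i \<in> {..<k}"
    show "c i * hn q (\<lambda>x. F i x - G x) \<le> c i * m"
    proof (cases "real i * h < t \<and> r < real i * h + h")
      case True
      then show ?thesis using b[of i] i c0 by (intro mult_left_mono) auto
    next
      case False
      then have "c i = 0" using r h by (auto simp: c_def clamp_time_def)
      then show ?thesis by simp
    qed
  qed
  also have "\<dots> = (t - r) * m" by (simp add: cs[symmetric] sum_distrib_right)
  finally show ?thesis .
qed

lemma L0: "0 \<le> L"
  using R by (simp add: L_def)

lemma V_lipschitz:
  assumes "0 \<le> r" "r \<le> T" "0 \<le> t" "t \<le> T"
  shows "hn s (\<lambda>x. V t x - V r x) \<le> L * \<bar>t - r\<bar>"
proof -
  have *: "hn s (\<lambda>x. V t x - V r x) \<le> L * (t - r)" if "0 \<le> r" "r \<le> t" "t \<le> T" for r t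
    using mean_value[OF that, of s "\<lambda>x. 0" L] F_props(3) L0 by (simp add: mult.commute)
  show ?thesis
  proof (cases "r \<le> t")
    case True
    then show ?thesis using *[of r t] assms by simp
  next
    case False
    then show ?thesis using *[of t r] assms by (simp add: wn_minus_commute[of _ "V t"])
  qed
qed

text \<open>The first term is the truncation of \<open>Bop\<close>, with factors 2 from the tail
  bound and from the doubled norms. The second comes from freezing the state during a step: it
  carries h times \<open>jb N\<close>, which is at most 1 / \<open>jb N\<close>.\<close>

definition "err = 8 * cB s * R * wn (wt s N) U0 + 16 * (cB s)\<^sup>2 * R^3 / jb N"

lemma err0: "0 \<le> err"
  using R by (simp add: err_def)

lemma consistency:
  assumes i: "i < k" and \<tau>: "real i * h \<le> \<tau>" "\<tau> \<le> real i * h + h"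
  shows "hn (s - 1) (\<lambda>x. F i x - Bop \<alpha> (V \<tau>) (V \<tau>) x) \<le> err"
proof -
  have ik: "i \<le> k" using i by simp
  have "real (Suc i) * h \<le> T" using i by (intro jT) simp
  then have \<tau>T: "0 \<le> \<tau>" "\<tau> \<le> T" using \<tau> h by (auto simp: algebra_simps intro: order_trans[rotated])
  note E = E_props[OF ik] and F = F_props[OF ik] and V = V_props[OF \<tau>T]
  let ?BE = "Bop \<alpha> (E i) (E i)" and ?BV = "Bop \<alpha> (V \<tau>) (V \<tau>)"
  have BE: "inH (s - 1) ?BE" and BV: "inH (s - 1) ?BV" by (rule Bop_inH(1)[OF a s]; fact)+
  have Fi: "inH (s - 1) (F i)" using F(1) by (rule inH_mono(1)) simp
  have "hn (s - 1) (\<lambda>x. F i x - ?BV x) \<le> hn (s - 1) (\<lambda>x. F i x - ?BE x) + hn (s - 1) (\<lambda>x. ?BE x - ?BV x)"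
    by (rule wn_triangle_diff[OF Fi BE BV])
  also have "hn (s - 1) (\<lambda>x. F i x - ?BE x) = hn (s - 1) (\<lambda>x. ?BE x - proj N ?BE x)"
    unfolding F_def by (rule wn_minus_commute)
  also have "\<dots> \<le> 2 * wn (wt (s - 1) N) ?BE" by (rule tail_le(2)[OF BE N])
  also have "\<dots> \<le> 2 * (cB s * hn s (E i) * wn (wt s N) (E i))"
    by (intro mult_left_mono Bop_tail[OF a N s E(1)]) auto
  also have "\<dots> \<le> 2 * (cB s * (2 * R) * (2 * wn (wt s N) U0))"
    using E(4)[OF N] E(5) R by (intro mult_left_mono mult_mono) auto
  also have "hn (s - 1) (\<lambda>x. ?BE x - ?BV x) \<le> cB s * (hn s (E i) + hn s (V \<tau>)) * hn s (\<lambda>x. E i x - V \<tau> x)"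
    by (rule Bop_lipschitz[OF a s E(1) V(1)])
  also have "\<dots> \<le> cB s * (2 * R + 2 * R) * (h * L)"
  proof (intro mult_mono add_mono E V mult_nonneg_nonneg add_nonneg_nonneg)
    have "(\<lambda>x. E i x - V \<tau> x) = (\<lambda>x. - complex_of_real (\<tau> - real i * h) * F i x)"
      unfolding cell[OF i \<tau>] by (simp add: algebra_simps)
    then have "hn s (\<lambda>x. E i x - V \<tau> x) = (\<tau> - real i * h) * hn s (F i)"
      using wsq_cmult(2)[OF F(1), of "- complex_of_real (\<tau> - real i * h)"] \<tau>
      by (simp only: norm_minus_cancel norm_of_real abs_of_nonneg diff_ge_0_iff_ge)
    also have "\<dots> \<le> h * L" using \<tau> F(3) L0 h by (intro mult_mono) auto
    finally show "hn s (\<lambda>x. E i x - V \<tau> x) \<le> h * L" .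
  qed (use R h L0 in auto)
  also have "\<dots> = (h * jb N) * (16 * (cB s)\<^sup>2 * R^3)"
    by (simp add: L_def power2_eq_square power3_eq_cube)
  also have "\<dots> \<le> (1 / jb N) * (16 * (cB s)\<^sup>2 * R^3)"
  proof (intro mult_right_mono)
    show "h * jb N \<le> 1 / jb N" using h(2) by (simp add: divide_simps power2_eq_square)
  qed (use R in auto)
  finally show ?thesis by (simp add: err_def)
qed

lemma approximate_solution: "approx_sol \<alpha> s T (2 * R) err V D"
  unfolding approx_sol_def
proof (intro conjI ballI)
  fix t assume t: "t \<in> {0..T}"
  then show "inH s (V t)" "herm (V t)" "hn s (V t) \<le> 2 * R" using V_props[of t] by auto
  have "((\<lambda>r. L * \<bar>r - t\<bar>) \<longlongrightarrow> L * \<bar>t - t\<bar>) (at t within {0..T})" by (intro tendsto_intros)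
  then have l: "((\<lambda>r. L * \<bar>r - t\<bar>) \<longlongrightarrow> 0) (at t within {0..T})" by simp
  show "((\<lambda>r. hn (1/2) (\<lambda>x. V r x - V t x)) \<longlongrightarrow> 0) (at t within {0..T})"
  proof (rule tendsto_sandwich[OF _ _ tendsto_const l])
    show "\<forall>\<^sub>F r in at t within {0..T}. hn (1/2) (\<lambda>x. V r x - V t x) \<le> L * \<bar>r - t\<bar>"
      unfolding eventually_at_filter
    proof (intro always_eventually allI impI)
      fix r assume "r \<noteq> t" "r \<in> {0..T}"
      then have "hn (1/2) (\<lambda>x. V r x - V t x) \<le> hn s (\<lambda>x. V r x - V t x)"
        using t s V_props(1) by (intro inH_mono(2) wsq_diff) auto
      also have "\<dots> \<le> L * \<bar>r - t\<bar>" using t \<open>r \<in> {0..T}\<close> by (intro V_lipschitz) auto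
      finally show "hn (1/2) (\<lambda>x. V r x - V t x) \<le> L * \<bar>r - t\<bar>" .
    qed
  qed auto
next
  fix t assume "t \<in> {0..<T}"
  then have t: "0 \<le> t" "t < T" by auto
  define j where "j = nat \<lfloor>t / h\<rfloor>"
  note j = find_cell[OF t, folded j_def]
  have D: "D t = F j" by (simp add: D_def j_def)
  have jk: "j \<le> k" using j by simp
  show "inH (1/2) (D t)" unfolding D using s by (intro inH_mono(1)[OF F_props(1)[OF jk]]) simp
  have BV: "inH (s - 1) (Bop \<alpha> (V t) (V t))" using V_props(1)[of t] t by (intro Bop_inH(1)[OF a s]) auto
  have "hn (1/2) (\<lambda>x. F j x - Bop \<alpha> (V t) (V t) x) \<le> hn (s - 1) (\<lambda>x. F j x - Bop \<alpha> (V t) (V t) x)"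
    using s by (intro inH_mono(2) wsq_diff BV inH_mono(1)[OF F_props(1)[OF jk]]) auto
  also have "\<dots> \<le> err" using j by (intro consistency) auto
  finally show "hn (1/2) (\<lambda>x. D t x - Bop \<alpha> (V t) (V t) x) \<le> err" unfolding D .
  \<comment> \<open>For small d the time t + d stays in the cell of t, where the quotient equals the
    slope exactly.\<close>
  have "\<forall>\<^sub>F d in at_right 0. d \<in> {0<..<real j * h + h - t}" using j by (intro eventually_at_right_real) auto
  then have "\<forall>\<^sub>F d in at_right 0. hn (1/2) (\<lambda>x. (V (t + d) x - V t x) / complex_of_real d - D t x) = 0"
  proof eventually_elim
    case (elim d)
    have "(V (t + d) x - V t x) / complex_of_real d - D t x = 0" for x
    proof -
      have "V (t + d) x = E j x + complex_of_real (t + d - real j * h) * F j x"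
        by (rule cell[OF j(1)]) (use elim j in auto)
      moreover have "V t x = E j x + complex_of_real (t - real j * h) * F j x"
        by (rule cell[OF j(1)]) (use j in auto)
      ultimately have "V (t + d) x - V t x = complex_of_real d * F j x" by (simp only:) (simp add: algebra_simps)
      then show ?thesis using elim by (simp add: D)
    qed
    then show ?case by simp
  qed
  then show "((\<lambda>d. hn (1/2) (\<lambda>x. (V (t + d) x - V t x) / complex_of_real d - D t x)) \<longlongrightarrow> 0) (at_right 0)"
    by (rule tendsto_eventually)
qed

end

section \<open>Solutions on the Fourier side\<close>

text \<open>The time derivative is taken in H^(s-1), the space into which \<open>Bop\<close> maps
  H^s.\<close>

definition fsol :: "real \<Rightarrow> real \<Rightarrow> real \<Rightarrow> (real \<Rightarrow> real \<Rightarrow> complex) \<Rightarrow> bool" where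
  "fsol \<alpha> s T U \<longleftrightarrow> (\<forall>t\<in>{0..T}. inH s (U t) \<and> herm (U t) \<and>
     ((\<lambda>r. hn s (\<lambda>x. U r x - U t x)) \<longlongrightarrow> 0) (at t within {0..T}) \<and>
     ((\<lambda>r. hn (s - 1) (\<lambda>x. (U r x - U t x) / complex_of_real (r - t) - Bop \<alpha> (U t) (U t) x)) \<longlongrightarrow> 0) (at t within {0..T}))"

lemma fsol_restrict:
  assumes "fsol \<alpha> s T U" "T' \<le> T"
  shows "fsol \<alpha> s T' U"
  using assms unfolding fsol_def by (auto intro: tendsto_within_subset[of _ _ _ "{0..T}"])

lemma fsol_bounded:
  assumes "fsol \<alpha> s T U"
  shows "\<exists>R. \<forall>t\<in>{0..T}. hn s (U t) \<le> R"
proof -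
  have "continuous_on {0..T} (\<lambda>t. hn s (U t))"
    unfolding continuous_on_def
  proof
    fix t assume t: "t \<in> {0..T}"
    have l: "((\<lambda>r. hn s (\<lambda>x. U r x - U t x)) \<longlongrightarrow> 0) (at t within {0..T})" using assms t by (auto simp: fsol_def)
    show "((\<lambda>r. hn s (U r)) \<longlongrightarrow> hn s (U t)) (at t within {0..T})"
    proof (rule Lim_transform[OF tendsto_const], rule tendsto_rabs_zero_cancel, rule tendsto_sandwich[OF _ _ tendsto_const l])
      show "\<forall>\<^sub>F r in at t within {0..T}. \<bar>hn s (U r) - hn s (U t)\<bar> \<le> hn s (\<lambda>x. U r x - U t x)"
        unfolding eventually_at_filter using assms t
        by (auto intro!: always_eventually wn_abs_diff_le simp: fsol_def)
    qed auto
  qed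
  then have "bounded ((\<lambda>t. hn s (U t)) ` {0..T})"
    by (intro compact_imp_bounded compact_continuous_image) auto
  then show ?thesis unfolding bounded_iff by auto
qed

text \<open>With \<beta> = \<alpha> and residual 0 this feeds uniqueness; with \<beta> = 0 the
  residual is the modelling error in the Burgers limit.\<close>

lemma fsol_approx_sol:
  assumes U: "fsol \<alpha> s T U" and a: "0 \<le> \<alpha>" "\<alpha> \<le> 1" and s: "3/2 < s"
    and R: "\<And>t. 0 \<le> t \<Longrightarrow> t \<le> T \<Longrightarrow> hn s (U t) \<le> R"
    and e: "\<And>t. 0 \<le> t \<Longrightarrow> t < T \<Longrightarrow> hn (1/2) (\<lambda>x. Bop \<alpha> (U t) (U t) x - Bop \<beta> (U t) (U t) x) \<le> \<epsilon>"
  shows "approx_sol \<beta> s T R \<epsilon> U (\<lambda>t. Bop \<alpha> (U t) (U t))"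
  unfolding approx_sol_def
proof (intro conjI ballI)
  fix t assume t: "t \<in> {0..T}"
  show "inH s (U t)" "herm (U t)" "hn s (U t) \<le> R" using U t R by (auto simp: fsol_def)
  have l: "((\<lambda>r. hn s (\<lambda>x. U r x - U t x)) \<longlongrightarrow> 0) (at t within {0..T})" using U t by (auto simp: fsol_def)
  show "((\<lambda>r. hn (1/2) (\<lambda>x. U r x - U t x)) \<longlongrightarrow> 0) (at t within {0..T})"
  proof (rule tendsto_sandwich[OF _ _ tendsto_const l])
    show "\<forall>\<^sub>F r in at t within {0..T}. hn (1/2) (\<lambda>x. U r x - U t x) \<le> hn s (\<lambda>x. U r x - U t x)"
      unfolding eventually_at_filter
    proof (intro always_eventually allI impI)
      fix r assume "r \<in> {0..T}"
      then have "inH s (\<lambda>x. U r x - U t x)" using U t by (auto intro!: wsq_diff(1) simp: fsol_def)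
      then show "hn (1/2) (\<lambda>x. U r x - U t x) \<le> hn s (\<lambda>x. U r x - U t x)" using s by (intro inH_mono(2)) auto
    qed
  qed auto
next
  fix t assume "t \<in> {0..<T}"
  then have t: "0 \<le> t" "t < T" by auto
  have Ut: "inH s (U t)" using U t by (auto simp: fsol_def)
  have B: "inH (s - 1) (Bop \<alpha> (U t) (U t))" by (rule Bop_inH(1)[OF a s Ut Ut])
  then show "inH (1/2) (Bop \<alpha> (U t) (U t))" using s by (auto intro: inH_mono(1))
  show "hn (1/2) (\<lambda>x. Bop \<alpha> (U t) (U t) x - Bop \<beta> (U t) (U t) x) \<le> \<epsilon>" using e t by auto
  have l: "((\<lambda>r. hn (s - 1) (\<lambda>x. (U r x - U t x) / complex_of_real (r - t) - Bop \<alpha> (U t) (U t) x)) \<longlongrightarrow> 0) (at t within {0..T})"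
    using U t by (auto simp: fsol_def)
  have ev: "\<forall>\<^sub>F h in at_right 0. h \<in> {0<..<T - t}" using t by (intro eventually_at_right_real) auto
  have "filterlim (\<lambda>h. t + h) (at t within {0..T}) (at_right 0)"
    unfolding filterlim_at
  proof
    show "\<forall>\<^sub>F h in at_right 0. t + h \<in> {0..T} \<and> t + h \<noteq> t" using ev by eventually_elim (use t in auto)
    have "((\<lambda>h. t + h) \<longlongrightarrow> t + 0) (at_right 0)" by (intro tendsto_intros)
    then show "((\<lambda>h. t + h) \<longlongrightarrow> t) (at_right 0)" by simp
  qed
  from filterlim_compose[OF l this]
  have l2: "((\<lambda>h. hn (s - 1) (\<lambda>x. (U (t + h) x - U t x) / complex_of_real h - Bop \<alpha> (U t) (U t) x)) \<longlongrightarrow> 0) (at_right 0)"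
    by simp
  show "((\<lambda>h. hn (1/2) (\<lambda>x. (U (t + h) x - U t x) / complex_of_real h - Bop \<alpha> (U t) (U t) x)) \<longlongrightarrow> 0) (at_right 0)"
  proof (rule tendsto_sandwich[OF _ _ tendsto_const l2])
    show "\<forall>\<^sub>F h in at_right 0. hn (1/2) (\<lambda>x. (U (t + h) x - U t x) / complex_of_real h - Bop \<alpha> (U t) (U t) x)
      \<le> hn (s - 1) (\<lambda>x. (U (t + h) x - U t x) / complex_of_real h - Bop \<alpha> (U t) (U t) x)"
      using ev
    proof eventually_elim
      case (elim h)
      have "inH s (\<lambda>x. inverse (complex_of_real h) * (U (t + h) x - U t x))"
        using U t elim by (intro wsq_cmult(1) wsq_diff(1)) (auto simp: fsol_def)
      then have "inH s (\<lambda>x. (U (t + h) x - U t x) / complex_of_real h)"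
        by (simp add: divide_inverse mult.commute)
      then have "inH (s - 1) (\<lambda>x. (U (t + h) x - U t x) / complex_of_real h)"
        by (rule inH_mono(1)) simp
      from wsq_diff(1)[OF this B] show ?case using s by (intro inH_mono(2)) auto
    qed
  qed auto
qed

lemma inH_AE_eq:
  assumes "inH r U" "inH r V" "hn r (\<lambda>x. U x - V x) = 0"
  shows "AE x in lborel. U x = V x"
proof -
  have "AE x in lborel. complex_of_real (wt r 0 x) * (U x - V x) = 0"
    using n2_eq_0_AE[OF wsq_sqint[OF wsq_diff(1)[OF assms(1,2)]]] assms(3) by (simp add: wn_def)
  then show ?thesis by eventually_elim (simp add: wt_0 order_less_imp_not_eq2)
qed

lemma hn_AE_eq:
  assumes "AE x in lborel. U x = V x" "inH r U" "inH r V"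
  shows "hn r (\<lambda>x. U x - V x) = 0"
proof -
  have "AE x in lborel. U x - V x = 0" using assms(1) by eventually_elim simp
  then have "hn r (\<lambda>x. U x - V x) = hn r (\<lambda>x. 0)" by (intro wn_cong_AE wsq_diff assms(2,3)) auto
  then show ?thesis by simp
qed

lemma fsol_unique:
  assumes U: "fsol \<alpha> s T U" and V: "fsol \<alpha> s T V" and a: "0 \<le> \<alpha>" "\<alpha> \<le> 1" and s: "3/2 < s"
    and init: "AE x in lborel. U 0 x = V 0 x" and t: "0 \<le> t" "t \<le> T"
  shows "AE x in lborel. U t x = V t x"
proof -
  obtain R1 R2 where R: "\<forall>t\<in>{0..T}. hn s (U t) \<le> R1" "\<forall>t\<in>{0..T}. hn s (V t) \<le> R2"
    using fsol_bounded[OF U] fsol_bounded[OF V] by blast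
  have A: "approx_sol \<alpha> s T R1 0 U (\<lambda>t. Bop \<alpha> (U t) (U t))" "approx_sol \<alpha> s T R2 0 V (\<lambda>t. Bop \<alpha> (V t) (V t))"
    by (rule fsol_approx_sol[OF U a s], use R in auto) (rule fsol_approx_sol[OF V a s], use R in auto)
  have i: "inH (1/2) (U t)" "inH (1/2) (V t)" if "0 \<le> t" "t \<le> T" for t
    using U V s that by (auto simp: fsol_def intro: inH_mono(1)[of s])
  have "hn (1/2) (\<lambda>x. U 0 x - V 0 x) = 0" using t by (intro hn_AE_eq init i) auto
  then have "(hn (1/2) (\<lambda>x. U t x - V t x))\<^sup>2 \<le> 0"
    using stability[OF a s A _ _ t] by simp
  then show ?thesis by (intro inH_AE_eq[OF i[OF t] ]) simp
qed

text \<open>Uniform convergence in H^s is decisive: it gives strong continuity in time, and it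
  allows the limit in the mean value inequality of the scheme.\<close>

theorem fourier_existence:
  assumes s: "3/2 < s" and T: "0 < T" "T * rate s (2 * R) \<le> 1" and a: "0 \<le> \<alpha>" "\<alpha> \<le> 1"
    and U0: "inH s U0" "herm U0" "hn s U0 \<le> R"
  shows "\<exists>U. fsol \<alpha> s T U \<and> (\<forall>t\<in>{0..T}. \<forall>M\<ge>0. wn (wt s M) (U t) \<le> 2 * wn (wt s M) U0) \<and> (AE x in lborel. U 0 x = U0 x)"
proof -
  have sh: "1/2 \<le> s" using s by simp
  have R: "0 \<le> R" using order_trans[OF wn_nonneg U0(3)] .
  have U0h: "inH (1/2) U0" by (rule inH_mono(1)[OF U0(1) sh])
  \<comment> \<open>Enough steps for the restriction h times the square of \<open>jb N\<close> at
    most 1; the successor keeps their number positive.\<close>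
  define k where "k n = Suc (nat \<lceil>T * (jb (real n))\<^sup>2\<rceil>)" for n :: nat
  have kpos: "0 < real (k n)" for n by (simp add: k_def)
  define h where "h n = T / real (k n)" for n
  have ES: "euler_scheme \<alpha> s (real n) (h n) R T (k n) U0" for n
  proof
    have "T * (jb (real n))\<^sup>2 \<le> real (k n)" unfolding k_def by linarith
    then show "h n * (jb (real n))\<^sup>2 \<le> 1" using kpos[of n] by (simp add: h_def divide_simps)
    show "0 < h n" "T = real (k n) * h n" using T kpos[of n] by (simp_all add: h_def)
    show "0 < k n" using kpos[of n] by simp
  qed (use s T a U0 in auto)
  define V where "V n = euler_scheme.V \<alpha> (real n) (h n) (k n) U0" for n
  define F where "F n = euler_scheme.F \<alpha> (real n) (h n) U0" for n
  define D where "D n = euler_scheme.D \<alpha> (real n) (h n) U0" for n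
  define \<epsilon> where "\<epsilon> n = euler_scheme.err s (real n) R U0" for n
  define L where "L n = euler_scheme.L s (real n) R" for n
  note Vp = euler_scheme.V_props[OF ES, folded V_def]
  note Vlip = euler_scheme.V_lipschitz[OF ES, folded V_def L_def]
  note Vmv = euler_scheme.mean_value[OF ES, folded V_def F_def]
  note Vcons = euler_scheme.consistency[OF ES, folded V_def F_def \<epsilon>_def]
  note Vapp = euler_scheme.approximate_solution[OF ES, folded V_def D_def \<epsilon>_def]
  note \<epsilon>0 = euler_scheme.err0[OF ES, folded \<epsilon>_def]
  have hpos: "0 < h n" for n using euler_scheme.h[OF ES] by blast
  have kh: "real (k n) * h n = T" for n using T kpos[of n] by (simp add: h_def)
  have Vh: "inH (1/2) (V n t)" if "0 \<le> t" "t \<le> T" for n t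
    by (rule inH_mono(1)[OF Vp(1)[OF that] sh])
  have "filterlim (\<lambda>n. jb (real n)) at_top sequentially"
    by (rule filterlim_at_top_mono[OF filterlim_real_sequentially])
      (auto intro!: always_eventually order_trans[OF _ abs_le_jb])
  then have "(\<lambda>n. 16 * (cB s)\<^sup>2 * R^3 / jb (real n)) \<longlonglongrightarrow> 0"
    by (intro tendsto_divide_0[OF tendsto_const] filterlim_at_top_imp_at_infinity)
  moreover have "(\<lambda>n. 8 * cB s * R * wn (wt s (real n)) U0) \<longlonglongrightarrow> 8 * cB s * R * 0"
    by (intro tendsto_intros tail_tendsto_0 U0)
  ultimately have "(\<lambda>n. 8 * cB s * R * wn (wt s (real n)) U0 + 16 * (cB s)\<^sup>2 * R^3 / jb (real n)) \<longlonglongrightarrow> 8 * cB s * R * 0 + 0"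
    by (intro tendsto_add)
  then have \<epsilon>lim: "\<epsilon> \<longlonglongrightarrow> 0"
    unfolding \<epsilon>_def euler_scheme.err_def[OF ES] by simp
  \<comment> \<open>A bound for the distance between the datum and its truncation, with the factor 2
    of \<open>tail_le\<close>.\<close>
  define \<delta> where "\<delta> n = 2 * wn (wt (1/2) (real n)) U0" for n :: nat
  have \<delta>lim: "\<delta> \<longlonglongrightarrow> 0" unfolding \<delta>_def using tendsto_mult[OF tendsto_const[of 2] tail_tendsto_0[OF U0h]] by simp
  have V0: "V n 0 = proj (real n) U0" for n
    proof
    have "clamp_time (h n) i 0 = 0" for i
    proof -
      have "0 \<le> real i * h n" using hpos[of n] by simp
      then have "min (h n) (0 - real i * h n) \<le> 0" by linarith
      then show ?thesis unfolding clamp_time_def by linarith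
    qed
    then show "V n 0 x = proj (real n) U0 x" for x
      unfolding V_def euler_scheme.V_def[OF ES] by simp
  qed
  have V0\<delta>: "hn (1/2) (\<lambda>x. V n 0 x - U0 x) \<le> \<delta> n" for n
    using tail_le(2)[OF U0h, of "real n"] unfolding V0 \<delta>_def by (simp add: wn_minus_commute[of _ U0])
  define C where "C = exp (2 * cD s * (2 * R + 2 * R) * T)"
  have stab: "(hn (1/2) (\<lambda>x. V m t x - V n t x))\<^sup>2 \<le> C * ((\<delta> m + \<delta> n)\<^sup>2 + 2 * (\<epsilon> m + \<epsilon> n) * (2 * R + 2 * R) * T)"
    if t: "0 \<le> t" "t \<le> T" for m n t
  proof -
    have d0: "hn (1/2) (\<lambda>x. V m 0 x - V n 0 x) \<le> \<delta> m + \<delta> n"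
    proof -
      have "hn (1/2) (\<lambda>x. V m 0 x - V n 0 x) \<le> hn (1/2) (\<lambda>x. V m 0 x - U0 x) + hn (1/2) (\<lambda>x. U0 x - V n 0 x)"
        using T by (intro wn_triangle_diff Vh U0h) auto
      then show ?thesis using V0\<delta>[of m] V0\<delta>[of n] by (simp add: wn_minus_commute[of _ U0])
    qed
    have "(hn (1/2) (\<lambda>x. V m t x - V n t x))\<^sup>2 \<le> exp (2 * cD s * (2 * R + 2 * R) * t) *
      ((hn (1/2) (\<lambda>x. V m 0 x - V n 0 x))\<^sup>2 + 2 * (\<epsilon> m + \<epsilon> n) * (2 * R + 2 * R) * t)"
      by (rule stability[OF a s Vapp Vapp \<epsilon>0 \<epsilon>0 t])
    also have "\<dots> \<le> C * ((\<delta> m + \<delta> n)\<^sup>2 + 2 * (\<epsilon> m + \<epsilon> n) * (2 * R + 2 * R) * T)"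
      unfolding C_def using t R \<epsilon>0[of m] \<epsilon>0[of n] d0
      by (intro mult_mono add_mono power_mono mult_left_mono) (auto intro!: mult_left_mono mult_nonneg_nonneg add_nonneg_nonneg)
    finally show ?thesis .
  qed
  have cauchy: "\<exists>N. \<forall>m\<ge>N. \<forall>n\<ge>N. \<forall>t. 0 \<le> t \<longrightarrow> t \<le> T \<longrightarrow> hn (1/2) (\<lambda>x. V m t x - V n t x) < e" if e: "0 < e" for e
  proof -
    have "((\<lambda>d. C * ((d + d)\<^sup>2 + 2 * (d + d) * (2 * R + 2 * R) * T)) \<longlongrightarrow> C * ((0 + 0)\<^sup>2 + 2 * (0 + 0) * (2 * R + 2 * R) * T)) (at_right 0)"
      by (intro tendsto_intros)
    then have "\<forall>\<^sub>F d in at_right 0. C * ((d + d)\<^sup>2 + 2 * (d + d) * (2 * R + 2 * R) * T) < e\<^sup>2"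
      using e by (intro order_tendstoD(2)) auto
    then have "\<forall>\<^sub>F d in at_right 0. 0 < d \<and> C * ((d + d)\<^sup>2 + 2 * (d + d) * (2 * R + 2 * R) * T) < e\<^sup>2"
      using eventually_at_right_less[of 0] by eventually_elim auto
    then obtain d where d: "0 < d" "C * ((d + d)\<^sup>2 + 2 * (d + d) * (2 * R + 2 * R) * T) < e\<^sup>2"
      using eventually_happens'[OF trivial_limit_at_right_real] by blast
    obtain N where N: "\<And>n. n \<ge> N \<Longrightarrow> \<delta> n < d \<and> \<epsilon> n < d"
      using eventually_conj[OF order_tendstoD(2)[OF \<delta>lim d(1)] order_tendstoD(2)[OF \<epsilon>lim d(1)]]
      unfolding eventually_sequentially by blast
    show ?thesis
    proof (intro exI[of _ N] allI impI)
      fix m n t assume mn: "N \<le> m" "N \<le> n" and t: "0 \<le> t" "t \<le> T"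
      have "\<delta> n \<ge> 0" for n by (simp add: \<delta>_def)
      then have "(hn (1/2) (\<lambda>x. V m t x - V n t x))\<^sup>2 \<le> C * ((d + d)\<^sup>2 + 2 * (d + d) * (2 * R + 2 * R) * T)"
        using N[OF mn(1)] N[OF mn(2)] R T \<epsilon>0
        by (intro order_trans[OF stab[OF t]] mult_left_mono add_mono power_mono mult_right_mono) (auto simp: C_def less_imp_le)
      then have "(hn (1/2) (\<lambda>x. V m t x - V n t x))\<^sup>2 < e\<^sup>2" using d by simp
      then show "hn (1/2) (\<lambda>x. V m t x - V n t x) < e" using e by (simp add: power2_less_imp_less)
    qed
  qed
  have "\<exists>U. inH (1/2) U \<and> herm U \<and> (\<lambda>n. hn (1/2) (\<lambda>x. V n t x - U x)) \<longlonglongrightarrow> 0" if t: "0 \<le> t" "t \<le> T" for t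
    using cauchy t by (intro inH_complete_herm Vh Vp) blast+
  then have "\<exists>U. \<forall>t. 0 \<le> t \<longrightarrow> t \<le> T \<longrightarrow> inH (1/2) (U t) \<and> herm (U t) \<and> (\<lambda>n. hn (1/2) (\<lambda>x. V n t x - U t x)) \<longlonglongrightarrow> 0"
    by (intro choice) blast
  then obtain U where U: "\<And>t. 0 \<le> t \<Longrightarrow> t \<le> T \<Longrightarrow> inH (1/2) (U t)" "\<And>t. 0 \<le> t \<Longrightarrow> t \<le> T \<Longrightarrow> herm (U t)"
    "\<And>t. 0 \<le> t \<Longrightarrow> t \<le> T \<Longrightarrow> (\<lambda>n. hn (1/2) (\<lambda>x. V n t x - U t x)) \<longlonglongrightarrow> 0" by blast
  have Utail: "wsq (wt s M) (U t)" "wn (wt s M) (U t) \<le> 2 * wn (wt s M) U0" if "0 \<le> t" "t \<le> T" "0 \<le> M" for t M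
    using wn_lower_semicontinuous[OF U(1)[OF that(1,2)] Vp(1)[OF that(1,2)] that(3) sh _ U(3)[OF that(1,2)] Vp(3)[OF that]] by auto
  have Us: "inH s (U t)" "hn s (U t) \<le> 2 * R" if "0 \<le> t" "t \<le> T" for t
    using Utail[OF that, of 0] U0(3) by auto
  \<comment> \<open>Both the approximation and its limit have tails at most twice those of U0, so
    their difference is admissible in \<open>small_if_tail_controlled\<close>.\<close>
  have unif: "\<exists>N. \<forall>n\<ge>N. \<forall>t. 0 \<le> t \<longrightarrow> t \<le> T \<longrightarrow> hn s (\<lambda>x. V n t x - U t x) \<le> e" if e: "0 < e" for e
  proof -
    obtain d where d: "0 < d" "\<And>W. inH s W \<Longrightarrow> (\<And>M. M \<ge> 0 \<Longrightarrow> wn (wt s M) W \<le> 4 * wn (wt s M) U0) \<Longrightarrow> hn (1/2) W \<le> d \<Longrightarrow> hn s W \<le> e"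
      using small_if_tail_controlled[OF U0(1) sh e] by blast
    obtain N where N: "\<And>m n t. m \<ge> N \<Longrightarrow> n \<ge> N \<Longrightarrow> 0 \<le> t \<Longrightarrow> t \<le> T \<Longrightarrow> hn (1/2) (\<lambda>x. V m t x - V n t x) < d"
      using cauchy[OF d(1)] by blast
    show ?thesis
    proof (intro exI[of _ N] allI impI)
      fix n t assume n: "n \<ge> N" and t: "0 \<le> t" "t \<le> T"
      show "hn s (\<lambda>x. V n t x - U t x) \<le> e"
      proof (rule d(2))
        show "inH s (\<lambda>x. V n t x - U t x)" by (intro wsq_diff(1) Vp(1) Us t)
        show "wn (wt s M) (\<lambda>x. V n t x - U t x) \<le> 4 * wn (wt s M) U0" if M: "0 \<le> M" for M
          using wsq_diff(2)[OF inH_tail(1)[OF Vp(1)[OF t] M] Utail(1)[OF t M], of n] Vp(3)[OF t M, of n] Utail(2)[OF t M] by simp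
        have "(\<lambda>m. d + hn (1/2) (\<lambda>x. V m t x - U t x)) \<longlonglongrightarrow> d + 0" by (intro tendsto_intros U(3) t)
        moreover have "\<forall>m\<ge>N. hn (1/2) (\<lambda>x. V n t x - U t x) \<le> d + hn (1/2) (\<lambda>x. V m t x - U t x)"
        proof (intro allI impI)
          fix m assume "m \<ge> N"
          then have "hn (1/2) (\<lambda>x. V n t x - V m t x) < d" using N n t by blast
          then show "hn (1/2) (\<lambda>x. V n t x - U t x) \<le> d + hn (1/2) (\<lambda>x. V m t x - U t x)"
            using wn_triangle_diff[OF Vh[OF t] Vh[OF t] U(1)[OF t], of n m] by simp
        qed
        ultimately show "hn (1/2) (\<lambda>x. V n t x - U t x) \<le> d" by (intro LIMSEQ_le_const[of _ d]) auto
      qed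
    qed
  qed
  have init: "AE x in lborel. U 0 x = U0 x"
  proof -
    have t: "0 \<le> (0::real)" "0 \<le> T" using T by auto
    have "(\<lambda>n. hn (1/2) (\<lambda>x. V n 0 x - U 0 x) + \<delta> n) \<longlonglongrightarrow> 0 + 0"
      by (intro tendsto_add U(3) t \<delta>lim)
    moreover have "hn (1/2) (\<lambda>x. U 0 x - U0 x) \<le> hn (1/2) (\<lambda>x. V n 0 x - U 0 x) + \<delta> n" for n
      using wn_triangle_diff[OF U(1)[OF t] Vh[OF t] U0h, of n] V0\<delta>[of n] by (simp add: wn_minus_commute[of _ "U 0"])
    ultimately have "hn (1/2) (\<lambda>x. U 0 x - U0 x) \<le> 0" by (intro LIMSEQ_le_const) auto
    then have "hn (1/2) (\<lambda>x. U 0 x - U0 x) = 0" by (simp add: order_antisym)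
    then show ?thesis by (intro inH_AE_eq[OF U(1)[OF t] U0h])
  qed
  \<comment> \<open>A uniform limit of curves that are Lipschitz in time. The constant
    \<open>L n\<close> depends on n, so n is fixed before the time distance d.\<close>
  have cont: "((\<lambda>r. hn s (\<lambda>x. U r x - U t x)) \<longlongrightarrow> 0) (at t within {0..T})" if t: "0 \<le> t" "t \<le> T" for t
  proof (rule tendstoI)
    fix e :: real assume e: "0 < e"
    obtain n where n: "\<And>t. 0 \<le> t \<Longrightarrow> t \<le> T \<Longrightarrow> hn s (\<lambda>x. V n t x - U t x) \<le> e / 4" using unif[of "e/4"] e by auto
    define d where "d = e / 4 / (L n + 1)"
    have L0: "0 \<le> L n" unfolding L_def by (rule euler_scheme.L0[OF ES])
    have d: "0 < d" "L n * d \<le> e / 4" using e L0 by (auto simp: d_def field_simps)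
    have "hn s (\<lambda>x. U r x - U t x) < e" if r: "r \<in> {0..T}" "dist r t < d" for r
    proof -
      have r': "0 \<le> r" "r \<le> T" using r by auto
      have "hn s (\<lambda>x. U r x - U t x) \<le> hn s (\<lambda>x. U r x - V n r x) + hn s (\<lambda>x. V n r x - U t x)"
        by (intro wn_triangle_diff Us Vp r' t)
      also have "hn s (\<lambda>x. V n r x - U t x) \<le> hn s (\<lambda>x. V n r x - V n t x) + hn s (\<lambda>x. V n t x - U t x)"
        by (intro wn_triangle_diff Us Vp r' t)
      also have "hn s (\<lambda>x. V n r x - V n t x) \<le> L n * \<bar>r - t\<bar>" by (intro Vlip r' t)
      also have "\<dots> \<le> L n * d" using r L0 by (intro mult_left_mono) (auto simp: dist_real_def)
      finally show ?thesis using n[OF r'] n[OF t] d e by (simp add: wn_minus_commute[of _ "U r"])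
    qed
    then show "\<forall>\<^sub>F r in at t within {0..T}. dist (hn s (\<lambda>x. U r x - U t x)) 0 < e"
      unfolding eventually_at using d by (auto intro!: exI[of _ d])
  qed
  \<comment> \<open>The mean value inequality is applied to the approximations on [p, q] with the
    fixed slope \<open>Bop \<alpha> (U t) (U t)\<close>; the number of the approximation is chosen
    after p < q.\<close>
  have deriv: "((\<lambda>r. hn (s - 1) (\<lambda>x. (U r x - U t x) / complex_of_real (r - t) - Bop \<alpha> (U t) (U t) x)) \<longlongrightarrow> 0) (at t within {0..T})"
    if t: "0 \<le> t" "t \<le> T" for t
  proof (rule tendstoI)
    fix e0 :: real assume e0: "0 < e0"
    \<comment> \<open>Half of e0, since the argument below ends with a weak inequality.\<close>
    define e where "e = e0 / 2"
    have e: "0 < e" using e0 by (simp add: e_def)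
    let ?B = "Bop \<alpha> (U t) (U t)"
    have Bs: "inH (s - 1) (Bop \<alpha> (U r) (U r))" if "0 \<le> r" "r \<le> T" for r
      by (intro Bop_inH(1)[OF a s] Us that)
    define c where "c = 4 * cB s * R"
    have c0: "0 \<le> c" using R by (simp add: c_def)
    have Blip: "hn (s - 1) (\<lambda>x. Bop \<alpha> A A x - Bop \<alpha> A' A' x) \<le> c * hn s (\<lambda>x. A x - A' x)"
      if "inH s A" "inH s A'" "hn s A \<le> 2 * R" "hn s A' \<le> 2 * R" for A A'
    proof -
      have "hn (s - 1) (\<lambda>x. Bop \<alpha> A A x - Bop \<alpha> A' A' x) \<le> cB s * (hn s A + hn s A') * hn s (\<lambda>x. A x - A' x)"
        by (rule Bop_lipschitz[OF a s that(1,2)])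
      also have "\<dots> \<le> cB s * (2 * R + 2 * R) * hn s (\<lambda>x. A x - A' x)"
        using that by (intro mult_right_mono mult_left_mono add_mono) auto
      finally show ?thesis by (simp add: c_def)
    qed
    have "\<forall>\<^sub>F r in at t within {0..T}. hn s (\<lambda>x. U r x - U t x) < e / 2 / (c + 1)"
      using order_tendstoD(2)[OF cont[OF t], of "e / 2 / (c + 1)"] e c0 by (simp add: add_nonneg_pos)
    then obtain d where d: "0 < d" "\<And>r. r \<in> {0..T} \<Longrightarrow> r \<noteq> t \<Longrightarrow> dist r t < d \<Longrightarrow> hn s (\<lambda>x. U r x - U t x) < e / 2 / (c + 1)"
      unfolding eventually_at by auto
    have Bd: "hn (s - 1) (\<lambda>x. Bop \<alpha> (U r) (U r) x - ?B x) \<le> e / 2" if r: "0 \<le> r" "r \<le> T" "\<bar>r - t\<bar> < d" for r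
    proof (cases "r = t")
      case True
      then show ?thesis using e by simp
    next
      case False
      have "hn (s - 1) (\<lambda>x. Bop \<alpha> (U r) (U r) x - ?B x) \<le> c * hn s (\<lambda>x. U r x - U t x)"
        by (intro Blip Us r t)
      also have "\<dots> \<le> c * (e / 2 / (c + 1))"
        using d(2)[of r] False r c0 by (intro mult_left_mono) (auto simp: dist_real_def)
      also have "\<dots> \<le> e / 2" using c0 e by (simp add: field_simps)
      finally show ?thesis .
    qed
    have key: "hn (s - 1) (\<lambda>x. U q x - U p x - complex_of_real (q - p) * ?B x) \<le> (q - p) * e"
      if p: "0 \<le> p" "p < q" "q \<le> T" and pq: "\<bar>p - t\<bar> < d" "\<bar>q - t\<bar> < d" for p q
    proof -
      \<comment> \<open>Chosen so that the errors of replacing the approximation by U, namely (q -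
        p) (1 + c) \<eta> in the slope and 2 \<eta> at the endpoints, amount to half of (q - p)
        e.\<close>
      define \<eta> where "\<eta> = (q - p) * (e / 2) / ((q - p) * (1 + c) + 2)"
      have den: "0 < (q - p) * (1 + c) + 2" using p c0 by (intro add_nonneg_pos mult_nonneg_nonneg) auto
      have \<eta>: "0 < \<eta>" using p e den by (simp add: \<eta>_def)
      have \<eta>e: "\<eta> * ((q - p) * (1 + c) + 2) = (q - p) * (e / 2)"
      proof -
        have "A / B * B = A" if "0 < B" for A B :: real using that by simp
        from this[OF den] show ?thesis unfolding \<eta>_def .
      qed
      obtain N1 where N1: "\<And>n t. n \<ge> N1 \<Longrightarrow> 0 \<le> t \<Longrightarrow> t \<le> T \<Longrightarrow> hn s (\<lambda>x. V n t x - U t x) \<le> \<eta>" using unif[OF \<eta>] by blast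
      obtain N2 where N2: "\<And>n. n \<ge> N2 \<Longrightarrow> \<epsilon> n < \<eta>"
        using order_tendstoD(2)[OF \<epsilon>lim \<eta>] unfolding eventually_sequentially by blast
      define n where "n = max N1 N2"
      have n1: "hn s (\<lambda>x. V n t x - U t x) \<le> \<eta>" if "0 \<le> t" "t \<le> T" for t using N1 that by (simp add: n_def)
      have n2: "\<epsilon> n \<le> \<eta>" using N2[of n] by (simp add: n_def)
      have T': "0 \<le> q" "p \<le> T" using p by auto
      have Vs: "inH (s - 1) (V n r)" and Us1: "inH (s - 1) (U r)" if "0 \<le> r" "r \<le> T" for r
        using Vp(1)[OF that] Us(1)[OF that] by (auto intro: inH_mono(1)[of s])
      have mv: "hn (s - 1) (\<lambda>x. V n q x - V n p x - complex_of_real (q - p) * ?B x) \<le> (q - p) * (\<eta> + c * \<eta> + e / 2)"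
      proof (rule Vmv)
        fix i assume i: "i < k n" "real i * h n < q" "p < real i * h n + h n"
        \<comment> \<open>A time in cell i that also lies in [p, q), at which the slope can be
          compared with the nonlinearity.\<close>
        define \<tau> where "\<tau> = max p (real i * h n)"
        have \<tau>: "real i * h n \<le> \<tau>" "\<tau> \<le> real i * h n + h n" "p \<le> \<tau>" "\<tau> < q"
          using i p hpos[of n] by (auto simp: \<tau>_def)
        have \<tau>T: "0 \<le> \<tau>" "\<tau> \<le> T" using \<tau> p by auto
        have \<tau>d: "\<bar>\<tau> - t\<bar> < d" using pq \<tau> by (auto simp: abs_less_iff)
        have Fi: "inH (s - 1) (F n i)"
          unfolding F_def by (rule inH_mono(1)[OF euler_scheme.F_props(1)[OF ES less_imp_le[OF i(1)]]]) simp
        have BV: "inH (s - 1) (Bop \<alpha> (V n \<tau>) (V n \<tau>))" by (intro Bop_inH(1)[OF a s] Vp \<tau>T)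
        have "hn (s - 1) (\<lambda>x. F n i x - ?B x) \<le> hn (s - 1) (\<lambda>x. F n i x - Bop \<alpha> (V n \<tau>) (V n \<tau>) x)
            + hn (s - 1) (\<lambda>x. Bop \<alpha> (V n \<tau>) (V n \<tau>) x - ?B x)"
          by (intro wn_triangle_diff Fi BV Bs t)
        also have "hn (s - 1) (\<lambda>x. F n i x - Bop \<alpha> (V n \<tau>) (V n \<tau>) x) \<le> \<eta>"
          by (rule order_trans[OF Vcons[OF i(1) \<tau>(1,2)] n2])
        also have "hn (s - 1) (\<lambda>x. Bop \<alpha> (V n \<tau>) (V n \<tau>) x - ?B x)
          \<le> hn (s - 1) (\<lambda>x. Bop \<alpha> (V n \<tau>) (V n \<tau>) x - Bop \<alpha> (U \<tau>) (U \<tau>) x) + hn (s - 1) (\<lambda>x. Bop \<alpha> (U \<tau>) (U \<tau>) x - ?B x)"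
          by (intro wn_triangle_diff BV Bs t \<tau>T)
        also have "hn (s - 1) (\<lambda>x. Bop \<alpha> (V n \<tau>) (V n \<tau>) x - Bop \<alpha> (U \<tau>) (U \<tau>) x) \<le> c * \<eta>"
          by (rule order_trans[OF Blip[OF Vp(1)[OF \<tau>T] Us(1)[OF \<tau>T] Vp(4)[OF \<tau>T] Us(2)[OF \<tau>T]] mult_left_mono[OF n1[OF \<tau>T] c0]])
        also have "hn (s - 1) (\<lambda>x. Bop \<alpha> (U \<tau>) (U \<tau>) x - ?B x) \<le> e / 2" by (rule Bd[OF \<tau>T \<tau>d])
        finally show "hn (s - 1) (\<lambda>x. F n i x - ?B x) \<le> \<eta> + c * \<eta> + e / 2" by simp
      qed (use p c0 \<eta> e Bs[OF t] in auto)
      define X where "X x = V n q x - V n p x - complex_of_real (q - p) * ?B x" for x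
      define Y where "Y x = V n q x - U q x" for x
      define Z where "Z x = V n p x - U p x" for x
      have X: "inH (s - 1) X" unfolding X_def by (intro wsq_diff(1) wsq_cmult(1) Vs Bs t p T')
      have Y: "inH s Y" and Z: "inH s Z" unfolding Y_def Z_def by (intro wsq_diff(1) Vp Us p T')+
      have Y1: "inH (s - 1) Y" "hn (s - 1) Y \<le> \<eta>"
        using inH_mono[OF Y, of "s - 1"] n1[OF T'(1) p(3)] unfolding Y_def[abs_def, symmetric] by auto
      have Z1: "inH (s - 1) Z" "hn (s - 1) Z \<le> \<eta>"
        using inH_mono[OF Z, of "s - 1"] n1[OF p(1) T'(2)] unfolding Z_def[abs_def, symmetric] by auto
      have "hn (s - 1) (\<lambda>x. U q x - U p x - complex_of_real (q - p) * ?B x) = hn (s - 1) (\<lambda>x. X x - (Y x - Z x))"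
        by (rule arg_cong[where f = "hn (s - 1)"]) (auto simp: X_def Y_def Z_def algebra_simps)
      also have "\<dots> \<le> hn (s - 1) X + hn (s - 1) (\<lambda>x. Y x - Z x)" by (intro wsq_diff(2) wsq_diff(1) X Y1 Z1)
      also have "\<dots> \<le> hn (s - 1) X + (hn (s - 1) Y + hn (s - 1) Z)" by (intro add_left_mono wsq_diff(2) Y1 Z1)
      also have "\<dots> \<le> (q - p) * (\<eta> + c * \<eta> + e / 2) + (\<eta> + \<eta>)"
        using mv Y1 Z1 unfolding X_def[abs_def, symmetric] by (intro add_mono) auto
      also have "\<dots> = \<eta> * ((q - p) * (1 + c) + 2) + (q - p) * (e / 2)" by (simp add: algebra_simps)
      also have "\<dots> = (q - p) * e" unfolding \<eta>e by (simp add: algebra_simps)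
      finally show ?thesis .
    qed
    have "hn (s - 1) (\<lambda>x. (U r x - U t x) / complex_of_real (r - t) - ?B x) < e0"
      if r: "r \<in> {0..T}" "r \<noteq> t" "dist r t < d" for r
    proof -
      define p q where "p = min r t" and "q = max r t"
      have pq: "0 \<le> p" "p < q" "q \<le> T" "\<bar>p - t\<bar> < d" "\<bar>q - t\<bar> < d"
        using r t d(1) by (auto simp: p_def q_def dist_real_def min_def max_def)
      have "(\<lambda>x. (U r x - U t x) / complex_of_real (r - t) - ?B x)
          = (\<lambda>x. inverse (complex_of_real (q - p)) * (U q x - U p x - complex_of_real (q - p) * ?B x))"
      proof
        fix x
        have "(U r x - U t x) / complex_of_real (r - t) = (U q x - U p x) / complex_of_real (q - p)"
          unfolding p_def q_def using r(2) minus_divide_divide[of "U r x - U t x" "complex_of_real (r - t)"]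
          by (auto simp: min_def max_def)
        then show "(U r x - U t x) / complex_of_real (r - t) - ?B x
          = inverse (complex_of_real (q - p)) * (U q x - U p x - complex_of_real (q - p) * ?B x)"
          using pq(2) by (simp add: field_simps)
      qed
      moreover have "inH (s - 1) (\<lambda>x. U q x - U p x - complex_of_real (q - p) * ?B x)"
        using pq by (intro wsq_diff(1) wsq_cmult(1) Bs t inH_mono(1)[OF Us(1)]) auto
      ultimately have "hn (s - 1) (\<lambda>x. (U r x - U t x) / complex_of_real (r - t) - ?B x)
          = cmod (inverse (complex_of_real (q - p))) * hn (s - 1) (\<lambda>x. U q x - U p x - complex_of_real (q - p) * ?B x)"
        by (simp only: wsq_cmult(2))
      also have "cmod (inverse (complex_of_real (q - p))) = inverse (q - p)"
        using pq by (simp only: norm_inverse norm_of_real abs_of_pos diff_gt_0_iff_gt)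
      also have "inverse (q - p) * hn (s - 1) (\<lambda>x. U q x - U p x - complex_of_real (q - p) * ?B x) \<le> inverse (q - p) * ((q - p) * e)"
        using pq by (intro mult_left_mono key) auto
      also have "\<dots> = e" using pq by simp
      also have "\<dots> < e0" using e0 by (simp add: e_def)
      finally show ?thesis .
    qed
    then show "\<forall>\<^sub>F r in at t within {0..T}. dist (hn (s - 1) (\<lambda>x. (U r x - U t x) / complex_of_real (r - t) - ?B x)) 0 < e0"
      unfolding eventually_at using d(1) by (auto intro!: exI[of _ d])
  qed
  have "fsol \<alpha> s T U" unfolding fsol_def using U(2) Us(1) cont deriv by auto
  then show ?thesis using Utail(2) init by auto
qed

text \<open>All solutions have the same datum, so \<open>stability\<close> sees only the modelling
  error, a positive power of \<alpha> in H^(1/2). The common tail bounds turn this into smallness in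
  H^s.\<close>

theorem fourier_zero_filter_limit:
  assumes s: "3/2 < s" and T: "0 \<le> T" and U0: "inH s U0" "hn s U0 \<le> R"
    and U: "\<And>\<alpha>. 0 \<le> \<alpha> \<Longrightarrow> \<alpha> < 1 \<Longrightarrow> fsol \<alpha> s T (U \<alpha>)"
    and tail: "\<And>\<alpha> t M. 0 \<le> \<alpha> \<Longrightarrow> \<alpha> < 1 \<Longrightarrow> 0 \<le> t \<Longrightarrow> t \<le> T \<Longrightarrow> 0 \<le> M \<Longrightarrow> wn (wt s M) (U \<alpha> t) \<le> 2 * wn (wt s M) U0"
    and init: "\<And>\<alpha>. 0 \<le> \<alpha> \<Longrightarrow> \<alpha> < 1 \<Longrightarrow> AE x in lborel. U \<alpha> 0 x = U0 x"
    and e: "0 < e"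
  shows "\<forall>\<^sub>F \<alpha> in at_right 0. \<forall>t\<in>{0..T}. hn s (\<lambda>x. U \<alpha> t x - U 0 t x) \<le> e"
proof -
  have sh: "1/2 \<le> s" using s by simp
  have R: "0 \<le> R" using order_trans[OF wn_nonneg U0(2)] .
  obtain d where d: "0 < d" "\<And>W. inH s W \<Longrightarrow> (\<And>M. M \<ge> 0 \<Longrightarrow> wn (wt s M) W \<le> 4 * wn (wt s M) U0) \<Longrightarrow> hn (1/2) W \<le> d \<Longrightarrow> hn s W \<le> e"
    using small_if_tail_controlled[OF U0(1) sh e] by blast
  define p where "p = min 1 (s - 3/2)"
  have p: "0 < p" using s by (simp add: p_def)
  define \<epsilon> where "\<epsilon> \<alpha> = \<alpha> powr p * (cB s * (2 * R)\<^sup>2)" for \<alpha>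
  define g where "g \<alpha> = exp (2 * cD s * (2 * R + 2 * R) * T) * (2 * (\<epsilon> \<alpha> + 0) * (2 * R + 2 * R) * T)" for \<alpha>
  have "((\<lambda>\<alpha>. \<alpha> powr p) \<longlongrightarrow> 0 powr p) (at_right 0)"
    using p by (intro tendsto_powr' tendsto_intros) (auto simp: eventually_at_filter)
  then have "((\<lambda>\<alpha>. \<alpha> powr p) \<longlongrightarrow> 0) (at_right 0)" by simp
  then have "(g \<longlongrightarrow> exp (2 * cD s * (2 * R + 2 * R) * T) * (2 * (0 * (cB s * (2 * R)\<^sup>2) + 0) * (2 * R + 2 * R) * T)) (at_right 0)"
    unfolding g_def \<epsilon>_def by (intro tendsto_intros)
  then have "\<forall>\<^sub>F \<alpha> in at_right 0. g \<alpha> < d\<^sup>2" using d by (intro order_tendstoD(2)) auto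
  moreover have "\<forall>\<^sub>F \<alpha> in at_right 0. \<alpha> \<in> {0<..<1::real}" by (intro eventually_at_right_real) auto
  ultimately show ?thesis
  proof eventually_elim
    case (elim \<alpha>)
    then have a: "0 \<le> \<alpha>" "\<alpha> < 1" "\<alpha> \<le> 1" by auto
    have bd: "hn s (U \<beta> t) \<le> 2 * R" if "0 \<le> \<beta>" "\<beta> < 1" "0 \<le> t" "t \<le> T" for \<beta> t
      using tail[OF that, of 0] U0(2) by simp
    have i: "inH s (U \<beta> t)" if "0 \<le> \<beta>" "\<beta> < 1" "0 \<le> t" "t \<le> T" for \<beta> t
      using U[OF that(1,2)] that by (auto simp: fsol_def)
    have A1: "approx_sol 0 s T (2 * R) (\<epsilon> \<alpha>) (U \<alpha>) (\<lambda>t. Bop \<alpha> (U \<alpha> t) (U \<alpha> t))"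
    proof (rule fsol_approx_sol[OF U[OF a(1,2)] a(1,3) s])
      fix t assume t: "0 \<le> t" "t < T"
      have "hn (1/2) (\<lambda>x. Bop \<alpha> (U \<alpha> t) (U \<alpha> t) x - Bop 0 (U \<alpha> t) (U \<alpha> t) x) \<le> \<alpha> powr p * (cB s * (hn s (U \<alpha> t))\<^sup>2)"
        unfolding p_def using t a by (intro consistency_bound i s) auto
      also have "\<dots> \<le> \<epsilon> \<alpha>" unfolding \<epsilon>_def using bd[of \<alpha> t] t a by (intro mult_left_mono power_mono) auto
      finally show "hn (1/2) (\<lambda>x. Bop \<alpha> (U \<alpha> t) (U \<alpha> t) x - Bop 0 (U \<alpha> t) (U \<alpha> t) x) \<le> \<epsilon> \<alpha>" .
    qed (use bd a in auto)
    have A2: "approx_sol 0 s T (2 * R) 0 (U 0) (\<lambda>t. Bop 0 (U 0 t) (U 0 t))"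
      by (rule fsol_approx_sol[OF U _ _ s]) (use bd in auto)
    show ?case
    proof
      fix t assume "t \<in> {0..T}"
      then have t: "0 \<le> t" "t \<le> T" by auto
      have h0: "hn (1/2) (\<lambda>x. U \<alpha> 0 x - U 0 0 x) = 0"
      proof (rule hn_AE_eq)
        show "AE x in lborel. U \<alpha> 0 x = U 0 0 x" using init[OF a(1,2)] init[of 0] by auto
      qed (use i T a sh in \<open>auto intro: inH_mono(1)[of s]\<close>)
      have "0 \<le> \<epsilon> \<alpha>" by (simp add: \<epsilon>_def)
      from stability[OF _ _ s A1 A2 this order_refl t]
      have "(hn (1/2) (\<lambda>x. U \<alpha> t x - U 0 t x))\<^sup>2 \<le> exp (2 * cD s * (2 * R + 2 * R) * t) * (2 * (\<epsilon> \<alpha> + 0) * (2 * R + 2 * R) * t)"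
        using h0 by simp
      also have "\<dots> \<le> g \<alpha>"
        unfolding g_def using t R \<open>0 \<le> \<epsilon> \<alpha>\<close> by (intro mult_mono) (auto intro!: mult_left_mono)
      also have "\<dots> \<le> d\<^sup>2" using elim by simp
      finally have "hn (1/2) (\<lambda>x. U \<alpha> t x - U 0 t x) \<le> d" using d by (simp add: power2_le_iff_abs_le)
      then show "hn s (\<lambda>x. U \<alpha> t x - U 0 t x) \<le> e"
      proof (rule d(2)[rotated 2])
        show "inH s (\<lambda>x. U \<alpha> t x - U 0 t x)" using a t by (intro wsq_diff(1) i) auto
        show "wn (wt s M) (\<lambda>x. U \<alpha> t x - U 0 t x) \<le> 4 * wn (wt s M) U0" if M: "0 \<le> M" for M
          using wsq_diff(2)[OF inH_tail(1)[OF i M] inH_tail(1)[OF i M], of \<alpha> t 0 t] tail[of \<alpha> t M] tail[of 0 t M] a t M by simp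
      qed
    qed
  qed
qed

section \<open>The Fourier transform on \<open>L\<^sup>2\<close>\<close>

definition ft :: "(real \<Rightarrow> complex) \<Rightarrow> real \<Rightarrow> complex" where
  "ft g \<xi> = (LINT x|lborel. exp (- (\<i> * complex_of_real (x * \<xi>))) * g x)"

lemma borel_measurable_cnj:
  "f \<in> borel_measurable M \<Longrightarrow> (\<lambda>x. cnj (f x)) \<in> borel_measurable M"
  by (intro borel_measurable_continuous_on[of cnj] continuous_intros) 

lemma ft_integrand_integrable:
  assumes "integrable lborel g"
  shows "integrable lborel (\<lambda>x. exp (- (\<i> * complex_of_real (x * \<xi>))) * g x)"
  by (rule Bochner_Integration.integrable_bound[OF assms]) (use assms in \<open>auto simp: norm_mult\<close>)

lemma ft_measurable [measurable (raw)]: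
  assumes [measurable]: "g \<in> borel_measurable borel"
  shows "ft g \<in> borel_measurable borel"
proof -
  have "(\<lambda>p. exp (- (\<i> * complex_of_real (snd p * fst p))) * g (snd p)) \<in> borel_measurable (borel \<Otimes>\<^sub>M lborel)"
    by measurable
  then have "(\<lambda>\<xi>. LINT x|lborel. exp (- (\<i> * complex_of_real (x * \<xi>))) * g x) \<in> borel_measurable borel"
    by (intro lborel.borel_measurable_lebesgue_integral) (simp add: split_beta')
  then show ?thesis unfolding ft_def[abs_def] .
qed

lemma cmod_ft_le: "integrable lborel g \<Longrightarrow> cmod (ft g \<xi>) \<le> (LINT x|lborel. cmod (g x))"
  unfolding ft_def using integral_norm_bound[of lborel "\<lambda>x. exp (- (\<i> * complex_of_real (x * \<xi>))) * g x"]
  by (simp add: norm_mult)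

lemma ft_cmult: "ft (\<lambda>x. c * g x) \<xi> = c * ft g \<xi>"
  unfolding ft_def using integral_mult_right_zero[of lborel c "\<lambda>x. exp (- (\<i> * complex_of_real (x * \<xi>))) * g x"]
  by (simp add: mult_ac)

lemma ft_add: "integrable lborel f \<Longrightarrow> integrable lborel g \<Longrightarrow> ft (\<lambda>x. f x + g x) \<xi> = ft f \<xi> + ft g \<xi>"
  unfolding ft_def by (simp only: distrib_left Bochner_Integration.integral_add ft_integrand_integrable)

lemma ft_diff: "integrable lborel f \<Longrightarrow> integrable lborel g \<Longrightarrow> ft (\<lambda>x. f x - g x) \<xi> = ft f \<xi> - ft g \<xi>"
  unfolding ft_def by (simp only: right_diff_distrib Bochner_Integration.integral_diff ft_integrand_integrable)

lemma ft_cnj: "ft (\<lambda>x. cnj (g x)) \<xi> = cnj (ft g (- \<xi>))"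
proof -
  have "ft (\<lambda>x. cnj (g x)) \<xi> = (LINT x|lborel. cnj (exp (- (\<i> * complex_of_real (x * - \<xi>))) * g x))"
    unfolding ft_def by (simp add: exp_cnj)
  then show ?thesis unfolding ft_def by (simp only: Bochner_Integration.integral_cnj)
qed

lemma ft_reflect: "ft (\<lambda>x. g (- x)) \<xi> = ft g (- \<xi>)"
  unfolding ft_def
  using lborel_integral_real_affine[of "-1" "\<lambda>x. exp (- (\<i> * complex_of_real (x * - \<xi>))) * g x" 0] by simp

lemma integral_reflect_lborel: "(LINT x|lborel. f (- x)) = (LINT x|lborel. f x)" for f :: "real \<Rightarrow> complex"
  using lborel_integral_real_affine[of "-1" f 0] by simp

lemma pair_product_integrable:
  fixes f g :: "real \<Rightarrow> complex"
  assumes f: "integrable lborel f" and g: "integrable lborel g"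
    and [measurable]: "e \<in> borel_measurable (borel \<Otimes>\<^sub>M borel)" and e: "\<And>p. cmod (e p) \<le> 1"
  shows "integrable (lborel \<Otimes>\<^sub>M lborel) (\<lambda>p. e p * (f (fst p) * g (snd p)))"
proof -
  have [measurable]: "f \<in> borel_measurable borel" "g \<in> borel_measurable borel" using f g by auto
  define A B where "A = (LINT x|lborel. cmod (f x))" and "B = (LINT x|lborel. cmod (g x))"
  have AB: "0 \<le> A" "0 \<le> B" by (auto simp: A_def B_def)
  have fA: "(\<integral>\<^sup>+x. ennreal (cmod (f x)) \<partial>lborel) = ennreal A" "(\<integral>\<^sup>+x. ennreal (cmod (g x)) \<partial>lborel) = ennreal B"
    unfolding A_def B_def using f g by (auto intro!: nn_integral_eq_integral)
  have "(\<integral>\<^sup>+x. (\<integral>\<^sup>+y. ennreal (cmod (e (x, y) * (f x * g y))) \<partial>lborel) \<partial>lborel)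
    \<le> (\<integral>\<^sup>+x. (\<integral>\<^sup>+y. ennreal (cmod (f x)) * ennreal (cmod (g y)) \<partial>lborel) \<partial>lborel)"
  proof (intro nn_integral_mono)
    fix x y
    have "cmod (e (x, y)) * (cmod (f x) * cmod (g y)) \<le> 1 * (cmod (f x) * cmod (g y))"
      by (intro mult_right_mono e) auto
    then show "ennreal (cmod (e (x, y) * (f x * g y))) \<le> ennreal (cmod (f x)) * ennreal (cmod (g y))"
      by (simp add: norm_mult ennreal_mult[symmetric] ennreal_leI)
  qed
  also have "\<dots> = ennreal (A * B)" using AB by (simp add: nn_integral_cmult nn_integral_multc fA ennreal_mult)
  finally have le: "(\<integral>\<^sup>+x. (\<integral>\<^sup>+y. ennreal (cmod (e (x, y) * (f x * g y))) \<partial>lborel) \<partial>lborel) \<le> ennreal (A * B)" .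
  show ?thesis by (rule pair_integrable(1)[of _ "A * B"]) (use le AB in auto)
qed

lemma ft_multiplication_formula:
  assumes f: "integrable lborel f" and g: "integrable lborel g"
  shows "(LINT \<xi>|lborel. ft f \<xi> * g \<xi>) = (LINT x|lborel. f x * ft g x)"
proof -
  define e where "e p = exp (- (\<i> * complex_of_real (fst p * snd p)))" for p :: "real \<times> real"
  have i: "integrable (lborel \<Otimes>\<^sub>M lborel) (\<lambda>p. e p * (f (fst p) * g (snd p)))"
    by (rule pair_product_integrable[OF f g]) (auto simp: e_def)
  have "(LINT \<xi>|lborel. ft f \<xi> * g \<xi>) = (LINT \<xi>|lborel. LINT x|lborel. e (x, \<xi>) * (f x * g \<xi>))"
    unfolding ft_def e_def
    by (intro Bochner_Integration.integral_cong refl) (subst integral_mult_left_zero[symmetric], simp add: mult_ac)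
  also have "\<dots> = (LINT x|lborel. LINT \<xi>|lborel. e (x, \<xi>) * (f x * g \<xi>))"
    using lborel_pair.Fubini_integral[of "\<lambda>x \<xi>. e (x, \<xi>) * (f x * g \<xi>)"] i by (simp add: split_beta')
  also have "\<dots> = (LINT x|lborel. f x * ft g x)"
    unfolding ft_def e_def
    by (intro Bochner_Integration.integral_cong refl) (subst integral_mult_right_zero[symmetric], simp add: mult_ac)
  finally show ?thesis .
qed

section \<open>Gaussians and their Fourier transforms\<close>

definition gauss :: "real \<Rightarrow> complex" where
  "gauss x = complex_of_real (exp (- x\<^sup>2 / 2))"

lemma gauss_measurable [measurable]: "gauss \<in> borel_measurable borel"
  unfolding gauss_def[abs_def] by measurable

lemma gauss_minus [simp]: "gauss (- x) = gauss x"
  by (simp add: gauss_def)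

lemma gauss_normal: "exp (- x\<^sup>2 / 2) = sqrt (2 * pi) * std_normal_density x"
  by (simp add: std_normal_density_def)

lemma gauss_integrable: "integrable lborel gauss" "(LINT x|lborel. exp (- x\<^sup>2 / 2)) = sqrt (2 * pi)"
proof -
  have i: "integrable lborel (\<lambda>x. exp (- x\<^sup>2 / 2) :: real)"
    unfolding gauss_normal using integrable_normal_density[of 1 0] by simp
  then show "integrable lborel gauss" unfolding gauss_def[abs_def] by (rule integrable_of_real)
  show "(LINT x|lborel. exp (- x\<^sup>2 / 2)) = sqrt (2 * pi)"
    unfolding gauss_normal using integral_normal_density[of 1 0] by simp
qed

lemma sqint_gauss: "sqint gauss"
proof -
  have le: "(cmod (gauss x))\<^sup>2 \<le> exp (- x\<^sup>2 / 2)" for x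
  proof -
    have "(cmod (gauss x))\<^sup>2 = exp (- x\<^sup>2 / 2) * exp (- x\<^sup>2 / 2)" by (simp add: gauss_def power2_eq_square)
    also have "\<dots> \<le> 1 * exp (- x\<^sup>2 / 2)" by (intro mult_right_mono) auto
    finally show ?thesis by simp
  qed
  have "integrable lborel (\<lambda>x. exp (- x\<^sup>2 / 2) :: real)"
    using integrable_Re[OF gauss_integrable(1)] by (simp add: gauss_def)
  then have "integrable lborel (\<lambda>x. (cmod (gauss x))\<^sup>2)"
  proof (rule Bochner_Integration.integrable_bound)
    show "AE x in lborel. norm ((cmod (gauss x))\<^sup>2) \<le> norm (exp (- x\<^sup>2 / 2))"
      by (intro AE_I2) (use le in simp)
  qed measurable
  then show ?thesis by (simp add: sqint_def)
qed

lemma ft_gauss: "ft gauss t = complex_of_real (sqrt (2 * pi)) * gauss t"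
proof -
  have "char std_normal_distribution (- t) = (LINT x|lborel. std_normal_density x *\<^sub>R iexp (- t * x))"
    unfolding char_def by (subst integral_density) auto
  also have "\<dots> = (LINT x|lborel. (1 / complex_of_real (sqrt (2 * pi))) * (exp (- (\<i> * complex_of_real (x * t))) * gauss x))"
    by (intro Bochner_Integration.integral_cong) (auto simp: gauss_def std_normal_density_def scaleR_conv_of_real mult_ac)
  also have "\<dots> = 1 / complex_of_real (sqrt (2 * pi)) * ft gauss t"
    unfolding ft_def by (rule integral_mult_right_zero)
  finally have "1 / complex_of_real (sqrt (2 * pi)) * ft gauss t = complex_of_real (exp (- t\<^sup>2 / 2))"
    by (simp add: char_std_normal_distribution)
  then have "ft gauss t / complex_of_real (sqrt (2 * pi)) = gauss t" by (simp add: gauss_def)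
  moreover have "complex_of_real (sqrt (2 * pi)) \<noteq> 0" by (simp del: real_sqrt_mult)
  ultimately have "ft gauss t = gauss t * complex_of_real (sqrt (2 * pi))" by (metis nonzero_divide_eq_eq)
  then show ?thesis by (simp only: mult.commute)
qed

lemma ft_gauss_scaled:
  assumes e: "0 < e"
  shows "ft (\<lambda>x. gauss (e * x)) t = complex_of_real (sqrt (2 * pi) / e) * gauss (t / e)"
proof -
  have "ft gauss (t / e) = \<bar>e\<bar> *\<^sub>R (LINT x|lborel. exp (- (\<i> * complex_of_real ((0 + e * x) * (t / e)))) * gauss (0 + e * x))"
    unfolding ft_def using e by (intro lborel_integral_real_affine) auto
  also have "\<dots> = complex_of_real e * ft (\<lambda>x. gauss (e * x)) t"
    unfolding ft_def using e by (simp add: scaleR_conv_of_real)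
  finally have "complex_of_real e * ft (\<lambda>x. gauss (e * x)) t = complex_of_real (sqrt (2 * pi)) * gauss (t / e)"
    by (simp add: ft_gauss)
  then show ?thesis using e by (simp add: field_simps)
qed

lemma gauss_scaled_integrable: "0 < e \<Longrightarrow> integrable lborel (\<lambda>x. gauss (e * x))"
  using lborel_integrable_real_affine[OF gauss_integrable(1), of e 0] by simp

lemma exp_imag_add:
  "exp (- (\<i> * complex_of_real r)) * exp (- (\<i> * complex_of_real q)) = exp (- (\<i> * complex_of_real (r + q)))"
  by (simp add: exp_add[symmetric] distrib_left)

lemma ft_modulate: "ft (\<lambda>x. exp (- (\<i> * complex_of_real (x * a))) * g x) t = ft g (t + a)"
  unfolding ft_def
  by (intro Bochner_Integration.integral_cong refl) (simp only: mult.assoc[symmetric] exp_imag_add distrib_left)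

lemma ft_translate: "ft (\<lambda>x. g (x - a)) t = exp (- (\<i> * complex_of_real (a * t))) * ft g t"
proof -
  have "ft (\<lambda>x. g (x - a)) t = (LINT x|lborel. exp (- (\<i> * complex_of_real ((a + x) * t))) * g x)"
    unfolding ft_def
    using lborel_integral_real_affine[of 1 "\<lambda>x. exp (- (\<i> * complex_of_real (x * t))) * g (x - a)" a] by simp
  also have "\<dots> = (LINT x|lborel. exp (- (\<i> * complex_of_real (a * t))) * (exp (- (\<i> * complex_of_real (x * t))) * g x))"
    by (intro Bochner_Integration.integral_cong refl) (simp only: mult.assoc[symmetric] exp_imag_add distrib_right)
  finally show ?thesis unfolding ft_def by (simp only: integral_mult_right_zero)
qed

text \<open>The inequality is obtained by Gaussian damping. The damped integral of the squared
  transform pairs g with its conjugate through a Gaussian kernel \<open>K\<close> of mass 2 pi;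
  Young's inequality bounds this uniformly in e, and Fatou's lemma lets e tend to 0.\<close>

lemma Plancherel_le:
  assumes gi: "integrable lborel g" and gs: "sqint g"
  shows "sqint (ft g)" "n2 (ft g) \<le> sqrt (2 * pi) * n2 g"
proof -
  have gm[measurable]: "g \<in> borel_measurable borel" using gi by auto
  note [measurable] = borel_measurable_cnj[OF gm]
  define n where "n = n2 g"
  define A where "A = (LINT x|lborel. cmod (g x))"
  have cb: "cmod (ft g \<xi>) \<le> A" for \<xi> unfolding A_def by (rule cmod_ft_le[OF gi])
  have A0: "0 \<le> A" by (simp add: A_def)
  have bd: "(\<integral>\<^sup>+\<xi>. ennreal ((cmod (ft g \<xi>))\<^sup>2 * exp (- (e * \<xi>)\<^sup>2 / 2)) \<partial>lborel) \<le> ennreal (2 * pi * n\<^sup>2)"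
    if e: "0 < e" for e
  proof -
    let ?\<gamma> = "\<lambda>\<xi>. gauss (e * \<xi>)"
    have \<gamma>i: "integrable lborel ?\<gamma>" by (rule gauss_scaled_integrable[OF e])
    define G where "G \<xi> = cnj (ft g \<xi>) * ?\<gamma> \<xi>" for \<xi>
    have cftm: "(\<lambda>\<xi>. cnj (ft g \<xi>)) \<in> borel_measurable borel" by (rule borel_measurable_cnj) measurable
    have Gm: "G \<in> borel_measurable borel" unfolding G_def using cftm by measurable
    have Gi: "integrable lborel G"
    proof (rule Bochner_Integration.integrable_bound)
      show "integrable lborel (\<lambda>\<xi>. complex_of_real A * ?\<gamma> \<xi>)" using \<gamma>i by simp
      show "AE \<xi> in lborel. norm (G \<xi>) \<le> norm (complex_of_real A * ?\<gamma> \<xi>)"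
        using cb A0 by (auto simp: G_def norm_mult intro!: mult_right_mono)
    qed (use Gm in simp)
    define K where "K z = sqrt (2 * pi) / e * exp (- (z / e)\<^sup>2 / 2)" for z :: real
    have K0: "0 \<le> K z" for z using e by (simp add: K_def)
    have [measurable]: "K \<in> borel_measurable borel" unfolding K_def[abs_def] by measurable
    have K: "ft ?\<gamma> t = complex_of_real (K t)" for t
      using ft_gauss_scaled[OF e, of t] by (simp add: K_def gauss_def)
    have Ki: "(\<integral>\<^sup>+z. ennreal (K z) \<partial>lborel) = ennreal (2 * pi)"
    proof -
      have i: "integrable lborel (\<lambda>x. exp (- (0 + (1/e) * x)\<^sup>2 / 2) :: real)"
        using integrable_Re[OF gauss_integrable(1)] e by (intro lborel_integrable_real_affine) (auto simp: gauss_def)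
      have "(LINT x|lborel. exp (- x\<^sup>2 / 2)) = \<bar>1/e\<bar> *\<^sub>R (LINT x|lborel. exp (- (0 + (1/e) * x)\<^sup>2 / 2))"
        using e by (intro lborel_integral_real_affine) auto
      then have "(LINT x|lborel. exp (- (x / e)\<^sup>2 / 2)) = e * sqrt (2 * pi)"
        using e gauss_integrable(2) by (simp add: field_simps del: real_sqrt_mult)
      then have "(LINT z|lborel. K z) = sqrt (2 * pi) / e * (e * sqrt (2 * pi))" unfolding K_def by simp
      also have "\<dots> = 2 * pi" using e by (simp del: real_sqrt_mult)
      finally have "(LINT z|lborel. K z) = 2 * pi" .
      moreover have "integrable lborel K" unfolding K_def[abs_def] using i by simp
      ultimately show ?thesis using K0 by (subst nn_integral_eq_integral) auto
    qed
    have ftG: "ft G x = (LINT y|lborel. complex_of_real (K (x - y)) * cnj (g y))" for x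
    proof -
      define \<phi> where "\<phi> \<xi> = exp (- (\<i> * complex_of_real (\<xi> * (- x)))) * ?\<gamma> \<xi>" for \<xi>
      have \<phi>i: "integrable lborel \<phi>" unfolding \<phi>_def by (rule ft_integrand_integrable[OF \<gamma>i])
      have "ft G x = (LINT \<xi>|lborel. \<phi> (- \<xi>) * cnj (ft g \<xi>))"
        unfolding ft_def[of G] G_def \<phi>_def by (intro Bochner_Integration.integral_cong refl) (simp add: mult_ac)
      also have "\<dots> = (LINT \<xi>|lborel. \<phi> (- \<xi>) * ft (\<lambda>x. cnj (g x)) (- \<xi>))" by (simp add: ft_cnj)
      also have "\<dots> = (LINT \<xi>|lborel. ft (\<lambda>x. cnj (g x)) \<xi> * \<phi> \<xi>)"
        using integral_reflect_lborel[of "\<lambda>\<xi>. \<phi> \<xi> * ft (\<lambda>x. cnj (g x)) \<xi>"] by (simp add: mult.commute)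
      also have "\<dots> = (LINT y|lborel. cnj (g y) * ft \<phi> y)"
        using gi by (intro ft_multiplication_formula \<phi>i) auto
      also have "\<dots> = (LINT y|lborel. complex_of_real (K (x - y)) * cnj (g y))"
      proof (intro Bochner_Integration.integral_cong refl)
        fix y
        have "K (y + - x) = K (x - y)" by (simp add: K_def power2_commute divide_simps)
        then show "cnj (g y) * ft \<phi> y = complex_of_real (K (x - y)) * cnj (g y)"
          unfolding \<phi>_def ft_modulate K by (simp only: mult.commute)
      qed
      finally show ?thesis .
    qed
    have eq: "ft g \<xi> * G \<xi> = complex_of_real ((cmod (ft g \<xi>))\<^sup>2 * exp (- (e * \<xi>)\<^sup>2 / 2))" for \<xi>
      unfolding G_def gauss_def mult.assoc[symmetric] complex_norm_square[symmetric] by simp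
    have "ennreal (cmod (LINT x|lborel. g x * ft G x)) \<le> (\<integral>\<^sup>+x. ennreal (cmod (g x * ft G x)) \<partial>lborel)"
      by (rule norm_integral_le_nn_integral)
    also have "\<dots> \<le> (\<integral>\<^sup>+x. (\<integral>\<^sup>+y. ennreal (cmod (g x) * K (x - y) * cmod (g y)) \<partial>lborel) \<partial>lborel)"
    proof (intro nn_integral_mono)
      fix x
      have "ennreal (cmod (g x * ft G x)) = ennreal (cmod (g x)) * ennreal (cmod (ft G x))"
        by (simp add: norm_mult ennreal_mult)
      also have "\<dots> \<le> ennreal (cmod (g x)) * (\<integral>\<^sup>+y. ennreal (K (x - y) * cmod (g y)) \<partial>lborel)"
        unfolding ftG using K0
          norm_integral_le_nn_integral[of lborel "\<lambda>y. complex_of_real (K (x - y)) * cnj (g y)"]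
        by (intro mult_left_mono) (auto simp: norm_mult)
      also have "\<dots> = (\<integral>\<^sup>+y. ennreal (cmod (g x) * K (x - y) * cmod (g y)) \<partial>lborel)"
        using K0 by (subst nn_integral_cmult[symmetric]) (auto simp: ennreal_mult[symmetric] mult.assoc)
      finally show "ennreal (cmod (g x * ft G x)) \<le> (\<integral>\<^sup>+y. ennreal (cmod (g x) * K (x - y) * cmod (g y)) \<partial>lborel)" .
    qed
    also have "\<dots> \<le> ennreal (n * (2 * pi) * n)"
      by (rule trilinear_L1_middle) (use K0 Ki sqint_nn_integral[OF gs] in \<open>auto simp: n_def\<close>)
    finally have c1: "cmod (LINT x|lborel. g x * ft G x) \<le> 2 * pi * n\<^sup>2"
      by (subst (asm) ennreal_le_iff) (auto simp: n_def power2_eq_square mult_ac)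
    have ii: "integrable lborel (\<lambda>\<xi>. (cmod (ft g \<xi>))\<^sup>2 * exp (- (e * \<xi>)\<^sup>2 / 2))"
    proof (rule Bochner_Integration.integrable_bound)
      show "integrable lborel (\<lambda>\<xi>. A\<^sup>2 * Re (?\<gamma> \<xi>))" using integrable_Re[OF \<gamma>i] by simp
      show "AE \<xi> in lborel. norm ((cmod (ft g \<xi>))\<^sup>2 * exp (- (e * \<xi>)\<^sup>2 / 2)) \<le> norm (A\<^sup>2 * Re (?\<gamma> \<xi>))"
        using cb by (auto simp: gauss_def abs_mult intro!: mult_right_mono power_mono)
    qed measurable
    have "(LINT \<xi>|lborel. (cmod (ft g \<xi>))\<^sup>2 * exp (- (e * \<xi>)\<^sup>2 / 2)) \<le> 2 * pi * n\<^sup>2"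
    proof -
      have "complex_of_real (LINT \<xi>|lborel. (cmod (ft g \<xi>))\<^sup>2 * exp (- (e * \<xi>)\<^sup>2 / 2)) = (LINT \<xi>|lborel. ft g \<xi> * G \<xi>)"
        unfolding eq by (rule integral_complex_of_real[symmetric])
      also have "\<dots> = (LINT x|lborel. g x * ft G x)" by (rule ft_multiplication_formula[OF gi Gi])
      finally have "cmod (complex_of_real (LINT \<xi>|lborel. (cmod (ft g \<xi>))\<^sup>2 * exp (- (e * \<xi>)\<^sup>2 / 2))) \<le> 2 * pi * n\<^sup>2"
        using c1 by simp
      then show ?thesis by (simp only: norm_of_real)
    qed
    then show ?thesis using ii by (subst nn_integral_eq_integral) (auto intro: ennreal_leI)
  qed
  have "(\<integral>\<^sup>+\<xi>. ennreal ((cmod (ft g \<xi>))\<^sup>2) \<partial>lborel)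
    = (\<integral>\<^sup>+\<xi>. liminf (\<lambda>k. ennreal ((cmod (ft g \<xi>))\<^sup>2 * exp (- (inverse (real (Suc k)) * \<xi>)\<^sup>2 / 2))) \<partial>lborel)"
  proof (intro nn_integral_cong)
    fix \<xi>
    have "(\<lambda>k. (cmod (ft g \<xi>))\<^sup>2 * exp (- (inverse (real (Suc k)) * \<xi>)\<^sup>2 / 2)) \<longlonglongrightarrow> (cmod (ft g \<xi>))\<^sup>2 * exp (- (0 * \<xi>)\<^sup>2 / 2)"
      by (intro tendsto_intros LIMSEQ_inverse_real_of_nat) auto
    then have "(\<lambda>k. ennreal ((cmod (ft g \<xi>))\<^sup>2 * exp (- (inverse (real (Suc k)) * \<xi>)\<^sup>2 / 2))) \<longlonglongrightarrow> ennreal ((cmod (ft g \<xi>))\<^sup>2)"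
      by (intro tendsto_ennrealI) simp
    then show "ennreal ((cmod (ft g \<xi>))\<^sup>2) = liminf (\<lambda>k. ennreal ((cmod (ft g \<xi>))\<^sup>2 * exp (- (inverse (real (Suc k)) * \<xi>)\<^sup>2 / 2)))"
      by (intro lim_imp_Liminf[symmetric] sequentially_bot)
  qed
  also have "\<dots> \<le> liminf (\<lambda>k. \<integral>\<^sup>+\<xi>. ennreal ((cmod (ft g \<xi>))\<^sup>2 * exp (- (inverse (real (Suc k)) * \<xi>)\<^sup>2 / 2)) \<partial>lborel)"
    by (rule nn_integral_liminf) measurable
  also have "\<dots> \<le> ennreal (2 * pi * n\<^sup>2)"
  proof (rule Liminf_le)
    show "\<forall>\<^sub>F k in sequentially. (\<integral>\<^sup>+\<xi>. ennreal ((cmod (ft g \<xi>))\<^sup>2 * exp (- (inverse (real (Suc k)) * \<xi>)\<^sup>2 / 2)) \<partial>lborel) \<le> ennreal (2 * pi * n\<^sup>2)"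
      by (intro always_eventually allI bd) simp
  qed simp
  also have "2 * pi * n\<^sup>2 = (sqrt (2 * pi) * n)\<^sup>2" by (simp add: power_mult_distrib del: real_sqrt_mult)
  finally have *: "(\<integral>\<^sup>+\<xi>. ennreal ((cmod (ft g \<xi>))\<^sup>2) \<partial>lborel) \<le> ennreal ((sqrt (2 * pi) * n)\<^sup>2)" .
  have "0 \<le> sqrt (2 * pi) * n" by (simp add: n_def)
  from sqint_boundI[OF _ this *] show "sqint (ft g)" "n2 (ft g) \<le> sqrt (2 * pi) * n2 g"
    by (auto simp: n_def)
qed

text \<open>The case t = 0 shows that the positive and negative parts have equal mass. Normalised to
  probability densities they share their characteristic function, so Levy's uniqueness theorem
  identifies them.\<close>

lemma real_L1_uniqueness:
  fixes h :: "real \<Rightarrow> real"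
  assumes h: "integrable lborel h" and z: "\<And>t. (LINT x|lborel. iexp (t * x) * complex_of_real (h x)) = 0"
  shows "AE x in lborel. h x = 0"
proof -
  have [measurable]: "h \<in> borel_measurable borel" using h by auto
  define p where "p x = max 0 (h x)" for x
  define q where "q x = max 0 (- h x)" for x
  have [measurable]: "p \<in> borel_measurable borel" "q \<in> borel_measurable borel" unfolding p_def q_def by measurable
  have pq: "0 \<le> p x" "0 \<le> q x" "h x = p x - q x" for x by (auto simp: p_def q_def)
  have pi: "integrable lborel p" and qi: "integrable lborel q" unfolding p_def q_def using h by auto
  have "complex_of_real (LINT x|lborel. h x) = 0" using z[of 0] by simp
  then have eq: "(LINT x|lborel. p x) = (LINT x|lborel. q x)" using pi qi by (simp add: pq(3))
  define c where "c = (LINT x|lborel. p x)"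
  have c0: "0 \<le> c" unfolding c_def using pq by (intro integral_nonneg_AE) auto
  have np: "(\<integral>\<^sup>+x. ennreal (p x) \<partial>lborel) = ennreal c" "(\<integral>\<^sup>+x. ennreal (q x) \<partial>lborel) = ennreal c"
    unfolding c_def using pi qi pq eq by (auto simp: nn_integral_eq_integral)
  show ?thesis
  proof (cases "c = 0")
    case True
    then have "AE x in lborel. ennreal (p x) = 0" "AE x in lborel. ennreal (q x) = 0"
      using np by (auto simp: nn_integral_0_iff_AE)
    then show ?thesis
    proof eventually_elim
      case (elim x)
      then show ?case using pq(1)[of x] pq(2)[of x] pq(3)[of x] by (simp add: ennreal_eq_0_iff)
    qed
  next
    case False
    then have c: "0 < c" using c0 by simp
    define M1 where "M1 = density lborel (\<lambda>x. ennreal (p x / c))"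
    define M2 where "M2 = density lborel (\<lambda>x. ennreal (q x / c))"
    have dist: "real_distribution (density lborel (\<lambda>x. ennreal (r x / c)))"
      if r[measurable]: "r \<in> borel_measurable borel" and r0: "\<And>x. 0 \<le> r x" and n: "(\<integral>\<^sup>+x. ennreal (r x) \<partial>lborel) = ennreal c" for r :: "real \<Rightarrow> real"
    proof -
      have "(\<integral>\<^sup>+x. ennreal (r x / c) \<partial>lborel) = (\<integral>\<^sup>+x. ennreal (r x) * ennreal (1 / c) \<partial>lborel)"
        using r0 c by (intro nn_integral_cong) (simp add: ennreal_mult[symmetric])
      also have "\<dots> = ennreal c * ennreal (1 / c)" by (simp add: nn_integral_multc n)
      also have "\<dots> = 1" using c by (simp add: ennreal_mult[symmetric])
      finally have "prob_space (density lborel (\<lambda>x. ennreal (r x / c)))"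
        by (intro prob_spaceI) (simp add: emeasure_density)
      then show ?thesis unfolding real_distribution_def real_distribution_axioms_def by simp
    qed
    have ch: "char (density lborel (\<lambda>x. ennreal (r x / c))) t = (1 / complex_of_real c) * (LINT x|lborel. iexp (t * x) * complex_of_real (r x))"
      if [measurable]: "r \<in> borel_measurable borel" and r0: "\<And>x. 0 \<le> r x" for r :: "real \<Rightarrow> real" and t
    proof -
      have "char (density lborel (\<lambda>x. ennreal (r x / c))) t = (LINT x|lborel. (r x / c) *\<^sub>R iexp (t * x))"
        unfolding char_def using c r0 by (subst integral_density) auto
      also have "\<dots> = (LINT x|lborel. (1 / complex_of_real c) * (iexp (t * x) * complex_of_real (r x)))"
        by (intro Bochner_Integration.integral_cong) (auto simp: scaleR_conv_of_real)
      also have "\<dots> = (1 / complex_of_real c) * (LINT x|lborel. iexp (t * x) * complex_of_real (r x))"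
        by (rule integral_mult_right_zero)
      finally show ?thesis .
    qed
    have int: "integrable lborel (\<lambda>x. iexp (t * x) * complex_of_real (r x))" if "integrable lborel r" for r t
      by (rule Bochner_Integration.integrable_bound[OF that]) (use that in \<open>auto simp: norm_mult\<close>)
    have "char M1 t = char M2 t" for t
    proof -
      have "(LINT x|lborel. iexp (t * x) * complex_of_real (p x)) - (LINT x|lborel. iexp (t * x) * complex_of_real (q x))
        = (LINT x|lborel. iexp (t * x) * complex_of_real (h x))"
        using int[OF pi, of t] int[OF qi, of t] by (simp add: pq(3) right_diff_distrib)
      then show ?thesis using z[of t] pq by (simp add: M1_def M2_def ch)
    qed
    then have "char M1 = char M2" by auto
    moreover have "real_distribution M1" "real_distribution M2" unfolding M1_def M2_def using pq np by (auto intro!: dist)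
    ultimately have "M1 = M2" by (intro Levy_uniqueness)
    then have "AE x in lborel. ennreal (p x / c) = ennreal (q x / c)"
      unfolding M1_def M2_def by (subst (asm) sigma_finite_measure.density_unique_iff[OF sigma_finite_lborel]) auto
    then show ?thesis
    proof eventually_elim
      case (elim x)
      then have "p x / c = q x / c" using pq c by (subst (asm) ennreal_inj) auto
      then show ?case using c pq(3)[of x] by simp
    qed
  qed
qed

text \<open>Reduction to real functions: the transform of the real part is built from those of the
  function and its conjugate, and multiplication by -i brings the imaginary part into the real
  one.\<close>

lemma L1_uniqueness:
  assumes H: "integrable lborel H" and z: "\<And>t. ft H t = 0"
  shows "AE x in lborel. H x = 0"
proof -
  have eq: "iexp (t * x) = exp (- (\<i> * complex_of_real (x * - t)))" for t x
    by (simp add: mult.commute)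
  have re: "AE x in lborel. Re (G x) = 0" if G: "integrable lborel G" and z: "\<And>t. ft G t = 0" for G
  proof (rule real_L1_uniqueness)
    fix t
    have cG: "integrable lborel (\<lambda>x. cnj (G x))" using G by simp
    have i: "integrable lborel (\<lambda>x. iexp (t * x) * G x)" "integrable lborel (\<lambda>x. iexp (t * x) * cnj (G x))"
      unfolding eq by (rule ft_integrand_integrable[OF G] ft_integrand_integrable[OF cG])+
    have e1: "(LINT x|lborel. iexp (t * x) * G x) = 0"
      using z[of "- t"] unfolding eq ft_def .
    have "(LINT x|lborel. iexp (t * x) * cnj (G x)) = ft (\<lambda>x. cnj (G x)) (- t)"
      unfolding eq ft_def ..
    then have e2: "(LINT x|lborel. iexp (t * x) * cnj (G x)) = 0" using z[of t] by (simp add: ft_cnj)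
    have "(LINT x|lborel. iexp (t * x) * complex_of_real (Re (G x))) = (LINT x|lborel. (1/2) * (iexp (t * x) * G x + iexp (t * x) * cnj (G x)))"
      by (intro Bochner_Integration.integral_cong refl) (simp add: distrib_left[symmetric] complex_add_cnj)
    also have "\<dots> = (1/2) * (LINT x|lborel. iexp (t * x) * G x + iexp (t * x) * cnj (G x))"
      by (rule integral_mult_right_zero)
    also have "\<dots> = 0" using i e1 e2 by simp
    finally show "(LINT x|lborel. iexp (t * x) * complex_of_real (Re (G x))) = 0" .
  qed (use G in auto)
  have "AE x in lborel. Re (H x) = 0" by (rule re[OF H z])
  moreover have "AE x in lborel. Re (- \<i> * H x) = 0"
    by (rule re) (use H z in \<open>auto simp: ft_cmult[of "- \<i>", simplified]\<close>)
  ultimately show ?thesis by eventually_elim (simp add: complex_eq_iff)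
qed

section \<open>Extension of the transform from L^1 to L^2 by truncation\<close>

definition trunc :: "real \<Rightarrow> (real \<Rightarrow> real) \<Rightarrow> real \<Rightarrow> complex" where
  "trunc R f x = complex_of_real (indicator {-R..R} x * f x)"

lemma L2_measurable: "f \<in> L2 \<Longrightarrow> f \<in> borel_measurable borel"
  by (simp add: L2_def)

lemma L2_sqint: "f \<in> L2 \<longleftrightarrow> sqint (\<lambda>x. complex_of_real (f x))"
proof -
  have m: "f \<in> borel_measurable borel \<longleftrightarrow> (\<lambda>x. complex_of_real (f x)) \<in> borel_measurable borel"
  proof
    assume "(\<lambda>x. complex_of_real (f x)) \<in> borel_measurable borel"
    from measurable_compose[OF this borel_measurable_Re]
    show "f \<in> borel_measurable borel" unfolding Re_complex_of_real .
  qed (rule measurable_compose[OF _ borel_measurable_of_real])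
  show ?thesis unfolding L2_def sqint_def mem_Collect_eq norm_of_real power2_abs by (simp add: m)
qed

lemma trunc_measurable [measurable (raw)]: "f \<in> borel_measurable borel \<Longrightarrow> trunc R f \<in> borel_measurable borel"
  unfolding trunc_def[abs_def] by measurable

lemma sqint_trunc:
  assumes f: "f \<in> L2"
  shows "sqint (trunc R f)" "sqint (\<lambda>x. complex_of_real (f x) - trunc R f x)" "integrable lborel (trunc R f)"
proof -
  have [measurable]: "f \<in> borel_measurable borel" by (rule L2_measurable[OF f])
  have sf: "sqint (\<lambda>x. complex_of_real (f x))" using f by (simp add: L2_sqint)
  show s: "sqint (trunc R f)"
    by (rule sqint_mono1(1)[OF sf]) (auto simp: trunc_def indicator_def)
  show "sqint (\<lambda>x. complex_of_real (f x) - trunc R f x)" by (rule sqint_diff(1)[OF sf s])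
  have "integrable lborel (indicator {-R..R} :: real \<Rightarrow> real)"
    by (rule integrable_real_indicator) (auto simp: emeasure_lborel_Icc_eq)
  then have "sqint (\<lambda>x. complex_of_real (indicator {-R..R} x))"
    by (simp add: sqint_def power2_eq_square indicator_inter_arith[symmetric])
  from sqint_Cauchy_Schwarz(2)[OF this sf] show "integrable lborel (trunc R f)"
    unfolding trunc_def by simp
qed

lemma ft_trunc: "(LINT x:{-R..R}|lborel. exp (- (\<i> * complex_of_real (x * \<xi>))) * complex_of_real (f x)) = ft (trunc R f) \<xi>"
  unfolding ft_def set_lebesgue_integral_def trunc_def
  by (rule Bochner_Integration.integral_cong[OF refl]) (simp add: indicator_def)

lemma is_fourier_ft:
  "is_fourier f F \<longleftrightarrow> F \<in> borel_measurable borel \<and>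
    ((\<lambda>R. \<integral>\<^sup>+\<xi>. ennreal ((cmod (F \<xi> - ft (trunc R f) \<xi>))\<^sup>2) \<partial>lborel) \<longlongrightarrow> 0) at_top"
  unfolding is_fourier_def ft_trunc by simp

text \<open>The extended integral in the definition may be infinite for some R. Finiteness for a
  single R already makes F square integrable, after which the real-valued \<open>n2\<close> can
  express the limit.\<close>

lemma is_fourier_iff:
  assumes f: "f \<in> L2"
  shows "is_fourier f F \<longleftrightarrow> sqint F \<and> ((\<lambda>R. n2 (\<lambda>\<xi>. F \<xi> - ft (trunc R f) \<xi>)) \<longlongrightarrow> 0) at_top"
proof -
  have [measurable]: "f \<in> borel_measurable borel" by (rule L2_measurable[OF f])
  have sft: "sqint (ft (trunc R f))" for R by (intro Plancherel_le sqint_trunc f)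
  have main: "(((\<lambda>R. \<integral>\<^sup>+\<xi>. ennreal ((cmod (F \<xi> - ft (trunc R f) \<xi>))\<^sup>2) \<partial>lborel) \<longlongrightarrow> 0) at_top)
    \<longleftrightarrow> ((\<lambda>R. n2 (\<lambda>\<xi>. F \<xi> - ft (trunc R f) \<xi>)) \<longlongrightarrow> 0) at_top" if F: "sqint F"
  proof -
    have e: "(\<integral>\<^sup>+\<xi>. ennreal ((cmod (F \<xi> - ft (trunc R f) \<xi>))\<^sup>2) \<partial>lborel) = ennreal ((n2 (\<lambda>\<xi>. F \<xi> - ft (trunc R f) \<xi>))\<^sup>2)" for R
      by (rule sqint_nn_integral[OF sqint_diff(1)[OF F sft]])
    show ?thesis unfolding e
    proof
      assume "((\<lambda>R. ennreal ((n2 (\<lambda>\<xi>. F \<xi> - ft (trunc R f) \<xi>))\<^sup>2)) \<longlongrightarrow> 0) at_top"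
      then have "((\<lambda>R. ennreal ((n2 (\<lambda>\<xi>. F \<xi> - ft (trunc R f) \<xi>))\<^sup>2)) \<longlongrightarrow> ennreal 0) at_top" by simp
      then have "((\<lambda>R. (n2 (\<lambda>\<xi>. F \<xi> - ft (trunc R f) \<xi>))\<^sup>2) \<longlongrightarrow> 0) at_top"
        by (rule tendsto_ennrealD) auto
      from tendsto_real_sqrt[OF this] show "((\<lambda>R. n2 (\<lambda>\<xi>. F \<xi> - ft (trunc R f) \<xi>)) \<longlongrightarrow> 0) at_top" by simp
    next
      assume "((\<lambda>R. n2 (\<lambda>\<xi>. F \<xi> - ft (trunc R f) \<xi>)) \<longlongrightarrow> 0) at_top"
      from tendsto_ennrealI[OF tendsto_power[OF this, of 2]]
      show "((\<lambda>R. ennreal ((n2 (\<lambda>\<xi>. F \<xi> - ft (trunc R f) \<xi>))\<^sup>2)) \<longlongrightarrow> 0) at_top" by simp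
    qed
  qed
  have "sqint F" if F: "is_fourier f F"
  proof -
    have m: "F \<in> borel_measurable borel" and l: "((\<lambda>R. \<integral>\<^sup>+\<xi>. ennreal ((cmod (F \<xi> - ft (trunc R f) \<xi>))\<^sup>2) \<partial>lborel) \<longlongrightarrow> 0) at_top"
      using F by (simp_all add: is_fourier_ft)
    have "\<forall>\<^sub>F R in at_top. (\<integral>\<^sup>+\<xi>. ennreal ((cmod (F \<xi> - ft (trunc R f) \<xi>))\<^sup>2) \<partial>lborel) < 1"
      by (rule order_tendstoD(2)[OF l]) simp
    then obtain R where R: "(\<integral>\<^sup>+\<xi>. ennreal ((cmod (F \<xi> - ft (trunc R f) \<xi>))\<^sup>2) \<partial>lborel) < 1"
      using eventually_happens'[OF trivial_limit_at_top_linorder] by blast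
    have "(\<lambda>\<xi>. F \<xi> - ft (trunc R f) \<xi>) \<in> borel_measurable borel" using m by measurable
    then have "sqint (\<lambda>\<xi>. F \<xi> - ft (trunc R f) \<xi>)"
      by (rule sqint_boundI(1)[where c = 1]) (use R in \<open>simp_all add: less_imp_le\<close>)
    from sqint_add(1)[OF this sft[of R]] show ?thesis by simp
  qed
  then show ?thesis
    using main by (auto simp: is_fourier_ft dest: sqint_measurable)
qed

lemma is_fourier_unique:
  assumes f: "f \<in> L2" and F: "is_fourier f F" and G: "is_fourier f G"
  shows "AE \<xi> in lborel. F \<xi> = G \<xi>"
proof -
  have sF: "sqint F" and sG: "sqint G"
    and lF: "((\<lambda>R. n2 (\<lambda>\<xi>. F \<xi> - ft (trunc R f) \<xi>)) \<longlongrightarrow> 0) at_top"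
    and lG: "((\<lambda>R. n2 (\<lambda>\<xi>. G \<xi> - ft (trunc R f) \<xi>)) \<longlongrightarrow> 0) at_top"
    using F G by (auto simp: is_fourier_iff[OF f])
  have sft: "sqint (ft (trunc R f))" for R by (intro Plancherel_le sqint_trunc f)
  have "n2 (\<lambda>\<xi>. F \<xi> - G \<xi>) \<le> n2 (\<lambda>\<xi>. F \<xi> - ft (trunc R f) \<xi>) + n2 (\<lambda>\<xi>. G \<xi> - ft (trunc R f) \<xi>)" for R
    using n2_triangle_diff[OF sqint_diff(1)[OF sF sft] sqint_diff(1)[OF sft sG], of R]
    by (simp add: n2_minus_commute[of _ G])
  then have "n2 (\<lambda>\<xi>. F \<xi> - G \<xi>) \<le> 0"
    using tendsto_lowerbound[OF tendsto_add[OF lF lG] _ trivial_limit_at_top_linorder] by auto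
  then have "n2 (\<lambda>\<xi>. F \<xi> - G \<xi>) = 0" by (simp add: order_antisym)
  from n2_eq_0_AE[OF sqint_diff(1)[OF sF sG] this] show ?thesis by simp
qed

lemma n2_trunc_tail:
  assumes f: "f \<in> L2"
  shows "((\<lambda>R. n2 (\<lambda>x. complex_of_real (f x) - trunc R f x)) \<longlongrightarrow> 0) at_top"
proof -
  have [measurable]: "f \<in> borel_measurable borel" by (rule L2_measurable[OF f])
  have "((\<lambda>R. LINT x|lborel. (cmod (complex_of_real (f x) - trunc R f x))\<^sup>2) \<longlongrightarrow> (LINT x::real|lborel. (0::real))) at_top"
  proof (rule integral_dominated_convergence_at_top[where w = "\<lambda>x. (f x)\<^sup>2"])
    show "integrable lborel (\<lambda>x. (f x)\<^sup>2)" using f by (simp add: L2_def)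
    show "\<forall>\<^sub>F R in at_top. AE x in lborel. norm ((cmod (complex_of_real (f x) - trunc R f x))\<^sup>2) \<le> (f x)\<^sup>2"
      by (intro always_eventually allI AE_I2) (auto simp: trunc_def indicator_def)
    show "AE x in lborel. ((\<lambda>R. (cmod (complex_of_real (f x) - trunc R f x))\<^sup>2) \<longlongrightarrow> 0) at_top"
    proof (intro AE_I2 tendsto_eventually)
      fix x :: real
      show "\<forall>\<^sub>F R in at_top. (cmod (complex_of_real (f x) - trunc R f x))\<^sup>2 = 0"
        using eventually_ge_at_top[of "\<bar>x\<bar>"] by eventually_elim (auto simp: trunc_def indicator_def abs_le_iff)
    qed
  qed measurable
  from tendsto_real_sqrt[OF this] show ?thesis by (simp add: n2_def)
qed

text \<open>The Plancherel inequality for differences of truncations gives the Cauchy property.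
  Completeness is used along the integers, and the same inequality carries the convergence over to
  real R.\<close>

lemma is_fourier_exists:
  assumes f: "f \<in> L2"
  shows "\<exists>F. is_fourier f F"
proof -
  have [measurable]: "f \<in> borel_measurable borel" by (rule L2_measurable[OF f])
  let ?F = "\<lambda>R. ft (trunc R f)"
  define \<tau> where "\<tau> R = sqrt (2 * pi) * n2 (\<lambda>x. complex_of_real (f x) - trunc R f x)" for R
  have \<tau>: "(\<tau> \<longlongrightarrow> 0) at_top" unfolding \<tau>_def using tendsto_mult[OF tendsto_const n2_trunc_tail[OF f]] by simp
  have sft: "sqint (?F R)" for R by (intro Plancherel_le sqint_trunc f)
  have d: "n2 (\<lambda>\<xi>. ?F R \<xi> - ?F R' \<xi>) \<le> \<tau> R + \<tau> R'" for R R'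
  proof -
    have i: "integrable lborel (\<lambda>x. trunc R f x - trunc R' f x)" and s: "sqint (\<lambda>x. trunc R f x - trunc R' f x)"
      by (intro Bochner_Integration.integrable_diff sqint_diff(1) sqint_trunc f)+
    have "n2 (\<lambda>\<xi>. ?F R \<xi> - ?F R' \<xi>) = n2 (ft (\<lambda>x. trunc R f x - trunc R' f x))"
      by (rule arg_cong[where f = n2]) (simp add: fun_eq_iff ft_diff[OF sqint_trunc(3)[OF f] sqint_trunc(3)[OF f]])
    also have "\<dots> \<le> sqrt (2 * pi) * n2 (\<lambda>x. trunc R f x - trunc R' f x)" by (rule Plancherel_le(2)[OF i s])
    also have "\<dots> \<le> sqrt (2 * pi) * (n2 (\<lambda>x. complex_of_real (f x) - trunc R f x) + n2 (\<lambda>x. complex_of_real (f x) - trunc R' f x))"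
    proof (intro mult_left_mono)
      have "n2 (\<lambda>x. trunc R f x - trunc R' f x) \<le> n2 (\<lambda>x. trunc R f x - complex_of_real (f x)) + n2 (\<lambda>x. complex_of_real (f x) - trunc R' f x)"
        using f by (intro n2_triangle_diff sqint_trunc sqint_diff(1)) (auto simp: L2_sqint)
      then show "n2 (\<lambda>x. trunc R f x - trunc R' f x) \<le> n2 (\<lambda>x. complex_of_real (f x) - trunc R f x) + n2 (\<lambda>x. complex_of_real (f x) - trunc R' f x)"
        by (simp add: n2_minus_commute[of "trunc R f"])
    qed simp
    finally show ?thesis by (simp add: \<tau>_def distrib_left)
  qed
  have \<tau>n: "(\<lambda>n. \<tau> (real n)) \<longlonglongrightarrow> 0" by (rule filterlim_compose[OF \<tau> filterlim_real_sequentially])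
  have "\<exists>F. sqint F \<and> (\<lambda>n. n2 (\<lambda>\<xi>. ?F (real n) \<xi> - F \<xi>)) \<longlonglongrightarrow> 0"
  proof (rule sqint_complete)
    show "sqint (?F (real n))" for n by (rule sft)
    fix e :: real assume "0 < e"
    then obtain N where N: "\<And>n. n \<ge> N \<Longrightarrow> \<tau> (real n) < e / 2"
      using order_tendstoD(2)[OF \<tau>n, of "e/2"] unfolding eventually_sequentially by auto
    show "\<exists>N. \<forall>m\<ge>N. \<forall>n\<ge>N. n2 (\<lambda>\<xi>. ?F (real m) \<xi> - ?F (real n) \<xi>) < e"
    proof (intro exI[of _ N] allI impI)
      fix m n assume "N \<le> m" "N \<le> n"
      then show "n2 (\<lambda>\<xi>. ?F (real m) \<xi> - ?F (real n) \<xi>) < e" using N[of m] N[of n] d[of "real m" "real n"] by simp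
    qed
  qed
  then obtain F where F: "sqint F" "(\<lambda>n. n2 (\<lambda>\<xi>. ?F (real n) \<xi> - F \<xi>)) \<longlonglongrightarrow> 0" by blast
  have "n2 (\<lambda>\<xi>. F \<xi> - ?F R \<xi>) \<le> \<tau> R" for R
  proof -
    have "(\<lambda>n. n2 (\<lambda>\<xi>. ?F (real n) \<xi> - F \<xi>) + (\<tau> (real n) + \<tau> R)) \<longlonglongrightarrow> 0 + (0 + \<tau> R)"
      by (intro tendsto_add F \<tau>n tendsto_const)
    moreover have "n2 (\<lambda>\<xi>. F \<xi> - ?F R \<xi>) \<le> n2 (\<lambda>\<xi>. ?F (real n) \<xi> - F \<xi>) + (\<tau> (real n) + \<tau> R)" for n
      using n2_triangle_diff[OF sqint_diff(1)[OF F(1) sft[of "real n"]] sqint_diff(1)[OF sft[of "real n"] sft[of R]]] d[of "real n" R]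
      n2_minus_commute[of F "?F (real n)"] by linarith
    ultimately show ?thesis by (intro LIMSEQ_le_const[of _ "\<tau> R", OF _ exI[of _ 0]]) auto
  qed
  then have "((\<lambda>R. n2 (\<lambda>\<xi>. F \<xi> - ?F R \<xi>)) \<longlongrightarrow> 0) at_top"
    by (intro tendsto_sandwich[OF _ _ tendsto_const \<tau>]) (auto intro!: always_eventually)
  then show ?thesis using F(1) is_fourier_iff[OF f] by blast
qed

lemma is_fourier_fourier: "f \<in> L2 \<Longrightarrow> is_fourier f (fourier f)"
proof -
  assume f: "f \<in> L2"
  show ?thesis unfolding fourier_def using someI_ex[OF is_fourier_exists[OF f]] .
qed

lemma fourier_sqint: "f \<in> L2 \<Longrightarrow> sqint (fourier f)"
proof -
  assume f: "f \<in> L2"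
  show ?thesis using is_fourier_fourier[OF f] unfolding is_fourier_iff[OF f] by (rule conjunct1)
qed

lemma fourier_AE_eq: "f \<in> L2 \<Longrightarrow> is_fourier f F \<Longrightarrow> AE \<xi> in lborel. fourier f \<xi> = F \<xi>"
proof -
  assume f: "f \<in> L2" and F: "is_fourier f F"
  show ?thesis by (rule is_fourier_unique[OF f is_fourier_fourier[OF f] F])
qed

lemma is_fourier_cong_AE:
  assumes "AE x in lborel. f x = g x" "f \<in> borel_measurable borel" "g \<in> borel_measurable borel"
  shows "is_fourier f = is_fourier g"
proof -
  have "ft (trunc R f) \<xi> = ft (trunc R g) \<xi>" for R \<xi>
    unfolding ft_def
  proof (rule integral_cong_AE)
    show "AE x in lborel. exp (- (\<i> * complex_of_real (x * \<xi>))) * trunc R f x = exp (- (\<i> * complex_of_real (x * \<xi>))) * trunc R g x"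
      using assms(1) by eventually_elim (simp add: trunc_def)
  qed (use assms(2,3) in measurable)
  then have "ft (trunc R f) = ft (trunc R g)" for R by (intro ext) simp
  then show ?thesis by (intro ext) (simp only: is_fourier_ft)
qed

text \<open>The chosen transforms agree as functions, not only almost everywhere: both are
  \<open>SOME\<close> of the same predicate.\<close>

lemma fourier_cong_AE:
  assumes "AE x in lborel. f x = g x" "f \<in> borel_measurable borel" "g \<in> borel_measurable borel"
  shows "fourier f = fourier g"
  unfolding fourier_def is_fourier_cong_AE[OF assms] ..

lemma L2_cong_AE:
  assumes "AE x in lborel. f x = g x" "g \<in> borel_measurable borel" "f \<in> L2"
  shows "g \<in> L2"
  unfolding L2_sqint
proof (rule sqint_cong_AE)
  show "sqint (\<lambda>x. complex_of_real (f x))" using assms(3) by (simp add: L2_sqint)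
  show "AE x in lborel. complex_of_real (f x) = complex_of_real (g x)" using assms(1) by eventually_elim simp
  show "(\<lambda>x. complex_of_real (g x)) \<in> borel_measurable borel" using assms(2) by measurable
qed

lemma is_fourier_linear:
  assumes f: "f \<in> L2" and g: "g \<in> L2" and F: "is_fourier f F" and G: "is_fourier g G"
  shows "(\<lambda>x. a * f x + b * g x) \<in> L2"
    "is_fourier (\<lambda>x. a * f x + b * g x) (\<lambda>\<xi>. complex_of_real a * F \<xi> + complex_of_real b * G \<xi>)"
proof -
  have sF: "sqint F" and sG: "sqint G"
    and lF: "((\<lambda>R. n2 (\<lambda>\<xi>. F \<xi> - ft (trunc R f) \<xi>)) \<longlongrightarrow> 0) at_top"
    and lG: "((\<lambda>R. n2 (\<lambda>\<xi>. G \<xi> - ft (trunc R g) \<xi>)) \<longlongrightarrow> 0) at_top"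
    using F G by (auto simp: is_fourier_iff[OF f] is_fourier_iff[OF g])
  have sft: "sqint (ft (trunc R f))" "sqint (ft (trunc R g))" for R by (intro Plancherel_le sqint_trunc f g)+
  have sf: "sqint (\<lambda>x. complex_of_real (f x))" "sqint (\<lambda>x. complex_of_real (g x))" using f g by (simp_all add: L2_sqint)
  show h: "(\<lambda>x. a * f x + b * g x) \<in> L2"
    using sqint_add(1)[OF sqint_cmult(1)[OF sf(1), of "complex_of_real a"] sqint_cmult(1)[OF sf(2), of "complex_of_real b"]]
    by (simp add: L2_sqint)
  have t: "ft (trunc R (\<lambda>x. a * f x + b * g x)) \<xi> = complex_of_real a * ft (trunc R f) \<xi> + complex_of_real b * ft (trunc R g) \<xi>" for R \<xi>
  proof -
    have "trunc R (\<lambda>x. a * f x + b * g x) = (\<lambda>x. complex_of_real a * trunc R f x + complex_of_real b * trunc R g x)"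
      by (auto simp: trunc_def algebra_simps)
    then have "ft (trunc R (\<lambda>x. a * f x + b * g x)) \<xi> = ft (\<lambda>x. complex_of_real a * trunc R f x + complex_of_real b * trunc R g x) \<xi>"
      by (rule arg_cong)
    also have "\<dots> = ft (\<lambda>x. complex_of_real a * trunc R f x) \<xi> + ft (\<lambda>x. complex_of_real b * trunc R g x) \<xi>"
      by (rule ft_add) (intro integrable_mult_right sqint_trunc(3) f g)+
    finally show ?thesis unfolding ft_cmult .
  qed
  have "((\<lambda>R. \<bar>a\<bar> * n2 (\<lambda>\<xi>. F \<xi> - ft (trunc R f) \<xi>) + \<bar>b\<bar> * n2 (\<lambda>\<xi>. G \<xi> - ft (trunc R g) \<xi>)) \<longlongrightarrow> \<bar>a\<bar> * 0 + \<bar>b\<bar> * 0) at_top"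
    by (intro tendsto_intros lF lG)
  then have l: "((\<lambda>R. \<bar>a\<bar> * n2 (\<lambda>\<xi>. F \<xi> - ft (trunc R f) \<xi>) + \<bar>b\<bar> * n2 (\<lambda>\<xi>. G \<xi> - ft (trunc R g) \<xi>)) \<longlongrightarrow> 0) at_top" by simp
  have "n2 (\<lambda>\<xi>. (complex_of_real a * F \<xi> + complex_of_real b * G \<xi>) - ft (trunc R (\<lambda>x. a * f x + b * g x)) \<xi>)
    \<le> \<bar>a\<bar> * n2 (\<lambda>\<xi>. F \<xi> - ft (trunc R f) \<xi>) + \<bar>b\<bar> * n2 (\<lambda>\<xi>. G \<xi> - ft (trunc R g) \<xi>)" for R
  proof -
    note d = sqint_diff(1)[OF sF sft(1), of R] sqint_diff(1)[OF sG sft(2), of R]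
    have "(\<lambda>\<xi>. (complex_of_real a * F \<xi> + complex_of_real b * G \<xi>) - ft (trunc R (\<lambda>x. a * f x + b * g x)) \<xi>)
      = (\<lambda>\<xi>. complex_of_real a * (F \<xi> - ft (trunc R f) \<xi>) + complex_of_real b * (G \<xi> - ft (trunc R g) \<xi>))"
      by (simp add: t algebra_simps)
    then show ?thesis
      using sqint_add(2)[OF sqint_cmult(1)[OF d(1), of "complex_of_real a"] sqint_cmult(1)[OF d(2), of "complex_of_real b"]]
      by (simp add: sqint_cmult(2)[OF d(1)] sqint_cmult(2)[OF d(2)])
  qed
  then have "((\<lambda>R. n2 (\<lambda>\<xi>. (complex_of_real a * F \<xi> + complex_of_real b * G \<xi>) - ft (trunc R (\<lambda>x. a * f x + b * g x)) \<xi>)) \<longlongrightarrow> 0) at_top"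
    by (intro tendsto_sandwich[OF _ _ tendsto_const l]) (auto intro!: always_eventually)
  then show "is_fourier (\<lambda>x. a * f x + b * g x) (\<lambda>\<xi>. complex_of_real a * F \<xi> + complex_of_real b * G \<xi>)"
    unfolding is_fourier_iff[OF h] using sF sG by (auto intro!: sqint_add(1) sqint_cmult(1))
qed

text \<open>The chosen representative may violate the symmetry on a null set. Its reflected
  conjugate is another transform of the same real function, and transforms are unique almost
  everywhere.\<close>

lemma fourier_herm:
  assumes f: "f \<in> L2"
  shows "AE \<xi> in lborel. fourier f (- \<xi>) = cnj (fourier f \<xi>)"
proof -
  define F where "F = fourier f"
  have sF: "sqint F" and lF: "((\<lambda>R. n2 (\<lambda>\<xi>. F \<xi> - ft (trunc R f) \<xi>)) \<longlongrightarrow> 0) at_top"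
    using is_fourier_fourier[OF f] by (auto simp: F_def is_fourier_iff[OF f])
  have ci: "inH 0 G = sqint G" "hn 0 G = n2 G" for G
    by (auto simp: wsq_def wn_def wt_0 order_less_imp_not_eq2 dest: sqint_measurable)
  have r: "sqint (\<lambda>\<xi>. cnj (G (- \<xi>)))" "n2 (\<lambda>\<xi>. cnj (G (- \<xi>))) = n2 G" if "sqint G" for G
    using inH_reflect_cnj[of 0 G] that by (auto simp: ci)
  have sft: "sqint (ft (trunc R f))" for R by (intro Plancherel_le sqint_trunc f)
  have h: "ft (trunc R f) \<xi> = cnj (ft (trunc R f) (- \<xi>))" for R \<xi>
  proof -
    have "(\<lambda>x. cnj (trunc R f x)) = trunc R f" by (auto simp: trunc_def)
    then show ?thesis using ft_cnj[of "trunc R f" \<xi>] by simp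
  qed
  have "n2 (\<lambda>\<xi>. cnj (F (- \<xi>)) - ft (trunc R f) \<xi>) = n2 (\<lambda>\<xi>. F \<xi> - ft (trunc R f) \<xi>)" for R
  proof -
    have "(\<lambda>\<xi>. cnj (F (- \<xi>)) - ft (trunc R f) \<xi>) = (\<lambda>\<xi>. cnj (F (- \<xi>) - ft (trunc R f) (- \<xi>)))"
      unfolding complex_cnj_diff h[symmetric] ..
    then show ?thesis using r(2)[OF sqint_diff(1)[OF sF sft]] by simp
  qed
  then have "is_fourier f (\<lambda>\<xi>. cnj (F (- \<xi>)))"
    unfolding is_fourier_iff[OF f] using lF r(1)[OF sF] by simp
  from fourier_AE_eq[OF f this] have "AE \<xi> in lborel. F \<xi> = cnj (F (- \<xi>))" by (simp add: F_def)
  then show ?thesis unfolding F_def by eventually_elim (metis complex_cnj_cnj)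
qed

lemma L2_multiplication_formula:
  assumes f: "f \<in> L2" and F: "is_fourier f F" and g: "integrable lborel g" "sqint g"
  shows "(LINT \<xi>|lborel. F \<xi> * g \<xi>) = (LINT x|lborel. complex_of_real (f x) * ft g x)"
proof -
  have [measurable]: "f \<in> borel_measurable borel" "g \<in> borel_measurable borel" using L2_measurable[OF f] g by auto
  have sF: "sqint F" and lF: "((\<lambda>R. n2 (\<lambda>\<xi>. F \<xi> - ft (trunc R f) \<xi>)) \<longlongrightarrow> 0) at_top"
    using F by (auto simp: is_fourier_iff[OF f])
  have sft: "sqint (ft (trunc R f))" for R by (intro Plancherel_le sqint_trunc f)
  have sf: "sqint (\<lambda>x. complex_of_real (f x))" using f by (simp add: L2_sqint)
  have sg: "sqint (ft g)" by (intro Plancherel_le g)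
  have 1: "((\<lambda>R. LINT \<xi>|lborel. ft (trunc R f) \<xi> * g \<xi>) \<longlongrightarrow> (LINT \<xi>|lborel. F \<xi> * g \<xi>)) at_top"
  proof (rule Lim_transform[OF tendsto_const], rule tendsto_norm_zero_cancel)
    have l: "((\<lambda>R. n2 (\<lambda>\<xi>. F \<xi> - ft (trunc R f) \<xi>) * n2 g) \<longlongrightarrow> 0) at_top"
      using tendsto_mult[OF lF tendsto_const[of "n2 g"]] by simp
    show "((\<lambda>R. norm ((LINT \<xi>|lborel. ft (trunc R f) \<xi> * g \<xi>) - (LINT \<xi>|lborel. F \<xi> * g \<xi>))) \<longlongrightarrow> 0) at_top"
    proof (rule tendsto_sandwich[OF _ _ tendsto_const l])
      show "\<forall>\<^sub>F R in at_top. norm ((LINT \<xi>|lborel. ft (trunc R f) \<xi> * g \<xi>) - (LINT \<xi>|lborel. F \<xi> * g \<xi>))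
        \<le> n2 (\<lambda>\<xi>. F \<xi> - ft (trunc R f) \<xi>) * n2 g"
      proof (intro always_eventually allI)
        fix R
        have "(LINT \<xi>|lborel. ft (trunc R f) \<xi> * g \<xi>) - (LINT \<xi>|lborel. F \<xi> * g \<xi>) = (LINT \<xi>|lborel. (ft (trunc R f) \<xi> - F \<xi>) * g \<xi>)"
          using sqint_Cauchy_Schwarz(2)[OF sft g(2)] sqint_Cauchy_Schwarz(2)[OF sF g(2)] by (simp add: left_diff_distrib)
        also have "norm \<dots> \<le> (LINT \<xi>|lborel. norm ((ft (trunc R f) \<xi> - F \<xi>) * g \<xi>))" by (rule integral_norm_bound)
        also have "\<dots> \<le> n2 (\<lambda>\<xi>. ft (trunc R f) \<xi> - F \<xi>) * n2 g"
          using sqint_Cauchy_Schwarz(3)[OF sqint_diff(1)[OF sft sF] g(2)] by (simp add: norm_mult)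
        finally show "norm ((LINT \<xi>|lborel. ft (trunc R f) \<xi> * g \<xi>) - (LINT \<xi>|lborel. F \<xi> * g \<xi>)) \<le> n2 (\<lambda>\<xi>. F \<xi> - ft (trunc R f) \<xi>) * n2 g"
          by (simp add: n2_minus_commute[of F])
      qed
    qed auto
  qed
  have 2: "((\<lambda>R. LINT x|lborel. trunc R f x * ft g x) \<longlongrightarrow> (LINT x|lborel. complex_of_real (f x) * ft g x)) at_top"
  proof (rule integral_dominated_convergence_at_top[where w = "\<lambda>x. cmod (complex_of_real (f x) * ft g x)"])
    show "integrable lborel (\<lambda>x. cmod (complex_of_real (f x) * ft g x))"
      by (intro integrable_norm sqint_Cauchy_Schwarz(2) sf sg)
    show "\<forall>\<^sub>F R in at_top. AE x in lborel. norm (trunc R f x * ft g x) \<le> cmod (complex_of_real (f x) * ft g x)"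
      by (intro always_eventually allI AE_I2) (auto simp: trunc_def indicator_def norm_mult)
    show "AE x in lborel. ((\<lambda>R. trunc R f x * ft g x) \<longlongrightarrow> complex_of_real (f x) * ft g x) at_top"
    proof (intro AE_I2 tendsto_eventually)
      fix x :: real
      show "\<forall>\<^sub>F R in at_top. trunc R f x * ft g x = complex_of_real (f x) * ft g x"
        using eventually_ge_at_top[of "\<bar>x\<bar>"] by eventually_elim (auto simp: trunc_def indicator_def abs_le_iff)
    qed
  qed measurable
  have "(LINT \<xi>|lborel. ft (trunc R f) \<xi> * g \<xi>) = (LINT x|lborel. trunc R f x * ft g x)" for R
    by (rule ft_multiplication_formula[OF sqint_trunc(3)[OF f] g(1)])
  with 2 have "((\<lambda>R. LINT \<xi>|lborel. ft (trunc R f) \<xi> * g \<xi>) \<longlongrightarrow> (LINT x|lborel. complex_of_real (f x) * ft g x)) at_top" by simp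
  from tendsto_unique[OF trivial_limit_at_top_linorder 1 this] show ?thesis .
qed

text \<open>The product of F with a Gaussian is integrable, so L^1 uniqueness becomes applicable to
  a merely square integrable F.\<close>

lemma AE_zero_if_gauss_zero:
  assumes F: "sqint F" and z: "\<And>a. (LINT \<xi>|lborel. F \<xi> * (exp (- (\<i> * complex_of_real (\<xi> * a))) * gauss \<xi>)) = 0"
  shows "AE \<xi> in lborel. F \<xi> = 0"
proof -
  have i: "integrable lborel (\<lambda>\<xi>. F \<xi> * gauss \<xi>)" by (rule sqint_Cauchy_Schwarz(2)[OF F sqint_gauss])
  have "AE \<xi> in lborel. F \<xi> * gauss \<xi> = 0"
  proof (rule L1_uniqueness[OF i])
    fix t
    show "ft (\<lambda>\<xi>. F \<xi> * gauss \<xi>) t = 0" using z[of t] unfolding ft_def by (simp add: mult_ac)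
  qed
  then show ?thesis by eventually_elim (simp add: gauss_def)
qed

lemma gauss_modulated:
  fixes a :: real
  defines "\<gamma> \<equiv> \<lambda>\<xi>. exp (- (\<i> * complex_of_real (\<xi> * a))) * gauss \<xi>"
  shows "integrable lborel \<gamma>" "sqint \<gamma>" "ft \<gamma> x = complex_of_real (sqrt (2 * pi)) * gauss (x + a)"
proof -
  show "integrable lborel \<gamma>" unfolding \<gamma>_def by (rule ft_integrand_integrable[OF gauss_integrable(1)])
  then have "\<gamma> \<in> borel_measurable borel" by auto
  then show "sqint \<gamma>" by (rule sqint_mono1(1)[OF sqint_gauss]) (simp add: \<gamma>_def norm_mult)
  show "ft \<gamma> x = complex_of_real (sqrt (2 * pi)) * gauss (x + a)"
    unfolding \<gamma>_def ft_modulate ft_gauss ..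
qed

lemma gauss_shifted:
  "integrable lborel (\<lambda>x. gauss (x - a))" "sqint (\<lambda>x. gauss (x - a))"
  "ft (\<lambda>x. gauss (x - a)) t = complex_of_real (sqrt (2 * pi)) * (exp (- (\<i> * complex_of_real (t * a))) * gauss t)"
proof -
  have m: "- a + 1 * x = x - a" for x :: real by simp
  have "integrable lborel (\<lambda>x. gauss (- a + 1 * x))"
    by (rule lborel_integrable_real_affine[OF gauss_integrable(1)]) simp
  then show "integrable lborel (\<lambda>x. gauss (x - a))" unfolding m .
  have "integrable lborel (\<lambda>x. (cmod (gauss (- a + 1 * x)))\<^sup>2)"
    by (rule lborel_integrable_real_affine) (use sqint_gauss in \<open>auto simp: sqint_def\<close>)
  then show "sqint (\<lambda>x. gauss (x - a))" using \<open>integrable lborel (\<lambda>x. gauss (x - a))\<close> unfolding m sqint_def by auto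
  show "ft (\<lambda>x. gauss (x - a)) t = complex_of_real (sqrt (2 * pi)) * (exp (- (\<i> * complex_of_real (t * a))) * gauss t)"
    unfolding ft_translate ft_gauss by (simp add: mult_ac)
qed

text \<open>Testing F against translated Gaussians amounts, by the multiplication formula, to
  testing f against modulated ones.\<close>

lemma fourier_injective:
  assumes f: "f \<in> L2" and F: "is_fourier f F" and z: "AE \<xi> in lborel. F \<xi> = 0"
  shows "AE x in lborel. f x = 0"
proof -
  have "AE x in lborel. complex_of_real (f x) = 0"
  proof (rule AE_zero_if_gauss_zero)
    show "sqint (\<lambda>x. complex_of_real (f x))" using f by (simp add: L2_sqint)
    fix a
    have Fm: "F \<in> borel_measurable borel" using F by (simp add: is_fourier_def)
    have "(LINT \<xi>|lborel. F \<xi> * gauss (\<xi> - a)) = (LINT \<xi>::real|lborel. 0)"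
    proof (rule integral_cong_AE)
      show "AE \<xi> in lborel. F \<xi> * gauss (\<xi> - a) = 0" using z by eventually_elim simp
    qed (use Fm gauss_shifted(1)[of a] in \<open>auto intro!: borel_measurable_times\<close>)
    then have "(LINT x|lborel. complex_of_real (f x) * ft (\<lambda>\<xi>. gauss (\<xi> - a)) x) = 0"
      using L2_multiplication_formula[OF f F gauss_shifted(1,2)[of a]] by simp
    moreover have "(LINT x|lborel. complex_of_real (f x) * ft (\<lambda>\<xi>. gauss (\<xi> - a)) x)
      = (LINT x|lborel. complex_of_real (sqrt (2 * pi)) * (complex_of_real (f x) * (exp (- (\<i> * complex_of_real (x * a))) * gauss x)))"
      unfolding gauss_shifted(3) by (intro Bochner_Integration.integral_cong) (auto simp: mult_ac)
    moreover have "\<dots> = complex_of_real (sqrt (2 * pi)) * (LINT x|lborel. complex_of_real (f x) * (exp (- (\<i> * complex_of_real (x * a))) * gauss x))"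
      by (rule integral_mult_right_zero)
    ultimately show "(LINT x|lborel. complex_of_real (f x) * (exp (- (\<i> * complex_of_real (x * a))) * gauss x)) = 0"
      by (simp del: real_sqrt_mult)
  qed
  then show ?thesis by simp
qed

text \<open>With spectra normalised by 2 pi the inversion formula has no prefactor: it is
  \<open>ft\<close> at the reflected point. For hermitian U the discarded imaginary part is
  0.\<close>

definition invF :: "(real \<Rightarrow> complex) \<Rightarrow> real \<Rightarrow> real" where
  "invF U x = Re (ft U (- x))"

lemma invF_herm:
  assumes "herm U"
  shows "complex_of_real (invF U x) = ft U (- x)"
proof -
  have "(\<lambda>y. cnj (U y)) = (\<lambda>y. U (- y))" using hermD[OF assms] by auto
  then have "cnj (ft U (- x)) = ft U (- x)" using ft_cnj[of U x] ft_reflect[of U x] by simp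
  then show ?thesis by (simp add: invF_def complex_eq_iff)
qed

lemma invF_measurable [measurable (raw)]: "U \<in> borel_measurable borel \<Longrightarrow> invF U \<in> borel_measurable borel"
proof -
  assume [measurable]: "U \<in> borel_measurable borel"
  have [measurable]: "ft U \<in> borel_measurable borel" by (rule ft_measurable) measurable
  show ?thesis unfolding invF_def[abs_def] by measurable
qed

text \<open>Fourier inversion, tested against modulated Gaussians. The multiplication formula moves
  the transform twice, and the two Gaussian transforms contribute a factor sqrt (2 pi) each.\<close>

theorem is_fourier_invF:
  assumes U: "integrable lborel U" "sqint U" "herm U"
  shows "invF U \<in> L2" "is_fourier (invF U) (\<lambda>\<xi>. complex_of_real (2 * pi) * U \<xi>)"
proof -
  have [measurable]: "U \<in> borel_measurable borel" using U by auto
  have sft: "sqint (ft U)" by (rule Plancherel_le(1)[OF U(1,2)])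
  note [measurable] = sqint_measurable[OF sft]
  have "integrable lborel (\<lambda>x. (cmod (ft U (0 + - 1 * x)))\<^sup>2)"
    by (rule lborel_integrable_real_affine) (use sft in \<open>auto simp: sqint_def\<close>)
  then have "sqint (\<lambda>x. ft U (- x))" by (simp add: sqint_def)
  then show L: "invF U \<in> L2" using invF_herm[OF U(3)] by (simp add: L2_sqint)
  obtain F where F: "is_fourier (invF U) F" using is_fourier_exists[OF L] by blast
  have sF: "sqint F" using F unfolding is_fourier_iff[OF L] by (rule conjunct1)
  have sU: "sqint (\<lambda>\<xi>. complex_of_real (2 * pi) * U \<xi>)" by (rule sqint_cmult(1)[OF U(2)])
  have "AE \<xi> in lborel. F \<xi> - complex_of_real (2 * pi) * U \<xi> = 0"
  proof (rule AE_zero_if_gauss_zero[OF sqint_diff(1)[OF sF sU]])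
    fix a
    let ?\<gamma> = "\<lambda>\<xi>. exp (- (\<i> * complex_of_real (\<xi> * a))) * gauss \<xi>"
    have c: "complex_of_real (sqrt (2 * pi)) * complex_of_real (sqrt (2 * pi)) = complex_of_real (2 * pi)"
      unfolding of_real_mult[symmetric] by simp
    have "(LINT \<xi>|lborel. F \<xi> * ?\<gamma> \<xi>) = (LINT x|lborel. complex_of_real (invF U x) * ft ?\<gamma> x)"
      by (rule L2_multiplication_formula[OF L F gauss_modulated(1,2)])
    also have "\<dots> = (LINT x|lborel. complex_of_real (sqrt (2 * pi)) * (ft U (- x) * gauss (- x - a)))"
      unfolding gauss_modulated(3) invF_herm[OF U(3)]
      by (intro Bochner_Integration.integral_cong) (auto simp: mult_ac gauss_def power2_commute[of _ "- a"] power2_eq_square algebra_simps)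
    also have "\<dots> = complex_of_real (sqrt (2 * pi)) * (LINT x|lborel. ft U (- x) * gauss (- x - a))"
      by (rule integral_mult_right_zero)
    also have "(LINT x|lborel. ft U (- x) * gauss (- x - a)) = (LINT x|lborel. ft U x * gauss (x - a))"
      by (rule integral_reflect_lborel)
    also have "\<dots> = (LINT \<xi>|lborel. U \<xi> * ft (\<lambda>x. gauss (x - a)) \<xi>)"
      by (rule ft_multiplication_formula[OF U(1) gauss_shifted(1)])
    also have "\<dots> = (LINT \<xi>|lborel. complex_of_real (sqrt (2 * pi)) * (U \<xi> * ?\<gamma> \<xi>))"
      unfolding gauss_shifted(3) by (intro Bochner_Integration.integral_cong) (auto simp: mult_ac)
    also have "\<dots> = complex_of_real (sqrt (2 * pi)) * (LINT \<xi>|lborel. U \<xi> * ?\<gamma> \<xi>)"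
      by (rule integral_mult_right_zero)
    finally have "(LINT \<xi>|lborel. F \<xi> * ?\<gamma> \<xi>) = complex_of_real (2 * pi) * (LINT \<xi>|lborel. U \<xi> * ?\<gamma> \<xi>)"
      unfolding mult.assoc[symmetric] c .
    also have "\<dots> = (LINT \<xi>|lborel. complex_of_real (2 * pi) * (U \<xi> * ?\<gamma> \<xi>))" by (rule integral_mult_right_zero[symmetric])
    also have "\<dots> = (LINT \<xi>|lborel. complex_of_real (2 * pi) * U \<xi> * ?\<gamma> \<xi>)" by (simp add: mult.assoc)
    finally have eq: "(LINT \<xi>|lborel. F \<xi> * ?\<gamma> \<xi>) = (LINT \<xi>|lborel. complex_of_real (2 * pi) * U \<xi> * ?\<gamma> \<xi>)" .
    have i1: "integrable lborel (\<lambda>\<xi>. F \<xi> * ?\<gamma> \<xi>)" by (rule sqint_Cauchy_Schwarz(2)[OF sF gauss_modulated(2)])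
    have i2: "integrable lborel (\<lambda>\<xi>. complex_of_real (2 * pi) * U \<xi> * ?\<gamma> \<xi>)" by (rule sqint_Cauchy_Schwarz(2)[OF sU gauss_modulated(2)])
    have "(LINT \<xi>|lborel. (F \<xi> - complex_of_real (2 * pi) * U \<xi>) * ?\<gamma> \<xi>) = (LINT \<xi>|lborel. F \<xi> * ?\<gamma> \<xi> - complex_of_real (2 * pi) * U \<xi> * ?\<gamma> \<xi>)"
      by (simp only: left_diff_distrib)
    also have "\<dots> = 0" using Bochner_Integration.integral_diff[OF i1 i2] eq by simp
    finally show "(LINT \<xi>|lborel. (F \<xi> - complex_of_real (2 * pi) * U \<xi>) * ?\<gamma> \<xi>) = 0" .
  qed
  then have ae: "AE \<xi> in lborel. F \<xi> = complex_of_real (2 * pi) * U \<xi>" by simp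
  have lF: "((\<lambda>R. n2 (\<lambda>\<xi>. F \<xi> - ft (trunc R (invF U)) \<xi>)) \<longlongrightarrow> 0) at_top"
    using F unfolding is_fourier_iff[OF L] by (rule conjunct2)
  have "n2 (\<lambda>\<xi>. F \<xi> - ft (trunc R (invF U)) \<xi>) = n2 (\<lambda>\<xi>. complex_of_real (2 * pi) * U \<xi> - ft (trunc R (invF U)) \<xi>)" for R
  proof (rule n2_cong_AE)
    show "AE \<xi> in lborel. F \<xi> - ft (trunc R (invF U)) \<xi> = complex_of_real (2 * pi) * U \<xi> - ft (trunc R (invF U)) \<xi>"
      using ae by eventually_elim simp
  qed (use sqint_measurable[OF sF] ft_measurable[of "trunc R (invF U)"] in measurable)
  then show "is_fourier (invF U) (\<lambda>\<xi>. complex_of_real (2 * pi) * U \<xi>)"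
    using lF sU unfolding is_fourier_iff[OF L] by simp
qed

lemma fourier_invF:
  assumes "integrable lborel U" "sqint U" "herm U"
  shows "AE \<xi> in lborel. fourier (invF U) \<xi> = complex_of_real (2 * pi) * U \<xi>"
  using is_fourier_invF[OF assms] by (rule fourier_AE_eq)

lemma AE_eq_if_fourier_eq:
  assumes f: "f \<in> L2" and g: "g \<in> L2" and eq: "AE \<xi> in lborel. fourier f \<xi> = fourier g \<xi>"
  shows "AE x in lborel. f x = g x"
proof -
  note l = is_fourier_linear[OF f g is_fourier_fourier[OF f] is_fourier_fourier[OF g], of 1 "-1"]
  have "AE x in lborel. 1 * f x + - 1 * g x = 0"
  proof (rule fourier_injective[OF l])
    show "AE \<xi> in lborel. complex_of_real 1 * fourier f \<xi> + complex_of_real (- 1) * fourier g \<xi> = 0"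
      using eq by eventually_elim simp
  qed
  then show ?thesis by eventually_elim simp
qed

section \<open>Weak derivatives\<close>

text \<open>The standard flat function exp (-1/x) times inverse powers. The powers are included
  because differentiation produces them, and their span is closed under it.\<close>

definition flat :: "nat \<Rightarrow> real \<Rightarrow> real" where
  "flat k x = (if 0 < x then exp (- inverse x) * inverse x ^ k else 0)"

text \<open>A single term of the exponential series beats the inverse power. Quadratic vanishing at
  0 then gives the derivative 0 there.\<close>

lemma flat_bound: "\<bar>flat k x\<bar> \<le> fact (k + 2) * x\<^sup>2"
proof (cases "0 < x")
  case True
  define y where "y = inverse x"
  have y: "0 < y" using True by (simp add: y_def)
  have "(\<Sum>n\<in>{k + 2}. y ^ n /\<^sub>R fact n) \<le> exp y"
    unfolding exp_def by (rule sum_le_suminf[OF summable_exp_generic]) (use y in auto)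
  then have "inverse (fact (k + 2)) * y ^ (k + 2) \<le> exp y" by simp
  then have "y ^ (k + 2) \<le> fact (k + 2) * exp y" by (simp add: field_simps del: fact_Suc power_Suc)
  then have "exp (- y) * y ^ (k + 2) \<le> fact (k + 2)" by (simp add: exp_minus field_simps del: fact_Suc power_Suc)
  then have "exp (- y) * y ^ (k + 2) * x\<^sup>2 \<le> fact (k + 2) * x\<^sup>2" by (rule mult_right_mono) simp
  moreover have "y ^ (k + 2) * x\<^sup>2 = y ^ k" using True by (simp add: y_def power_add field_simps power2_eq_square)
  ultimately have "exp (- y) * y ^ k \<le> fact (k + 2) * x\<^sup>2" by (simp only: mult.assoc)
  then show ?thesis using True y by (simp add: flat_def y_def[symmetric])
qed (simp add: flat_def)

lemma flat_deriv: "(flat k has_real_derivative flat (k + 2) x - real k * flat (k + 1) x) (at x)"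
proof -
  consider "0 < x" | "x < 0" | "x = 0" by linarith
  then show ?thesis
  proof cases
    case 1
    have "((\<lambda>x. exp (- inverse x) * inverse x ^ k) has_real_derivative
      exp (- inverse x) * inverse x ^ (k + 2) - real k * (exp (- inverse x) * inverse x ^ (k + 1))) (at x)"
    proof (cases k)
      case 0
      then show ?thesis using 1 by (auto intro!: derivative_eq_intros simp: power2_eq_square)
    next
      case (Suc m)
      have "((\<lambda>x. exp (- inverse x) * inverse x ^ k) has_real_derivative
        exp (- inverse x) * (inverse x)\<^sup>2 * inverse x ^ k + exp (- inverse x) * (real k * inverse x ^ (k - 1) * - (inverse x)\<^sup>2)) (at x)"
        using 1 by (auto intro!: derivative_eq_intros simp: power2_eq_square)
      then show ?thesis by (simp add: Suc power2_eq_square mult_ac)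
    qed
    then have "((\<lambda>x. exp (- inverse x) * inverse x ^ k) has_real_derivative flat (k + 2) x - real k * flat (k + 1) x) (at x)"
      using 1 by (simp add: flat_def)
    then show ?thesis
      by (rule has_field_derivative_transform_within_open[where S = "{0<..}"]) (use 1 in \<open>auto simp: flat_def\<close>)
  next
    case 2
    have "((\<lambda>x. 0) has_real_derivative flat (k + 2) x - real k * flat (k + 1) x) (at x)"
      using 2 by (simp add: flat_def)
    then show ?thesis
      by (rule has_field_derivative_transform_within_open[where S = "{..<0}"]) (use 2 in \<open>auto simp: flat_def\<close>)
  next
    case 3
    have "((\<lambda>h. (flat k (0 + h) - flat k 0) / h) \<longlongrightarrow> 0) (at 0)"
    proof (rule Lim_null_comparison)
      show "\<forall>\<^sub>F h in at 0. norm ((flat k (0 + h) - flat k 0) / h) \<le> fact (k + 2) * \<bar>h\<bar>"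
      proof (rule eventually_at_filter[THEN iffD2], intro always_eventually allI impI)
        fix h :: real assume "h \<noteq> 0"
        then show "norm ((flat k (0 + h) - flat k 0) / h) \<le> fact (k + 2) * \<bar>h\<bar>"
          using flat_bound[of k h] by (simp add: flat_def[of k 0] pos_divide_le_eq mult.assoc power2_eq_square del: fact_Suc)
      qed
      show "((\<lambda>h. fact (k + 2) * \<bar>h\<bar>) \<longlongrightarrow> 0) (at (0::real))"
        by (rule tendsto_eq_intros refl tendsto_rabs | simp)+
    qed
    then show ?thesis using 3 by (simp add: DERIV_def flat_def[of _ 0])
  qed
qed

text \<open>An algebra closed under differentiation: iterated derivatives remain in it, so
  smoothness needs no formula for them. The phase b covers sines as well as cosines.\<close>

inductive_set smooth_alg :: "(real \<Rightarrow> real) set" where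
  const: "(\<lambda>x. c) \<in> smooth_alg"
| trig: "(\<lambda>x. cos (t * x + b)) \<in> smooth_alg"
| flat: "(\<lambda>x. flat k (a + c * x)) \<in> smooth_alg"
| add: "f \<in> smooth_alg \<Longrightarrow> g \<in> smooth_alg \<Longrightarrow> (\<lambda>x. f x + g x) \<in> smooth_alg"
| mult: "f \<in> smooth_alg \<Longrightarrow> g \<in> smooth_alg \<Longrightarrow> (\<lambda>x. f x * g x) \<in> smooth_alg"

lemma smooth_alg_deriv:
  assumes "f \<in> smooth_alg"
  shows "\<exists>f'\<in>smooth_alg. \<forall>x. (f has_real_derivative f' x) (at x)"
  using assms
proof induction
  case (const c)
  show ?case by (rule bexI[OF _ smooth_alg.const[of 0]]) simp
next
  case (trig t b)
  have "((\<lambda>x. cos (t * x + b)) has_real_derivative t * cos (t * x + (b + pi / 2))) (at x)" for x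
    by (auto intro!: derivative_eq_intros simp: cos_add sin_add algebra_simps)
  then show ?case by (intro bexI[OF _ smooth_alg.mult[OF smooth_alg.const smooth_alg.trig]] allI)
next
  case (flat k a c)
  have "((\<lambda>x. flat k (a + c * x)) has_real_derivative c * (flat (k + 2) (a + c * x) + - real k * flat (k + 1) (a + c * x))) (at x)" for x
  proof -
    have "((\<lambda>x. a + c * x) has_real_derivative c) (at x)" by (auto intro!: derivative_eq_intros)
    from DERIV_chain2[OF flat_deriv this] show ?thesis by (simp add: mult.commute)
  qed
  then show ?case
    by (intro bexI[OF _ smooth_alg.mult[OF smooth_alg.const smooth_alg.add[OF smooth_alg.flat smooth_alg.mult[OF smooth_alg.const smooth_alg.flat]]]] allI)
next
  case (add f g)
  then obtain f' g' where "f' \<in> smooth_alg" "g' \<in> smooth_alg" "\<And>x. (f has_real_derivative f' x) (at x)" "\<And>x. (g has_real_derivative g' x) (at x)"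
    by blast
  then show ?case by (intro bexI[OF _ smooth_alg.add[of f' g']] allI DERIV_add) auto
next
  case (mult f g)
  then obtain f' g' where d: "f' \<in> smooth_alg" "g' \<in> smooth_alg" "\<And>x. (f has_real_derivative f' x) (at x)" "\<And>x. (g has_real_derivative g' x) (at x)"
    by blast
  show ?case
    by (rule bexI[OF _ smooth_alg.add[OF smooth_alg.mult[OF d(1) mult.hyps(2)] smooth_alg.mult[OF d(2) mult.hyps(1)]]])
      (intro allI DERIV_mult d)
qed

lemma smooth_alg_differentiable: "f \<in> smooth_alg \<Longrightarrow> f differentiable_on UNIV"
  using smooth_alg_deriv[of f] by (auto simp: differentiable_on_def real_differentiable_def)

lemma smooth_alg_funpow_deriv: "f \<in> smooth_alg \<Longrightarrow> (deriv ^^ n) f \<in> smooth_alg"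
proof (induction n)
  case (Suc n)
  then obtain g where g: "g \<in> smooth_alg" "\<And>x. ((deriv ^^ n) f has_real_derivative g x) (at x)"
    using smooth_alg_deriv by blast
  have "deriv ((deriv ^^ n) f) = g" by (rule ext, rule DERIV_imp_deriv, rule g(2))
  then show ?case using g(1) by simp
qed simp

text \<open>Smooth, positive on (-r, r) and zero outside. The factors \<open>1 * x\<close> and
  \<open>- 1 * x\<close> reproduce the affine shape of the rule
  \<open>smooth_alg.flat\<close>.\<close>

definition bump :: "real \<Rightarrow> real \<Rightarrow> real" where
  "bump r x = flat 0 (r + 1 * x) * flat 0 (r + - 1 * x)"

lemma bump_pos: "\<bar>x\<bar> < r \<Longrightarrow> 0 < bump r x"
  and bump_zero: "r \<le> \<bar>x\<bar> \<Longrightarrow> bump r x = 0"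
  and bump_bounds: "0 \<le> bump r x" "bump r x \<le> 1"
  by (auto simp: bump_def flat_def intro!: mult_le_one)

lemma bump_trig: "(\<lambda>x. bump r x * cos (t * x + b)) \<in> smooth_alg"
  unfolding bump_def by (intro smooth_alg.mult smooth_alg.trig smooth_alg.flat)

lemma test_function_bump_trig: "test_function (\<lambda>x. bump r x * cos (t * x + b))"
  unfolding test_function_def
proof (intro conjI allI exI[of _ r] impI)
  show "(deriv ^^ n) (\<lambda>x. bump r x * cos (t * x + b)) differentiable_on UNIV" for n
    by (intro smooth_alg_differentiable smooth_alg_funpow_deriv bump_trig)
qed (simp add: bump_zero)

lemma bump_trig_measurable: "(\<lambda>x. bump r x * cos (t * x + b)) \<in> borel_measurable borel"
  by (intro borel_measurable_continuous_onI differentiable_imp_continuous_on smooth_alg_differentiable bump_trig)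

text \<open>The fundamental lemma of the calculus of variations by Fourier analysis. The product of
  d with a bump is integrable, its transform is a pairing of d with bumps times cosines, hence 0,
  and L^1 uniqueness applies.\<close>

lemma locally_integrable_eq_0:
  assumes d: "locally_integrable d"
    and z: "\<And>\<phi>. test_function \<phi> \<Longrightarrow> (LINT x|lborel. d x * \<phi> x) = 0"
  shows "AE x in lborel. d x = 0"
proof -
  have [measurable]: "d \<in> borel_measurable borel" using d by (simp add: locally_integrable_def)
  have "AE x in lborel. \<bar>x\<bar> < real n \<longrightarrow> d x = 0" for n
  proof -
    define r where "r = real n"
    have i0: "integrable lborel (\<lambda>x. indicator {-r..r} x * d x)"
      using d by (simp add: locally_integrable_def set_integrable_def)
    have i: "integrable lborel (\<lambda>x. d x * (bump r x * cos (t * x + b)))" for t b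
    proof (rule Bochner_Integration.integrable_bound[OF i0])
      note [measurable] = bump_trig_measurable
      show "(\<lambda>x. d x * (bump r x * cos (t * x + b))) \<in> borel_measurable lborel" by measurable
      have "\<bar>bump r x * cos (t * x + b)\<bar> \<le> 1" for x
        using bump_bounds[of r x] by (simp add: abs_mult mult_le_one)
      then have "\<bar>d x\<bar> * \<bar>bump r x * cos (t * x + b)\<bar> \<le> \<bar>d x\<bar>" for x
        by (rule mult_left_le) simp
      then show "AE x in lborel. norm (d x * (bump r x * cos (t * x + b))) \<le> norm (indicator {-r..r} x * d x)"
        by (intro AE_I2) (auto simp: indicator_def abs_mult bump_zero)
    qed
    have i1: "integrable lborel (\<lambda>x. complex_of_real (d x * (bump r x * cos (t * x + b))))" for t b
      by (rule integrable_of_real[OF i])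
    have z1: "(LINT x|lborel. complex_of_real (d x * (bump r x * cos (t * x + b)))) = 0" for t b
      using z[OF test_function_bump_trig] by (simp only: integral_complex_of_real of_real_0)
    let ?H = "\<lambda>x. complex_of_real (d x * bump r x)"
    have "AE x in lborel. ?H x = 0"
    proof (rule L1_uniqueness)
      show "integrable lborel ?H" using i1[of 0 0] by simp
      fix t
      \<comment> \<open>The cosine with phase pi/2 is minus the sine, so both parts of the
        exponential lead to test functions.\<close>
      have e: "exp (- (\<i> * complex_of_real (x * t))) * ?H x
        = complex_of_real (d x * (bump r x * cos (t * x + 0))) + \<i> * complex_of_real (d x * (bump r x * cos (t * x + pi / 2)))" for x
        by (simp add: complex_eq_iff exp_eq_polar cis.ctr Re_exp Im_exp cos_add mult_ac)
      have "ft ?H t = (LINT x|lborel. complex_of_real (d x * (bump r x * cos (t * x + 0))) + \<i> * complex_of_real (d x * (bump r x * cos (t * x + pi / 2))))"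
        unfolding ft_def e ..
      also have "\<dots> = (LINT x|lborel. complex_of_real (d x * (bump r x * cos (t * x + 0)))) + (LINT x|lborel. \<i> * complex_of_real (d x * (bump r x * cos (t * x + pi / 2))))"
        by (intro Bochner_Integration.integral_add integrable_mult_right i1)
      also have "\<dots> = 0" by (simp only: z1 integral_mult_right_zero mult_zero_right add_0)
      finally show "ft ?H t = 0" .
    qed
    then show ?thesis
    proof eventually_elim
      fix x assume "?H x = 0"
      then show "\<bar>x\<bar> < real n \<longrightarrow> d x = 0" using bump_pos[of x r] by (auto simp: r_def)
    qed
  qed
  then have "AE x in lborel. \<forall>n. \<bar>x\<bar> < real n \<longrightarrow> d x = 0" by (subst AE_all_countable) blast
  then show ?thesis
  proof eventually_elim
    fix x assume "\<forall>n. \<bar>x\<bar> < real n \<longrightarrow> d x = 0"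
    then show "d x = 0" using reals_Archimedean2[of "\<bar>x\<bar>"] by blast
  qed
qed

lemma test_functionD:
  assumes "test_function \<phi>"
  shows "(\<phi> has_real_derivative deriv \<phi> x) (at x)" "continuous_on A \<phi>" "continuous_on A (deriv \<phi>)"
proof -
  have d: "(deriv ^^ n) \<phi> differentiable_on UNIV" for n using assms by (simp add: test_function_def)
  from d[of 0] have "\<phi> differentiable at x" by (auto simp: differentiable_on_def)
  then show "(\<phi> has_real_derivative deriv \<phi> x) (at x)" by (simp add: real_differentiable_def) (metis DERIV_imp_deriv)
  show "continuous_on A \<phi>" "continuous_on A (deriv \<phi>)"
    using differentiable_imp_continuous_on[OF d[of 0]] differentiable_imp_continuous_on[OF d[of 1]]
    by (auto intro: continuous_on_subset)
qed

lemma test_function_support: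
  assumes t: "test_function \<phi>"
  obtains R where "0 < R" "\<And>x. R \<le> \<bar>x\<bar> \<Longrightarrow> \<phi> x = 0 \<and> deriv \<phi> x = 0"
proof -
  obtain R where R: "\<And>x. R < \<bar>x\<bar> \<Longrightarrow> \<phi> x = 0" using t by (auto simp: test_function_def)
  have "\<phi> x = 0 \<and> deriv \<phi> x = 0" if x: "\<bar>R\<bar> + 1 \<le> \<bar>x\<bar>" for x
  proof
    show "\<phi> x = 0" using R x by auto
    have "open {y::real. R < \<bar>y\<bar>}" by (intro open_Collect_less continuous_intros)
    moreover have "((\<lambda>y. 0) has_real_derivative 0) (at x)" by simp
    ultimately have "(\<phi> has_real_derivative 0) (at x)"
      using has_field_derivative_transform_within_open[of "\<lambda>y. 0" 0 x "{y. R < \<bar>y\<bar>}" \<phi>] x R by auto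
    then show "deriv \<phi> x = 0" by (rule DERIV_imp_deriv)
  qed
  then show ?thesis using that[of "\<bar>R\<bar> + 1"] by force
qed

lemma compact_support_integral:
  fixes f :: "real \<Rightarrow> 'b::{banach, second_countable_topology}"
  assumes c: "continuous_on {-R..R} f" and z: "\<And>x. R \<le> \<bar>x\<bar> \<Longrightarrow> f x = 0"
  shows "integrable lborel f" "(\<lambda>x. indicator {-R..R} x *\<^sub>R f x) = f"
proof -
  show e: "(\<lambda>x. indicator {-R..R} x *\<^sub>R f x) = f" using z by (auto simp: indicator_def fun_eq_iff)
  show "integrable lborel f" using borel_integrable_atLeastAtMost'[OF c] by (simp add: set_integrable_def e)
qed

lemma test_function_integrable:
  assumes t: "test_function \<phi>"
  shows "integrable lborel \<phi>" "integrable lborel (deriv \<phi>)"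
proof -
  obtain R where R: "\<And>x. R \<le> \<bar>x\<bar> \<Longrightarrow> \<phi> x = 0 \<and> deriv \<phi> x = 0" using test_function_support[OF t] by metis
  show "integrable lborel \<phi>" "integrable lborel (deriv \<phi>)"
    using R by (auto intro!: compact_support_integral(1)[of R] test_functionD[OF t])
qed

lemma ft_deriv:
  assumes t: "test_function \<phi>"
  shows "ft (\<lambda>x. complex_of_real (deriv \<phi> x)) \<xi> = \<i> * complex_of_real \<xi> * ft (\<lambda>x. complex_of_real (\<phi> x)) \<xi>"
proof -
  obtain R where "0 < R" and R: "\<And>x. R \<le> \<bar>x\<bar> \<Longrightarrow> \<phi> x = 0 \<and> deriv \<phi> x = 0" using test_function_support[OF t] by metis
  let ?e = "\<lambda>x. exp (- (\<i> * complex_of_real (x * \<xi>)))"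
  let ?g = "\<lambda>x. ?e x * complex_of_real (deriv \<phi> x) - \<i> * complex_of_real \<xi> * (?e x * complex_of_real (\<phi> x))"
  have d: "((\<lambda>x. ?e x * complex_of_real (\<phi> x)) has_vector_derivative ?g x) (at x within {-R..R})" for x
  proof -
    have 1: "((\<lambda>x. complex_of_real (\<phi> x)) has_vector_derivative complex_of_real (deriv \<phi> x)) (at x within {-R..R})"
      by (rule has_vector_derivative_at_within[OF has_vector_derivative_of_real[OF test_functionD(1)[OF t]]])
    have 2: "(?e has_vector_derivative (- \<i> * complex_of_real \<xi>) * ?e x) (at x within {-R..R})"
    proof -
      have "((\<lambda>z. exp (- (\<i> * (z * complex_of_real \<xi>)))) has_field_derivative (- \<i> * complex_of_real \<xi>) * ?e x) (at (complex_of_real x))"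
        by (auto intro!: derivative_eq_intros)
      from has_vector_derivative_real_field[OF this] show ?thesis by (simp add: has_vector_derivative_at_within)
    qed
    from has_vector_derivative_mult[OF 2 1] show ?thesis by (simp add: algebra_simps)
  qed
  have c: "continuous_on A (\<lambda>x. complex_of_real (\<phi> x))" "continuous_on A (\<lambda>x. complex_of_real (deriv \<phi> x))" for A
    by (intro continuous_on_of_real test_functionD(2,3)[OF t])+
  have cg: "continuous_on {-R..R} ?g" by (intro continuous_intros c)
  have "(LINT x|lborel. ?g x) = (LINT x|lborel. indicator {-R..R} x *\<^sub>R ?g x)"
    using compact_support_integral(2)[OF cg] R by simp
  also have "\<dots> = ?e R * complex_of_real (\<phi> R) - ?e (- R) * complex_of_real (\<phi> (- R))"
    by (rule integral_FTC_atLeastAtMost[OF _ d cg]) (use \<open>0 < R\<close> in auto)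
  also have "\<dots> = 0" using R[of R] R[of "- R"] by simp
  finally have z: "(LINT x|lborel. ?g x) = 0" .
  have i: "integrable lborel (\<lambda>x. ?e x * complex_of_real (\<phi> x))" "integrable lborel (\<lambda>x. ?e x * complex_of_real (deriv \<phi> x))"
    by (intro ft_integrand_integrable integrable_of_real test_function_integrable t)+
  have "(LINT x|lborel. ?g x) = (LINT x|lborel. ?e x * complex_of_real (deriv \<phi> x)) - (LINT x|lborel. \<i> * complex_of_real \<xi> * (?e x * complex_of_real (\<phi> x)))"
    by (rule Bochner_Integration.integral_diff[OF i(2) integrable_mult_right[OF i(1)]])
  also have "(LINT x|lborel. \<i> * complex_of_real \<xi> * (?e x * complex_of_real (\<phi> x))) = \<i> * complex_of_real \<xi> * (LINT x|lborel. ?e x * complex_of_real (\<phi> x))"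
    by (rule integral_mult_right_zero)
  finally show ?thesis using z unfolding ft_def by simp
qed

text \<open>Moves a pairing with a test function to the Fourier side, where differentiating the test
  function is multiplication by a factor.\<close>

lemma invF_pairing:
  assumes U: "integrable lborel U" "herm U" and f: "AE x in lborel. f x = invF U x" "f \<in> borel_measurable borel"
    and \<phi>: "integrable lborel \<phi>"
  shows "complex_of_real (LINT x|lborel. f x * \<phi> x) = (LINT \<xi>|lborel. U \<xi> * ft (\<lambda>x. complex_of_real (\<phi> x)) (- \<xi>))"
proof -
  let ?\<phi> = "\<lambda>x. complex_of_real (\<phi> x)"
  have [measurable]: "U \<in> borel_measurable borel" "\<phi> \<in> borel_measurable borel" "f \<in> borel_measurable borel" using U \<phi> f by auto
  have [measurable]: "ft U \<in> borel_measurable borel" by (rule ft_measurable) measurable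
  have "complex_of_real (LINT x|lborel. f x * \<phi> x) = (LINT x|lborel. complex_of_real (f x * \<phi> x))"
    by (rule integral_complex_of_real[symmetric])
  also have "\<dots> = (LINT x|lborel. ft U (- x) * ?\<phi> x)"
  proof (rule integral_cong_AE)
    show "AE x in lborel. complex_of_real (f x * \<phi> x) = ft U (- x) * ?\<phi> x"
      using f(1) by eventually_elim (simp add: invF_herm[OF U(2)])
  qed measurable
  also have "\<dots> = (LINT x|lborel. ft U x * ?\<phi> (- x))"
    using integral_reflect_lborel[of "\<lambda>x. ft U x * ?\<phi> (- x)"] by simp
  also have "\<dots> = (LINT \<xi>|lborel. U \<xi> * ft (\<lambda>x. ?\<phi> (- x)) \<xi>)"
  proof (rule ft_multiplication_formula[OF U(1)])
    have "integrable lborel (\<lambda>x. ?\<phi> (0 + - 1 * x))"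
      by (rule lborel_integrable_real_affine[OF integrable_of_real[OF \<phi>]]) simp
    then show "integrable lborel (\<lambda>x. ?\<phi> (- x))" by simp
  qed
  also have "\<dots> = (LINT \<xi>|lborel. U \<xi> * ft ?\<phi> (- \<xi>))" unfolding ft_reflect[of ?\<phi>] ..
  finally show ?thesis .
qed

lemma L2_locally_integrable: "f \<in> L2 \<Longrightarrow> locally_integrable f"
proof -
  assume f: "f \<in> L2"
  have "set_integrable lborel {-R..R} f" for R
    using integrable_Re[OF sqint_trunc(3)[OF f, of R]] by (simp add: set_integrable_def trunc_def)
  then show ?thesis using L2_measurable[OF f] by (simp add: locally_integrable_def)
qed

text \<open>The pairing shows that g is a weak derivative. The one picked by \<open>SOME\<close> may
  be another, but their difference annihilates all test functions.\<close>

lemma weak_deriv_eq: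
  assumes f: "f \<in> L2" "AE x in lborel. f x = invF U x" and g: "g \<in> L2" "AE x in lborel. g x = invF D x"
    and U: "integrable lborel U" "herm U" and D: "integrable lborel D" "herm D"
    and UD: "\<And>\<xi>. D \<xi> = \<i> * complex_of_real \<xi> * U \<xi>"
  shows "AE x in lborel. weak_deriv f x = g x" "weak_deriv f \<in> borel_measurable borel"
proof -
  note fm = L2_measurable[OF f(1)] and gm = L2_measurable[OF g(1)]
  have w: "is_weak_deriv f g"
    unfolding is_weak_deriv_def
  proof (intro conjI allI impI L2_locally_integrable f g)
    fix \<phi> assume t: "test_function \<phi>"
    have "complex_of_real (LINT x|lborel. f x * deriv \<phi> x) = (LINT \<xi>|lborel. U \<xi> * (\<i> * complex_of_real (- \<xi>) * ft (\<lambda>x. complex_of_real (\<phi> x)) (- \<xi>)))"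
      unfolding invF_pairing[OF U f(2) fm test_function_integrable(2)[OF t]] ft_deriv[OF t] ..
    also have "\<dots> = (LINT \<xi>|lborel. - (D \<xi> * ft (\<lambda>x. complex_of_real (\<phi> x)) (- \<xi>)))"
      unfolding UD by (simp add: mult_ac)
    also have "\<dots> = - complex_of_real (LINT x|lborel. g x * \<phi> x)"
      unfolding invF_pairing[OF D g(2) gm test_function_integrable(1)[OF t]] by (rule integral_minus)
    finally have "complex_of_real (LINT x|lborel. f x * deriv \<phi> x) = complex_of_real (- (LINT x|lborel. g x * \<phi> x))"
      unfolding of_real_minus .
    then show "(LINT x|lborel. f x * deriv \<phi> x) = - (LINT x|lborel. g x * \<phi> x)" by (simp only: of_real_eq_iff)
  qed
  have h: "is_weak_deriv f (weak_deriv f)" unfolding weak_deriv_def by (rule someI[of _ g]) (rule w)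
  define h' where "h' = weak_deriv f"
  have lh: "locally_integrable h'" and lg: "locally_integrable g" using h w by (auto simp: is_weak_deriv_def h'_def)
  then show "weak_deriv f \<in> borel_measurable borel" by (simp add: locally_integrable_def h'_def)
  have hm: "h' \<in> borel_measurable borel" using lh by (simp add: locally_integrable_def)
  have "AE x in lborel. h' x - g x = 0"
  proof (rule locally_integrable_eq_0)
    show "locally_integrable (\<lambda>x. h' x - g x)"
      using lh lg unfolding locally_integrable_def by (auto intro!: set_integral_diff(1) borel_measurable_diff)
    fix \<phi> assume t: "test_function \<phi>"
    obtain R where "0 < R" and R: "\<And>x. R \<le> \<bar>x\<bar> \<Longrightarrow> \<phi> x = 0 \<and> deriv \<phi> x = 0" using test_function_support[OF t] by metis
    have "compact (\<phi> ` {-R..R})" by (intro compact_continuous_image test_functionD(2)[OF t] compact_Icc)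
    then obtain C where C: "\<And>x. x \<in> {-R..R} \<Longrightarrow> \<bar>\<phi> x\<bar> \<le> C" using compact_imp_bounded by (fastforce simp: bounded_iff)
    have pm: "\<phi> \<in> borel_measurable borel" by (rule borel_measurable_continuous_onI[OF test_functionD(2)[OF t]])
    have i: "integrable lborel (\<lambda>x. u x * \<phi> x)" if u: "locally_integrable u" for u
    proof (rule Bochner_Integration.integrable_bound)
      show "integrable lborel (\<lambda>x. C * (indicator {-R..R} x * u x))"
        using u by (intro integrable_mult_right) (simp add: locally_integrable_def set_integrable_def)
      show "(\<lambda>x. u x * \<phi> x) \<in> borel_measurable lborel" using u pm by (auto simp: locally_integrable_def)
      show "AE x in lborel. norm (u x * \<phi> x) \<le> norm (C * (indicator {-R..R} x * u x))"
      proof (rule AE_I2)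
        fix x
        show "norm (u x * \<phi> x) \<le> norm (C * (indicator {-R..R} x * u x))"
        proof (cases "x \<in> {-R..R}")
          case True
          then have "\<bar>\<phi> x\<bar> \<le> \<bar>C\<bar>" using C[of x] by simp
          then show ?thesis using True by (simp add: abs_mult mult.commute[of "\<bar>u x\<bar>"] mult_right_mono)
        next
          case False
          then have "R \<le> \<bar>x\<bar>" by auto
          then show ?thesis using R by simp
        qed
      qed
    qed
    have "(LINT x|lborel. (h' x - g x) * \<phi> x) = (LINT x|lborel. h' x * \<phi> x) - (LINT x|lborel. g x * \<phi> x)"
      unfolding left_diff_distrib by (rule Bochner_Integration.integral_diff[OF i[OF lh] i[OF lg]])
    also have "\<dots> = 0" using h w t unfolding is_weak_deriv_def h'_def[symmetric] by force
    finally show "(LINT x|lborel. (h' x - g x) * \<phi> x) = 0" .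
  qed
  then show "AE x in lborel. weak_deriv f x = g x" unfolding h'_def by eventually_elim simp
qed

section \<open>Real functions through their Fourier transforms\<close>

lemma sobolev_weight:
  assumes eq: "AE \<xi> in lborel. F \<xi> = complex_of_real (2 * pi) * U \<xi>"
    and [measurable]: "F \<in> borel_measurable borel" "U \<in> borel_measurable borel"
  shows "integrable lborel (\<lambda>\<xi>. (1 + \<xi>\<^sup>2) powr r * (cmod (F \<xi>))\<^sup>2) \<longleftrightarrow> inH r U"
    and "sqrt (LINT \<xi>|lborel. (1 + \<xi>\<^sup>2) powr r * (cmod (F \<xi>))\<^sup>2) = 2 * pi * hn r U"
proof -
  let ?g = "\<lambda>\<xi>. (cmod (complex_of_real (wt r 0 \<xi>) * U \<xi>))\<^sup>2"
  have w: "(1 + \<xi>\<^sup>2) powr r = (wt r 0 \<xi>)\<^sup>2" for \<xi> :: real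
    unfolding wt_0 power2_eq_square[of "jb \<xi> powr r"] powr_mult[symmetric] power2_eq_square[of "jb \<xi>", symmetric] jb_sq ..
  have ae: "AE \<xi> in lborel. (1 + \<xi>\<^sup>2) powr r * (cmod (F \<xi>))\<^sup>2 = (2 * pi)\<^sup>2 * ?g \<xi>"
    using eq by eventually_elim (simp add: w norm_mult power_mult_distrib)
  have "integrable lborel (\<lambda>\<xi>. (1 + \<xi>\<^sup>2) powr r * (cmod (F \<xi>))\<^sup>2) \<longleftrightarrow> integrable lborel (\<lambda>\<xi>. (2 * pi)\<^sup>2 * ?g \<xi>)"
    by (rule integrable_cong_AE[OF _ _ ae]) measurable
  also have "\<dots> \<longleftrightarrow> inH r U" unfolding wsq_def sqint_def by simp
  finally show "integrable lborel (\<lambda>\<xi>. (1 + \<xi>\<^sup>2) powr r * (cmod (F \<xi>))\<^sup>2) \<longleftrightarrow> inH r U" .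
  have "(LINT \<xi>|lborel. (1 + \<xi>\<^sup>2) powr r * (cmod (F \<xi>))\<^sup>2) = (LINT \<xi>|lborel. (2 * pi)\<^sup>2 * ?g \<xi>)"
    by (rule integral_cong_AE[OF _ _ ae]) measurable
  also have "\<dots> = (2 * pi)\<^sup>2 * (LINT \<xi>|lborel. ?g \<xi>)" by (rule integral_mult_right_zero)
  finally show "sqrt (LINT \<xi>|lborel. (1 + \<xi>\<^sup>2) powr r * (cmod (F \<xi>))\<^sup>2) = 2 * pi * hn r U"
    by (simp only: real_sqrt_mult real_sqrt_abs wn_def n2_def) simp
qed

text \<open>\<open>U\<close> is the Fourier transform divided by \<open>2\<pi>\<close>; with this normalisation a product of functions
  corresponds to a plain convolution of spectra.\<close>

definition spectral :: "(real \<Rightarrow> complex) \<Rightarrow> (real \<Rightarrow> real) \<Rightarrow> bool" where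
  "spectral U f \<longleftrightarrow> integrable lborel U \<and> sqint U \<and> herm U \<and> f \<in> borel_measurable borel \<and> (AE x in lborel. f x = invF U x)"

lemma spectralD:
  assumes "spectral U f"
  shows "integrable lborel U" "sqint U" "herm U" "f \<in> borel_measurable borel" "AE x in lborel. f x = invF U x"
    "U \<in> borel_measurable borel" "f \<in> L2" "AE \<xi> in lborel. fourier f \<xi> = complex_of_real (2 * pi) * U \<xi>"
proof -
  show 1: "integrable lborel U" "sqint U" "herm U" and f: "f \<in> borel_measurable borel" "AE x in lborel. f x = invF U x"
    using assms by (simp_all add: spectral_def)
  show "U \<in> borel_measurable borel" using 1(1) by auto
  note i = is_fourier_invF(1)[OF 1]
  have ae: "AE x in lborel. invF U x = f x" using f(2) by eventually_elim simp
  show "f \<in> L2" by (rule L2_cong_AE[OF ae f(1) i])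
  show "AE \<xi> in lborel. fourier f \<xi> = complex_of_real (2 * pi) * U \<xi>"
    using fourier_invF[OF 1] unfolding fourier_cong_AE[OF f(2,1) L2_measurable[OF i]] .
qed

lemma spectral_invF:
  assumes "integrable lborel U" "sqint U" "herm U"
  shows "spectral U (invF U)"
  using assms L2_measurable[OF is_fourier_invF(1)[OF assms]] by (simp add: spectral_def)

text \<open>Injectivity of the transform. Each differential equation is translated into an equation
  for spectra through this equivalence.\<close>

lemma spectral_AE_iff:
  assumes f: "spectral U f" and g: "spectral V g"
  shows "(AE x in lborel. f x = g x) \<longleftrightarrow> (AE \<xi> in lborel. U \<xi> = V \<xi>)"
proof
  assume "AE x in lborel. f x = g x"
  from fourier_cong_AE[OF this spectralD(4)[OF f] spectralD(4)[OF g]] have e: "fourier f = fourier g" .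
  show "AE \<xi> in lborel. U \<xi> = V \<xi>"
    using spectralD(8)[OF f] spectralD(8)[OF g] unfolding e by eventually_elim simp
next
  assume ae: "AE \<xi> in lborel. U \<xi> = V \<xi>"
  show "AE x in lborel. f x = g x"
  proof (rule AE_eq_if_fourier_eq[OF spectralD(7)[OF f] spectralD(7)[OF g]])
    show "AE \<xi> in lborel. fourier f \<xi> = fourier g \<xi>"
      using spectralD(8)[OF f] spectralD(8)[OF g] ae by eventually_elim simp
  qed
qed

lemma spectral_sobolev:
  assumes "spectral U f"
  shows "f \<in> sobolev r \<longleftrightarrow> inH r U" "sobolev_norm r f = 2 * pi * hn r U"
proof -
  note d = spectralD[OF assms]
  note w = sobolev_weight[OF d(8) sqint_measurable[OF fourier_sqint[OF d(7)]] d(6)]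
  show "f \<in> sobolev r \<longleftrightarrow> inH r U" using w(1) d(7) by (simp add: sobolev_def)
  show "sobolev_norm r f = 2 * pi * hn r U" unfolding sobolev_norm_def by (rule w(2))
qed

lemma inH_L1_sqint:
  assumes U: "inH r U" and r: "1/2 < r"
  shows "integrable lborel U" "sqint U"
proof -
  have [measurable]: "U \<in> borel_measurable borel" by (rule wsq_measurable[OF U])
  have "integrable lborel (\<lambda>x. jb x powr 0 * cmod (U x))" by (rule inH_integrable(1)[OF U]) (use r in simp)
  then have "integrable lborel (\<lambda>x. cmod (U x))" by (simp add: order_less_imp_not_eq2)
  then show "integrable lborel U" by (subst (asm) integrable_norm_iff) measurable
  have "inH 0 U" by (rule inH_mono(1)[OF U]) (use r in simp)
  then show "sqint U" by (simp add: wsq_def wt_0 order_less_imp_not_eq2)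
qed

lemma inH_spectral:
  assumes "inH r U" "1/2 < r" "herm U"
  shows "spectral U (invF U)"
  by (rule spectral_invF[OF inH_L1_sqint[OF assms(1,2)] assms(3)])

definition spec :: "(real \<Rightarrow> real) \<Rightarrow> real \<Rightarrow> complex" where
  "spec f = (SOME U. spectral U f)"

lemma sobolev_spec:
  assumes f: "f \<in> sobolev r" and r: "1/2 < r"
  shows "spectral (spec f) f" "inH r (spec f)"
proof -
  define F where "F = fourier f"
  \<comment> \<open>Averaging with the reflected conjugate makes the spectrum hermitian at every
    point; 4 pi combines the average with the normalisation by 2 pi.\<close>
  define U where "U \<xi> = (F \<xi> + cnj (F (- \<xi>))) / complex_of_real (4 * pi)" for \<xi>
  have L: "f \<in> L2" and i: "integrable lborel (\<lambda>\<xi>. (1 + \<xi>\<^sup>2) powr r * (cmod (F \<xi>))\<^sup>2)"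
    using f by (simp_all add: sobolev_def F_def)
  have Fm[measurable]: "F \<in> borel_measurable borel" unfolding F_def by (rule sqint_measurable[OF fourier_sqint[OF L]])
  have Um: "U \<in> borel_measurable borel"
    unfolding U_def[abs_def] by (intro borel_measurable_divide borel_measurable_add borel_measurable_cnj) measurable
  have ae: "AE \<xi> in lborel. F \<xi> = complex_of_real (2 * pi) * U \<xi>"
    using fourier_herm[OF L] unfolding F_def[symmetric] by eventually_elim (simp add: U_def)
  have inH: "inH r U" using i sobolev_weight(1)[OF ae Fm Um] by simp
  have h: "herm U" by (simp add: herm_def U_def add.commute)
  have s: "spectral U (invF U)" by (rule inH_spectral[OF inH r h])
  have "AE x in lborel. f x = invF U x"
  proof (rule AE_eq_if_fourier_eq[OF L spectralD(7)[OF s]])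
    show "AE \<xi> in lborel. fourier f \<xi> = fourier (invF U) \<xi>"
      using ae spectralD(8)[OF s] unfolding F_def by eventually_elim simp
  qed
  then have "spectral U f" using s L2_measurable[OF L] by (simp add: spectral_def)
  then show sp: "spectral (spec f) f" unfolding spec_def by (rule someI[of "\<lambda>U. spectral U f" U])
  show "inH r (spec f)" using f spectral_sobolev(1)[OF sp] by blast
qed

lemma spectral_linear:
  assumes f: "spectral U f" and g: "spectral V g"
  shows "spectral (\<lambda>\<xi>. complex_of_real a * U \<xi> + complex_of_real b * V \<xi>) (\<lambda>x. a * f x + b * g x)"
  unfolding spectral_def
proof (intro conjI)
  note df = spectralD[OF f] and dg = spectralD[OF g]
  show "integrable lborel (\<lambda>\<xi>. complex_of_real a * U \<xi> + complex_of_real b * V \<xi>)"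
    by (intro Bochner_Integration.integrable_add integrable_mult_right df(1) dg(1))
  show "sqint (\<lambda>\<xi>. complex_of_real a * U \<xi> + complex_of_real b * V \<xi>)"
    by (intro sqint_add(1) sqint_cmult(1) df(2) dg(2))
  show "herm (\<lambda>\<xi>. complex_of_real a * U \<xi> + complex_of_real b * V \<xi>)"
    unfolding herm_def using hermD[OF df(3)] hermD[OF dg(3)] by simp
  show "(\<lambda>x. a * f x + b * g x) \<in> borel_measurable borel"
    by (intro borel_measurable_add borel_measurable_times borel_measurable_const df(4) dg(4))
  have "invF (\<lambda>\<xi>. complex_of_real a * U \<xi> + complex_of_real b * V \<xi>) x = a * invF U x + b * invF V x" for x
    unfolding invF_def ft_add[OF integrable_mult_right[OF df(1)] integrable_mult_right[OF dg(1)]] ft_cmult by simp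
  note e = this
  show "AE x in lborel. a * f x + b * g x = invF (\<lambda>\<xi>. complex_of_real a * U \<xi> + complex_of_real b * V \<xi>) x"
    unfolding e using df(5) dg(5) by eventually_elim simp
qed

section \<open>Products, derivatives and the Helmholtz inverse on spectra\<close>

abbreviation conv :: "(real \<Rightarrow> complex) \<Rightarrow> (real \<Rightarrow> complex) \<Rightarrow> real \<Rightarrow> complex" where
  "conv \<equiv> Kop (\<lambda>_ _. 1)"

lemma conv_eq: "conv U V x = (LINT y|lborel. U (x - y) * V y)"
  by (simp add: Kop_def)

lemma conv_L1:
  assumes U: "integrable lborel U" and V: "integrable lborel V"
  shows "integrable lborel (conv U V)" "ft (conv U V) t = ft U t * ft V t"
proof -
  have [measurable]: "U \<in> borel_measurable borel" "V \<in> borel_measurable borel" using U V by auto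
  have iU: "integrable lborel (\<lambda>x. U (x - y))" for y
  proof -
    have "integrable lborel (\<lambda>x. U (- y + 1 * x))" by (rule lborel_integrable_real_affine[OF U]) simp
    moreover have "- y + 1 * x = x - y" for x by simp
    ultimately show ?thesis by (simp only:)
  qed
  have nU: "(LINT x|lborel. norm (U (x - y))) = (LINT x|lborel. norm (U x))" for y
    using lborel_integral_real_affine[of 1 "\<lambda>x. norm (U x)" "- y"] by simp
  have pi: "integrable (lborel \<Otimes>\<^sub>M lborel) (\<lambda>p. (e :: real \<Rightarrow> complex) (snd p) * (U (snd p - fst p) * V (fst p)))"
    if [measurable]: "e \<in> borel_measurable borel" and e1: "\<And>x. cmod (e x) = 1" for e
  proof (rule lborel_pair.Fubini_integrable)
    show "integrable lborel (\<lambda>y. LINT x|lborel. norm (e (snd (y, x)) * (U (snd (y, x) - fst (y, x)) * V (fst (y, x)))))"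
      using V by (simp add: norm_mult e1 nU integrable_norm)
    have "integrable lborel (\<lambda>x. e x * (U (x - y) * V y))" for y
    proof (rule Bochner_Integration.integrable_bound[OF integrable_mult_left[OF iU[of y], of "V y"]])
      show "(\<lambda>x. e x * (U (x - y) * V y)) \<in> borel_measurable lborel" by measurable
    qed (simp add: norm_mult e1)
    then show "AE y in lborel. integrable lborel (\<lambda>x. e (snd (y, x)) * (U (snd (y, x) - fst (y, x)) * V (fst (y, x))))" by simp
  qed measurable
  have "integrable (lborel \<Otimes>\<^sub>M lborel) (\<lambda>(y, x). U (x - y) * V y)"
    using pi[of "\<lambda>_. 1"] by (simp add: case_prod_beta')
  from lborel_pair.integrable_snd[OF this] show "integrable lborel (conv U V)" unfolding conv_eq[abs_def] .
  let ?e = "\<lambda>x. exp (- (\<i> * complex_of_real (x * t)))"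
  have i2: "integrable (lborel \<Otimes>\<^sub>M lborel) (\<lambda>(y, x). ?e x * (U (x - y) * V y))"
    using pi[of ?e] by (simp add: case_prod_beta')
  have "ft (conv U V) t = (LINT x|lborel. LINT y|lborel. ?e x * (U (x - y) * V y))"
    unfolding ft_def conv_eq by (simp only: integral_mult_right_zero)
  also have "\<dots> = (LINT y|lborel. LINT x|lborel. ?e x * (U (x - y) * V y))"
    by (rule lborel_pair.Fubini_integral[OF i2])
  also have "\<dots> = (LINT y|lborel. ft (\<lambda>x. U (x - y)) t * V y)"
    unfolding ft_def mult.assoc[symmetric] by (simp only: integral_mult_left_zero)
  also have "\<dots> = (LINT y|lborel. ft U t * (?e y * V y))"
    unfolding ft_translate by (simp add: mult_ac)
  also have "\<dots> = ft U t * ft V t" unfolding ft_def[of V] by (rule integral_mult_right_zero)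
  finally show "ft (conv U V) t = ft U t * ft V t" .
qed

lemma conv_sqint:
  assumes U: "integrable lborel U" and V: "sqint V"
  shows "sqint (conv U V)"
proof (rule sqint_boundI(1))
  have [measurable]: "U \<in> borel_measurable borel" "V \<in> borel_measurable borel" using U sqint_measurable[OF V] by auto
  show "conv U V \<in> borel_measurable borel" by measurable
  define N where "N = (LINT y|lborel. cmod (U y))"
  show "0 \<le> n2 V * N" by (simp add: N_def n2_def)
  have nU: "(\<integral>\<^sup>+y. ennreal (cmod (U y)) \<partial>lborel) = ennreal N"
    unfolding N_def by (rule nn_integral_eq_integral) (use U in auto)
  have "ennreal ((cmod (conv U V x))\<^sup>2) \<le> (\<integral>\<^sup>+y. ennreal (cmod (V y) * cmod (U (x - y))) \<partial>lborel)\<^sup>2" for x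
  proof -
    have "ennreal (cmod (conv U V x)) \<le> (\<integral>\<^sup>+y. ennreal (cmod (V y) * cmod (U (x - y))) \<partial>lborel)"
      unfolding conv_eq using norm_integral_le_nn_integral[of lborel "\<lambda>y. U (x - y) * V y"] by (simp add: norm_mult mult.commute)
    from power_mono[OF this, of 2] show ?thesis by (simp add: ennreal_power)
  qed
  then have "(\<integral>\<^sup>+x. ennreal ((cmod (conv U V x))\<^sup>2) \<partial>lborel) \<le> (\<integral>\<^sup>+x. (\<integral>\<^sup>+y. ennreal (cmod (V y) * cmod (U (x - y))) \<partial>lborel)\<^sup>2 \<partial>lborel)"
    by (rule nn_integral_mono)
  also have "\<dots> \<le> (\<integral>\<^sup>+y. ennreal ((cmod (V y))\<^sup>2) \<partial>lborel) * (\<integral>\<^sup>+y. ennreal (cmod (U y)) \<partial>lborel)\<^sup>2"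
    by (rule Young_nn_integral) simp_all
  also have "\<dots> = ennreal ((n2 V * N)\<^sup>2)"
    unfolding sqint_nn_integral[OF V] nU by (simp add: ennreal_power ennreal_mult[symmetric] power_mult_distrib N_def)
  finally show "(\<integral>\<^sup>+x. ennreal ((cmod (conv U V x))\<^sup>2) \<partial>lborel) \<le> ennreal ((n2 V * N)\<^sup>2)" .
qed

lemma spectral_mult:
  assumes f: "spectral U f" and g: "spectral V g"
  shows "spectral (conv U V) (\<lambda>x. f x * g x)"
  unfolding spectral_def
proof (intro conjI)
  note df = spectralD[OF f] and dg = spectralD[OF g]
  show "integrable lborel (conv U V)" by (rule conv_L1(1)[OF df(1) dg(1)])
  show "sqint (conv U V)" by (rule conv_sqint[OF df(1) dg(2)])
  show h: "herm (conv U V)" unfolding herm_def by (intro allI herm_Kop[OF df(3) dg(3)] refl)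
  show "(\<lambda>x. f x * g x) \<in> borel_measurable borel" by (intro borel_measurable_times df(4) dg(4))
  have "complex_of_real (invF (conv U V) x) = complex_of_real (invF U x * invF V x)" for x
    unfolding of_real_mult invF_herm[OF h] invF_herm[OF df(3)] invF_herm[OF dg(3)] by (rule conv_L1(2)[OF df(1) dg(1)])
  then have e: "invF (conv U V) x = invF U x * invF V x" for x by (simp only: of_real_eq_iff)
  show "AE x in lborel. f x * g x = invF (conv U V) x" unfolding e using df(5) dg(5) by eventually_elim simp
qed

definition dmul :: "(real \<Rightarrow> complex) \<Rightarrow> real \<Rightarrow> complex" where
  "dmul U \<xi> = \<i> * complex_of_real \<xi> * U \<xi>"

lemma dmul_measurable: "U \<in> borel_measurable borel \<Longrightarrow> dmul U \<in> borel_measurable borel"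
  unfolding dmul_def[abs_def] by measurable

lemma spectral_weak_deriv:
  assumes f: "spectral U f" and D: "integrable lborel (dmul U)" "sqint (dmul U)"
  shows "spectral (dmul U) (weak_deriv f)"
proof -
  note df = spectralD[OF f]
  have h: "herm (dmul U)" using hermD[OF df(3)] by (simp add: herm_def dmul_def)
  note s = spectral_invF[OF D h]
  note dg = spectralD[OF s]
  note w = weak_deriv_eq[OF df(7,5) dg(7,5) df(1,3) D(1) h dmul_def]
  show ?thesis unfolding spectral_def using D h w by simp
qed

text \<open>The multiplier lies between 0 and 1, so the candidate spectrum is admissible and its
  inverse transform witnesses the choice. Since the transform of any choice is prescribed,
  injectivity fixes it almost everywhere.\<close>

lemma spectral_helmholtz:
  assumes f: "spectral U f"
  shows "spectral (\<lambda>\<xi>. complex_of_real (hm \<alpha> \<xi>) * U \<xi>) (helmholtz_inv \<alpha> f)"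
proof -
  note df = spectralD[OF f]
  let ?H = "\<lambda>\<xi>. complex_of_real (hm \<alpha> \<xi>) * U \<xi>"
  have Um[measurable]: "U \<in> borel_measurable borel" by (rule df(6))
  have Hm: "?H \<in> borel_measurable borel" by measurable
  have le: "cmod (?H \<xi>) \<le> cmod (U \<xi>)" for \<xi>
    using hm_le_1[of \<alpha> \<xi>] by (simp add: norm_mult mult_left_le_one_le)
  have H: "integrable lborel ?H" "sqint ?H"
    using Hm le by (auto intro!: Bochner_Integration.integrable_bound[OF df(1)] sqint_mono1(1)[OF df(2)])
  have h: "herm ?H" using hermD[OF df(3)] by (simp add: herm_def)
  note s = spectral_invF[OF H h]
  let ?P = "\<lambda>g. g \<in> L2 \<and> (AE \<xi> in lborel. fourier g \<xi> = complex_of_real (inverse (1 + \<alpha>\<^sup>2 * \<xi>\<^sup>2)) * fourier f \<xi>)"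
  have "?P (invF ?H)"
  proof
    show "AE \<xi> in lborel. fourier (invF ?H) \<xi> = complex_of_real (inverse (1 + \<alpha>\<^sup>2 * \<xi>\<^sup>2)) * fourier f \<xi>"
      using spectralD(8)[OF s] df(8) by eventually_elim (simp add: hm_def inverse_eq_divide)
  qed (rule spectralD(7)[OF s])
  then have P: "?P (helmholtz_inv \<alpha> f)" unfolding helmholtz_inv_def by (rule someI[of ?P])
  have "AE x in lborel. helmholtz_inv \<alpha> f x = invF ?H x"
  proof (rule AE_eq_if_fourier_eq[OF conjunct1[OF P] spectralD(7)[OF s]])
    show "AE \<xi> in lborel. fourier (helmholtz_inv \<alpha> f) \<xi> = fourier (invF ?H) \<xi>"
      using conjunct2[OF P] spectralD(8)[OF s] df(8) by eventually_elim (simp add: hm_def inverse_eq_divide)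
  qed
  then show ?thesis unfolding spectral_def using H h L2_measurable[OF conjunct1[OF P]] by simp
qed

lemma integral_swap_conv:
  fixes f :: "real \<Rightarrow> complex"
  shows "(LINT y|lborel. f (x - y)) = (LINT y|lborel. f y)"
  using lborel_integral_real_affine[of "-1" f x] by simp

lemma dmul_bounds:
  assumes V: "inH s V" "3/2 < s"
  shows "integrable lborel (dmul V)" "sqint (dmul V)"
proof -
  have [measurable]: "V \<in> borel_measurable borel" by (rule wsq_measurable[OF V(1)])
  have m: "dmul V \<in> borel_measurable borel" by (rule dmul_measurable) measurable
  have le: "cmod (dmul V \<xi>) \<le> jb \<xi> * cmod (V \<xi>)" for \<xi>
    by (simp add: dmul_def norm_mult mult_right_mono abs_le_jb)
  show "integrable lborel (dmul V)"
    by (rule Bochner_Integration.integrable_bound[OF inH_aw(1)[OF V]]) (use m le in auto)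
  have "inH 1 V" by (rule inH_mono(1)[OF V(1)]) (use V in simp)
  from wsq_sqint[OF this] show "sqint (dmul V)"
    by (rule sqint_mono1(1)) (use m le in \<open>auto simp: wt_0 norm_mult\<close>)
qed

text \<open>The substitution y -> x - y expresses on spectra that u times its derivative is half the
  derivative of u^2. This identifies the summand 1/2 of \<open>kern\<close> with the transport
  term.\<close>

lemma Bop_square_expand:
  assumes V: "inH s V" "3/2 < s"
  shows "conv V (dmul V) x = \<i> / 2 * complex_of_real x * conv V V x"
    and "Bop \<alpha> V V x = - conv V (dmul V) x
      - \<i> * complex_of_real x * (complex_of_real (hm \<alpha> x) * (conv V V x + complex_of_real (\<alpha>\<^sup>2 / 2) * conv (dmul V) (dmul V) x))"
proof -
  have V1: "inH 1 V" by (rule inH_mono(1)[OF V(1)]) (use V in simp)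
  have j: "1 \<le> jb (x - y) * jb y" for y using mult_mono[of 1 "jb (x - y)" 1 "jb y"] by simp
  have i1: "integrable lborel (\<lambda>y. V (x - y) * V y)"
    using Kop_integrable[OF _ V1 V1, of "\<lambda>_ _. 1" x 1] j by simp
  have i2: "integrable lborel (\<lambda>y. complex_of_real y * V (x - y) * V y)"
  proof (rule Kop_integrable[OF _ V1 V1, of "\<lambda>x y. y" x 1])
    show "\<bar>y\<bar> \<le> 1 * (jb (x - y) * jb y)" for y
      using mult_mono[of 1 "jb (x - y)" "\<bar>y\<bar>" "jb y"] abs_le_jb[of y] by simp
  qed measurable
  have i3: "integrable lborel (\<lambda>y. complex_of_real ((x - y) * y) * V (x - y) * V y)"
  proof (rule Kop_integrable[OF _ V1 V1, of "\<lambda>x y. (x - y) * y" x 1])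
    show "\<bar>(x - y) * y\<bar> \<le> 1 * (jb (x - y) * jb y)" for y
      by (simp add: abs_mult mult_mono abs_le_jb)
  qed measurable
  define P where "P = (LINT y|lborel. complex_of_real y * V (x - y) * V y)"
  define Q where "Q = (LINT y|lborel. complex_of_real ((x - y) * y) * V (x - y) * V y)"
  have "P = (LINT y|lborel. complex_of_real (x - y) * V (x - (x - y)) * V (x - y))"
    unfolding P_def by (rule integral_swap_conv[symmetric])
  also have "\<dots> = (LINT y|lborel. complex_of_real x * (V (x - y) * V y) - complex_of_real y * V (x - y) * V y)"
    by (simp add: algebra_simps)
  also have "\<dots> = (LINT y|lborel. complex_of_real x * (V (x - y) * V y)) - P"
    unfolding P_def by (rule Bochner_Integration.integral_diff[OF integrable_mult_right[OF i1] i2])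
  also have "(LINT y|lborel. complex_of_real x * (V (x - y) * V y)) = complex_of_real x * conv V V x"
    unfolding conv_eq by (rule integral_mult_right_zero)
  finally have P: "2 * P = complex_of_real x * conv V V x" by simp
  have "conv V (dmul V) x = (LINT y|lborel. \<i> * (complex_of_real y * V (x - y) * V y))"
    unfolding conv_eq dmul_def by (simp add: mult_ac)
  also have "\<dots> = \<i> * P" unfolding P_def by (rule integral_mult_right_zero)
  finally have cP: "conv V (dmul V) x = \<i> * P" .
  have "\<i> * P = \<i> / 2 * (2 * P)" by simp
  then show 1: "conv V (dmul V) x = \<i> / 2 * complex_of_real x * conv V V x" unfolding cP P by (simp add: mult.assoc)
  have "conv (dmul V) (dmul V) x = (LINT y|lborel. - (complex_of_real ((x - y) * y) * V (x - y) * V y))"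
    unfolding conv_eq dmul_def by (simp add: algebra_simps)
  also have "\<dots> = - Q" unfolding Q_def by (rule integral_minus)
  finally have Q: "conv (dmul V) (dmul V) x = - Q" .
  let ?a = "complex_of_real (1 / 2 + hm \<alpha> x)" and ?b = "complex_of_real (\<alpha>\<^sup>2 / 2 * hm \<alpha> x)"
  have "Kop (kern \<alpha>) V V x = (LINT y|lborel. ?a * (V (x - y) * V y) - ?b * (complex_of_real ((x - y) * y) * V (x - y) * V y))"
    unfolding Kop_def kern_def of_real_diff[of "1 / 2 + hm \<alpha> x"] of_real_mult[of "\<alpha>\<^sup>2 / 2 * hm \<alpha> x"] left_diff_distrib
    by (simp only: mult.assoc)
  also have "\<dots> = (LINT y|lborel. ?a * (V (x - y) * V y)) - (LINT y|lborel. ?b * (complex_of_real ((x - y) * y) * V (x - y) * V y))"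
    by (rule Bochner_Integration.integral_diff[OF integrable_mult_right[OF i1] integrable_mult_right[OF i3]])
  also have "\<dots> = ?a * conv V V x - ?b * Q"
    unfolding conv_eq Q_def by (simp only: integral_mult_right_zero)
  finally have K: "Kop (kern \<alpha>) V V x = ?a * conv V V x + ?b * conv (dmul V) (dmul V) x" unfolding Q by simp
  show "Bop \<alpha> V V x = - conv V (dmul V) x
      - \<i> * complex_of_real x * (complex_of_real (hm \<alpha> x) * (conv V V x + complex_of_real (\<alpha>\<^sup>2 / 2) * conv (dmul V) (dmul V) x))"
    unfolding Bop_def K 1 by (simp add: algebra_simps)
qed

lemma burgers_iff:
  assumes v: "spectral V v" "inH s V" "3/2 < s" and w: "spectral W w"
  shows "burgers v w \<longleftrightarrow> (AE \<xi> in lborel. W \<xi> = Bop 0 V V \<xi>)"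
proof -
  note d = spectral_weak_deriv[OF v(1) dmul_bounds[OF v(2,3)]]
  \<comment> \<open>The summand \<open>0 * w x\<close> brings the right-hand side into the shape of
    \<open>spectral_linear\<close>.\<close>
  have "burgers v w \<longleftrightarrow> (AE x in lborel. w x = 0 * w x + - 3 * (v x * weak_deriv v x))"
    unfolding burgers_def by (simp add: algebra_simps eq_neg_iff_add_eq_0)
  also have "\<dots> \<longleftrightarrow> (AE \<xi> in lborel. W \<xi> = complex_of_real 0 * W \<xi> + complex_of_real (- 3) * conv V (dmul V) \<xi>)"
    by (rule spectral_AE_iff[OF w spectral_linear[OF w spectral_mult[OF v(1) d]]])
  finally have "burgers v w \<longleftrightarrow> (AE \<xi> in lborel. W \<xi> = complex_of_real 0 * W \<xi> + complex_of_real (- 3) * conv V (dmul V) \<xi>)" .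
  moreover have "complex_of_real 0 * W \<xi> + complex_of_real (- 3) * conv V (dmul V) \<xi> = Bop 0 V V \<xi>" for \<xi>
    unfolding Bop_square_expand(2)[OF v(2,3)] Bop_square_expand(1)[OF v(2,3)] by (simp add: hm_def)
  ultimately show ?thesis by (simp only:)
qed

text \<open>For \<alpha> > 0 the Helmholtz inverse gains a derivative, since |\<xi>| times
  \<open>hm\<close> is at most 1/\<alpha>. This bound only identifies the weak derivative of the
  nonlocal term; it enters no uniform estimate.\<close>

lemma camassa_holm_iff:
  assumes v: "spectral V v" "inH s V" "3/2 < s" and w: "spectral W w" and a: "0 < \<alpha>"
  shows "camassa_holm \<alpha> v w \<longleftrightarrow> (AE \<xi> in lborel. W \<xi> = Bop \<alpha> V V \<xi>)"
proof -
  note d = spectral_weak_deriv[OF v(1) dmul_bounds[OF v(2,3)]]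
  note vd = spectral_mult[OF v(1) d]
  let ?Q = "\<lambda>\<xi>. complex_of_real 1 * conv V V \<xi> + complex_of_real (\<alpha>\<^sup>2 / 2) * conv (dmul V) (dmul V) \<xi>"
  let ?H = "\<lambda>\<xi>. complex_of_real (hm \<alpha> \<xi>) * ?Q \<xi>"
  have q: "spectral ?Q (\<lambda>y. (v y)\<^sup>2 + \<alpha>\<^sup>2 / 2 * (weak_deriv v y)\<^sup>2)"
    using spectral_linear[OF spectral_mult[OF v(1) v(1)] spectral_mult[OF d d], of 1 "\<alpha>\<^sup>2 / 2"] by (simp add: power2_eq_square)
  note dq = spectralD[OF q]
  note h = spectral_helmholtz[OF q, of \<alpha>]
  have le: "cmod (dmul ?H \<xi>) \<le> cmod (complex_of_real (1 / \<alpha>) * ?Q \<xi>)" for \<xi>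
  proof -
    have "0 \<le> (1 - \<alpha> * \<bar>\<xi>\<bar>)\<^sup>2 + \<alpha> * \<bar>\<xi>\<bar>" using a by simp
    then have "\<alpha> * \<bar>\<xi>\<bar> \<le> 1 + \<alpha>\<^sup>2 * \<xi>\<^sup>2" by (simp add: power2_diff power_mult_distrib)
    then have "\<bar>\<xi>\<bar> * hm \<alpha> \<xi> \<le> 1 / \<alpha>"
      using a by (simp add: hm_def field_simps add_pos_nonneg)
    then have "(\<bar>\<xi>\<bar> * hm \<alpha> \<xi>) * cmod (?Q \<xi>) \<le> 1 / \<alpha> * cmod (?Q \<xi>)" by (rule mult_right_mono) simp
    then show ?thesis using a by (simp add: dmul_def norm_mult mult.assoc norm_divide)
  qed
  have m: "dmul ?H \<in> borel_measurable borel" by (rule dmul_measurable[OF spectralD(6)[OF h]])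
  have b1: "integrable lborel (dmul ?H)"
  proof (rule Bochner_Integration.integrable_bound[OF integrable_mult_right[OF dq(1), of "complex_of_real (1 / \<alpha>)"]])
    show "dmul ?H \<in> borel_measurable lborel" using m by simp
    show "AE \<xi> in lborel. cmod (dmul ?H \<xi>) \<le> cmod (complex_of_real (1 / \<alpha>) * ?Q \<xi>)" using le by (rule AE_I2)
  qed
  have b2: "sqint (dmul ?H)"
    by (rule sqint_mono1(1)[OF sqint_cmult(1)[OF dq(2), of "complex_of_real (1 / \<alpha>)"] m le])
  note hd = spectral_weak_deriv[OF h b1 b2]
  have "camassa_holm \<alpha> v w \<longleftrightarrow> (AE x in lborel. w x = - 1 * (v x * weak_deriv v x)
      + - 1 * weak_deriv (helmholtz_inv \<alpha> (\<lambda>y. (v y)\<^sup>2 + \<alpha>\<^sup>2 / 2 * (weak_deriv v y)\<^sup>2)) x)"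
  proof -
    have "(a + b = - c) \<longleftrightarrow> (a = - 1 * b + - 1 * c)" for a b c :: real by linarith
    then show ?thesis unfolding camassa_holm_def by simp
  qed
  also have "\<dots> \<longleftrightarrow> (AE \<xi> in lborel. W \<xi> = complex_of_real (- 1) * conv V (dmul V) \<xi> + complex_of_real (- 1) * dmul ?H \<xi>)"
    by (rule spectral_AE_iff[OF w spectral_linear[OF vd hd]])
  finally have "camassa_holm \<alpha> v w \<longleftrightarrow> (AE \<xi> in lborel. W \<xi> = complex_of_real (- 1) * conv V (dmul V) \<xi> + complex_of_real (- 1) * dmul ?H \<xi>)" .
  moreover have "complex_of_real (- 1) * conv V (dmul V) \<xi> + complex_of_real (- 1) * dmul ?H \<xi> = Bop \<alpha> V V \<xi>" for \<xi>
    unfolding Bop_square_expand(2)[OF v(2,3)] dmul_def[of ?H] by simp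
  ultimately show ?thesis by (simp only:)
qed

section \<open>From the Fourier side to the Cauchy problems\<close>

lemma spectral_diff:
  assumes "spectral U f" "spectral V g"
  shows "spectral (\<lambda>\<xi>. U \<xi> - V \<xi>) (\<lambda>x. f x - g x)"
  using spectral_linear[OF assms, of 1 "- 1"] by simp

lemma spectral_quotient:
  assumes "spectral U f" "spectral V g" "spectral W w"
  shows "spectral (\<lambda>\<xi>. (U \<xi> - V \<xi>) / complex_of_real h - W \<xi>) (\<lambda>x. (f x - g x) / h - w x)"
  using spectral_linear[OF spectral_diff[OF assms(1,2)] assms(3), of "1 / h" "- 1"]
  by (simp add: of_real_divide)

text \<open>The equation determines the spectrum of the time derivative only up to null sets, so W
  may be replaced by any measurable Z that agrees with it almost everywhere.\<close>

lemma sobolev_limits_iff: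
  assumes S: "\<And>r. r \<in> A \<Longrightarrow> spectral (U r) (v r)" and t: "t \<in> A"
  shows "((\<lambda>r. sobolev_norm s (\<lambda>x. v r x - v t x)) \<longlongrightarrow> 0) (at t within A)
      \<longleftrightarrow> ((\<lambda>r. hn s (\<lambda>x. U r x - U t x)) \<longlongrightarrow> 0) (at t within A)"
    and "spectral W w \<Longrightarrow> AE \<xi> in lborel. W \<xi> = Z \<xi> \<Longrightarrow> Z \<in> borel_measurable borel \<Longrightarrow>
      ((\<lambda>r. sobolev_norm s (\<lambda>x. (v r x - v t x) / (r - t) - w x)) \<longlongrightarrow> 0) (at t within A)
      \<longleftrightarrow> ((\<lambda>r. hn s (\<lambda>x. (U r x - U t x) / complex_of_real (r - t) - Z x)) \<longlongrightarrow> 0) (at t within A)"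
proof -
  have c: "((\<lambda>r. 2 * pi * f r) \<longlongrightarrow> 0) F \<longleftrightarrow> (f \<longlongrightarrow> 0) F" for f and F :: "real filter"
    using tendsto_mult_left_iff[of "2 * pi" f 0 F] by simp
  show "((\<lambda>r. sobolev_norm s (\<lambda>x. v r x - v t x)) \<longlongrightarrow> 0) (at t within A)
      \<longleftrightarrow> ((\<lambda>r. hn s (\<lambda>x. U r x - U t x)) \<longlongrightarrow> 0) (at t within A)"
    unfolding c[symmetric, of "\<lambda>r. hn s (\<lambda>x. U r x - U t x)"]
    by (rule Lim_cong_within[OF refl refl refl]) (rule spectral_sobolev(2)[OF spectral_diff[OF S S[OF t]]])
  assume W: "spectral W w" and ae: "AE \<xi> in lborel. W \<xi> = Z \<xi>" and Zm: "Z \<in> borel_measurable borel"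
  have "sobolev_norm s (\<lambda>x. (v r x - v t x) / (r - t) - w x)
    = 2 * pi * hn s (\<lambda>x. (U r x - U t x) / complex_of_real (r - t) - Z x)" if r: "r \<in> A" for r
  proof -
    note q = spectral_quotient[OF S[OF r] S[OF t] W, of "r - t"]
    note [measurable] = spectralD(6)[OF S[OF r]] spectralD(6)[OF S[OF t]] spectralD(6)[OF W] Zm
    have "hn s (\<lambda>x. (U r x - U t x) / complex_of_real (r - t) - W x)
      = hn s (\<lambda>x. (U r x - U t x) / complex_of_real (r - t) - Z x)"
      unfolding wn_def
    proof (rule n2_cong_AE)
      show "AE x in lborel. complex_of_real (wt s 0 x) * ((U r x - U t x) / complex_of_real (r - t) - W x)
        = complex_of_real (wt s 0 x) * ((U r x - U t x) / complex_of_real (r - t) - Z x)"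
        using ae by eventually_elim simp
    qed measurable
    then show ?thesis using spectral_sobolev(2)[OF q] by simp
  qed
  then show "((\<lambda>r. sobolev_norm s (\<lambda>x. (v r x - v t x) / (r - t) - w x)) \<longlongrightarrow> 0) (at t within A)
      \<longleftrightarrow> ((\<lambda>r. hn s (\<lambda>x. (U r x - U t x) / complex_of_real (r - t) - Z x)) \<longlongrightarrow> 0) (at t within A)"
    unfolding c[symmetric, of "\<lambda>r. hn s (\<lambda>x. (U r x - U t x) / complex_of_real (r - t) - Z x)"]
    by (intro Lim_cong_within refl)
qed

text \<open>What the two equations have in common; the passage between spectra and solutions is
  proved once from it.\<close>

definition eqn_symbol :: "real \<Rightarrow> real \<Rightarrow> ((real \<Rightarrow> real) \<Rightarrow> (real \<Rightarrow> real) \<Rightarrow> bool) \<Rightarrow> bool" where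
  "eqn_symbol s \<alpha> E \<longleftrightarrow> (\<forall>V v W w. spectral V v \<longrightarrow> inH s V \<longrightarrow> spectral W w \<longrightarrow>
     (E v w \<longleftrightarrow> (AE \<xi> in lborel. W \<xi> = Bop \<alpha> V V \<xi>)))"

lemma eqn_symbolD:
  "eqn_symbol s \<alpha> E \<Longrightarrow> spectral V v \<Longrightarrow> inH s V \<Longrightarrow> spectral W w \<Longrightarrow> E v w \<longleftrightarrow> (AE \<xi> in lborel. W \<xi> = Bop \<alpha> V V \<xi>)"
  unfolding eqn_symbol_def by blast

lemma fsol_of_cauchy_solution:
  assumes s: "3/2 < s" and E: "eqn_symbol s \<alpha> E" and sol: "cauchy_solution s E u\<^sub>0 T v"
  shows "fsol \<alpha> s T (\<lambda>t. spec (v t))" "\<And>t. t \<in> {0..T} \<Longrightarrow> spectral (spec (v t)) (v t)"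
    "AE x in lborel. v 0 x = u\<^sub>0 x"
proof -
  from sol obtain w where c: "sobolev_continuous s T v" and i: "AE x in lborel. v 0 x = u\<^sub>0 x"
    and d: "sobolev_time_deriv (s - 1) T v w" and e: "\<And>t. t \<in> {0..T} \<Longrightarrow> E (v t) (w t)"
    unfolding cauchy_solution_def by blast
  show "AE x in lborel. v 0 x = u\<^sub>0 x" by (rule i)
  have s1: "1/2 < s" "1/2 < s - 1" using s by simp_all
  have vs: "v t \<in> sobolev s" and ws: "w t \<in> sobolev (s - 1)" if "t \<in> {0..T}" for t
    using c d that unfolding sobolev_continuous_def sobolev_time_deriv_def by blast+
  note sv = sobolev_spec[OF vs s1(1)] and sw = sobolev_spec[OF ws s1(2)]
  show S: "spectral (spec (v t)) (v t)" if "t \<in> {0..T}" for t by (rule sv(1)[OF that])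
  show "fsol \<alpha> s T (\<lambda>t. spec (v t))"
    unfolding fsol_def
  proof (intro ballI conjI)
    fix t assume t: "t \<in> {0..T}"
    show "inH s (spec (v t))" by (rule sv(2)[OF t])
    show "herm (spec (v t))" by (rule spectralD(3)[OF S[OF t]])
    note lim = sobolev_limits_iff[where U = "\<lambda>t. spec (v t)" and v = v and A = "{0..T}", OF _ t]
    have "((\<lambda>r. sobolev_norm s (\<lambda>x. v r x - v t x)) \<longlongrightarrow> 0) (at t within {0..T})"
      using c t unfolding sobolev_continuous_def by blast
    then show "((\<lambda>r. hn s (\<lambda>x. spec (v r) x - spec (v t) x)) \<longlongrightarrow> 0) (at t within {0..T})"
      using lim(1)[OF S, of s] by (simp only:)
    have ae: "AE \<xi> in lborel. spec (w t) \<xi> = Bop \<alpha> (spec (v t)) (spec (v t)) \<xi>"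
      using e[OF t] unfolding eqn_symbolD[OF E S[OF t] sv(2)[OF t] sw(1)[OF t]] .
    have m: "Bop \<alpha> (spec (v t)) (spec (v t)) \<in> borel_measurable borel"
      by (intro Bop_measurable spectralD(6)[OF S[OF t]])
    have "((\<lambda>r. sobolev_norm (s - 1) (\<lambda>x. (v r x - v t x) / (r - t) - w t x)) \<longlongrightarrow> 0) (at t within {0..T})"
      using d t unfolding sobolev_time_deriv_def by blast
    then show "((\<lambda>r. hn (s - 1) (\<lambda>x. (spec (v r) x - spec (v t) x) / complex_of_real (r - t)
        - Bop \<alpha> (spec (v t)) (spec (v t)) x)) \<longlongrightarrow> 0) (at t within {0..T})"
      using lim(2)[OF S sw(1)[OF t] ae m, of "s - 1"] by (simp only:)
  qed
qed

lemma fsolD: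
  assumes "fsol \<alpha> s T U" "t \<in> {0..T}"
  shows "inH s (U t)" "herm (U t)" "((\<lambda>r. hn s (\<lambda>x. U r x - U t x)) \<longlongrightarrow> 0) (at t within {0..T})"
    "((\<lambda>r. hn (s - 1) (\<lambda>x. (U r x - U t x) / complex_of_real (r - t) - Bop \<alpha> (U t) (U t) x)) \<longlongrightarrow> 0) (at t within {0..T})"
  using assms unfolding fsol_def by blast+

lemma fsol_spectral:
  assumes "fsol \<alpha> s T U" "t \<in> {0..T}" "3/2 < s"
  shows "spectral (U t) (invF (U t))"
  by (rule inH_spectral[OF fsolD(1)[OF assms(1,2)] _ fsolD(2)[OF assms(1,2)]]) (use assms(3) in simp)

text \<open>A competitor is an arbitrary solution on an arbitrary interval. Its chosen spectra form
  an \<open>fsol\<close>, so uniqueness on the Fourier side settles the common interval.\<close>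

lemma the_solution_of_fsol:
  assumes s: "3/2 < s" and a: "0 \<le> \<alpha>" "\<alpha> \<le> 1" and E: "eqn_symbol s \<alpha> E" and T: "0 \<le> T"
    and U: "fsol \<alpha> s T U" and u0: "u\<^sub>0 \<in> sobolev s" and init: "AE \<xi> in lborel. U 0 \<xi> = spec u\<^sub>0 \<xi>"
  shows "the_solution s E u\<^sub>0 T (\<lambda>t. invF (U t))"
  unfolding the_solution_def
proof (intro conjI allI impI ballI)
  have s1: "1/2 < s" "1/2 < s - 1" using s by simp_all
  have z: "0 \<in> {0..T}" using T by simp
  note S = fsol_spectral[OF U _ s]
  note s0 = sobolev_spec(1)[OF u0 s1(1)]
  have i0: "AE x in lborel. invF (U 0) x = u\<^sub>0 x" unfolding spectral_AE_iff[OF S[OF z] s0] by (rule init)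
  define w where "w t = invF (Bop \<alpha> (U t) (U t))" for t
  have B: "inH (s - 1) (Bop \<alpha> (U t) (U t))" and W: "spectral (Bop \<alpha> (U t) (U t)) (w t)" if t: "t \<in> {0..T}" for t
  proof -
    show B: "inH (s - 1) (Bop \<alpha> (U t) (U t))" by (rule Bop_inH(1)[OF a s fsolD(1)[OF U t] fsolD(1)[OF U t]])
    show "spectral (Bop \<alpha> (U t) (U t)) (w t)"
      unfolding w_def by (rule inH_spectral[OF B s1(2) herm_Bop[OF fsolD(2)[OF U t] fsolD(2)[OF U t]]])
  qed
  have c: "sobolev_continuous s T (\<lambda>t. invF (U t))"
    unfolding sobolev_continuous_def
  proof (intro ballI conjI)
    fix t assume t: "t \<in> {0..T}"
    show "invF (U t) \<in> sobolev s" unfolding spectral_sobolev(1)[OF S[OF t]] by (rule fsolD(1)[OF U t])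
    show "((\<lambda>r. sobolev_norm s (\<lambda>x. invF (U r) x - invF (U t) x)) \<longlongrightarrow> 0) (at t within {0..T})"
      by (rule iffD2[OF sobolev_limits_iff(1)[where U = U and v = "\<lambda>t. invF (U t)" and A = "{0..T}", OF S t] fsolD(3)[OF U t]])
  qed
  have d: "sobolev_time_deriv (s - 1) T (\<lambda>t. invF (U t)) w"
    unfolding sobolev_time_deriv_def
  proof (intro ballI conjI)
    fix t assume t: "t \<in> {0..T}"
    have "inH (s - 1) (U t)" by (rule inH_mono(1)[OF fsolD(1)[OF U t]]) simp
    then show "invF (U t) \<in> sobolev (s - 1)" unfolding spectral_sobolev(1)[OF S[OF t]] .
    show "w t \<in> sobolev (s - 1)" unfolding spectral_sobolev(1)[OF W[OF t]] by (rule B[OF t])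
    show "((\<lambda>r. sobolev_norm (s - 1) (\<lambda>x. (invF (U r) x - invF (U t) x) / (r - t) - w t x)) \<longlongrightarrow> 0) (at t within {0..T})"
      by (rule iffD2[OF sobolev_limits_iff(2)[where U = U and v = "\<lambda>t. invF (U t)" and A = "{0..T}",
          OF S t W[OF t] AE_I2[OF refl] spectralD(6)[OF W[OF t]]] fsolD(4)[OF U t]])
  qed
  have e: "E (invF (U t)) (w t)" if t: "t \<in> {0..T}" for t
    unfolding eqn_symbolD[OF E S[OF t] fsolD(1)[OF U t] W[OF t]] by simp
  show "cauchy_solution s E u\<^sub>0 T (\<lambda>t. invF (U t))"
    unfolding cauchy_solution_def using c i0 d e by blast
  fix T' v t
  assume sol: "cauchy_solution s E u\<^sub>0 T' v" and t: "t \<in> {0..min T T'}"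
  note V = fsol_of_cauchy_solution[OF s E sol]
  have t': "t \<in> {0..T}" "t \<in> {0..T'}" and z': "0 \<in> {0..T'}" using t by auto
  have "AE \<xi> in lborel. spec (v 0) \<xi> = spec u\<^sub>0 \<xi>"
    using V(3) unfolding spectral_AE_iff[OF V(2)[OF z'] s0] .
  then have "AE \<xi> in lborel. spec (v 0) \<xi> = U 0 \<xi>" using init by eventually_elim simp
  then have "AE \<xi> in lborel. spec (v t) \<xi> = U t \<xi>"
    using t fsol_unique[OF fsol_restrict[OF V(1), of "min T T'"] fsol_restrict[OF U, of "min T T'"] a s] by simp
  then show "AE x in lborel. v t x = invF (U t) x"
    unfolding spectral_AE_iff[OF V(2)[OF t'(2)] S[OF t'(1)]] .
qed

lemma continuous_on_hn_diff:
  assumes U: "fsol \<alpha> s T U" and V: "fsol \<beta> s T V"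
  shows "continuous_on {0..T} (\<lambda>t. hn s (\<lambda>x. U t x - V t x))"
  unfolding continuous_on_def
proof
  fix t assume t: "t \<in> {0..T}"
  note u = fsolD(1)[OF U] and v = fsolD(1)[OF V]
  have l: "((\<lambda>r. hn s (\<lambda>x. U r x - U t x) + hn s (\<lambda>x. V r x - V t x)) \<longlongrightarrow> 0) (at t within {0..T})"
    using tendsto_add[OF fsolD(3)[OF U t] fsolD(3)[OF V t]] by simp
  have "((\<lambda>r. hn s (\<lambda>x. U r x - V r x) - hn s (\<lambda>x. U t x - V t x)) \<longlongrightarrow> 0) (at t within {0..T})"
  proof (rule Lim_null_comparison[OF _ l])
    show "\<forall>\<^sub>F r in at t within {0..T}. norm (hn s (\<lambda>x. U r x - V r x) - hn s (\<lambda>x. U t x - V t x))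
      \<le> hn s (\<lambda>x. U r x - U t x) + hn s (\<lambda>x. V r x - V t x)"
      unfolding eventually_at_filter
    proof (intro always_eventually allI impI)
      fix r assume r: "r \<in> {0..T}"
      have "\<bar>hn s (\<lambda>x. U r x - V r x) - hn s (\<lambda>x. U t x - V t x)\<bar> \<le> hn s (\<lambda>x. (U r x - V r x) - (U t x - V t x))"
        by (rule wn_abs_diff_le[OF wsq_diff(1)[OF u[OF r] v[OF r]] wsq_diff(1)[OF u[OF t] v[OF t]]])
      also have "(\<lambda>x. (U r x - V r x) - (U t x - V t x)) = (\<lambda>x. (U r x - U t x) - (V r x - V t x))"
        by (simp add: algebra_simps)
      also have "hn s \<dots> \<le> hn s (\<lambda>x. U r x - U t x) + hn s (\<lambda>x. V r x - V t x)"
        by (rule wsq_diff(2)[OF wsq_diff(1)[OF u[OF r] u[OF t]] wsq_diff(1)[OF v[OF r] v[OF t]]])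
      finally show "norm (hn s (\<lambda>x. U r x - V r x) - hn s (\<lambda>x. U t x - V t x))
        \<le> hn s (\<lambda>x. U r x - U t x) + hn s (\<lambda>x. V r x - V t x)" by simp
    qed
  qed
  from Lim_null[THEN iffD2, OF this]
  show "((\<lambda>r. hn s (\<lambda>x. U r x - V r x)) \<longlongrightarrow> hn s (\<lambda>x. U t x - V t x)) (at t within {0..T})" .
qed

text \<open>Continuity of the norm in time supplies measurability. The lower bound uses T > 0: over
  a null space the essential supremum would be minus infinity.\<close>

lemma Linf_bounds:
  assumes s: "3/2 < s" and T: "0 < T" and U: "fsol \<alpha> s T U" and V: "fsol \<beta> s T V"
    and le: "\<And>t. t \<in> {0..T} \<Longrightarrow> hn s (\<lambda>x. U t x - V t x) \<le> e"
  shows "0 \<le> Linf_sobolev_norm s T (\<lambda>t x. invF (U t) x - invF (V t) x)"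
    and "Linf_sobolev_norm s T (\<lambda>t x. invF (U t) x - invF (V t) x) \<le> ereal (2 * pi * e)"
proof -
  let ?M = "restrict_space lborel {0..T}"
  let ?g = "\<lambda>t. sobolev_norm s (\<lambda>x. invF (U t) x - invF (V t) x)"
  have g: "?g t = 2 * pi * hn s (\<lambda>x. U t x - V t x)" if t: "t \<in> {0..T}" for t
    by (rule spectral_sobolev(2)[OF spectral_diff[OF fsol_spectral[OF U t s] fsol_spectral[OF V t s]]])
  have "continuous_on {0..T} ?g \<longleftrightarrow> continuous_on {0..T} (\<lambda>t. 2 * pi * hn s (\<lambda>x. U t x - V t x))"
    by (rule continuous_on_cong[OF refl g])
  then have "continuous_on {0..T} ?g"
    using continuous_on_mult_left[OF continuous_on_hn_diff[OF U V], of "2 * pi"] by blast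
  from borel_measurable_continuous_on_restrict[OF this] have "?g \<in> borel_measurable ?M"
    using measurable_cong_sets[OF sets_restrict_space_cong[OF sets_lborel, of "{0..T}"] refl[of "sets borel"]] by blast
  then have m: "(\<lambda>t. ereal (?g t)) \<in> borel_measurable ?M" by measurable
  have sp: "space ?M = {0..T}" by (simp add: space_restrict_space)
  show "Linf_sobolev_norm s T (\<lambda>t x. invF (U t) x - invF (V t) x) \<le> ereal (2 * pi * e)"
    unfolding Linf_sobolev_norm_def
  proof (rule esssup_I[OF m AE_I2])
    fix t assume "t \<in> space ?M"
    then have t: "t \<in> {0..T}" unfolding sp .
    show "ereal (?g t) \<le> ereal (2 * pi * e)" unfolding g[OF t] using le[OF t] by simp
  qed
  have "emeasure ?M (space ?M) \<noteq> 0"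
    unfolding sp using T by (subst emeasure_restrict_space) simp_all
  from esssup_const[OF this, of "0 :: ereal"] have "0 = esssup ?M (\<lambda>t. 0 :: ereal)" by simp
  also have "\<dots> \<le> esssup ?M (\<lambda>t. ereal (?g t))"
  proof (rule esssup_AE_mono[OF _ AE_I2])
    fix t assume "t \<in> space ?M"
    then have t: "t \<in> {0..T}" unfolding sp .
    show "(0 :: ereal) \<le> ereal (?g t)" unfolding g[OF t] by simp
  qed simp
  finally show "0 \<le> Linf_sobolev_norm s T (\<lambda>t x. invF (U t) x - invF (V t) x)" unfolding Linf_sobolev_norm_def .
qed

theorem theorem1p1:
  fixes s :: real
  assumes "s > 3 / 2"
  shows "\<exists>\<tau> :: real \<Rightarrow> real. \<forall>u\<^sub>0 \<in> sobolev s.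
    (let T = \<tau> (sobolev_norm s u\<^sub>0) in
      T > 0 \<and>
      (\<exists>S :: real \<Rightarrow> real \<Rightarrow> real \<Rightarrow> real.
        (\<forall>\<alpha>\<in>{0<..<1}. the_solution s (camassa_holm \<alpha>) u\<^sub>0 T (S \<alpha>)) \<and>
        the_solution s burgers u\<^sub>0 T (S 0) \<and>
        ((\<lambda>\<alpha>. Linf_sobolev_norm s T (\<lambda>t x. S \<alpha> t x - S 0 t x)) \<longlongrightarrow> 0) (at_right 0)))"
proof (intro exI ballI, unfold Let_def)
  fix u\<^sub>0 assume u0: "u\<^sub>0 \<in> sobolev s"
  \<comment> \<open>The witness for \<tau> stays schematic until the last \<open>show\<close>; this
    is its value. The spectral norm R is the Sobolev norm divided by 2 pi.\<close>
  let ?T = "\<lambda>N. 1 / rate s (2 * (N / (2 * pi)))"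
  define R where "R = hn s (spec u\<^sub>0)"
  define T where "T = 1 / rate s (2 * R)"
  have s: "3/2 < s" and s1: "1/2 < s" using assms by simp_all
  note sp = sobolev_spec[OF u0 s1]
  have "sobolev_norm s u\<^sub>0 / (2 * pi) = R" unfolding spectral_sobolev(2)[OF sp(1)] R_def by simp
  then have T_eq: "?T (sobolev_norm s u\<^sub>0) = T" by (simp only: T_def)
  have R: "0 \<le> R" by (simp add: R_def)
  have "1 \<le> rate s (2 * R)" using R by (intro rate_pos s) simp
  then have T: "0 < T" "T * rate s (2 * R) \<le> 1" by (simp_all add: T_def)
  have "\<exists>U. fsol \<alpha> s T U \<and> (\<forall>t\<in>{0..T}. \<forall>M\<ge>0. wn (wt s M) (U t) \<le> 2 * wn (wt s M) (spec u\<^sub>0)) \<and> (AE x in lborel. U 0 x = spec u\<^sub>0 x)"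
    if "\<alpha> \<in> {0..<1}" for \<alpha>
    by (rule fourier_existence[OF s T _ _ sp(2) spectralD(3)[OF sp(1)]]) (use that in \<open>simp_all add: R_def\<close>)
  then obtain U where U: "\<And>\<alpha>. \<alpha> \<in> {0..<1} \<Longrightarrow> fsol \<alpha> s T (U \<alpha>)"
    and tail: "\<And>\<alpha> t M. \<alpha> \<in> {0..<1} \<Longrightarrow> t \<in> {0..T} \<Longrightarrow> 0 \<le> M \<Longrightarrow> wn (wt s M) (U \<alpha> t) \<le> 2 * wn (wt s M) (spec u\<^sub>0)"
    and init: "\<And>\<alpha>. \<alpha> \<in> {0..<1} \<Longrightarrow> AE x in lborel. U \<alpha> 0 x = spec u\<^sub>0 x"
    using bchoice[of "{0..<1}" "\<lambda>\<alpha> U. fsol \<alpha> s T U \<and> (\<forall>t\<in>{0..T}. \<forall>M\<ge>0. wn (wt s M) (U t) \<le> 2 * wn (wt s M) (spec u\<^sub>0)) \<and> (AE x in lborel. U 0 x = spec u\<^sub>0 x)"]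
    by blast
  have U0: "fsol 0 s T (U 0)" by (rule U) simp
  have CH: "the_solution s (camassa_holm \<alpha>) u\<^sub>0 T (\<lambda>t. invF (U \<alpha> t))" if a: "\<alpha> \<in> {0<..<1}" for \<alpha>
  proof (rule the_solution_of_fsol[OF s _ _ _ _ U u0 init])
    show "eqn_symbol s \<alpha> (camassa_holm \<alpha>)"
      unfolding eqn_symbol_def using camassa_holm_iff[OF _ _ s, of _ _ _ _ \<alpha>] a by simp
  qed (use a T in auto)
  have B: "the_solution s burgers u\<^sub>0 T (\<lambda>t. invF (U 0 t))"
  proof (rule the_solution_of_fsol[OF s _ _ _ _ U u0 init])
    show "eqn_symbol s 0 burgers" unfolding eqn_symbol_def using burgers_iff[OF _ _ s] by simp
  qed (use T in auto)
  have small: "\<forall>\<^sub>F \<alpha> in at_right 0. 0 \<le> Linf_sobolev_norm s T (\<lambda>t x. invF (U \<alpha> t) x - invF (U 0 t) x) \<and>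
      Linf_sobolev_norm s T (\<lambda>t x. invF (U \<alpha> t) x - invF (U 0 t) x) \<le> ereal (2 * pi * e)" if e: "0 < e" for e
  proof -
    have "\<forall>\<^sub>F \<alpha> in at_right 0. \<forall>t\<in>{0..T}. hn s (\<lambda>x. U \<alpha> t x - U 0 t x) \<le> e"
      by (rule fourier_zero_filter_limit[OF s _ sp(2), where R = R]) (use T U tail init e in \<open>auto simp: R_def\<close>)
    moreover have "\<forall>\<^sub>F \<alpha> in at_right (0::real). \<alpha> \<in> {0<..<1}" by (rule eventually_at_right_real) simp
    ultimately show ?thesis
    proof eventually_elim
      case (elim \<alpha>)
      then have "fsol \<alpha> s T (U \<alpha>)" by (intro U) auto
      from Linf_bounds[OF s T(1) this U0] elim show ?case by blast
    qed
  qed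
  have "((\<lambda>\<alpha>. Linf_sobolev_norm s T (\<lambda>t x. invF (U \<alpha> t) x - invF (U 0 t) x)) \<longlongrightarrow> 0) (at_right 0)"
  proof (rule order_tendstoI)
    fix a :: ereal assume "a < 0"
    then show "\<forall>\<^sub>F \<alpha> in at_right 0. a < Linf_sobolev_norm s T (\<lambda>t x. invF (U \<alpha> t) x - invF (U 0 t) x)"
      using small[of 1] by (auto elim!: eventually_mono)
  next
    fix a :: ereal assume "0 < a"
    then obtain r :: real where r: "0 < ereal r" "ereal r < a" using ereal_dense2 by blast
    have "0 < r / (2 * pi)" using r by simp
    from small[OF this] show "\<forall>\<^sub>F \<alpha> in at_right 0. Linf_sobolev_norm s T (\<lambda>t x. invF (U \<alpha> t) x - invF (U 0 t) x) < a"
    proof eventually_elim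
      case (elim \<alpha>)
      then have "Linf_sobolev_norm s T (\<lambda>t x. invF (U \<alpha> t) x - invF (U 0 t) x) \<le> ereal r" by simp
      then show ?case using r(2) by (rule le_less_trans)
    qed
  qed
  then show "0 < ?T (sobolev_norm s u\<^sub>0) \<and>
    (\<exists>S :: real \<Rightarrow> real \<Rightarrow> real \<Rightarrow> real.
        (\<forall>\<alpha>\<in>{0<..<1}. the_solution s (camassa_holm \<alpha>) u\<^sub>0 (?T (sobolev_norm s u\<^sub>0)) (S \<alpha>)) \<and>
        the_solution s burgers u\<^sub>0 (?T (sobolev_norm s u\<^sub>0)) (S 0) \<and>
        ((\<lambda>\<alpha>. Linf_sobolev_norm s (?T (sobolev_norm s u\<^sub>0)) (\<lambda>t x. S \<alpha> t x - S 0 t x)) \<longlongrightarrow> 0) (at_right 0))"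
    unfolding T_eq using T(1) CH B by (intro conjI exI[of _ "\<lambda>\<alpha> t. invF (U \<alpha> t)"] ballI)
qed

end
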